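(* Suppose there exists a function $J:\overline{\mathcal Q}\to\mathbb R$ such that (a) $J(x,t)$ is continuously differentiable in $t$ and twice continuously differentiable in $x$ in the domain $\mathcal Q$; (b) $J(x,t)$ solves the stochastic Hamilton-Jacobi-Isaacs PDE $$\begin{cases}-\partial_tJ=V+f^\top\partial_xJ+\frac12\mathrm{Tr}\left(\Sigma\Sigma^\top\partial_x^2J\right)+\frac12(\partial_xJ)^\top\left(G_vR_v^{-1}G_v^\top-G_uR_u^{-1}G_u^\top\right)\partial_xJ,&\forall(x,t)\in\mathcal Q,\\[2pt]\displaystyle\lim_{(x,t)\to(y,s),\,(x,t)\in\mathcal Q}J(x,t)=\phi(y),&\forall(y,s)\in\partial\mathcal Q.\end{cases}$$ Then: (i) $J(x,t)$ is the value of the game: $J(x,t)=\min_u\max_vC(x,t;u,v)=\max_v\min_uC(x,t;u,v)$ for all $(x,t)\in\overline{\mathcal Q}$. (ii) The optimal (saddle-point) solution of the risk-minimizing zero-sum stochastic differential game $\min_u\max_v C(x_0,t_0;u,v)$ is given by $$u^*(x,t)=-R_u^{-1}(x,t)G_u^\top(x,t)\partial_xJ(x,t),\qquad v^*(x,t)=R_v^{-1}(x,t)G_v^\top(x,t)\partial_xJ(x,t).$$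
   Context: $\mathcal X_s\subseteq\mathbb R^n$ is a bounded open set (safe region) with boundary $\partial\mathcal X_s$; $t_0<T$; $\mathcal Q=\mathcal X_s\times[t_0,T)$, $\partial\mathcal Q=(\partial\mathcal X_s\times[t_0,T])\cup(\mathcal X_s\times\{T\})$, $\overline{\mathcal Q}=\overline{\mathcal X_s}\times[t_0,T]$. The game dynamics are $dx=f(x,t)dt+G_u(x,t)u(x,t)dt+G_v(x,t)v(x,t)dt+\Sigma(x,t)dw$, $x(t_0)=x_0\in\mathcal X_s$, with $u\in\mathbb R^m$ (agent), $v\in\mathbb R^l$ (adversary), $w$ a $k$-dimensional standard Wiener process, coefficients regular enough that a unique strong solution exists, and $u,v$ square integrable and measurable with respect to the $\sigma$-algebra generated by the past states. For the process started at $(x,t)$, $t_f$ is the first exit time from $\mathcal Q$, $t_f=\inf\{s>t:(x(s),s)\notin\mathcal Q\}$. $R_u(x,t)\in\mathbb R^{m\times m}$ and $R_v(x,t)\in\mathbb R^{l\times l}$ are positive definite for all $(x,t)$; $V$ is a running state cost; $\phi(x)=\psi(x)\mathbf 1_{x\in\mathcal X_s}+\eta\mathbf 1_{x\in\partial\mathcal X_s}$ with terminal cost $\psi$ and weight $\eta>0$. For $(x,t)\in\overline{\mathcal Q}$, $$C(x,t;u,v)=\mathbb E_{x,t}\Big[\phi(x(t_f))+\int_t^{t_f}\big(\tfrac12u^\top R_uu-\tfrac12v^\top R_vv+V\big)ds\Big],$$ where $\mathbb E_{x,t}$ conditions on $x(t)=x$. A pair $(u^*,v^* )$ of admissible policies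 over $[t,T)$ is a saddle-point solution if for each $(x,t)\in\overline{\mathcal Q}$ and all admissible $(u,v)$, $C(x,t;u^*,v)\le C(x,t;u^*,v^* )\le C(x,t;u,v^* )$; $C(x,t;u^*,v^* )$ is then the value of the game.
   Formalization: Added assumptions: J equals φ on ∂Q (the limit from inside Q alone leaves J free there, so (i) could fail); u* and v* are admissible (not implied by (a)–(b), e.g. they may fail square integrability); the running cost up to t_f is integrable for all admissible pairs. *)

theory Defs
  imports "HOL-Probability.Probability"
begin

section \<open>Wiener process, filtrations, progressive measurability\<close>

text \<open>
  The filtration generated by the increments of \<open>w\<close> after time \<open>t\<close>, augmented by the measurable
  null sets of \<open>M\<close>.
\<close>

definition wiener_filtration ::
    "'w measure \<Rightarrow> (real \<Rightarrow> 'w \<Rightarrow> real^'k) \<Rightarrow> real \<Rightarrow> real \<Rightarrow> 'w measure" where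
  "wiener_filtration M w t s =
     sigma (space M)
       ({(\<lambda>\<omega>. w r \<omega> - w t \<omega>) -` B \<inter> space M | r B. r \<in> {t..s} \<and> B \<in> sets borel} \<union> null_sets M)"

text \<open>
  Standard \<open>k\<close>-dimensional Wiener process on \<open>[a, b]\<close> started at time \<open>a\<close>: the product density says
  that \<open>w s - w r\<close> is centred Gaussian with covariance \<open>(s - r) I\<close>.
\<close>

definition wiener_process ::
    "'w measure \<Rightarrow> real \<Rightarrow> real \<Rightarrow> (real \<Rightarrow> 'w \<Rightarrow> real^'k) \<Rightarrow> bool" where
  "wiener_process M a b w \<longleftrightarrow>
     (\<forall>s\<in>{a..b}. w s \<in> borel_measurable M) \<and>
     (AE \<omega> in M. w a \<omega> = 0) \<and>
     (AE \<omega> in M. continuous_on {a..b} (\<lambda>s. w s \<omega>)) \<and>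
     (\<forall>r s. a \<le> r \<longrightarrow> r < s \<longrightarrow> s \<le> b \<longrightarrow>
        distributed M lborel (\<lambda>\<omega>. w s \<omega> - w r \<omega>)
          (\<lambda>z. ennreal (\<Prod>i\<in>UNIV. normal_density 0 (sqrt (s - r)) (z $ i))) \<and>
        prob_space.indep_set M
          (sets (wiener_filtration M w a r))
          (sets (vimage_algebra (space M) (\<lambda>\<omega>. w s \<omega> - w r \<omega>) borel)))"

definition progressive ::
    "real set \<Rightarrow> real \<Rightarrow> (real \<Rightarrow> 'w measure) \<Rightarrow> (real \<Rightarrow> 'w \<Rightarrow> 'b::topological_space) \<Rightarrow> bool" where
  "progressive I t F h \<longleftrightarrow>
     (\<forall>s\<in>I. (\<lambda>(r, \<omega>). h r \<omega>) \<in> borel_measurable (restrict_space borel {t..s} \<Otimes>\<^sub>M F s))"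


section \<open>The Ito integral\<close>

text \<open>
  A simple process is \<open>\<Sum>i<N. \<xi> i\<close> times the indicator of \<open>(p i, p (Suc i)]\<close>, with each \<open>\<xi> i\<close>
  bounded and measurable at time \<open>p i\<close>.
\<close>

definition simple_process ::
    "real \<Rightarrow> real \<Rightarrow> (real \<Rightarrow> 'w measure) \<Rightarrow> nat \<Rightarrow> (nat \<Rightarrow> real)
      \<Rightarrow> (nat \<Rightarrow> 'w \<Rightarrow> real^'k^'n) \<Rightarrow> bool" where
  "simple_process t T F N p \<xi> \<longleftrightarrow>
     (\<forall>i\<le>N. p i \<in> {t..T}) \<and> (\<forall>i<N. p i \<le> p (Suc i)) \<and>
     (\<forall>i<N. \<xi> i \<in> borel_measurable (F (p i)) \<and> (\<exists>c. \<forall>\<omega>\<in>space (F (p i)). norm (\<xi> i \<omega>) \<le> c))"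

definition simple_value ::
    "nat \<Rightarrow> (nat \<Rightarrow> real) \<Rightarrow> (nat \<Rightarrow> 'w \<Rightarrow> real^'k^'n) \<Rightarrow> real \<Rightarrow> 'w \<Rightarrow> real^'k^'n" where
  "simple_value N p \<xi> r \<omega> = (\<Sum>i<N. indicat_real {p i<..p (Suc i)} r *\<^sub>R \<xi> i \<omega>)"

definition simple_integral ::
    "(real \<Rightarrow> 'w \<Rightarrow> real^'k) \<Rightarrow> nat \<Rightarrow> (nat \<Rightarrow> real) \<Rightarrow> (nat \<Rightarrow> 'w \<Rightarrow> real^'k^'n)
      \<Rightarrow> real \<Rightarrow> 'w \<Rightarrow> real^'n" where
  "simple_integral w N p \<xi> s \<omega> =
     (\<Sum>i<N. \<xi> i \<omega> *v (w (min s (p (Suc i))) \<omega> - w (min s (p i)) \<omega>))"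

text \<open>
  \<open>Y s\<close> is the Ito integral of \<open>H\<close> over \<open>[t, s]\<close>, for progressive \<open>H\<close> with almost surely square
  integrable paths: the continuous adapted process that is the limit in probability of integrals of
  simple processes converging to \<open>H\<close> in \<open>L\<^sup>2(t, T)\<close> in probability. This determines \<open>Y\<close> up to
  indistinguishability.
\<close>

definition ito_integral ::
    "'w measure \<Rightarrow> (real \<Rightarrow> 'w measure) \<Rightarrow> (real \<Rightarrow> 'w \<Rightarrow> real^'k) \<Rightarrow> real \<Rightarrow> real
      \<Rightarrow> (real \<Rightarrow> 'w \<Rightarrow> real^'k^'n) \<Rightarrow> (real \<Rightarrow> 'w \<Rightarrow> real^'n) \<Rightarrow> bool" where
  "ito_integral M F w t T H Y \<longleftrightarrow>
     progressive {t..T} t F H \<and>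
     (AE \<omega> in M. (\<integral>\<^sup>+r\<in>{t..T}. ennreal ((norm (H r \<omega>))\<^sup>2) \<partial>lborel) < \<infinity>) \<and>
     (\<forall>s\<in>{t..T}. Y s \<in> borel_measurable (F s)) \<and>
     (\<forall>\<omega>\<in>space M. continuous_on {t..T} (\<lambda>s. Y s \<omega>)) \<and>
     (\<exists>N p \<xi>.
        (\<forall>j. simple_process t T F (N j) (p j) (\<xi> j)) \<and>
        (\<forall>\<epsilon>>0. (\<lambda>j. measure M {\<omega>\<in>space M.
            (\<integral>\<^sup>+r\<in>{t..T}. ennreal ((norm (simple_value (N j) (p j) (\<xi> j) r \<omega> - H r \<omega>))\<^sup>2) \<partial>lborel)
              > ennreal \<epsilon>}) \<longlonglongrightarrow> 0) \<and>
        (\<forall>s\<in>{t..T}. \<forall>\<epsilon>>0. (\<lambda>j. measure M {\<omega>\<in>space M.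
            norm (simple_integral w (N j) (p j) (\<xi> j) s \<omega> - Y s \<omega>) > \<epsilon>}) \<longlonglongrightarrow> 0))"


section \<open>Game data\<close>

record ('n, 'm, 'l, 'k) game =
  safe_set :: "(real^'n) set"
  init_time :: real
  end_time :: real
  drift :: "real^'n \<Rightarrow> real \<Rightarrow> real^'n"
  gain_u :: "real^'n \<Rightarrow> real \<Rightarrow> real^'m^'n"
  gain_v :: "real^'n \<Rightarrow> real \<Rightarrow> real^'l^'n"
  diffusion :: "real^'n \<Rightarrow> real \<Rightarrow> real^'k^'n"
  weight_u :: "real^'n \<Rightarrow> real \<Rightarrow> real^'m^'m"
  weight_v :: "real^'n \<Rightarrow> real \<Rightarrow> real^'l^'l"
  state_cost :: "real^'n \<Rightarrow> real \<Rightarrow> real"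
  term_cost :: "real^'n \<Rightarrow> real"
  exit_weight :: real

definition pos_def :: "real^'a^'a \<Rightarrow> bool" where
  "pos_def A \<longleftrightarrow> transpose A = A \<and> (\<forall>z. z \<noteq> 0 \<longrightarrow> z \<bullet> (A *v z) > 0)"

definition coeff_measurable ::
    "('n::finite, 'm::finite, 'l::finite, 'k::finite) game
      \<Rightarrow> (real^'n \<Rightarrow> real \<Rightarrow> 'b::topological_space) \<Rightarrow> bool" where
  "coeff_measurable G h \<longleftrightarrow>
     (\<lambda>(x, t). h x t) \<in>
       borel_measurable (restrict_space borel (UNIV \<times> {init_time G..end_time G}))"

definition game_data :: "('n::finite, 'm::finite, 'l::finite, 'k::finite) game \<Rightarrow> bool" where
  "game_data G \<longleftrightarrow>
     open (safe_set G) \<and> bounded (safe_set G) \<and> init_time G < end_time G \<and> exit_weight G > 0 \<and>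
     (\<forall>x. \<forall>t\<in>{init_time G..end_time G}. pos_def (weight_u G x t) \<and> pos_def (weight_v G x t)) \<and>
     coeff_measurable G (drift G) \<and> coeff_measurable G (gain_u G) \<and> coeff_measurable G (gain_v G) \<and>
     coeff_measurable G (diffusion G) \<and> coeff_measurable G (weight_u G) \<and>
     coeff_measurable G (weight_v G) \<and> coeff_measurable G (state_cost G)"

definition cyl :: "('n::finite, 'm::finite, 'l::finite, 'k::finite) game \<Rightarrow> ((real^'n) \<times> real) set" where
  "cyl G = safe_set G \<times> {init_time G..<end_time G}"

definition cyl_boundary ::
    "('n::finite, 'm::finite, 'l::finite, 'k::finite) game \<Rightarrow> ((real^'n) \<times> real) set" where
  "cyl_boundary G =
     (frontier (safe_set G) \<times> {init_time G..end_time G}) \<union> (safe_set G \<times> {end_time G})"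

definition cyl_closure ::
    "('n::finite, 'm::finite, 'l::finite, 'k::finite) game \<Rightarrow> ((real^'n) \<times> real) set" where
  "cyl_closure G = closure (safe_set G) \<times> {init_time G..end_time G}"


section \<open>Policies, trajectories and cost\<close>

text \<open>
  The space of continuous paths on \<open>[t, T]\<close> with the sigma-algebra generated by the states up to
  time \<open>s\<close>. A policy is a functional \<open>u s \<xi>\<close> of time and of the state path, depending on the past
  states only; state feedback is the special case \<open>markov\<close>. Progressive rather than merely adapted
  measurability makes the time integrals meaningful.
\<close>

definition past_states :: "real \<Rightarrow> real \<Rightarrow> real \<Rightarrow> (real \<Rightarrow> real^'n) measure" where
  "past_states t T s =
     sigma {\<xi>. continuous_on {t..T} \<xi>}
       {{\<xi>. continuous_on {t..T} \<xi> \<and> \<xi> r \<in> B} | r B. r \<in> {t..s} \<and> B \<in> sets borel}"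

type_synonym ('n, 'm) policy = "real \<Rightarrow> (real \<Rightarrow> real^'n) \<Rightarrow> real^'m"

definition nonanticipative :: "real \<Rightarrow> real \<Rightarrow> ('n::finite, 'm::finite) policy \<Rightarrow> bool" where
  "nonanticipative t T u \<longleftrightarrow> progressive {t..<T} t (past_states t T) u"

definition markov :: "(real^'n \<Rightarrow> real \<Rightarrow> real^'m) \<Rightarrow> ('n, 'm) policy" where
  "markov h = (\<lambda>s \<xi>. h (\<xi> s) s)"

definition velocity ::
    "('n::finite, 'm::finite, 'l::finite, 'k::finite) game \<Rightarrow> ('n, 'm) policy \<Rightarrow> ('n, 'l) policy
      \<Rightarrow> (real \<Rightarrow> real^'n) \<Rightarrow> real \<Rightarrow> real^'n" where
  "velocity G u v \<xi> s =
     drift G (\<xi> s) s + gain_u G (\<xi> s) s *v u s \<xi> + gain_v G (\<xi> s) s *v v s \<xi>"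

text \<open>Strong solution of the closed-loop dynamics on \<open>[t, T]\<close> with \<open>X t = x\<close>.\<close>

definition strong_solution ::
    "'w measure \<Rightarrow> (real \<Rightarrow> 'w \<Rightarrow> real^'k) \<Rightarrow> ('n::finite, 'm::finite, 'l::finite, 'k::finite) game
      \<Rightarrow> real^'n \<Rightarrow> real \<Rightarrow> ('n, 'm) policy \<Rightarrow> ('n, 'l) policy
      \<Rightarrow> (real \<Rightarrow> 'w \<Rightarrow> real^'n) \<Rightarrow> bool" where
  "strong_solution M w G x t u v X \<longleftrightarrow>
     (\<forall>s\<in>{t..end_time G}. X s \<in> borel_measurable (wiener_filtration M w t s)) \<and>
     (\<forall>\<omega>\<in>space M. continuous_on {t..end_time G} (\<lambda>s. X s \<omega>)) \<and>
     (\<exists>Y. ito_integral M (wiener_filtration M w t) w t (end_time G)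
            (\<lambda>s \<omega>. diffusion G (X s \<omega>) s) Y \<and>
          (AE \<omega> in M.
             set_integrable lborel {t..<end_time G} (velocity G u v (\<lambda>r. X r \<omega>)) \<and>
             (\<forall>s\<in>{t..end_time G}.
                X s \<omega> = x + (LBINT r:{t..<s}. velocity G u v (\<lambda>q. X q \<omega>) r) + Y s \<omega>)))"

definition unique_strong_solution ::
    "'w measure \<Rightarrow> (real \<Rightarrow> 'w \<Rightarrow> real^'k) \<Rightarrow> ('n::finite, 'm::finite, 'l::finite, 'k::finite) game
      \<Rightarrow> real^'n \<Rightarrow> real \<Rightarrow> ('n, 'm) policy \<Rightarrow> ('n, 'l) policy \<Rightarrow> bool" where
  "unique_strong_solution M w G x t u v \<longleftrightarrow>
     (\<exists>X. strong_solution M w G x t u v X) \<and>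
     (\<forall>X X'. strong_solution M w G x t u v X \<longrightarrow> strong_solution M w G x t u v X' \<longrightarrow>
        (AE \<omega> in M. \<forall>s\<in>{t..end_time G}. X s \<omega> = X' s \<omega>))"

text \<open>
  Points \<open>(\<xi> s, s)\<close> with \<open>s \<ge> end_time G\<close> are never in \<open>cyl G\<close>, so the infimum is over a nonempty
  set, lies in \<open>[t, end_time G]\<close>, and does not depend on \<open>\<xi>\<close> beyond \<open>end_time G\<close>.
\<close>

definition exit_time ::
    "('n::finite, 'm::finite, 'l::finite, 'k::finite) game \<Rightarrow> real \<Rightarrow> (real \<Rightarrow> real^'n) \<Rightarrow> real" where
  "exit_time G t \<xi> = Inf {s. t < s \<and> (\<xi> s, s) \<notin> cyl G}"

definition phi :: "('n::finite, 'm::finite, 'l::finite, 'k::finite) game \<Rightarrow> real^'n \<Rightarrow> real" where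
  "phi G y = term_cost G y * indicator (safe_set G) y
           + exit_weight G * indicator (frontier (safe_set G)) y"

definition running_cost ::
    "('n::finite, 'm::finite, 'l::finite, 'k::finite) game \<Rightarrow> ('n, 'm) policy \<Rightarrow> ('n, 'l) policy
      \<Rightarrow> (real \<Rightarrow> real^'n) \<Rightarrow> real \<Rightarrow> real" where
  "running_cost G u v \<xi> s =
     1/2 * (u s \<xi> \<bullet> (weight_u G (\<xi> s) s *v u s \<xi>))
     - 1/2 * (v s \<xi> \<bullet> (weight_v G (\<xi> s) s *v v s \<xi>)) + state_cost G (\<xi> s) s"

definition path_cost ::
    "('n::finite, 'm::finite, 'l::finite, 'k::finite) game \<Rightarrow> real \<Rightarrow> ('n, 'm) policy \<Rightarrow> ('n, 'l) policy
      \<Rightarrow> (real \<Rightarrow> real^'n) \<Rightarrow> real" where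
  "path_cost G t u v \<xi> =
     phi G (\<xi> (exit_time G t \<xi>)) + (LBINT s:{t..<exit_time G t \<xi>}. running_cost G u v \<xi> s)"

text \<open>
  The cost \<open>C(x, t; u, v)\<close>. Conditioning on \<open>x(t) = x\<close> is rendered by starting the dynamics at \<open>x\<close>
  at time \<open>t\<close>; under \<open>unique_strong_solution\<close> the choice of the solution does not matter.
\<close>

definition cost ::
    "'w measure \<Rightarrow> (real \<Rightarrow> 'w \<Rightarrow> real^'k) \<Rightarrow> ('n::finite, 'm::finite, 'l::finite, 'k::finite) game
      \<Rightarrow> real^'n \<Rightarrow> real \<Rightarrow> ('n, 'm) policy \<Rightarrow> ('n, 'l) policy \<Rightarrow> real" where
  "cost M w G x t u v =
     (let X = (SOME X. strong_solution M w G x t u v X)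
      in \<integral>\<omega>. path_cost G t u v (\<lambda>s. X s \<omega>) \<partial>M)"


section \<open>Admissible policies, saddle points and values\<close>

definition square_integrable ::
    "'w measure \<Rightarrow> real \<Rightarrow> real \<Rightarrow> ('n::finite, 'm::finite) policy \<Rightarrow> (real \<Rightarrow> 'w \<Rightarrow> real^'n) \<Rightarrow> bool" where
  "square_integrable M t T u X \<longleftrightarrow>
     (\<integral>\<^sup>+\<omega>. (\<integral>\<^sup>+s\<in>{t..<T}. ennreal ((norm (u s (\<lambda>r. X r \<omega>)))\<^sup>2) \<partial>lborel) \<partial>M) < \<infinity>"

definition cost_integrable ::
    "'w measure \<Rightarrow> ('n::finite, 'm::finite, 'l::finite, 'k::finite) game \<Rightarrow> real
      \<Rightarrow> ('n, 'm) policy \<Rightarrow> ('n, 'l) policy \<Rightarrow> (real \<Rightarrow> 'w \<Rightarrow> real^'n) \<Rightarrow> bool" where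
  "cost_integrable M G t u v X \<longleftrightarrow>
     integrable (M \<Otimes>\<^sub>M lborel)
       (\<lambda>(\<omega>, s). indicat_real {t..<exit_time G t (\<lambda>r. X r \<omega>)} s * running_cost G u v (\<lambda>r. X r \<omega>) s)"

text \<open>
  \<open>U t\<close> and \<open>V t\<close> are the admissible policies of the two players over \<open>[t, T)\<close>. Whether the dynamics
  are uniquely solvable and whether \<open>u\<close>, \<open>v\<close> are square integrable along the trajectory is a property
  of the pair \<open>(u, v)\<close>, whereas \<open>min max\<close> needs one class per player; hence the standing assumptions
  are imposed on all pairs from the two classes. The last requirement makes \<open>cost\<close> the
  expectation it is meant to be (a Bochner integral of a non-integrable function is 0).
\<close>

definition admissible_classes ::
    "'w measure \<Rightarrow> (real \<Rightarrow> 'w \<Rightarrow> real^'k) \<Rightarrow> ('n::finite, 'm::finite, 'l::finite, 'k::finite) game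
      \<Rightarrow> (real \<Rightarrow> ('n, 'm) policy set) \<Rightarrow> (real \<Rightarrow> ('n, 'l) policy set) \<Rightarrow> bool" where
  "admissible_classes M w G U V \<longleftrightarrow>
     (\<forall>t\<in>{init_time G..end_time G}.
        (\<forall>u\<in>U t. nonanticipative t (end_time G) u) \<and>
        (\<forall>v\<in>V t. nonanticipative t (end_time G) v) \<and>
        (\<forall>x\<in>closure (safe_set G). \<forall>u\<in>U t. \<forall>v\<in>V t.
           unique_strong_solution M w G x t u v \<and>
           (\<forall>X. strong_solution M w G x t u v X \<longrightarrow>
              square_integrable M t (end_time G) u X \<and>
              square_integrable M t (end_time G) v X \<and>
              cost_integrable M G t u v X)))"

definition saddle_point ::
    "'w measure \<Rightarrow> (real \<Rightarrow> 'w \<Rightarrow> real^'k) \<Rightarrow> ('n::finite, 'm::finite, 'l::finite, 'k::finite) game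
      \<Rightarrow> (real \<Rightarrow> ('n, 'm) policy set) \<Rightarrow> (real \<Rightarrow> ('n, 'l) policy set)
      \<Rightarrow> ('n, 'm) policy \<Rightarrow> ('n, 'l) policy \<Rightarrow> bool" where
  "saddle_point M w G U V us vs \<longleftrightarrow>
     (\<forall>(x, t)\<in>cyl_closure G. us \<in> U t \<and> vs \<in> V t \<and>
        (\<forall>u\<in>U t. \<forall>v\<in>V t.
           cost M w G x t us v \<le> cost M w G x t us vs \<and>
           cost M w G x t us vs \<le> cost M w G x t u vs))"

text \<open>
  \<open>c = min_u max_v C u v\<close> and \<open>c = max_v min_u C u v\<close>: the outer optimum is attained, and so is the
  inner one at the outer optimiser. At other policies the inner optimum is a supremum (infimum),
  which need not be attained or finite.
\<close>

definition is_min_max :: "('u \<Rightarrow> 'v \<Rightarrow> real) \<Rightarrow> 'u set \<Rightarrow> 'v set \<Rightarrow> real \<Rightarrow> bool" where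
  "is_min_max C A B c \<longleftrightarrow>
     (\<exists>u\<in>A. (\<exists>v\<in>B. C u v = c) \<and> (\<forall>v\<in>B. C u v \<le> c)) \<and>
     (\<forall>u\<in>A. ereal c \<le> (SUP v\<in>B. ereal (C u v)))"

definition is_max_min :: "('u \<Rightarrow> 'v \<Rightarrow> real) \<Rightarrow> 'u set \<Rightarrow> 'v set \<Rightarrow> real \<Rightarrow> bool" where
  "is_max_min C A B c \<longleftrightarrow>
     (\<exists>v\<in>B. (\<exists>u\<in>A. C u v = c) \<and> (\<forall>u\<in>A. c \<le> C u v)) \<and>
     (\<forall>v\<in>B. (INF u\<in>A. ereal (C u v)) \<le> ereal c)"


section \<open>The Hamilton-Jacobi-Isaacs equation\<close>

text \<open>
  \<open>J\<close> is of class \<open>C\<^sup>1\<close> in \<open>t\<close> and \<open>C\<^sup>2\<close> in \<open>x\<close> on \<open>cyl G\<close>, with time derivative \<open>Jt\<close>, gradient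
  \<open>Jx\<close> and Hessian \<open>Jxx\<close>. The time derivative is one-sided at \<open>init_time G\<close>.
\<close>

definition C12_derivs ::
    "('n::finite, 'm::finite, 'l::finite, 'k::finite) game \<Rightarrow> (real^'n \<Rightarrow> real \<Rightarrow> real)
      \<Rightarrow> (real^'n \<Rightarrow> real \<Rightarrow> real) \<Rightarrow> (real^'n \<Rightarrow> real \<Rightarrow> real^'n)
      \<Rightarrow> (real^'n \<Rightarrow> real \<Rightarrow> real^'n^'n) \<Rightarrow> bool" where
  "C12_derivs G J Jt Jx Jxx \<longleftrightarrow>
     (\<forall>(x, t)\<in>cyl G.
        ((\<lambda>s. J x s) has_real_derivative Jt x t) (at t within {init_time G..<end_time G}) \<and>
        (GDERIV (\<lambda>y. J y t) x :> Jx x t) \<and>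
        ((\<lambda>y. Jx y t) has_derivative (\<lambda>h. Jxx x t *v h)) (at x)) \<and>
     continuous_on (cyl G) (\<lambda>(x, t). Jt x t) \<and>
     continuous_on (cyl G) (\<lambda>(x, t). Jx x t) \<and>
     continuous_on (cyl G) (\<lambda>(x, t). Jxx x t)"

definition HJI_equation ::
    "('n::finite, 'm::finite, 'l::finite, 'k::finite) game \<Rightarrow> (real^'n \<Rightarrow> real \<Rightarrow> real)
      \<Rightarrow> (real^'n \<Rightarrow> real \<Rightarrow> real^'n) \<Rightarrow> (real^'n \<Rightarrow> real \<Rightarrow> real^'n^'n) \<Rightarrow> bool" where
  "HJI_equation G Jt Jx Jxx \<longleftrightarrow>
     (\<forall>(x, t)\<in>cyl G.
        - Jt x t =
          state_cost G x t + drift G x t \<bullet> Jx x t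
          + 1/2 * trace (diffusion G x t ** transpose (diffusion G x t) ** Jxx x t)
          + 1/2 * (Jx x t \<bullet>
              ((gain_v G x t ** matrix_inv (weight_v G x t) ** transpose (gain_v G x t)
                - gain_u G x t ** matrix_inv (weight_u G x t) ** transpose (gain_u G x t))
               *v Jx x t)))"

definition HJI_boundary ::
    "('n::finite, 'm::finite, 'l::finite, 'k::finite) game \<Rightarrow> (real^'n \<Rightarrow> real \<Rightarrow> real) \<Rightarrow> bool" where
  "HJI_boundary G J \<longleftrightarrow>
     (\<forall>(y, s)\<in>cyl_boundary G. ((\<lambda>(x, t). J x t) \<longlongrightarrow> phi G y) (at (y, s) within cyl G))"

end

theory Submission
  imports Defs
begin

text \<open>
  The classical verification argument. Ito's formula for \<open>J\<close> along a trajectory, together with the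
  equation and completion of the squares, shows that the running cost plus the increment of \<open>J\<close> is
  a martingale plus the integral of \<open>1/2 |u - u*|\<^sup>2 - 1/2 |v - v*|\<^sup>2\<close>, in the norms given by the
  weights. Hence \<open>C(u, v*) \<ge> J \<ge> C(u*, v)\<close>, once the martingale has expectation zero.

  Only the case of Ito's formula where all terms are bounded is needed: \<open>J\<close> is multiplied by a
  \<open>C\<^sup>2\<close> cutoff in \<open>x\<close>, supported in the safe set, and by a \<open>C\<^sup>1\<close> cutoff in the clock, the integral of
  \<open>|b| + |H|\<^sup>2\<close> over \<open>[t, s]\<close>. It is proved in the weak form \<open>E (Z (M q - M p)) = 0\<close>, for bounded \<open>Z\<close>
  measurable at time \<open>p\<close>, first for constant \<open>H\<close> by Taylor expansion along uniform grids and Gaussian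
  moments, then for simple \<open>H\<close>, then for general \<open>H\<close> along an almost surely convergent subsequence.
  The martingale is stopped when the path leaves a compact part of the safe set or the clock
  exceeds \<open>n\<close>, and \<open>n\<close> tends to infinity. Since \<open>x\<close> may lie on the boundary of the safe set, all this
  starts at a time \<open>\<sigma> > t\<close>, on the event that the process has not left the safe set by then, and
  finally \<open>\<sigma>\<close> tends to \<open>t\<close>.
\<close>

text \<open>The controls are only pathwise integrable and the derivatives of \<open>J\<close> come
  without bounds, so no term of Ito's formula need have an expectation. The clock repairs this
  without stopping any integral: while it is below a level \<open>c\<close>, the integral of its own
  rate is at most \<open>c\<close>, and the rate dominates the drift and the squared diffusion.
  Increments are then bounded by a deterministic constant, the same for a process and for its simple
  approximations. The weak form is chosen because optional stopping along grids only multiplies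
  increments by indicators of past events; the stochastic integral of the gradient never has to be
  constructed. When the localisation is removed, the dominating variable is a different one: a bound
  of \<open>J\<close> on the cylinder, obtained from its boundary limits by compactness, plus the
  absolute running cost along the path, integrable by admissibility. Times stay below the terminal
  time, where neither derivatives of \<open>J\<close> nor measurability of the policies is given. A
  factor \<epsilon> of either sign carries both inequalities of the saddle point through a single
  argument.\<close>

section \<open>Measurability jointly in time and chance\<close>

text \<open>Time is replaced by the grid point to its left. At a fixed grid index the value is
  measurable, there are countably many indices, and the values converge by continuity of the path.
  Applied with a sigma-algebra of the past in place of \<open>M\<close>, this makes a continuous
  adapted process progressive.\<close>

lemma continuous_paths_jointly_measurable:
  fixes f :: "real \<Rightarrow> 'w \<Rightarrow> 'b::{metric_space, second_countable_topology}"
  assumes cont: "\<And>\<omega>. \<omega> \<in> space M \<Longrightarrow> continuous_on {a..b} (\<lambda>s. f s \<omega>)"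
    and meas: "\<And>s. s \<in> {a..b} \<Longrightarrow> f s \<in> borel_measurable M"
  shows "(\<lambda>(r, \<omega>). f r \<omega>) \<in> borel_measurable (restrict_space borel {a..b} \<Otimes>\<^sub>M M)"
proof (cases "a \<le> b")
  case False
  then have "space (restrict_space borel {a..b} \<Otimes>\<^sub>M M) = {}"
    by (simp add: space_pair_measure)
  then show ?thesis by (simp add: measurable_def)
next
  case True
  \<comment> \<open>The grid point left of \<open>r\<close> may lie before \<open>a\<close>;
    clamping to \<open>{a..b}\<close> keeps \<open>f\<close> at times where it is measurable and
    does not increase the distance to \<open>r\<close>.\<close>
  define c where "c m i = max a (min b (real_of_int i / real (Suc m)))" for m :: nat and i :: int
  have c: "c m i \<in> {a..b}" for m i using True by (auto simp: c_def)
  define g where "g m x = f (c m \<lfloor>fst x * real (Suc m)\<rfloor>) (snd x)" for m :: nat and x :: "real \<times> 'w"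
  have "g m \<in> borel_measurable (restrict_space borel {a..b} \<Otimes>\<^sub>M M)" for m
    unfolding g_def
  proof (rule measurable_compose_countable[where f = "\<lambda>i x. f (c m i) (snd x)"])
    show "(\<lambda>x. f (c m i) (snd x)) \<in> borel_measurable (restrict_space borel {a..b} \<Otimes>\<^sub>M M)" for i
      using meas[OF c] by measurable
    show "(\<lambda>x. \<lfloor>fst x * real (Suc m)\<rfloor>) \<in>
        measurable (restrict_space borel {a..b} \<Otimes>\<^sub>M M) (count_space UNIV)"
      by (rule measurable_compose[OF measurable_fst], rule measurable_restrict_space1) measurable
  qed
  moreover have "(\<lambda>m. g m x) \<longlonglongrightarrow> (case x of (r, \<omega>) \<Rightarrow> f r \<omega>)"
    if x_in: "x \<in> space (restrict_space borel {a..b} \<Otimes>\<^sub>M M)" for x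
  proof -
    obtain r \<omega> where x: "x = (r, \<omega>)" "r \<in> {a..b}" "\<omega> \<in> space M"
      using x_in by (cases x) (auto simp: space_pair_measure space_restrict_space)
    have d: "\<bar>c m \<lfloor>r * real (Suc m)\<rfloor> - r\<bar> \<le> 1 / real (Suc m)" for m
    proof -
      define k where "k = real (Suc m)"
      have k: "k > 0" by (simp add: k_def)
      define y where "y = real_of_int \<lfloor>r * k\<rfloor>"
      have "y \<le> r * k" "r * k - 1 \<le> y" unfolding y_def by linarith+
      then have "y / k \<le> r" "(r * k - 1) / k \<le> y / k"
        using k by (simp_all add: divide_le_eq divide_right_mono)
      moreover have "(r * k - 1) / k = r - 1 / k" using k by (simp add: field_simps)
      ultimately have "real_of_int \<lfloor>r * real (Suc m)\<rfloor> / real (Suc m) \<le> r"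
        "r - 1 / real (Suc m) \<le> real_of_int \<lfloor>r * real (Suc m)\<rfloor> / real (Suc m)"
        unfolding y_def k_def by simp_all
      moreover have "0 \<le> 1 / real (Suc m)" by simp
      ultimately show ?thesis using x(2) unfolding c_def atLeastAtMost_iff by linarith
    qed
    have "(\<lambda>m. c m \<lfloor>r * real (Suc m)\<rfloor> - r) \<longlonglongrightarrow> 0"
      by (rule Lim_null_comparison[OF _ LIMSEQ_inverse_real_of_nat])
        (use d in \<open>auto simp: inverse_eq_divide\<close>)
    then have "(\<lambda>m. c m \<lfloor>r * real (Suc m)\<rfloor>) \<longlonglongrightarrow> r"
      by (simp add: LIM_zero_iff)
    then have "(\<lambda>m. f (c m \<lfloor>r * real (Suc m)\<rfloor>) \<omega>) \<longlonglongrightarrow> f r \<omega>"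
      using cont[OF x(3)] x(2) c by (auto simp: continuous_on_sequentially o_def)
    then show ?thesis by (simp add: g_def x)
  qed
  ultimately show ?thesis by (rule borel_measurable_LIMSEQ_metric)
qed

text \<open>Converts progressive measurability, with time first and restricted, into the form that
  Fubini asks for: time second, on the whole line, and zero outside \<open>S\<close>.\<close>

lemma measurable_indicator_times_restricted:
  fixes h :: "real \<Rightarrow> 'w \<Rightarrow> 'b::{real_normed_vector, second_countable_topology}"
  assumes h: "(\<lambda>(r, \<omega>). h r \<omega>) \<in> borel_measurable (restrict_space borel S \<Otimes>\<^sub>M F)"
    and S: "S \<in> sets borel"
  shows "(\<lambda>(\<omega>, r). indicat_real S r *\<^sub>R h r \<omega>) \<in> borel_measurable (F \<Otimes>\<^sub>M lborel)"
proof -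
  have eq: "(\<lambda>(\<omega>, r). indicat_real S r *\<^sub>R h r \<omega>)
      = (\<lambda>x. if snd x \<in> S then (\<lambda>(r, \<omega>). h r \<omega>) (snd x, fst x) else 0)"
    by (auto simp: indicator_def)
  have *: "(\<lambda>x. (\<lambda>(r, \<omega>). h r \<omega>) (snd x, fst x)) \<in>
      borel_measurable (restrict_space (F \<Otimes>\<^sub>M lborel) {x. snd x \<in> S})"
  proof (rule measurable_compose[OF _ h], rule measurable_Pair)
    show "snd \<in> measurable (restrict_space (F \<Otimes>\<^sub>M lborel) {x. snd x \<in> S}) (restrict_space borel S)"
      by (rule measurable_restrict_space2)
        (auto simp: space_restrict_space intro!: measurable_restrict_space1)
    show "fst \<in> measurable (restrict_space (F \<Otimes>\<^sub>M lborel) {x. snd x \<in> S}) F"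
      by (rule measurable_restrict_space1) simp
  qed
  have "{x \<in> space (F \<Otimes>\<^sub>M lborel). snd x \<in> S} \<in> sets (F \<Otimes>\<^sub>M lborel)"
    using S by measurable
  then show ?thesis
    unfolding eq using * by (subst measurable_If_restrict_space_iff) (auto simp: Collect_neg_eq)
qed

lemma measurable_restricted_pair_mono:
  assumes f: "f \<in> measurable (restrict_space borel S \<Otimes>\<^sub>M F) N" and le: "sets F \<subseteq> sets M" "space F = space M"
  shows "f \<in> measurable (restrict_space borel S \<Otimes>\<^sub>M M) N"
proof -
  have "(\<lambda>x. x) \<in> measurable M F"
    using le by (intro measurableI) auto
  then have "(\<lambda>x. (fst x, snd x)) \<in> measurable (restrict_space borel S \<Otimes>\<^sub>M M) (restrict_space borel S \<Otimes>\<^sub>M F)"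
    by (intro measurable_Pair measurable_fst measurable_compose[OF measurable_snd])
  from measurable_compose[OF this f] show ?thesis by simp
qed

text \<open>Adaptedness of each single \<open>h r\<close> would not suffice here; joint
  measurability with respect to \<open>F\<close> is what integration in time preserves.\<close>

lemma set_integral_adapted:
  fixes h :: "real \<Rightarrow> 'w \<Rightarrow> 'b::{banach, second_countable_topology}"
  assumes h: "(\<lambda>(r, \<omega>). h r \<omega>) \<in> borel_measurable (restrict_space borel S \<Otimes>\<^sub>M F)"
    and S: "S \<in> sets borel"
  shows "(\<lambda>\<omega>. LBINT r:S. h r \<omega>) \<in> borel_measurable F"
  unfolding set_lebesgue_integral_def
  by (rule lborel.borel_measurable_lebesgue_integral)
    (use measurable_indicator_times_restricted[OF assms] in simp)

section \<open>Moments of Gaussian vectors\<close>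

text \<open>On a Euclidean space, \<open>lborel\<close> is the image of a product measure indexed by
  the basis vectors. The product over coordinates is therefore reindexed along \<open>axis\<close>,
  and Fubini for finite products applies.\<close>

lemma lborel_vec_integral_prod:
  fixes f :: "'k::finite \<Rightarrow> real \<Rightarrow> real"
  assumes "\<And>i. integrable lborel (f i)"
  shows "integrable lborel (\<lambda>z::real^'k. \<Prod>i\<in>UNIV. f i (z $ i))" (is ?I)
    and "(\<integral>z. (\<Prod>i\<in>UNIV. f i ((z::real^'k) $ i)) \<partial>lborel) = (\<Prod>i\<in>UNIV. \<integral>x. f i x \<partial>lborel)" (is ?E)
proof -
  interpret product_sigma_finite "\<lambda>b::real^'k. lborel :: real measure" ..
  \<comment> \<open>The inverse of \<open>axis\<close>, since the factors are numbered by
    coordinates but the product space by basis vectors.\<close>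
  define ix where "ix b = (THE i. b = axis i (1::real))" for b :: "real^'k"
  have ix: "ix (axis i 1) = i" for i
    unfolding ix_def by (auto simp: axis_eq_axis)
  have B: "(Basis :: (real^'k) set) = range (\<lambda>i. axis i 1)" by (auto simp: Basis_vec_def)
  have inj: "inj (\<lambda>i. axis i (1::real) :: real^'k)" by (auto simp: inj_def axis_eq_axis)
  have re: "(\<Prod>b\<in>(Basis :: (real^'k) set). F b) = (\<Prod>i\<in>UNIV. F (axis i 1))" for F :: "real^'k \<Rightarrow> real"
    unfolding B by (subst prod.reindex[OF inj]) simp
  have comp: "(\<Sum>b\<in>Basis. h b *\<^sub>R b) $ i = h (axis i (1::real))" for h :: "real^'k \<Rightarrow> real" and i
  proof -
    have "(\<Sum>b\<in>(Basis :: (real^'k) set). h b *\<^sub>R b) $ i = (\<Sum>j\<in>UNIV. h (axis j 1) * (axis j 1 :: real^'k) $ i)"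
      unfolding B by (subst sum.reindex[OF inj]) (simp add: sum_component)
    also have "\<dots> = (\<Sum>j\<in>UNIV. if j = i then h (axis j 1) else 0)"
      by (rule sum.cong) (auto simp: axis_def)
    finally show ?thesis by simp
  qed
  have meas: "(\<lambda>z::real^'k. \<Prod>i\<in>UNIV. f i (z $ i)) \<in> borel_measurable borel"
    using assms[THEN borel_measurable_integrable] by measurable
  have i: "integrable (\<Pi>\<^sub>M b\<in>Basis. lborel) (\<lambda>h. \<Prod>b\<in>Basis. f (ix b) (h (b::real^'k)))"
    by (rule product_integrable_prod) (auto simp: assms)
  have e: "(\<integral>h. (\<Prod>b\<in>Basis. f (ix b) (h (b::real^'k))) \<partial>(\<Pi>\<^sub>M b\<in>Basis. lborel))
      = (\<Prod>b\<in>Basis. \<integral>x. f (ix b) x \<partial>lborel)"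
    by (rule product_integral_prod) (auto simp: assms)
  show ?I
    by (subst lborel_eq, subst integrable_distr_eq)
      (use meas i in \<open>auto simp: re comp ix simp del: sum_component\<close>)
  show ?E
    by (subst lborel_eq, subst integral_distr)
      (use meas e in \<open>auto simp: re comp ix simp del: sum_component\<close>)
qed

lemma normal_moments:
  assumes "\<sigma> > 0"
  shows "has_bochner_integral lborel (\<lambda>x. normal_density 0 \<sigma> x) 1"
    and "has_bochner_integral lborel (\<lambda>x. normal_density 0 \<sigma> x * x) 0"
    and "has_bochner_integral lborel (\<lambda>x. normal_density 0 \<sigma> x * x\<^sup>2) (\<sigma>\<^sup>2)"
    and "has_bochner_integral lborel (\<lambda>x. normal_density 0 \<sigma> x * x ^ 4) (3 * \<sigma> ^ 4)"
  using normal_moment_even[OF assms, of 0 0] normal_moment_odd[OF assms, of 0 0]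
    normal_moment_even[OF assms, of 0 1] normal_moment_even[OF assms, of 0 2] assms
  by (auto simp: field_simps fact_numeral power2_eq_square power4_eq_xxxx)

text \<open>A single formula for the expectation of an arbitrary monomial in the coordinates gives
  all three claims by choosing the exponents: the density is a product, so the expectation is a
  product of one-dimensional moments.\<close>

lemma gaussian_vector_moments:
  fixes D :: "'w \<Rightarrow> real^'k"
  assumes D: "distributed M lborel D (\<lambda>z. ennreal (\<Prod>i\<in>UNIV. normal_density 0 \<sigma> (z $ i)))"
    and \<sigma>: "\<sigma> > 0"
  shows "has_bochner_integral M (\<lambda>\<omega>. D \<omega> $ i) 0"
    and "has_bochner_integral M (\<lambda>\<omega>. D \<omega> $ i * D \<omega> $ j) (if i = j then \<sigma>\<^sup>2 else 0)"
    and "has_bochner_integral M (\<lambda>\<omega>. (D \<omega> $ i) ^ 4) (3 * \<sigma> ^ 4)"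
proof -
  have key: "has_bochner_integral M (\<lambda>\<omega>. \<Prod>i\<in>UNIV. D \<omega> $ i ^ e i)
      (\<Prod>i\<in>UNIV. \<integral>x. normal_density 0 \<sigma> x * x ^ e i \<partial>lborel)" for e :: "'k \<Rightarrow> nat"
  proof -
    have int: "integrable lborel (\<lambda>x. normal_density 0 \<sigma> x * x ^ n)" for n
      using integrable_normal_moment[OF \<sigma>, of 0 n] by simp
    have m: "(\<lambda>z::real^'k. \<Prod>i\<in>UNIV. z $ i ^ e i) \<in> borel_measurable lborel"
      by measurable
    have eq: "(\<lambda>z::real^'k. (\<Prod>i\<in>UNIV. normal_density 0 \<sigma> (z $ i)) * (\<Prod>i\<in>UNIV. z $ i ^ e i))
      = (\<lambda>z. \<Prod>i\<in>UNIV. normal_density 0 \<sigma> (z $ i) * z $ i ^ e i)"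
      by (simp add: prod.distrib)
    have d: "(\<lambda>z::real^'k. \<Prod>i\<in>UNIV. normal_density 0 \<sigma> (z $ i)) \<in> borel_measurable lborel"
      by measurable
    have "integrable M (\<lambda>\<omega>. \<Prod>i\<in>UNIV. D \<omega> $ i ^ e i)"
      using distributed_integrable[OF D m] lborel_vec_integral_prod(1)[OF int]
      by (auto simp: eq prod_nonneg)
    moreover have "(\<integral>\<omega>. (\<Prod>i\<in>UNIV. D \<omega> $ i ^ e i) \<partial>M)
        = (\<Prod>i\<in>UNIV. \<integral>x. normal_density 0 \<sigma> x * x ^ e i \<partial>lborel)"
      using distributed_integral[OF D m] lborel_vec_integral_prod(2)[OF int, of e]
      by (simp add: eq prod_nonneg)
    ultimately show ?thesis by (simp add: has_bochner_integral_iff)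
  qed
  note m = normal_moments[OF \<sigma>, THEN has_bochner_integral_integral_eq]
  have e1: "(\<Prod>l\<in>UNIV. z $ l ^ (if l = i then n else 0)) = z $ i ^ n" for z :: "real^'k" and i n
  proof -
    have "(\<Prod>l\<in>UNIV. z $ l ^ (if l = i then n else 0)) = (\<Prod>l\<in>UNIV. if l = i then z $ i ^ n else 1)"
      by (rule prod.cong) auto
    then show ?thesis by simp
  qed
  have i1: "(\<Prod>l\<in>UNIV. \<integral>x. normal_density 0 \<sigma> x * x ^ (if l = i then n else 0) \<partial>lborel)
      = (\<integral>x. normal_density 0 \<sigma> x * x ^ n \<partial>lborel)" for i :: 'k and n
  proof -
    have "(\<Prod>l\<in>UNIV. \<integral>x. normal_density 0 \<sigma> x * x ^ (if l = i then n else 0) \<partial>lborel)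
       = (\<Prod>l\<in>UNIV. if l = i then (\<integral>x. normal_density 0 \<sigma> x * x ^ n \<partial>lborel) else 1)"
      by (rule prod.cong) (auto simp: m)
    then show ?thesis by simp
  qed
  show "has_bochner_integral M (\<lambda>\<omega>. D \<omega> $ i) 0"
    using key[of "\<lambda>l. if l = i then 1 else 0"] by (simp add: e1 i1 m)
  show "has_bochner_integral M (\<lambda>\<omega>. (D \<omega> $ i) ^ 4) (3 * \<sigma> ^ 4)"
    using key[of "\<lambda>l. if l = i then 4 else 0"] by (simp add: e1 i1 m)
  show "has_bochner_integral M (\<lambda>\<omega>. D \<omega> $ i * D \<omega> $ j) (if i = j then \<sigma>\<^sup>2 else 0)"
  proof (cases "i = j")
    case True
    have "has_bochner_integral M (\<lambda>\<omega>. (D \<omega> $ i)\<^sup>2) (\<sigma>\<^sup>2)"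
      using key[of "\<lambda>l. if l = i then 2 else 0"] by (simp add: e1 i1 m)
    with True show ?thesis by (simp add: power2_eq_square)
  next
    case False
    \<comment> \<open>Exponent one at both \<open>i\<close> and \<open>j\<close>: the product of
      moments contains the first moment of a centred Gaussian, which is zero.\<close>
    let ?e = "\<lambda>l. (if l = i then 1 else 0) + (if l = j then 1 else (0::nat))"
    have e: "(\<Prod>l\<in>UNIV. z $ l ^ ?e l) = z $ i * z $ j" for z :: "real^'k"
      using e1[of z i 1] e1[of z j 1] by (simp add: power_add prod.distrib del: power_add[symmetric])
    have z: "(\<Prod>l\<in>UNIV. \<integral>x. normal_density 0 \<sigma> x * x ^ ?e l \<partial>lborel) = 0"
      by (rule prod_zero[OF finite]) (use False in \<open>auto simp: m intro!: bexI[of _ i]\<close>)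
    show ?thesis using key[of ?e] False unfolding e z by simp
  qed
qed

section \<open>Taylor expansion and Riemann-Stieltjes sums\<close>

text \<open>The norm on matrices is the Frobenius norm, being the Euclidean norm of the vector of
  row norms. Cauchy-Schwarz in each row therefore suffices.\<close>

lemma norm_matrix_vector_mult_le:
  fixes A :: "real^'k^'n"
  shows "norm (A *v x) \<le> norm A * norm x"
proof -
  have "norm ((A *v x) $ i) \<le> norm (A $ i) * norm x" for i
    by (metis Cauchy_Schwarz_ineq2 matrix_vector_mul_component real_norm_def)
  then have "norm (A *v x) \<le> L2_set (\<lambda>i. norm (A $ i) * norm x) UNIV"
    unfolding norm_vec_def[of "A *v x"] by (intro L2_set_mono) auto
  also have "\<dots> = norm A * norm x"
    by (simp add: norm_vec_def[of A] L2_set_left_distrib)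
  finally show ?thesis .
qed

text \<open>Separates the matrix entries, known at the beginning of a time step, from the products
  of increments, whose means given the past are known.\<close>

lemma quadratic_form_congruence:
  fixes A :: "real^'k^'n" and N :: "real^'n^'n"
  shows "(A *v v) \<bullet> (N *v (A *v v)) =
    (\<Sum>i\<in>UNIV. \<Sum>j\<in>UNIV. (transpose A ** N ** A) $ i $ j * (v $ i * v $ j))"
proof -
  have "(A *v v) \<bullet> (N *v (A *v v)) = v \<bullet> ((transpose A ** N ** A) *v v)"
    unfolding matrix_vector_mul_assoc[symmetric] transpose_matrix_vector
    by (metis dot_lmul_matrix inner_commute)
  moreover have "v \<bullet> (B *v v) = (\<Sum>i\<in>UNIV. \<Sum>j\<in>UNIV. B $ i $ j * (v $ i * v $ j))" for B :: "real^'k^'k"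
    unfolding inner_vec_def matrix_vector_mult_def
    by (auto simp: sum_distrib_left intro!: sum.cong)
  ultimately show ?thesis by simp
qed

lemma trace_congruence:
  fixes A :: "real^'k^'n" and N :: "real^'n^'n"
  shows "trace (A ** transpose A ** N) = trace (transpose A ** N ** A)"
  by (metis matrix_mul_assoc trace_mul_sym)

text \<open>An entry of the product is the bilinear form of \<open>N\<close> at a column of
  \<open>G\<close> and a column of \<open>H\<close>.\<close>

lemma abs_transpose_mult_component_le:
  fixes G H :: "real^'k^'n" and N :: "real^'n^'n"
  shows "\<bar>(transpose G ** N ** H) $ i $ j\<bar> \<le> norm G * norm H * norm N"
proof -
  have "(transpose G ** N ** H) $ i $ j = (G *v axis i 1) \<bullet> (N *v (H *v axis j 1))"
  proof -
    have "(G *v axis i 1) \<bullet> (N *v (H *v axis j 1)) = axis i 1 \<bullet> ((transpose G ** N ** H) *v axis j 1)"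
      unfolding matrix_vector_mul_assoc[symmetric] transpose_matrix_vector
      by (metis dot_lmul_matrix inner_commute)
    then show ?thesis by (simp add: inner_axis' matrix_vector_mult_basis column_def)
  qed
  also have "\<bar>\<dots>\<bar> \<le> norm (G *v axis i 1) * (norm N * norm (H *v axis j 1))"
    by (meson Cauchy_Schwarz_ineq2 mult_left_mono norm_ge_zero norm_matrix_vector_mult_le order_trans)
  also have "\<dots> \<le> norm G * (norm N * norm H)"
    using norm_matrix_vector_mult_le[of G "axis i 1"] norm_matrix_vector_mult_le[of H "axis j 1"]
    by (intro mult_mono) (auto simp: norm_axis_1)
  finally show ?thesis by (simp add: mult_ac)
qed

text \<open>Cyclic invariance turns the trace into one over the \<open>CARD('k)\<close> noise
  coordinates, where each diagonal entry is bounded separately. Keeping two different matrices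
  prepares the comparison of two diffusion coefficients.\<close>

lemma abs_trace_bilinear_le:
  fixes H G :: "real^'k^'n" and N :: "real^'n^'n"
  shows "\<bar>trace (H ** transpose G ** N)\<bar> \<le> CARD('k) * (norm H * norm G * norm N)"
proof -
  have "trace (H ** transpose G ** N) = trace (transpose G ** N ** H)"
    by (metis matrix_mul_assoc trace_mul_sym)
  moreover have "\<bar>trace (transpose G ** N ** H)\<bar> \<le> (\<Sum>i\<in>(UNIV::'k set). norm G * norm H * norm N)"
    unfolding trace_def by (rule order_trans[OF sum_abs], rule sum_mono) (rule abs_transpose_mult_component_le)
  ultimately show ?thesis by (simp add: mult_ac)
qed

lemma abs_trace_congruence_le:
  fixes A :: "real^'k^'n" and N :: "real^'n^'n"
  shows "\<bar>trace (A ** transpose A ** N)\<bar> \<le> CARD('k) * ((norm A)\<^sup>2 * norm N)"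
  using abs_trace_bilinear_le[of A A N] by (simp add: power2_eq_square)

lemma mvt_along_segment:
  fixes f :: "'a::real_inner \<Rightarrow> real"
  assumes "\<And>x. (f has_derivative (\<lambda>h. f1 x \<bullet> h)) (at x)"
  shows "\<exists>\<theta>\<in>{0..1}. f y - f x = f1 (x + \<theta> *\<^sub>R (y - x)) \<bullet> (y - x)"
proof -
  have "((\<lambda>\<theta>. f (x + \<theta> *\<^sub>R (y - x))) has_derivative (\<lambda>d. f1 (x + \<theta> *\<^sub>R (y - x)) \<bullet> (d *\<^sub>R (y - x)))) (at \<theta>)" for \<theta>
    by (rule has_derivative_compose[OF _ assms]) (auto intro!: derivative_eq_intros)
  then have "((\<lambda>\<theta>. f (x + \<theta> *\<^sub>R (y - x))) has_real_derivative f1 (x + \<theta> *\<^sub>R (y - x)) \<bullet> (y - x)) (at \<theta>)" for \<theta>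
    by (rule has_derivative_imp_has_field_derivative) auto
  from MVT2[OF zero_less_one this]
  obtain \<theta> where "0 < \<theta>" "\<theta> < 1" "f (x + 1 *\<^sub>R (y - x)) - f (x + 0 *\<^sub>R (y - x)) = f1 (x + \<theta> *\<^sub>R (y - x)) \<bullet> (y - x)"
    by auto
  then show ?thesis by (intro bexI[of _ \<theta>]) auto
qed

lemma taylor2_along_segment:
  fixes f :: "real^'n \<Rightarrow> real"
  assumes d1: "\<And>x. (f has_derivative (\<lambda>h. f1 x \<bullet> h)) (at x)"
    and d2: "\<And>x. (f1 has_derivative (\<lambda>h. f2 x *v h)) (at x)"
  shows "\<exists>\<theta>\<in>{0..1}. f (x + h) - f x - f1 x \<bullet> h = 1/2 * (h \<bullet> (f2 (x + \<theta> *\<^sub>R h) *v h))"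
proof -
  \<comment> \<open>The derivatives of \<open>f\<close> along the ray from \<open>x\<close> in
    direction \<open>h\<close>, listed as a sequence for the one-dimensional Maclaurin theorem with
    Lagrange remainder.\<close>
  define D where "D m \<theta> = (if m = 0 then f (x + \<theta> *\<^sub>R h) else if m = 1 then f1 (x + \<theta> *\<^sub>R h) \<bullet> h
    else h \<bullet> (f2 (x + \<theta> *\<^sub>R h) *v h))" for m :: nat and \<theta> :: real
  have 0: "(D 0 has_real_derivative D 1 \<theta>) (at \<theta>)" for \<theta>
  proof -
    have "((\<lambda>\<theta>. f (x + \<theta> *\<^sub>R h)) has_derivative (\<lambda>d. f1 (x + \<theta> *\<^sub>R h) \<bullet> (d *\<^sub>R h))) (at \<theta>)"
      by (rule has_derivative_compose[OF _ d1]) (auto intro!: derivative_eq_intros)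
    then show ?thesis
      unfolding D_def by (intro has_derivative_imp_has_field_derivative) (auto simp: fun_eq_iff)
  qed
  have 1: "(D 1 has_real_derivative D 2 \<theta>) (at \<theta>)" for \<theta>
  proof -
    have "((\<lambda>\<theta>. f1 (x + \<theta> *\<^sub>R h)) has_derivative (\<lambda>d. f2 (x + \<theta> *\<^sub>R h) *v (d *\<^sub>R h))) (at \<theta>)"
      by (rule has_derivative_compose[OF _ d2]) (auto intro!: derivative_eq_intros)
    then have "((\<lambda>\<theta>. f1 (x + \<theta> *\<^sub>R h) \<bullet> h) has_derivative (\<lambda>d. (f2 (x + \<theta> *\<^sub>R h) *v (d *\<^sub>R h)) \<bullet> h)) (at \<theta>)"
      by (auto intro!: derivative_eq_intros)
    then show ?thesis
      unfolding D_def
      by (intro has_derivative_imp_has_field_derivative)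
        (auto simp: fun_eq_iff matrix_vector_mult_scaleR inner_commute)
  qed
  have "\<exists>t>0. t \<le> 1 \<and> f (x + 1 *\<^sub>R h) = (\<Sum>m<2. D m 0 / fact m * 1 ^ m) + D 2 t / fact 2 * 1 ^ 2"
  proof (rule Maclaurin2)
    show "\<forall>m t. m < 2 \<and> 0 \<le> t \<and> t \<le> 1 \<longrightarrow> (D m has_real_derivative D (Suc m) t) (at t)"
    proof (intro allI impI)
      fix m t assume "m < (2::nat) \<and> 0 \<le> t \<and> t \<le> (1::real)"
      then have "m = 0 \<or> m = 1" by auto
      with 0[of t] 1[of t] show "(D m has_real_derivative D (Suc m) t) (at t)"
        by (auto simp: numeral_2_eq_2)
    qed
  qed (auto simp: D_def)
  then obtain t where "0 < t" "t \<le> 1" "f (x + h) = f x + f1 x \<bullet> h + h \<bullet> (f2 (x + t *\<^sub>R h) *v h) / 2"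
    by (auto simp: numeral_2_eq_2 D_def)
  then show ?thesis by (intro bexI[of _ t]) auto
qed

text \<open>The fourth-order term takes care of the steps that leave the \<open>\<delta>\<close>-ball.\<close>

lemma taylor2_remainder_bound:
  fixes f :: "real^'n \<Rightarrow> real"
  assumes d1: "\<And>x. (f has_derivative (\<lambda>h. f1 x \<bullet> h)) (at x)"
    and d2: "\<And>x. (f1 has_derivative (\<lambda>h. f2 x *v h)) (at x)"
    and bound: "\<And>x. norm (f2 x) \<le> C"
    and unif: "\<And>x y. norm (x - y) < \<delta> \<Longrightarrow> norm (f2 x - f2 y) \<le> \<epsilon>"
    and \<delta>: "\<delta> > 0" and \<epsilon>: "\<epsilon> > 0"
  shows "\<bar>f (x + h) - f x - f1 x \<bullet> h - 1/2 * (h \<bullet> (f2 x *v h))\<bar>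
    \<le> \<epsilon> * (norm h)\<^sup>2 + C / \<delta>\<^sup>2 * norm h ^ 4"
proof -
  obtain \<theta> where \<theta>: "\<theta> \<in> {0..1}" "f (x + h) - f x - f1 x \<bullet> h = 1/2 * (h \<bullet> (f2 (x + \<theta> *\<^sub>R h) *v h))"
    using taylor2_along_segment[OF d1 d2] by blast
  have C: "C \<ge> 0" using bound[of 0] norm_ge_zero[of "f2 0"] by linarith
  have "f (x + h) - f x - f1 x \<bullet> h - 1/2 * (h \<bullet> (f2 x *v h)) = 1/2 * (h \<bullet> ((f2 (x + \<theta> *\<^sub>R h) - f2 x) *v h))"
    unfolding \<theta>(2) by (simp add: matrix_vector_mult_diff_rdistrib inner_diff_right field_simps)
  also have "\<bar>\<dots>\<bar> \<le> 1/2 * (norm h * (norm (f2 (x + \<theta> *\<^sub>R h) - f2 x) * norm h))"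
    unfolding abs_mult using order_trans[OF Cauchy_Schwarz_ineq2 mult_left_mono[OF norm_matrix_vector_mult_le norm_ge_zero]]
    by simp
  also have "\<dots> = 1/2 * norm (f2 (x + \<theta> *\<^sub>R h) - f2 x) * (norm h)\<^sup>2"
    by (simp add: power2_eq_square)
  also have "\<dots> \<le> \<epsilon> * (norm h)\<^sup>2 + C / \<delta>\<^sup>2 * norm h ^ 4"
  proof (cases "norm h < \<delta>")
    case True
    have "norm (x + \<theta> *\<^sub>R h - x) \<le> 1 * norm h" using \<theta>(1) by (auto intro: mult_left_le_one_le)
    with True have "norm (f2 (x + \<theta> *\<^sub>R h) - f2 x) \<le> \<epsilon>" by (intro unif) simp
    then have "1/2 * norm (f2 (x + \<theta> *\<^sub>R h) - f2 x) * (norm h)\<^sup>2 \<le> \<epsilon> * (norm h)\<^sup>2"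
      using \<epsilon> by (intro mult_right_mono) auto
    moreover have "0 \<le> C / \<delta>\<^sup>2 * norm h ^ 4" using C by simp
    ultimately show ?thesis by linarith
  next
    case False
    have "norm (f2 (x + \<theta> *\<^sub>R h) - f2 x) \<le> 2 * C"
      using norm_triangle_ineq4[of "f2 (x + \<theta> *\<^sub>R h)" "f2 x"] bound[of x] bound[of "x + \<theta> *\<^sub>R h"] by linarith
    then have "1/2 * norm (f2 (x + \<theta> *\<^sub>R h) - f2 x) * (norm h)\<^sup>2 \<le> C * (norm h)\<^sup>2"
      by (intro mult_right_mono) auto
    also have "\<dots> \<le> C * ((norm h)\<^sup>2 * ((norm h)\<^sup>2 / \<delta>\<^sup>2))"
    proof -
      have "1 \<le> (norm h)\<^sup>2 / \<delta>\<^sup>2" using False \<delta> by (simp add: power_mono)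
      then show ?thesis
        using C by (intro mult_left_mono) (metis mult.right_neutral mult_left_mono zero_le_power2)+
    qed
    also have "\<dots> = C / \<delta>\<^sup>2 * norm h ^ 4" by (simp add: power4_eq_xxxx power2_eq_square)
    also have "\<dots> \<le> \<epsilon> * (norm h)\<^sup>2 + C / \<delta>\<^sup>2 * norm h ^ 4" using \<epsilon> by simp
    finally show ?thesis .
  qed
  finally show ?thesis .
qed

text \<open>Each truncated increment is at most the increment of the minimum of \<open>A\<close> and
  \<open>c + 1\<close>: below level \<open>c\<close> there is room for a jump of size one before
  that cap is reached. The sum telescopes, with a bound that depends neither on the grid nor on the
  path.\<close>

lemma sum_truncated_increments_le:
  fixes A :: "nat \<Rightarrow> real"
  assumes "\<And>k. A k \<le> A (Suc k)" and "A 0 \<ge> 0" and "c \<ge> 0"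
  shows "(\<Sum>k<n. if A k < c then min 1 (A (Suc k) - A k) else 0) \<le> c + 1"
proof -
  have "(if A k < c then min 1 (A (Suc k) - A k) else 0) \<le> min (A (Suc k)) (c + 1) - min (A k) (c + 1)" for k
    using assms(1)[of k] by auto
  then have "(\<Sum>k<n. if A k < c then min 1 (A (Suc k) - A k) else 0)
      \<le> (\<Sum>k<n. min (A (Suc k)) (c + 1) - min (A k) (c + 1))"
    by (rule sum_mono)
  also have "\<dots> = min (A n) (c + 1) - min (A 0) (c + 1)" by (rule sum_lessThan_telescope)
  finally show ?thesis using assms by auto
qed

lemma set_integral_split:
  fixes f :: "real \<Rightarrow> 'b::{banach, second_countable_topology}"
  assumes "set_integrable lborel {p..<r} f" "p \<le> q" "q \<le> r"
  shows "(LBINT x:{p..<r}. f x) = (LBINT x:{p..<q}. f x) + (LBINT x:{q..<r}. f x)"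
proof -
  have "{p..<r} = {p..<q} \<union> {q..<r}" using assms by auto
  moreover have "set_integrable lborel {p..<q} f" "set_integrable lborel {q..<r} f"
    by (rule set_integrable_subset[OF assms(1)]; use assms in auto)+
  ultimately show ?thesis by (simp add: set_integral_Un)
qed

lemma set_integral_sum_grid:
  fixes f :: "real \<Rightarrow> 'b::{banach, second_countable_topology}"
  assumes "set_integrable lborel {s 0..<s n} f" "\<And>k. s k \<le> s (Suc k)"
  shows "(\<Sum>k<n. LBINT x:{s k..<s (Suc k)}. f x) = (LBINT x:{s 0..<s n}. f x)"
  using assms(1)
proof (induction n)
  case (Suc n)
  have 0: "s 0 \<le> s n" using assms(2) by (simp add: lift_Suc_mono_le)
  have "set_integrable lborel {s 0..<s n} f"
    by (rule set_integrable_subset[OF Suc.prems]) (use assms(2)[of n] in auto)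
  with Suc.IH set_integral_split[OF Suc.prems 0 assms(2)] show ?case by simp
qed (simp add: set_lebesgue_integral_def)

lemma set_integrable_continuous_inner:
  fixes b c :: "real \<Rightarrow> 'e::euclidean_space"
  assumes b: "set_integrable lborel {p..<q} b" and c: "continuous_on {p..q} c"
  shows "set_integrable lborel {p..<q} (\<lambda>r. c r \<bullet> b r)"
proof -
  have "bounded (c ` {p..q})" using c compact_continuous_image compact_imp_bounded by blast
  then obtain K where "\<forall>x\<in>c ` {p..q}. norm x \<le> K" unfolding bounded_iff ..
  then have K: "norm (c r) \<le> K" if "r \<in> {p..q}" for r using that by blast
  have mc: "(\<lambda>r. indicat_real {p..q} r *\<^sub>R c r) \<in> borel_measurable borel"
    using borel_measurable_continuous_on_indicator[OF _ c] by simp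
  have mb: "(\<lambda>r. indicat_real {p..<q} r *\<^sub>R b r) \<in> borel_measurable lborel"
    using b unfolding set_integrable_def by (rule borel_measurable_integrable)
  have eq: "indicat_real {p..<q} r *\<^sub>R (c r \<bullet> b r)
      = (indicat_real {p..q} r *\<^sub>R c r) \<bullet> (indicat_real {p..<q} r *\<^sub>R b r)" for r
    by (auto simp: indicator_def)
  show ?thesis
    unfolding set_integrable_def
  proof (rule Bochner_Integration.integrable_bound)
    show "integrable lborel (\<lambda>r. K * norm (indicat_real {p..<q} r *\<^sub>R b r))"
      using integrable_norm[OF b[unfolded set_integrable_def]] by (rule integrable_mult_right)
    show "(\<lambda>r. indicat_real {p..<q} r *\<^sub>R (c r \<bullet> b r)) \<in> borel_measurable lborel"
      unfolding eq using mc mb by measurable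
    show "AE r in lborel. norm (indicat_real {p..<q} r *\<^sub>R (c r \<bullet> b r))
        \<le> norm (K * norm (indicat_real {p..<q} r *\<^sub>R b r))"
    proof (rule AE_I2)
      fix r
      have "\<bar>c r \<bullet> b r\<bar> \<le> K * norm (b r)" if "p \<le> r" "r < q"
        using order_trans[OF Cauchy_Schwarz_ineq2 mult_right_mono[OF K norm_ge_zero]] that by auto
      then show "norm (indicat_real {p..<q} r *\<^sub>R (c r \<bullet> b r)) \<le> norm (K * norm (indicat_real {p..<q} r *\<^sub>R b r))"
        by (auto simp: indicator_def intro: order_trans[OF _ abs_ge_self])
    qed
  qed
qed

text \<open>Since \<open>b\<close> is merely integrable, it is integrated exactly over each cell;
  only the continuous factor \<open>c\<close> is sampled. The sample \<open>d m k\<close> need not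
  be a value of \<open>c\<close>, only uniformly close to it on the cell, and the error is at most
  \<open>e\<close> times the integral of the norm of \<open>b\<close>.\<close>

lemma riemann_stieltjes_tendsto:
  fixes b c :: "real \<Rightarrow> 'e::euclidean_space" and s :: "nat \<Rightarrow> nat \<Rightarrow> real"
  assumes b: "set_integrable lborel {p..<q} b" and c: "continuous_on {p..q} c"
    and s: "\<And>m. s m 0 = p" "\<And>m. s m (N m) = q" "\<And>m k. s m k \<le> s m (Suc k)"
    and close: "\<And>e. e > 0 \<Longrightarrow> \<forall>\<^sub>F m in sequentially. \<forall>k<N m. \<forall>r\<in>{s m k..<s m (Suc k)}. norm (d m k - c r) \<le> e"
  shows "(\<lambda>m. \<Sum>k<N m. d m k \<bullet> (LBINT r:{s m k..<s m (Suc k)}. b r))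
    \<longlonglongrightarrow> (LBINT r:{p..<q}. c r \<bullet> b r)"
proof (rule tendstoI)
  fix \<epsilon> :: real assume \<epsilon>: "\<epsilon> > 0"
  define L where "L = (LBINT r:{p..<q}. norm (b r))"
  have L: "L \<ge> 0" unfolding L_def set_lebesgue_integral_def by (rule Bochner_Integration.integral_nonneg) auto
  \<comment> \<open>The summand 1 covers the case that \<open>b\<close> vanishes almost
    everywhere.\<close>
  define e where "e = \<epsilon> / (2 * (L + 1))"
  have e: "e > 0" using \<epsilon> L by (simp add: e_def)
  have bn: "set_integrable lborel {p..<q} (\<lambda>r. norm (b r))" using b by (rule set_integrable_norm)
  have cb: "set_integrable lborel {p..<q} (\<lambda>r. c r \<bullet> b r)"
    by (rule set_integrable_continuous_inner[OF b c])
  show "\<forall>\<^sub>F m in sequentially. dist (\<Sum>k<N m. d m k \<bullet> (LBINT r:{s m k..<s m (Suc k)}. b r))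
      (LBINT r:{p..<q}. c r \<bullet> b r) < \<epsilon>"
    using close[OF e]
  proof eventually_elim
    case (elim m)
    have mono: "s m k \<le> s m l" if "k \<le> l" for k l using s(3) that by (simp add: lift_Suc_mono_le)
    have sub: "{s m k..<s m (Suc k)} \<subseteq> {p..<q}" if "k < N m" for k
      using mono[of 0 k] mono[of "Suc k" "N m"] that s by auto
    have ib: "set_integrable lborel {s m k..<s m (Suc k)} b" if "k < N m" for k
      by (rule set_integrable_subset[OF b _ sub[OF that]]) auto
    have ic: "set_integrable lborel {s m k..<s m (Suc k)} (\<lambda>r. c r \<bullet> b r)" if "k < N m" for k
      by (rule set_integrable_subset[OF cb _ sub[OF that]]) auto
    have ibn: "set_integrable lborel {s m k..<s m (Suc k)} (\<lambda>r. norm (b r))" if "k < N m" for k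
      by (rule set_integrable_subset[OF bn _ sub[OF that]]) auto
    have step: "\<bar>d m k \<bullet> (LBINT r:{s m k..<s m (Suc k)}. b r) - (LBINT r:{s m k..<s m (Suc k)}. c r \<bullet> b r)\<bar>
        \<le> e * (LBINT r:{s m k..<s m (Suc k)}. norm (b r))" if k: "k < N m" for k
    proof -
      have 1: "d m k \<bullet> (LBINT r:{s m k..<s m (Suc k)}. b r) = (LBINT r:{s m k..<s m (Suc k)}. d m k \<bullet> b r)"
        using ib[OF k] unfolding set_lebesgue_integral_def set_integrable_def
        by (simp flip: integral_inner_right add: inner_scaleR_right)
      have i1: "set_integrable lborel {s m k..<s m (Suc k)} (\<lambda>r. d m k \<bullet> b r)"
        using integrable_inner_right[of "d m k" lborel "\<lambda>r. indicat_real {s m k..<s m (Suc k)} r *\<^sub>R b r"] ib[OF k]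
        unfolding set_integrable_def by (simp add: inner_scaleR_right)
      have "\<bar>(LBINT r:{s m k..<s m (Suc k)}. d m k \<bullet> b r - c r \<bullet> b r)\<bar>
          \<le> (LBINT r:{s m k..<s m (Suc k)}. e * norm (b r))"
      proof -
        have "norm (LBINT r:{s m k..<s m (Suc k)}. d m k \<bullet> b r - c r \<bullet> b r)
            \<le> (LBINT r:{s m k..<s m (Suc k)}. norm (d m k \<bullet> b r - c r \<bullet> b r))"
          by (rule set_integral_norm_bound[OF set_integral_diff(1)[OF i1 ic[OF k]]])
        also have "\<dots> \<le> (LBINT r:{s m k..<s m (Suc k)}. e * norm (b r))"
        proof (rule set_integral_mono)
          show "set_integrable lborel {s m k..<s m (Suc k)} (\<lambda>r. norm (d m k \<bullet> b r - c r \<bullet> b r))"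
            by (rule set_integrable_norm[OF set_integral_diff(1)[OF i1 ic[OF k]]])
          show "set_integrable lborel {s m k..<s m (Suc k)} (\<lambda>r. e * norm (b r))"
            using ibn[OF k] by simp
          fix r assume r: "r \<in> {s m k..<s m (Suc k)}"
          have "norm ((d m k - c r) \<bullet> b r) \<le> norm (d m k - c r) * norm (b r)"
            by (simp add: Cauchy_Schwarz_ineq2)
          also have "\<dots> \<le> e * norm (b r)" using elim k r by (intro mult_right_mono) auto
          finally show "norm (d m k \<bullet> b r - c r \<bullet> b r) \<le> e * norm (b r)" by (simp add: inner_diff_left)
        qed
        finally show ?thesis by simp
      qed
      then show ?thesis unfolding 1 using set_integral_diff(2)[OF i1 ic[OF k]] by simp
    qed
    have eq: "(LBINT r:{p..<q}. c r \<bullet> b r) = (\<Sum>k<N m. LBINT r:{s m k..<s m (Suc k)}. c r \<bullet> b r)"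
      using set_integral_sum_grid[of "s m" "N m" "\<lambda>r. c r \<bullet> b r"] cb s by simp
    have eqL: "L = (\<Sum>k<N m. LBINT r:{s m k..<s m (Suc k)}. norm (b r))"
      using set_integral_sum_grid[of "s m" "N m" "\<lambda>r. norm (b r)"] bn s by (simp add: L_def)
    have "dist (\<Sum>k<N m. d m k \<bullet> (LBINT r:{s m k..<s m (Suc k)}. b r)) (LBINT r:{p..<q}. c r \<bullet> b r)
        \<le> (\<Sum>k<N m. e * (LBINT r:{s m k..<s m (Suc k)}. norm (b r)))"
      unfolding eq dist_real_def sum_subtractf[symmetric]
      by (rule order_trans[OF sum_abs sum_mono]) (use step in auto)
    also have "\<dots> = e * L" unfolding eqL sum_distrib_left ..
    also have "\<dots> < \<epsilon>"
      using \<epsilon> L by (simp add: e_def field_simps add_pos_nonneg) (smt (verit) mult_nonneg_nonneg)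
    finally show ?case .
  qed
qed

text \<open>Continuity is taken from the gauge integral, which agrees with the Lebesgue integral of
  an integrable function; the endpoint that distinguishes half-open from closed intervals is
  negligible.\<close>

lemma continuous_on_indefinite_set_integral:
  fixes f :: "real \<Rightarrow> 'b::euclidean_space"
  assumes "set_integrable lborel {p..<q} f"
  shows "continuous_on {p..q} (\<lambda>s. LBINT r:{p..<s}. f r)"
proof -
  have "f integrable_on {p..<q}" using set_borel_integral_eq_integral(1)[OF assms] .
  then have "f integrable_on {p..q}"
    by (rule integrable_spike_set) (auto intro: negligible_subset[of "{q}"])
  then have "continuous_on {p..q} (\<lambda>s. integral {p..s} f)" by (rule indefinite_integral_continuous_1)
  moreover have "integral {p..s} f = (LBINT r:{p..<s}. f r)" if "s \<in> {p..q}" for s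
  proof -
    have "set_integrable lborel {p..<s} f"
      by (rule set_integrable_subset[OF assms]) (use that in auto)
    then have "(LBINT r:{p..<s}. f r) = integral {p..<s} f" by (rule set_borel_integral_eq_integral(2))
    also have "\<dots> = integral {p..s} f"
      by (rule integral_spike_set) (auto intro: negligible_subset[of "{s}"])
    finally show ?thesis by simp
  qed
  ultimately show ?thesis by (simp cong: continuous_on_cong_simp)
qed

text \<open>Beyond the last time \<rho> at which the accumulated integral is at most
  \<open>c\<close> the integrand is cut to zero, and at \<rho> the integral has not exceeded
  \<open>c\<close>. This is the estimate that makes the clock useful: the left side is an integral
  of its rate, the bound a constant.\<close>

lemma integral_below_level_le:
  fixes a :: "real \<Rightarrow> real"
  assumes a: "set_integrable lborel {p..<q} a" "\<And>r. a r \<ge> 0" and c: "c \<ge> 0" and A0: "A0 \<ge> 0"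
  shows "(LBINT r:{p..<q}. (if A0 + (LBINT x:{p..<r}. a x) < c then a r else 0)) \<le> c"
proof -
  let ?A = "\<lambda>r. LBINT x:{p..<r}. a x"
  \<comment> \<open>With \<le> in place of < the set is closed, so that its supremum belongs to
    it.\<close>
  define S where "S = {r \<in> {p..q}. A0 + ?A r \<le> c}"
  have int: "set_integrable lborel {p..<r} a" if "r \<le> q" for r
    by (rule set_integrable_subset[OF a(1)]) (use that in auto)
  show ?thesis
  proof (cases "S = {}")
    case True
    have "\<not> A0 + ?A r < c" if "r \<in> {p..<q}" for r
    proof
      assume "A0 + ?A r < c"
      then have "r \<in> S" using that by (simp add: S_def)
      with True show False by simp
    qed
    then have "(LBINT r:{p..<q}. (if A0 + ?A r < c then a r else 0)) = (LBINT r:{p..<q}. 0)"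
      by (intro set_lebesgue_integral_cong) auto
    then show ?thesis using c by simp
  next
    case False
    have "closed ({p..q} \<inter> ?A -` {..c - A0})"
      by (rule continuous_closed_preimage[OF continuous_on_indefinite_set_integral[OF a(1)]]) auto
    also have "{p..q} \<inter> ?A -` {..c - A0} = S" by (auto simp: S_def)
    finally have "closed S" .
    define \<rho> where "\<rho> = Sup S"
    have "\<rho> \<in> S" unfolding \<rho>_def
      by (rule closed_contains_Sup[OF False _ \<open>closed S\<close>]) (auto simp: S_def bdd_above_def)
    then have \<rho>: "p \<le> \<rho>" "\<rho> \<le> q" "A0 + ?A \<rho> \<le> c" by (auto simp: S_def)
    have le: "r \<le> \<rho>" if "r \<in> S" for r
      unfolding \<rho>_def by (rule cSup_upper[OF that]) (auto simp: S_def bdd_above_def)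
    have "(LBINT r:{p..<q}. (if A0 + ?A r < c then a r else 0)) \<le> (LBINT r:{p..<\<rho>}. a r)"
      unfolding set_lebesgue_integral_def[of lborel "{p..<q}"] set_lebesgue_integral_def[of lborel "{p..<\<rho>}"]
    proof (rule integral_mono_AE')
      show "integrable lborel (\<lambda>r. indicat_real {p..<\<rho>} r *\<^sub>R a r)"
        using int[OF \<rho>(2)] by (simp add: set_integrable_def)
      show "AE r in lborel. indicat_real {p..<q} r *\<^sub>R (if A0 + ?A r < c then a r else 0)
          \<le> indicat_real {p..<\<rho>} r *\<^sub>R a r"
        \<comment> \<open>At \<rho> itself the left integrand may be positive, while the half-open
          interval on the right excludes this point.\<close>
        using AE_lborel_singleton[of \<rho>]
      proof eventually_elim
        case (elim r)
        have "r \<in> S" if "p \<le> r" "r < q" "A0 + ?A r < c"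
          using that by (simp add: S_def)
        then show ?case using le[of r] elim a(2)[of r] by (auto simp: indicator_def split: if_splits)
      qed
      show "AE r in lborel. 0 \<le> indicat_real {p..<\<rho>} r *\<^sub>R a r" using a(2) by auto
    qed
    then show ?thesis using \<rho>(3) A0 by linarith
  qed
qed

section \<open>Ito's formula for a constant diffusion coefficient\<close>

text \<open>Only those consequences of the Gaussian law are kept that the Taylor expansion consumes:
  first and second moments of an increment against a bounded variable of the past, and its fourth
  moments. Continuity is demanded of every path, which a modification on a null set
  provides.\<close>

locale filtered_wiener = prob_space M for M :: "'w measure" +
  fixes F :: "real \<Rightarrow> 'w measure" and w :: "real \<Rightarrow> 'w \<Rightarrow> real^'k" and t T :: real
  assumes space_F: "\<And>s. s \<in> {t..T} \<Longrightarrow> space (F s) = space M"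
    and F_mono: "\<And>r s. t \<le> r \<Longrightarrow> r \<le> s \<Longrightarrow> s \<le> T \<Longrightarrow> sets (F r) \<subseteq> sets (F s)"
    and F_le: "\<And>s. s \<in> {t..T} \<Longrightarrow> sets (F s) \<subseteq> sets M"
    and w_continuous: "\<And>\<omega>. \<omega> \<in> space M \<Longrightarrow> continuous_on {t..T} (\<lambda>s. w s \<omega>)"
    and w_adapted: "\<And>r s. t \<le> r \<Longrightarrow> r \<le> s \<Longrightarrow> s \<le> T \<Longrightarrow> (\<lambda>\<omega>. w s \<omega> - w r \<omega>) \<in> borel_measurable (F s)"
    and w_mean: "\<And>r s \<zeta> B i. t \<le> r \<Longrightarrow> r < s \<Longrightarrow> s \<le> T \<Longrightarrow> \<zeta> \<in> borel_measurable (F r) \<Longrightarrow>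
        (\<And>\<omega>. \<omega> \<in> space M \<Longrightarrow> \<bar>\<zeta> \<omega>\<bar> \<le> B) \<Longrightarrow>
        has_bochner_integral M (\<lambda>\<omega>. \<zeta> \<omega> * (w s \<omega> - w r \<omega>) $ i) 0"
    and w_covariance: "\<And>r s \<zeta> B i j. t \<le> r \<Longrightarrow> r < s \<Longrightarrow> s \<le> T \<Longrightarrow> \<zeta> \<in> borel_measurable (F r) \<Longrightarrow>
        (\<And>\<omega>. \<omega> \<in> space M \<Longrightarrow> \<bar>\<zeta> \<omega>\<bar> \<le> B) \<Longrightarrow>
        has_bochner_integral M (\<lambda>\<omega>. \<zeta> \<omega> * ((w s \<omega> - w r \<omega>) $ i * (w s \<omega> - w r \<omega>) $ j))
          (if i = j then (s - r) * (\<integral>\<omega>. \<zeta> \<omega> \<partial>M) else 0)"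
    and w_fourth: "\<And>r s i. t \<le> r \<Longrightarrow> r < s \<Longrightarrow> s \<le> T \<Longrightarrow>
        has_bochner_integral M (\<lambda>\<omega>. ((w s \<omega> - w r \<omega>) $ i) ^ 4) (3 * (s - r)\<^sup>2)"
begin

lemma measurable_F_mono:
  assumes "t \<le> r" "r \<le> s" "s \<le> T" "f \<in> measurable (F r) N"
  shows "f \<in> measurable (F s) N"
  using assms(4) measurable_mono[OF subset_refl refl F_mono[OF assms(1-3)]]
    space_F[of r] space_F[of s] assms(1-3) by auto

lemma measurable_F_M:
  assumes "s \<in> {t..T}" "f \<in> measurable (F s) N"
  shows "f \<in> measurable M N"
  using assms(2) measurable_mono[OF subset_refl refl F_le[OF assms(1)]] space_F[OF assms(1)] by auto

lemma w_norm_moments: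
  fixes r s :: real
  assumes "t \<le> r" "r < s" "s \<le> T"
  shows "has_bochner_integral M (\<lambda>\<omega>. (norm (w s \<omega> - w r \<omega>))\<^sup>2) (CARD('k) * (s - r))"
    and "integrable M (\<lambda>\<omega>. norm (w s \<omega> - w r \<omega>) ^ 4)"
    and "(\<integral>\<omega>. norm (w s \<omega> - w r \<omega>) ^ 4 \<partial>M) \<le> 3 * (real CARD('k))\<^sup>2 * (s - r)\<^sup>2"
proof -
  let ?D = "\<lambda>\<omega>. w s \<omega> - w r \<omega>"
  have n2: "(norm x)\<^sup>2 = (\<Sum>i\<in>UNIV. x $ i * x $ i)" for x :: "real^'k"
    by (simp add: power2_norm_eq_inner inner_vec_def)
  have "has_bochner_integral M (\<lambda>\<omega>. ?D \<omega> $ i * ?D \<omega> $ i) (s - r)" for i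
    using w_covariance[OF assms, of "\<lambda>_. 1" 1 i i] prob_space by simp
  then have "has_bochner_integral M (\<lambda>\<omega>. \<Sum>i\<in>UNIV. ?D \<omega> $ i * ?D \<omega> $ i) (\<Sum>i\<in>(UNIV::'k set). s - r)"
    by (rule has_bochner_integral_sum)
  then show "has_bochner_integral M (\<lambda>\<omega>. (norm (?D \<omega>))\<^sup>2) (CARD('k) * (s - r))"
    by (simp add: n2)
  have four: "has_bochner_integral M (\<lambda>\<omega>. CARD('k) * (\<Sum>i\<in>UNIV. (?D \<omega> $ i) ^ 4))
      (CARD('k) * (\<Sum>i\<in>(UNIV::'k set). 3 * (s - r)\<^sup>2))"
    by (intro has_bochner_integral_mult_right has_bochner_integral_sum w_fourth assms)
  \<comment> \<open>Cauchy-Schwarz against the constant vector costs one factor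
    \<open>CARD('k)\<close>; summing the fourth moments over the coordinates costs the
    other.\<close>
  have le: "norm x ^ 4 \<le> CARD('k) * (\<Sum>i\<in>UNIV. (x $ i) ^ 4)" for x :: "real^'k"
  proof -
    have "norm x ^ 4 = (\<Sum>i\<in>UNIV. (x $ i)\<^sup>2)\<^sup>2"
      using n2[of x] by (metis (no_types, lifting) power2_eq_square power4_eq_xxxx mult.assoc sum.cong)
    also have "\<dots> \<le> (\<Sum>i\<in>UNIV. ((x $ i)\<^sup>2)\<^sup>2) * (\<Sum>i\<in>(UNIV::'k set). 1\<^sup>2)"
      using Cauchy_Schwarz_ineq_sum[of "\<lambda>i. (x $ i)\<^sup>2" "\<lambda>_. 1" UNIV] by simp
    also have "\<dots> = CARD('k) * (\<Sum>i\<in>UNIV. (x $ i) ^ 4)" by (simp flip: power_mult)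
    finally show ?thesis .
  qed
  have meas: "?D \<in> borel_measurable M"
    using measurable_F_M[OF _ w_adapted[of r s]] assms by auto
  show i: "integrable M (\<lambda>\<omega>. norm (?D \<omega>) ^ 4)"
    by (rule Bochner_Integration.integrable_bound[OF integrable.intros[OF four]])
      (use meas in \<open>auto intro!: AE_I2 order_trans[OF le abs_ge_self] simp del: vector_minus_component\<close>)
  have "(\<integral>\<omega>. norm (?D \<omega>) ^ 4 \<partial>M) \<le> (\<integral>\<omega>. CARD('k) * (\<Sum>i\<in>UNIV. (?D \<omega> $ i) ^ 4) \<partial>M)"
    by (rule integral_mono[OF i integrable.intros[OF four]]) (rule le)
  also have "\<dots> = 3 * (real CARD('k))\<^sup>2 * (s - r)\<^sup>2"
    using has_bochner_integral_integral_eq[OF four] by (simp add: power2_eq_square)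
  finally show "(\<integral>\<omega>. norm (?D \<omega>) ^ 4 \<partial>M) \<le> 3 * (real CARD('k))\<^sup>2 * (s - r)\<^sup>2" .
qed

end

text \<open>
  The extra argument \<open>a\<close> is fed with an increasing process that dominates the drift and the squared
  diffusion; since everything vanishes for \<open>a \<ge> c\<close>, no stopping is needed in the Ito formula.
\<close>

locale test_function =
  fixes lo hi :: real and \<Phi> \<Phi>t \<Phi>a :: "real^'n \<Rightarrow> real \<Rightarrow> real \<Rightarrow> real"
    and \<Phi>x :: "real^'n \<Rightarrow> real \<Rightarrow> real \<Rightarrow> real^'n"
    and \<Phi>xx :: "real^'n \<Rightarrow> real \<Rightarrow> real \<Rightarrow> real^'n^'n" and C c :: real
  assumes c_nonneg: "c \<ge> 0"
    and deriv_t: "\<And>x s a. s \<in> {lo..hi} \<Longrightarrow> ((\<lambda>s. \<Phi> x s a) has_real_derivative \<Phi>t x s a) (at s within {lo..hi})"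
    and deriv_a: "\<And>x s a. s \<in> {lo..hi} \<Longrightarrow> ((\<lambda>a. \<Phi> x s a) has_real_derivative \<Phi>a x s a) (at a)"
    and deriv_x: "\<And>x s a. s \<in> {lo..hi} \<Longrightarrow> ((\<lambda>x. \<Phi> x s a) has_derivative (\<lambda>h. \<Phi>x x s a \<bullet> h)) (at x)"
    and deriv_xx: "\<And>x s a. s \<in> {lo..hi} \<Longrightarrow> ((\<lambda>x. \<Phi>x x s a) has_derivative (\<lambda>h. \<Phi>xx x s a *v h)) (at x)"
    and bound: "\<And>x s a. s \<in> {lo..hi} \<Longrightarrow> \<bar>\<Phi> x s a\<bar> \<le> C"
    and bound_t: "\<And>x s a. s \<in> {lo..hi} \<Longrightarrow> \<bar>\<Phi>t x s a\<bar> \<le> C"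
    and bound_a: "\<And>x s a. s \<in> {lo..hi} \<Longrightarrow> \<bar>\<Phi>a x s a\<bar> \<le> C"
    and bound_x: "\<And>x s a. s \<in> {lo..hi} \<Longrightarrow> norm (\<Phi>x x s a) \<le> C"
    and bound_xx: "\<And>x s a. s \<in> {lo..hi} \<Longrightarrow> norm (\<Phi>xx x s a) \<le> C"
    and vanish: "\<And>x s a. s \<in> {lo..hi} \<Longrightarrow> a \<ge> c \<Longrightarrow> \<Phi> x s a = 0"
    and vanish_t: "\<And>x s a. s \<in> {lo..hi} \<Longrightarrow> a \<ge> c \<Longrightarrow> \<Phi>t x s a = 0"
    and vanish_a: "\<And>x s a. s \<in> {lo..hi} \<Longrightarrow> a \<ge> c \<Longrightarrow> \<Phi>a x s a = 0"
    and vanish_x: "\<And>x s a. s \<in> {lo..hi} \<Longrightarrow> a \<ge> c \<Longrightarrow> \<Phi>x x s a = 0"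
    and vanish_xx: "\<And>x s a. s \<in> {lo..hi} \<Longrightarrow> a \<ge> c \<Longrightarrow> \<Phi>xx x s a = 0"
    and ucont: "uniformly_continuous_on (UNIV \<times> {lo..hi} \<times> UNIV) (\<lambda>(x, s, a). \<Phi> x s a)"
    and ucont_t: "uniformly_continuous_on (UNIV \<times> {lo..hi} \<times> UNIV) (\<lambda>(x, s, a). \<Phi>t x s a)"
    and ucont_a: "uniformly_continuous_on (UNIV \<times> {lo..hi} \<times> UNIV) (\<lambda>(x, s, a). \<Phi>a x s a)"
    and ucont_x: "uniformly_continuous_on (UNIV \<times> {lo..hi} \<times> UNIV) (\<lambda>(x, s, a). \<Phi>x x s a)"
    and ucont_xx: "uniformly_continuous_on (UNIV \<times> {lo..hi} \<times> UNIV) (\<lambda>(x, s, a). \<Phi>xx x s a)"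

lemma continuous_slice_measurable:
  fixes f :: "'a::second_countable_topology \<Rightarrow> real \<Rightarrow> real \<Rightarrow> 'b::{metric_space, second_countable_topology}"
  assumes "continuous_on (UNIV \<times> S \<times> UNIV) (\<lambda>(x, s, a). f x s a)" "s \<in> S"
    and [measurable]: "X \<in> borel_measurable M" "A \<in> borel_measurable M"
  shows "(\<lambda>\<omega>. f (X \<omega>) s (A \<omega>)) \<in> borel_measurable M"
proof -
  have "continuous_on UNIV (\<lambda>y. (\<lambda>(x, s, a). f x s a) (fst y, s, snd y))"
    by (rule continuous_on_compose2[OF assms(1)]) (use assms(2) in \<open>auto intro!: continuous_intros\<close>)
  then have "(\<lambda>y. f (fst y) s (snd y)) \<in> borel_measurable borel"
    by (simp add: borel_measurable_continuous_onI)
  then have "(\<lambda>\<omega>. (\<lambda>y. f (fst y) s (snd y)) (X \<omega>, A \<omega>)) \<in> borel_measurable M"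
    by (rule measurable_compose[rotated]) (simp add: borel_prod[symmetric])
  then show ?thesis by simp
qed

lemma continuous_along_path:
  assumes "continuous_on (UNIV \<times> S \<times> UNIV) (\<lambda>(x, s, a). f x s a)"
    and "continuous_on S' X" "continuous_on S' A" "S' \<subseteq> S"
  shows "continuous_on S' (\<lambda>r. f (X r) r (A r))"
proof -
  have "continuous_on S' (\<lambda>r. (\<lambda>(x, s, a). f x s a) (X r, r, A r))"
    by (rule continuous_on_compose2[OF assms(1)]) (use assms in \<open>auto intro!: continuous_intros\<close>)
  then show ?thesis by simp
qed

context test_function
begin

lemmas cont = uniformly_continuous_imp_continuous[OF ucont]
lemmas cont_t = uniformly_continuous_imp_continuous[OF ucont_t]
lemmas cont_a = uniformly_continuous_imp_continuous[OF ucont_a]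
lemmas cont_x = uniformly_continuous_imp_continuous[OF ucont_x]
lemmas cont_xx = uniformly_continuous_imp_continuous[OF ucont_xx]

lemma ucont_xx_slice:
  assumes "\<epsilon> > 0"
  obtains \<delta> where "\<delta> > 0"
    "\<And>x y s a. s \<in> {lo..hi} \<Longrightarrow> norm (x - y) < \<delta> \<Longrightarrow> norm (\<Phi>xx x s a - \<Phi>xx y s a) \<le> \<epsilon>"
proof -
  obtain \<delta> where \<delta>: "\<delta> > 0" and *: "\<And>z z'. z \<in> UNIV \<times> {lo..hi} \<times> UNIV \<Longrightarrow> z' \<in> UNIV \<times> {lo..hi} \<times> UNIV \<Longrightarrow>
     dist z' z < \<delta> \<Longrightarrow> dist ((\<lambda>(x, s, a). \<Phi>xx x s a) z') ((\<lambda>(x, s, a). \<Phi>xx x s a) z) < \<epsilon>"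
    using ucont_xx assms unfolding uniformly_continuous_on_def by metis
  show thesis
  proof (rule that[OF \<delta>])
    fix x y :: "real^'n" and s a :: real assume "s \<in> {lo..hi}" "norm (x - y) < \<delta>"
    then show "norm (\<Phi>xx x s a - \<Phi>xx y s a) \<le> \<epsilon>"
      using *[of "(y, s, a)" "(x, s, a)"] by (auto simp: dist_Pair_Pair dist_norm)
  qed
qed

end

lemma borel_measurable_cart_nth [measurable (raw)]:
  fixes f :: "'w \<Rightarrow> 'b::{second_countable_topology, topological_space}^'n"
  assumes "f \<in> borel_measurable M"
  shows "(\<lambda>x. f x $ i) \<in> borel_measurable M"
  using assms
  by (rule measurable_compose) (intro borel_measurable_continuous_onI continuous_intros)

lemma borel_measurable_matrix_vector_mult [measurable (raw)]:
  fixes A :: "'w \<Rightarrow> real^'k^'n"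
  assumes [measurable]: "A \<in> borel_measurable M" "v \<in> borel_measurable M"
  shows "(\<lambda>x. A x *v v x) \<in> borel_measurable M"
proof (subst borel_measurable_euclidean_space, rule ballI)
  fix b :: "real^'n" assume "b \<in> Basis"
  then obtain i where b: "b = axis i 1" by (auto simp: Basis_vec_def)
  have "(\<lambda>x. \<Sum>j\<in>UNIV. A x $ i $ j * v x $ j) \<in> borel_measurable M" by measurable
  then show "(\<lambda>x. (A x *v v x) \<bullet> b) \<in> borel_measurable M"
    by (simp add: b inner_axis matrix_vector_mult_def)
qed

text \<open>The second-order Taylor polynomial contributes nothing in the mean: the linear term has
  mean zero given the past, and the quadratic one is compensated by the trace. Only the remainder is
  left, of size \<epsilon> times the step plus the square of the step, so that its sum over a fine
  grid is small.\<close>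

lemma (in filtered_wiener) conditional_taylor_bound:
  fixes r s :: real and \<Phi> :: "real^'n \<Rightarrow> real \<Rightarrow> real \<Rightarrow> real"
  assumes \<Phi>: "test_function lo hi \<Phi> \<Phi>t \<Phi>a \<Phi>x \<Phi>xx C c"
    and r: "t \<le> r" "r < s" "s \<le> T" "r \<in> {lo..hi}"
    and Z: "Z \<in> borel_measurable (F r)" "\<And>\<omega>. \<omega> \<in> space M \<Longrightarrow> \<bar>Z \<omega>\<bar> \<le> B"
    and X: "X \<in> borel_measurable (F r)" and A: "A \<in> borel_measurable (F r)"
    and \<xi>: "\<xi> \<in> borel_measurable (F r)" "\<And>\<omega>. \<omega> \<in> space M \<Longrightarrow> norm (\<xi> \<omega>) \<le> L"
    and \<delta>: "\<delta> > 0" "\<epsilon> > 0"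
    and unif: "\<And>x y a. norm (x - y) < \<delta> \<Longrightarrow> norm (\<Phi>xx x r a - \<Phi>xx y r a) \<le> \<epsilon>"
  defines "Q \<equiv> \<lambda>\<omega>. Z \<omega> * (\<Phi> (X \<omega> + \<xi> \<omega> *v (w s \<omega> - w r \<omega>)) r (A \<omega>) - \<Phi> (X \<omega>) r (A \<omega>)
      - (s - r) * (1/2 * trace (\<xi> \<omega> ** transpose (\<xi> \<omega>) ** \<Phi>xx (X \<omega>) r (A \<omega>))))"
  shows "integrable M Q" and "\<bar>\<integral>\<omega>. Q \<omega> \<partial>M\<bar>
     \<le> B * (\<epsilon> * L\<^sup>2 * (CARD('k) * (s - r)) + C / \<delta>\<^sup>2 * L ^ 4 * (3 * (real CARD('k))\<^sup>2 * (s - r)\<^sup>2))"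
proof -
  interpret \<Phi>: test_function lo hi \<Phi> \<Phi>t \<Phi>a \<Phi>x \<Phi>xx C c by fact
  define D where "D \<omega> = w s \<omega> - w r \<omega>" for \<omega>
  define U where "U \<omega> = \<Phi>x (X \<omega>) r (A \<omega>)" for \<omega>
  define N where "N \<omega> = \<Phi>xx (X \<omega>) r (A \<omega>)" for \<omega>
  define h where "h \<omega> = \<xi> \<omega> *v D \<omega>" for \<omega>
  define R where "R \<omega> = \<Phi> (X \<omega> + h \<omega>) r (A \<omega>) - \<Phi> (X \<omega>) r (A \<omega>) - U \<omega> \<bullet> h \<omega>
      - 1/2 * (h \<omega> \<bullet> (N \<omega> *v h \<omega>))" for \<omega>
  have rT: "r \<in> {t..T}" "s \<in> {t..T}" using r by auto
  obtain \<omega>0 where \<omega>0: "\<omega>0 \<in> space M" using not_empty by auto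
  have B: "B \<ge> 0" using Z(2)[OF \<omega>0] by linarith
  have L: "L \<ge> 0" using \<xi>(2)[OF \<omega>0] norm_ge_zero order_trans by blast
  have C: "C \<ge> 0" using \<Phi>.bound[OF r(4), of 0 0] by linarith
  note [measurable] = Z(1) X A \<xi>(1)
  have U [measurable]: "U \<in> borel_measurable (F r)"
    unfolding U_def by (rule continuous_slice_measurable[OF \<Phi>.cont_x r(4)]) measurable
  have N [measurable]: "N \<in> borel_measurable (F r)"
    unfolding N_def by (rule continuous_slice_measurable[OF \<Phi>.cont_xx r(4)]) measurable
  have first: "has_bochner_integral M (\<lambda>\<omega>. Z \<omega> * (U \<omega> \<bullet> h \<omega>)) 0"
  proof -
    \<comment> \<open>Written coordinate by coordinate, so that the factor in front of each
      increment is bounded and measurable at time \<open>r\<close>.\<close>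
    have "has_bochner_integral M (\<lambda>\<omega>. \<Sum>i\<in>UNIV. (Z \<omega> * (\<Sum>l\<in>UNIV. U \<omega> $ l * \<xi> \<omega> $ l $ i)) * D \<omega> $ i) (\<Sum>i\<in>(UNIV::'k set). 0)"
      unfolding D_def
    proof (rule has_bochner_integral_sum, rule w_mean[OF r(1-3)])
      fix i :: 'k
      show "(\<lambda>\<omega>. Z \<omega> * (\<Sum>l\<in>UNIV. U \<omega> $ l * \<xi> \<omega> $ l $ i)) \<in> borel_measurable (F r)" by measurable
      fix \<omega> assume \<omega>: "\<omega> \<in> space M"
      have "\<bar>\<Sum>l\<in>UNIV. U \<omega> $ l * \<xi> \<omega> $ l $ i\<bar> \<le> (\<Sum>l\<in>(UNIV::'n set). C * L)"
      proof (rule order_trans[OF sum_abs], rule sum_mono)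
        fix l
        have "\<bar>U \<omega> $ l\<bar> \<le> C"
          using component_le_norm_cart[of "U \<omega>" l] \<Phi>.bound_x[OF r(4), of "X \<omega>" "A \<omega>"] by (simp add: U_def)
        moreover have "\<bar>\<xi> \<omega> $ l $ i\<bar> \<le> L"
          using component_le_norm_cart[of "\<xi> \<omega> $ l" i] Finite_Cartesian_Product.norm_nth_le[of "\<xi> \<omega>" l] \<xi>(2)[OF \<omega>] by linarith
        ultimately show "\<bar>U \<omega> $ l * \<xi> \<omega> $ l $ i\<bar> \<le> C * L"
          using C L by (simp add: abs_mult mult_mono)
      qed
      then show "\<bar>Z \<omega> * (\<Sum>l\<in>UNIV. U \<omega> $ l * \<xi> \<omega> $ l $ i)\<bar> \<le> B * (\<Sum>l\<in>(UNIV::'n set). C * L)"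
        unfolding abs_mult using Z(2)[OF \<omega>] B by (intro mult_mono) auto
    qed
    moreover have "(\<Sum>i\<in>UNIV. (Z \<omega> * (\<Sum>l\<in>UNIV. U \<omega> $ l * \<xi> \<omega> $ l $ i)) * D \<omega> $ i) = Z \<omega> * (U \<omega> \<bullet> h \<omega>)" for \<omega>
    proof -
      have "U \<omega> \<bullet> h \<omega> = (U \<omega> v* \<xi> \<omega>) \<bullet> D \<omega>" by (simp add: h_def dot_lmul_matrix)
      also have "\<dots> = (\<Sum>i\<in>UNIV. (\<Sum>l\<in>UNIV. U \<omega> $ l * \<xi> \<omega> $ l $ i) * D \<omega> $ i)"
        by (simp add: inner_vec_def vector_matrix_mult_def mult.commute)
      finally show ?thesis by (simp add: sum_distrib_left sum_distrib_right mult.assoc)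
    qed
    ultimately show ?thesis by simp
  qed
  define K where "K \<omega> = transpose (\<xi> \<omega>) ** N \<omega> ** \<xi> \<omega>" for \<omega>
  have Kb: "\<bar>Z \<omega> * K \<omega> $ i $ j\<bar> \<le> B * (L\<^sup>2 * C)" if \<omega>: "\<omega> \<in> space M" for \<omega> i j
  proof -
    have "\<bar>K \<omega> $ i $ j\<bar> \<le> (norm (\<xi> \<omega>))\<^sup>2 * norm (N \<omega>)"
      unfolding K_def power2_eq_square by (rule abs_transpose_mult_component_le)
    also have "\<dots> \<le> L\<^sup>2 * C"
      using \<xi>(2)[OF \<omega>] \<Phi>.bound_xx[OF r(4), of "X \<omega>" "A \<omega>"] by (intro mult_mono power_mono) (auto simp: N_def)
    finally show ?thesis unfolding abs_mult using Z(2)[OF \<omega>] B by (intro mult_mono) auto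
  qed
  have Km: "(\<lambda>\<omega>. Z \<omega> * K \<omega> $ i $ j) \<in> borel_measurable (F r)" for i j
    unfolding K_def matrix_matrix_mult_def transpose_def by simp measurable
  have Ki: "integrable M (\<lambda>\<omega>. Z \<omega> * K \<omega> $ i $ j)" for i j
    by (rule integrable_const_bound[where B = "B * (L\<^sup>2 * C)"])
      (use Kb measurable_F_M[OF rT(1) Km] in auto)
  have tr: "trace (\<xi> \<omega> ** transpose (\<xi> \<omega>) ** N \<omega>) = (\<Sum>i\<in>UNIV. K \<omega> $ i $ i)" for \<omega>
    unfolding trace_congruence K_def unfolding trace_def ..
  have second: "has_bochner_integral M (\<lambda>\<omega>. Z \<omega> * (h \<omega> \<bullet> (N \<omega> *v h \<omega>) - (s - r) * trace (\<xi> \<omega> ** transpose (\<xi> \<omega>) ** N \<omega>))) 0"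
  proof -
    \<comment> \<open>Only the diagonal survives, since distinct coordinates are uncorrelated given
      the past; its sum is the trace.\<close>
    have "has_bochner_integral M (\<lambda>\<omega>. \<Sum>i\<in>UNIV. \<Sum>j\<in>UNIV. (Z \<omega> * K \<omega> $ i $ j) * (D \<omega> $ i * D \<omega> $ j))
       (\<Sum>i\<in>UNIV. \<Sum>j\<in>UNIV. if i = j then (s - r) * (\<integral>\<omega>. Z \<omega> * K \<omega> $ i $ j \<partial>M) else 0)"
      unfolding D_def by (intro has_bochner_integral_sum w_covariance[OF r(1-3) Km Kb])
    also have "(\<lambda>\<omega>. \<Sum>i\<in>UNIV. \<Sum>j\<in>UNIV. (Z \<omega> * K \<omega> $ i $ j) * (D \<omega> $ i * D \<omega> $ j)) = (\<lambda>\<omega>. Z \<omega> * (h \<omega> \<bullet> (N \<omega> *v h \<omega>)))"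
      unfolding h_def quadratic_form_congruence K_def by (simp add: sum_distrib_left mult_ac)
    also have "(\<Sum>i\<in>UNIV. \<Sum>j\<in>UNIV. if i = j then (s - r) * (\<integral>\<omega>. Z \<omega> * K \<omega> $ i $ j \<partial>M) else 0)
      = (\<integral>\<omega>. (s - r) * (Z \<omega> * trace (\<xi> \<omega> ** transpose (\<xi> \<omega>) ** N \<omega>)) \<partial>M)"
      using Ki by (simp add: tr sum_distrib_left)
    finally have 1: "has_bochner_integral M (\<lambda>\<omega>. Z \<omega> * (h \<omega> \<bullet> (N \<omega> *v h \<omega>))) \<dots>" .
    have 2: "integrable M (\<lambda>\<omega>. (s - r) * (Z \<omega> * trace (\<xi> \<omega> ** transpose (\<xi> \<omega>) ** N \<omega>)))"
      using Ki by (simp add: tr sum_distrib_left)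
    from has_bochner_integral_diff[OF 1 has_bochner_integral_integrable[OF 2]]
    show ?thesis by (simp add: algebra_simps)
  qed
  have Q: "Q \<omega> = Z \<omega> * R \<omega> + (Z \<omega> * (U \<omega> \<bullet> h \<omega>)
      + 1/2 * (Z \<omega> * (h \<omega> \<bullet> (N \<omega> *v h \<omega>) - (s - r) * trace (\<xi> \<omega> ** transpose (\<xi> \<omega>) ** N \<omega>))))" for \<omega>
    unfolding Q_def R_def N_def h_def D_def by (simp add: field_simps)
  have rest: "has_bochner_integral M (\<lambda>\<omega>. Z \<omega> * (U \<omega> \<bullet> h \<omega>)
      + 1/2 * (Z \<omega> * (h \<omega> \<bullet> (N \<omega> *v h \<omega>) - (s - r) * trace (\<xi> \<omega> ** transpose (\<xi> \<omega>) ** N \<omega>)))) (0 + 1/2 * 0)"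
    by (intro has_bochner_integral_add first has_bochner_integral_mult_right second)
  define G where "G \<omega> = B * (\<epsilon> * L\<^sup>2 * (norm (D \<omega>))\<^sup>2 + C / \<delta>\<^sup>2 * L ^ 4 * norm (D \<omega>) ^ 4)" for \<omega>
  have Gi: "integrable M G" and Ge: "(\<integral>\<omega>. G \<omega> \<partial>M)
      \<le> B * (\<epsilon> * L\<^sup>2 * (CARD('k) * (s - r)) + C / \<delta>\<^sup>2 * L ^ 4 * (3 * (real CARD('k))\<^sup>2 * (s - r)\<^sup>2))"
  proof -
    note m = w_norm_moments[OF r(1-3), folded D_def]
    show "integrable M G"
      unfolding G_def using m(1,2) by (auto simp: has_bochner_integral_iff)
    have "(\<integral>\<omega>. G \<omega> \<partial>M) = B * (\<epsilon> * L\<^sup>2 * (\<integral>\<omega>. (norm (D \<omega>))\<^sup>2 \<partial>M) + C / \<delta>\<^sup>2 * L ^ 4 * (\<integral>\<omega>. norm (D \<omega>) ^ 4 \<partial>M))"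
      unfolding G_def using m(1,2) by (simp add: has_bochner_integral_iff)
    also have "\<dots> \<le> B * (\<epsilon> * L\<^sup>2 * (CARD('k) * (s - r)) + C / \<delta>\<^sup>2 * L ^ 4 * (3 * (real CARD('k))\<^sup>2 * (s - r)\<^sup>2))"
      using m(1,3) B C L \<delta> by (intro mult_left_mono add_mono) (auto simp: has_bochner_integral_iff)
    finally show "(\<integral>\<omega>. G \<omega> \<partial>M)
      \<le> B * (\<epsilon> * L\<^sup>2 * (CARD('k) * (s - r)) + C / \<delta>\<^sup>2 * L ^ 4 * (3 * (real CARD('k))\<^sup>2 * (s - r)\<^sup>2))" .
  qed
  have RG: "\<bar>Z \<omega> * R \<omega>\<bar> \<le> G \<omega>" if \<omega>: "\<omega> \<in> space M" for \<omega>
  proof -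
    have "\<bar>R \<omega>\<bar> \<le> \<epsilon> * (norm (h \<omega>))\<^sup>2 + C / \<delta>\<^sup>2 * norm (h \<omega>) ^ 4"
      unfolding R_def U_def N_def
      by (rule taylor2_remainder_bound[where f = "\<lambda>x. \<Phi> x r (A \<omega>)" and ?f1.0 = "\<lambda>x. \<Phi>x x r (A \<omega>)" and ?f2.0 = "\<lambda>x. \<Phi>xx x r (A \<omega>)"])
        (use \<Phi>.deriv_x[OF r(4)] \<Phi>.deriv_xx[OF r(4)] \<Phi>.bound_xx[OF r(4)] unif \<delta> in auto)
    also have "\<dots> \<le> \<epsilon> * (L * norm (D \<omega>))\<^sup>2 + C / \<delta>\<^sup>2 * (L * norm (D \<omega>)) ^ 4"
    proof -
      have "norm (h \<omega>) \<le> L * norm (D \<omega>)"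
        unfolding h_def using norm_matrix_vector_mult_le[of "\<xi> \<omega>" "D \<omega>"] \<xi>(2)[OF \<omega>]
        by (meson mult_right_mono norm_ge_zero order_trans)
      then show ?thesis using \<delta> C by (intro add_mono mult_left_mono power_mono) auto
    qed
    finally show ?thesis
      unfolding G_def abs_mult using Z(2)[OF \<omega>] B by (intro mult_mono) (auto simp: power_mult_distrib mult_ac)
  qed
  have meas: "(\<lambda>\<omega>. Z \<omega> * R \<omega>) \<in> borel_measurable M"
  proof -
    note [measurable] = measurable_F_M[OF rT(1) Z(1)] measurable_F_M[OF rT(1) X] measurable_F_M[OF rT(1) A]
      measurable_F_M[OF rT(1) \<xi>(1)] measurable_F_M[OF rT(1) U] measurable_F_M[OF rT(1) N]
    have D [measurable]: "D \<in> borel_measurable M"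
      unfolding D_def using measurable_F_M[OF rT(2) w_adapted] r by auto
    have h [measurable]: "h \<in> borel_measurable M"
      unfolding h_def by measurable
    have [measurable]: "(\<lambda>\<omega>. \<Phi> (X \<omega> + h \<omega>) r (A \<omega>)) \<in> borel_measurable M" "(\<lambda>\<omega>. \<Phi> (X \<omega>) r (A \<omega>)) \<in> borel_measurable M"
      by (rule continuous_slice_measurable[OF \<Phi>.cont r(4)]; measurable)+
    show ?thesis unfolding R_def by measurable
  qed
  have ZR: "integrable M (\<lambda>\<omega>. Z \<omega> * R \<omega>)"
    by (rule Bochner_Integration.integrable_bound[OF Gi meas]) (use RG in \<open>auto intro: order_trans[OF _ abs_ge_self]\<close>)
  show "integrable M Q"
    unfolding Q using ZR integrable.intros[OF rest] by (rule Bochner_Integration.integrable_add)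
  have "(\<integral>\<omega>. Q \<omega> \<partial>M) = (\<integral>\<omega>. Z \<omega> * R \<omega> \<partial>M)"
    unfolding Q using Bochner_Integration.integral_add[OF ZR integrable.intros[OF rest]]
      has_bochner_integral_integral_eq[OF rest] by simp
  also have "\<bar>\<dots>\<bar> \<le> (\<integral>\<omega>. \<bar>Z \<omega> * R \<omega>\<bar> \<partial>M)" by (rule integral_abs_bound)
  also have "\<dots> \<le> (\<integral>\<omega>. G \<omega> \<partial>M)"
    by (rule integral_mono[OF _ Gi]) (use ZR RG in auto)
  also note Ge
  finally show "\<bar>\<integral>\<omega>. Q \<omega> \<partial>M\<bar>
     \<le> B * (\<epsilon> * L\<^sup>2 * (CARD('k) * (s - r)) + C / \<delta>\<^sup>2 * L ^ 4 * (3 * (real CARD('k))\<^sup>2 * (s - r)\<^sup>2))" .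
qed

section \<open>Uniform grids and the finite-variation part of the expansion\<close>

text \<open>The index \<open>m\<close> stands for \<open>Suc m\<close> cells, so that the mesh is
  meaningful for every natural number.\<close>

definition grid :: "real \<Rightarrow> real \<Rightarrow> nat \<Rightarrow> nat \<Rightarrow> real" where
  "grid p q m k = p + real k * ((q - p) / real (Suc m))"

lemma grid_0 [simp]: "grid p q m 0 = p"
  by (simp add: grid_def)

lemma grid_last [simp]: "grid p q m (Suc m) = q"
  unfolding grid_def by (simp del: of_nat_Suc)

lemma grid_Suc: "grid p q m (Suc k) = grid p q m k + (q - p) / real (Suc m)"
proof -
  have "real (Suc k) * h = real k * h + h" for h by (simp add: distrib_right)
  then show ?thesis unfolding grid_def by (simp only: add.assoc)
qed

lemma grid_mono:
  assumes "p \<le> q" "k \<le> l"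
  shows "grid p q m k \<le> grid p q m l"
  unfolding grid_def using assms by (intro add_left_mono mult_right_mono) auto

lemma grid_Suc_less: "p < q \<Longrightarrow> grid p q m k < grid p q m (Suc k)"
  by (simp add: grid_Suc del: of_nat_Suc)

lemma grid_in:
  assumes "p \<le> q" "k \<le> Suc m"
  shows "grid p q m k \<in> {p..q}"
  using grid_mono[OF assms(1), of 0 k m] grid_mono[OF assms, of m] by simp

lemma mesh_tendsto_0: "(\<lambda>m. (q - p) / real (Suc m)) \<longlonglongrightarrow> 0"
  by (rule LIMSEQ_Suc[OF lim_const_over_n])

lemma eventually_mesh_less:
  assumes "\<delta> > 0"
  shows "\<forall>\<^sub>F m in sequentially. (q - p) / real (Suc m) < \<delta>"
  using order_tendstoD(2)[OF mesh_tendsto_0 assms] .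

lemma eventually_oscillation_less:
  fixes \<gamma> :: "real \<Rightarrow> 'a::metric_space"
  assumes "continuous_on {p..q} \<gamma>" "p \<le> q" "e > 0"
  shows "\<forall>\<^sub>F m in sequentially. \<forall>k<Suc m. \<forall>r\<in>{grid p q m k..grid p q m (Suc k)}.
    \<forall>r'\<in>{grid p q m k..grid p q m (Suc k)}. dist (\<gamma> r) (\<gamma> r') < e"
proof -
  have "uniformly_continuous_on {p..q} \<gamma>"
    using assms(1) by (rule compact_uniformly_continuous) simp
  then obtain \<delta> where \<delta>: "\<delta> > 0"
    and *: "\<And>r r'. r \<in> {p..q} \<Longrightarrow> r' \<in> {p..q} \<Longrightarrow> dist r r' < \<delta> \<Longrightarrow> dist (\<gamma> r) (\<gamma> r') < e"
    using assms(3) unfolding uniformly_continuous_on_def by metis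
  show ?thesis
    using eventually_mesh_less[OF \<delta>, of q p]
  proof eventually_elim
    case (elim m)
    show ?case
    proof (intro allI ballI impI)
      fix k r r' assume k: "k < Suc m" and r: "r \<in> {grid p q m k..grid p q m (Suc k)}"
        and r': "r' \<in> {grid p q m k..grid p q m (Suc k)}"
      have "{grid p q m k..grid p q m (Suc k)} \<subseteq> {p..q}"
        using grid_in[OF assms(2), of k m] grid_in[OF assms(2), of "Suc k" m] k by auto
      moreover have "dist r r' < \<delta>"
        using r r' elim unfolding grid_Suc dist_real_def by auto
      ultimately show "dist (\<gamma> r) (\<gamma> r') < e" using r r' by (intro *) auto
    qed
  qed
qed

text \<open>The drift of the test function along a state with drift \<open>b\<close> and diffusion
  coefficient \<open>H\<close> and a clock growing at rate \<alpha>. The clock has no second-order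
  term because it has finite variation.\<close>

definition ito_generator ::
    "(real^'n \<Rightarrow> real \<Rightarrow> real \<Rightarrow> real) \<Rightarrow> (real^'n \<Rightarrow> real \<Rightarrow> real \<Rightarrow> real)
      \<Rightarrow> (real^'n \<Rightarrow> real \<Rightarrow> real \<Rightarrow> real^'n) \<Rightarrow> (real^'n \<Rightarrow> real \<Rightarrow> real \<Rightarrow> real^'n^'n)
      \<Rightarrow> real^'n \<Rightarrow> real \<Rightarrow> real \<Rightarrow> real^'n \<Rightarrow> real \<Rightarrow> real^'k^'n \<Rightarrow> real" where
  "ito_generator \<Phi>t \<Phi>a \<Phi>x \<Phi>xx x s a b \<alpha> H =
     \<Phi>x x s a \<bullet> b + \<Phi>t x s a + \<Phi>a x s a * \<alpha> + 1/2 * trace (H ** transpose H ** \<Phi>xx x s a)"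

lemma continuous_on_trace_mult:
  fixes N :: "'a::topological_space \<Rightarrow> real^'n^'n" and H :: "real^'n^'n"
  assumes "continuous_on S N"
  shows "continuous_on S (\<lambda>r. trace (H ** N r))"
  unfolding trace_def matrix_matrix_mult_def by (simp, intro continuous_intros assms)

text \<open>Covers all intermediate points that the mean value theorems produce in a cell: a state
  off the right endpoint by at most the drift increment, a time in the cell, and a clock value
  between those at its ends.\<close>

lemma (in test_function) close_along_grid:
  fixes f :: "real^'n \<Rightarrow> real \<Rightarrow> real \<Rightarrow> 'e::real_normed_vector"
  assumes f: "uniformly_continuous_on (UNIV \<times> {lo..hi} \<times> UNIV) (\<lambda>(x, s, a). f x s a)"
    and pq: "lo \<le> p" "p \<le> q" "q \<le> hi"
    and X: "continuous_on {p..q} X" and A: "continuous_on {p..q} A" and B: "continuous_on {p..q} (B :: real \<Rightarrow> real^'n)"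
    and e: "e > 0"
  shows "\<forall>\<^sub>F m in sequentially. \<forall>k<Suc m. \<forall>r\<in>{grid p q m k..grid p q m (Suc k)}. \<forall>x s \<alpha>.
    norm (x - X (grid p q m (Suc k))) \<le> norm (B (grid p q m (Suc k)) - B (grid p q m k)) \<longrightarrow>
    s \<in> {grid p q m k..grid p q m (Suc k)} \<longrightarrow> \<alpha> \<in> {A (grid p q m k)..A (grid p q m (Suc k))} \<longrightarrow>
    norm (f x s \<alpha> - f (X r) r (A r)) \<le> e"
proof -
  obtain \<delta> where \<delta>: "\<delta> > 0"
    and *: "\<And>z z'. z \<in> UNIV \<times> {lo..hi} \<times> UNIV \<Longrightarrow> z' \<in> UNIV \<times> {lo..hi} \<times> UNIV \<Longrightarrow>
     dist z' z < \<delta> \<Longrightarrow> dist ((\<lambda>(x, s, a). f x s a) z') ((\<lambda>(x, s, a). f x s a) z) < e"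
    using f e unfolding uniformly_continuous_on_def by metis
  \<comment> \<open>Two shares go to the state, one to the time and two to the clock.\<close>
  have \<delta>4: "\<delta> / 5 > 0" using \<delta> by simp
  have "continuous_on {p..q} (\<lambda>r. r)" by (intro continuous_intros)
  note osc = eventually_oscillation_less[OF _ pq(2) \<delta>4]
  show ?thesis
    using osc[OF X] osc[OF A] osc[OF B] osc[OF \<open>continuous_on {p..q} (\<lambda>r. r)\<close>]
  proof eventually_elim
    case (elim m)
    show ?case
    proof (intro allI ballI impI)
      fix k r x s \<alpha>
      let ?u = "grid p q m k" and ?v = "grid p q m (Suc k)"
      assume k: "k < Suc m" and r: "r \<in> {?u..?v}" and x: "norm (x - X ?v) \<le> norm (B ?v - B ?u)"
        and s: "s \<in> {?u..?v}" and \<alpha>: "\<alpha> \<in> {A ?u..A ?v}"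
      have uv: "?u \<in> {?u..?v}" "?v \<in> {?u..?v}" using grid_mono[OF pq(2), of k "Suc k" m] by auto
      have sub: "{?u..?v} \<subseteq> {lo..hi}"
        using grid_in[OF pq(2), of k m] grid_in[OF pq(2), of "Suc k" m] k pq by auto
      have 1: "dist x (X r) < 2 * (\<delta> / 5)"
      proof -
        have "dist x (X r) \<le> norm (x - X ?v) + dist (X ?v) (X r)"
          using dist_triangle[of x "X r" "X ?v"] by (simp add: dist_norm)
        moreover have "norm (B ?v - B ?u) < \<delta> / 5" using elim(3) k uv by (simp add: dist_norm)
        moreover have "dist (X ?v) (X r) < \<delta> / 5" using elim(1) k uv r by simp
        ultimately show ?thesis using x by linarith
      qed
      have 2: "dist s r < \<delta> / 5" using elim(4) k s r by simp
      have 3: "dist \<alpha> (A r) < 2 * (\<delta> / 5)"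
      proof -
        have "dist (A ?v) (A ?u) < \<delta> / 5" "dist (A ?u) (A r) < \<delta> / 5" using elim(2) k uv r by simp_all
        then show ?thesis using \<alpha> unfolding dist_real_def atLeastAtMost_iff by linarith
      qed
      have "dist (x, s, \<alpha>) (X r, r, A r) \<le> dist x (X r) + (dist s r + dist \<alpha> (A r))"
        unfolding dist_Pair_Pair
        by (rule order_trans[OF sqrt_sum_squares_le_sum add_left_mono[OF order_trans[OF eq_refl sqrt_sum_squares_le_sum]]]) simp_all
      then have "dist (x, s, \<alpha>) (X r, r, A r) < \<delta>" using 1 2 3 by simp
      from *[OF _ _ this] show "norm (f x s \<alpha> - f (X r) r (A r)) \<le> e"
        using s r sub by (auto simp: dist_norm)
    qed
  qed
qed

text \<open>
  The finite-variation part of the Ito expansion converges path by path; the diffusion enters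
  only through the Riemann sums of the second-order term.
\<close>

lemma (in test_function) finite_variation_part:
  fixes \<beta> :: "real \<Rightarrow> real^'n" and H :: "real^'k^'n"
  assumes pq: "lo \<le> p" "p < q" "q \<le> hi"
    and X: "continuous_on {p..q} X" and A0: "A p \<ge> 0"
    and A: "\<And>s. s \<in> {p..q} \<Longrightarrow> A s = A p + (LBINT r:{p..<s}. \<alpha> r)"
    and \<beta>: "set_integrable lborel {p..<q} \<beta>" and \<alpha>: "set_integrable lborel {p..<q} \<alpha>"
    and le: "\<And>r. r \<in> {p..<q} \<Longrightarrow> norm (\<beta> r) \<le> \<alpha> r"
  defines "B \<equiv> \<lambda>m k. LBINT r:{grid p q m k..<grid p q m (Suc k)}. \<beta> r"
  defines "P \<equiv> \<lambda>m k. \<Phi> (X (grid p q m (Suc k))) (grid p q m (Suc k)) (A (grid p q m (Suc k)))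
      - \<Phi> (X (grid p q m (Suc k)) - B m k) (grid p q m k) (A (grid p q m k))"
  defines "R \<equiv> \<lambda>m k. (q - p) / real (Suc m) * (1/2 * trace (H ** transpose H **
      \<Phi>xx (X (grid p q m k)) (grid p q m k) (A (grid p q m k))))"
  shows "(\<lambda>m. (\<Sum>k<Suc m. P m k) + (\<Sum>k<Suc m. R m k)) \<longlonglongrightarrow>
      (LBINT r:{p..<q}. ito_generator \<Phi>t \<Phi>a \<Phi>x \<Phi>xx (X r) r (A r) (\<beta> r) (\<alpha> r) H)"
    and "\<bar>(\<Sum>k<Suc m. P m k) + (\<Sum>k<Suc m. R m k)\<bar>
      \<le> C * (q - p) + 2 * C * (c + 1) + (q - p) * (CARD('k) * ((norm H)\<^sup>2 * C))"
proof -
  let ?g = "grid p q"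
  define Bf where "Bf s = (LBINT r:{p..<s}. \<beta> r)" for s
  have pq': "p \<le> q" using pq by simp
  have C: "C \<ge> 0" using bound[of lo 0 0] pq by auto
  have Bc: "continuous_on {p..q} Bf"
    unfolding Bf_def by (rule continuous_on_indefinite_set_integral[OF \<beta>])
  have Ac: "continuous_on {p..q} A"
    by (rule continuous_on_eq[OF continuous_on_add[OF continuous_on_const
          continuous_on_indefinite_set_integral[OF \<alpha>]], of "A p"]) (rule A[symmetric])
  have g_in: "?g m k \<in> {p..q}" "?g m (Suc k) \<in> {p..q}" "?g m k \<in> {lo..hi}" "?g m (Suc k) \<in> {lo..hi}"
    "?g m k < ?g m (Suc k)" if "k < Suc m" for m k
    using grid_in[OF pq', of k m] grid_in[OF pq', of "Suc k" m] pq that grid_Suc_less[OF pq(2)] by auto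
  have B_eq: "B m k = Bf (?g m (Suc k)) - Bf (?g m k)" if "k < Suc m" for m k
  proof -
    have "set_integrable lborel {p..<?g m (Suc k)} \<beta>"
      by (rule set_integrable_subset[OF \<beta>]) (use g_in[OF that] in auto)
    from set_integral_split[OF this, of "?g m k"] g_in[OF that] show ?thesis
      by (simp add: B_def Bf_def)
  qed
  have A_inc: "A (?g m (Suc k)) - A (?g m k) = (LBINT r:{?g m k..<?g m (Suc k)}. \<alpha> r)" if "k < Suc m" for m k
  proof -
    have "set_integrable lborel {p..<?g m (Suc k)} \<alpha>"
      by (rule set_integrable_subset[OF \<alpha>]) (use g_in[OF that] in auto)
    from set_integral_split[OF this, of "?g m k"] g_in[OF that] A[of "?g m k"] A[of "?g m (Suc k)"]
    show ?thesis by simp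
  qed
  have sub: "{?g m k..<?g m (Suc k)} \<subseteq> {p..<q}" if "k < Suc m" for m k using g_in[OF that] by auto
  have \<alpha>nn: "0 \<le> \<alpha> r" if "r \<in> {p..<q}" for r using le[OF that] norm_ge_zero order_trans by blast
  have B_le: "norm (B m k) \<le> A (?g m (Suc k)) - A (?g m k)" if k: "k < Suc m" for m k
  proof -
    have i: "set_integrable lborel {?g m k..<?g m (Suc k)} \<beta>" "set_integrable lborel {?g m k..<?g m (Suc k)} \<alpha>"
      by (rule set_integrable_subset[OF \<beta>] set_integrable_subset[OF \<alpha>]; use sub[OF k] in auto)+
    have "norm (B m k) \<le> (LBINT r:{?g m k..<?g m (Suc k)}. norm (\<beta> r))"
      unfolding B_def by (rule set_integral_norm_bound[OF i(1)])
    also have "\<dots> \<le> (LBINT r:{?g m k..<?g m (Suc k)}. \<alpha> r)"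
      by (rule set_integral_mono[OF set_integrable_norm[OF i(1)] i(2)]) (use le sub[OF k] in auto)
    finally show ?thesis using A_inc[OF k] by simp
  qed
  have A_mono: "A (?g m k) \<le> A (?g m (Suc k))" if "k < Suc m" for m k
    using B_le[OF that] norm_ge_zero[of "B m k"] by linarith
  \<comment> \<open>The increment is taken apart along three legs: the state moves by the drift
    increment at the right end of the cell, then the time moves back, then the clock. Each leg
    yields a derivative at an intermediate point.\<close>
  have "\<forall>m k. \<exists>d1 d2 d3. k < Suc m \<longrightarrow>
      P m k = d1 \<bullet> B m k + d2 * ((q - p) / real (Suc m)) + d3 * (A (?g m (Suc k)) - A (?g m k)) \<and>
      (\<exists>x. norm (x - X (?g m (Suc k))) \<le> norm (B m k) \<and> d1 = \<Phi>x x (?g m (Suc k)) (A (?g m (Suc k)))) \<and>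
      (\<exists>x. \<exists>s\<in>{?g m k..?g m (Suc k)}. norm (x - X (?g m (Suc k))) \<le> norm (B m k) \<and> d2 = \<Phi>t x s (A (?g m (Suc k)))) \<and>
      (\<exists>x. \<exists>a\<in>{A (?g m k)..A (?g m (Suc k))}. norm (x - X (?g m (Suc k))) \<le> norm (B m k) \<and> d3 = \<Phi>a x (?g m k) a)"
  proof (intro allI)
    fix m k
    show "\<exists>d1 d2 d3. k < Suc m \<longrightarrow>
      P m k = d1 \<bullet> B m k + d2 * ((q - p) / real (Suc m)) + d3 * (A (?g m (Suc k)) - A (?g m k)) \<and>
      (\<exists>x. norm (x - X (?g m (Suc k))) \<le> norm (B m k) \<and> d1 = \<Phi>x x (?g m (Suc k)) (A (?g m (Suc k)))) \<and>
      (\<exists>x. \<exists>s\<in>{?g m k..?g m (Suc k)}. norm (x - X (?g m (Suc k))) \<le> norm (B m k) \<and> d2 = \<Phi>t x s (A (?g m (Suc k)))) \<and>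
      (\<exists>x. \<exists>a\<in>{A (?g m k)..A (?g m (Suc k))}. norm (x - X (?g m (Suc k))) \<le> norm (B m k) \<and> d3 = \<Phi>a x (?g m k) a)"
    proof (cases "k < Suc m")
      case k: True
      let ?u = "?g m k" and ?v = "?g m (Suc k)"
      define y where "y = X ?v - B m k"
      have y: "norm (y - X ?v) \<le> norm (B m k)" by (simp add: y_def)
      obtain \<theta> where \<theta>: "\<theta> \<in> {0..1}"
        "\<Phi> (X ?v) ?v (A ?v) - \<Phi> y ?v (A ?v) = \<Phi>x (y + \<theta> *\<^sub>R (X ?v - y)) ?v (A ?v) \<bullet> (X ?v - y)"
        using mvt_along_segment[of "\<lambda>x. \<Phi> x ?v (A ?v)" "\<lambda>x. \<Phi>x x ?v (A ?v)" "X ?v" y] deriv_x[OF g_in(4)[OF k]] by blast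
      have x1: "norm (y + \<theta> *\<^sub>R (X ?v - y) - X ?v) \<le> norm (B m k)"
      proof -
        have "y + \<theta> *\<^sub>R (X ?v - y) - X ?v = - ((1 - \<theta>) *\<^sub>R B m k)" by (simp add: y_def algebra_simps)
        then show ?thesis using \<theta>(1) by (simp add: mult_left_le_one_le)
      qed
      have "\<exists>s\<in>{?u<..<?v}. \<Phi> y ?v (A ?v) - \<Phi> y ?u (A ?v) = \<Phi>t y s (A ?v) * (?v - ?u)"
      proof (rule mvt_simple[OF g_in(5)[OF k]])
        fix s assume "?u \<le> s" "s \<le> ?v"
        then have "s \<in> {lo..hi}" "{?u..?v} \<subseteq> {lo..hi}" using g_in[OF k] by auto
        then show "((\<lambda>s. \<Phi> y s (A ?v)) has_derivative (*) (\<Phi>t y s (A ?v))) (at s within {?u..?v})"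
          using deriv_t has_field_derivative_subset unfolding has_field_derivative_def[symmetric] by blast
      qed
      then obtain s where s': "s \<in> {?u<..<?v}"
        and s2: "\<Phi> y ?v (A ?v) - \<Phi> y ?u (A ?v) = \<Phi>t y s (A ?v) * (?v - ?u)" by blast
      then have s: "s \<in> {?u..?v}" by simp
      obtain a where a: "a \<in> {A ?u..A ?v}" "\<Phi> y ?u (A ?v) - \<Phi> y ?u (A ?u) = \<Phi>a y ?u a * (A ?v - A ?u)"
      \<comment> \<open>The clock may stand still on a cell, where the mean value theorem has no
        interval to work on.\<close>
      proof (cases "A ?u = A ?v")
        case True
        then show thesis by (intro that[of "A ?u"]) auto
      next
        case False
        then have "A ?u < A ?v" using A_mono[OF k] by simp
        from MVT2[OF this, of "\<lambda>a. \<Phi> y ?u a" "\<lambda>a. \<Phi>a y ?u a"] deriv_a[OF g_in(3)[OF k]]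
        obtain a where "A ?u < a" "a < A ?v" "\<Phi> y ?u (A ?v) - \<Phi> y ?u (A ?u) = (A ?v - A ?u) * \<Phi>a y ?u a" by blast
        then show thesis by (intro that[of a]) auto
      qed
      have "P m k = (\<Phi> (X ?v) ?v (A ?v) - \<Phi> y ?v (A ?v)) + (\<Phi> y ?v (A ?v) - \<Phi> y ?u (A ?v))
          + (\<Phi> y ?u (A ?v) - \<Phi> y ?u (A ?u))"
        by (simp add: P_def y_def)
      also have "\<dots> = \<Phi>x (y + \<theta> *\<^sub>R (X ?v - y)) ?v (A ?v) \<bullet> B m k
          + \<Phi>t y s (A ?v) * ((q - p) / real (Suc m)) + \<Phi>a y ?u a * (A ?v - A ?u)"
        unfolding \<theta>(2) s2 a(2) by (simp add: y_def grid_Suc)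
      finally show ?thesis
        using x1 y s a(1) by blast
    qed simp
  qed
  then obtain d1 d2 d3 where d:
    "\<And>m k. k < Suc m \<Longrightarrow> P m k = d1 m k \<bullet> B m k + d2 m k * ((q - p) / real (Suc m)) + d3 m k * (A (?g m (Suc k)) - A (?g m k))"
    "\<And>m k. k < Suc m \<Longrightarrow> \<exists>x. norm (x - X (?g m (Suc k))) \<le> norm (B m k) \<and> d1 m k = \<Phi>x x (?g m (Suc k)) (A (?g m (Suc k)))"
    "\<And>m k. k < Suc m \<Longrightarrow> \<exists>x. \<exists>s\<in>{?g m k..?g m (Suc k)}. norm (x - X (?g m (Suc k))) \<le> norm (B m k) \<and> d2 m k = \<Phi>t x s (A (?g m (Suc k)))"
    "\<And>m k. k < Suc m \<Longrightarrow> \<exists>x. \<exists>a\<in>{A (?g m k)..A (?g m (Suc k))}. norm (x - X (?g m (Suc k))) \<le> norm (B m k) \<and> d3 m k = \<Phi>a x (?g m k) a"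
    by metis
  have path: "continuous_on {p..q} (\<lambda>r. f (X r) r (A r))"
    if "continuous_on (UNIV \<times> {lo..hi} \<times> UNIV) (\<lambda>(x, s, a). f x s a)" for f :: "real^'n \<Rightarrow> real \<Rightarrow> real \<Rightarrow> 'z::topological_space"
    by (rule continuous_along_path[OF that X Ac]) (use pq in auto)
  have trc: "continuous_on {p..q} (\<lambda>r. 1/2 * trace (H ** transpose H ** \<Phi>xx (X r) r (A r)))"
    by (intro continuous_intros continuous_on_trace_mult path[OF cont_xx])
  note close = close_along_grid[OF _ pq(1) pq' pq(3) X Ac Bc]
  have one: "set_integrable lborel {p..<q} (\<lambda>_. 1::real)"
    using pq' by (auto simp: set_integrable_def intro!: integrable_real_indicator)
  note rs = riemann_stieltjes_tendsto[where s = ?g and N = Suc and p = p and q = q]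
  have grid_rules: "\<And>m. ?g m 0 = p" "\<And>m. ?g m (Suc m) = q" "\<And>m k. ?g m k \<le> ?g m (Suc k)"
    using grid_mono[OF pq'] by auto
  have l1: "(\<lambda>m. \<Sum>k<Suc m. d1 m k \<bullet> (LBINT r:{?g m k..<?g m (Suc k)}. \<beta> r))
      \<longlonglongrightarrow> (LBINT r:{p..<q}. \<Phi>x (X r) r (A r) \<bullet> \<beta> r)"
  proof (rule rs[OF \<beta> path[OF cont_x] grid_rules])
    fix e :: real assume "e > 0"
    from close[OF ucont_x this]
    show "\<forall>\<^sub>F m in sequentially. \<forall>k<Suc m. \<forall>r\<in>{?g m k..<?g m (Suc k)}. norm (d1 m k - \<Phi>x (X r) r (A r)) \<le> e"
    proof eventually_elim
      case (elim m)
      show ?case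
      proof (intro allI impI ballI)
        fix k r assume k: "k < Suc m" and r: "r \<in> {?g m k..<?g m (Suc k)}"
        obtain x where x: "norm (x - X (?g m (Suc k))) \<le> norm (B m k)" "d1 m k = \<Phi>x x (?g m (Suc k)) (A (?g m (Suc k)))"
          using d(2)[OF k] by blast
        have "r \<in> {?g m k..?g m (Suc k)}" "?g m (Suc k) \<in> {?g m k..?g m (Suc k)}"
          "A (?g m (Suc k)) \<in> {A (?g m k)..A (?g m (Suc k))}"
          using r g_in[OF k] A_mono[OF k] by auto
        then show "norm (d1 m k - \<Phi>x (X r) r (A r)) \<le> e"
          unfolding x(2) using elim k x(1) unfolding B_eq[OF k] by blast
      qed
    qed
  qed
  have l2: "(\<lambda>m. \<Sum>k<Suc m. d2 m k \<bullet> (LBINT r:{?g m k..<?g m (Suc k)}. 1))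
      \<longlonglongrightarrow> (LBINT r:{p..<q}. \<Phi>t (X r) r (A r) \<bullet> 1)"
  proof (rule rs[OF one path[OF cont_t] grid_rules])
    fix e :: real assume "e > 0"
    from close[OF ucont_t this]
    show "\<forall>\<^sub>F m in sequentially. \<forall>k<Suc m. \<forall>r\<in>{?g m k..<?g m (Suc k)}. norm (d2 m k - \<Phi>t (X r) r (A r)) \<le> e"
    proof eventually_elim
      case (elim m)
      show ?case
      proof (intro allI impI ballI)
        fix k r assume k: "k < Suc m" and r: "r \<in> {?g m k..<?g m (Suc k)}"
        obtain x s where x: "norm (x - X (?g m (Suc k))) \<le> norm (B m k)" "s \<in> {?g m k..?g m (Suc k)}" "d2 m k = \<Phi>t x s (A (?g m (Suc k)))"
          using d(3)[OF k] by blast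
        have "r \<in> {?g m k..?g m (Suc k)}" "A (?g m (Suc k)) \<in> {A (?g m k)..A (?g m (Suc k))}"
          using r A_mono[OF k] by auto
        then show "norm (d2 m k - \<Phi>t (X r) r (A r)) \<le> e"
          unfolding x(3) using elim k x(1,2) unfolding B_eq[OF k] by blast
      qed
    qed
  qed
  have l3: "(\<lambda>m. \<Sum>k<Suc m. d3 m k \<bullet> (LBINT r:{?g m k..<?g m (Suc k)}. \<alpha> r))
      \<longlonglongrightarrow> (LBINT r:{p..<q}. \<Phi>a (X r) r (A r) \<bullet> \<alpha> r)"
  proof (rule rs[OF \<alpha> path[OF cont_a] grid_rules])
    fix e :: real assume "e > 0"
    from close[OF ucont_a this]
    show "\<forall>\<^sub>F m in sequentially. \<forall>k<Suc m. \<forall>r\<in>{?g m k..<?g m (Suc k)}. norm (d3 m k - \<Phi>a (X r) r (A r)) \<le> e"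
    proof eventually_elim
      case (elim m)
      show ?case
      proof (intro allI impI ballI)
        fix k r assume k: "k < Suc m" and r: "r \<in> {?g m k..<?g m (Suc k)}"
        obtain x a where x: "norm (x - X (?g m (Suc k))) \<le> norm (B m k)" "a \<in> {A (?g m k)..A (?g m (Suc k))}" "d3 m k = \<Phi>a x (?g m k) a"
          using d(4)[OF k] by blast
        have "r \<in> {?g m k..?g m (Suc k)}" "?g m k \<in> {?g m k..?g m (Suc k)}"
          using r g_in[OF k] by auto
        then show "norm (d3 m k - \<Phi>a (X r) r (A r)) \<le> e"
          unfolding x(3) using elim k x(1,2) unfolding B_eq[OF k] by blast
      qed
    qed
  qed
  have l4: "(\<lambda>m. \<Sum>k<Suc m. (1/2 * trace (H ** transpose H ** \<Phi>xx (X (?g m k)) (?g m k) (A (?g m k)))) \<bullet> (LBINT r:{?g m k..<?g m (Suc k)}. 1))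
      \<longlonglongrightarrow> (LBINT r:{p..<q}. (1/2 * trace (H ** transpose H ** \<Phi>xx (X r) r (A r))) \<bullet> 1)"
  proof (rule rs[OF one trc grid_rules])
    fix e :: real assume e: "e > 0"
    show "\<forall>\<^sub>F m in sequentially. \<forall>k<Suc m. \<forall>r\<in>{?g m k..<?g m (Suc k)}.
        norm (1/2 * trace (H ** transpose H ** \<Phi>xx (X (?g m k)) (?g m k) (A (?g m k)))
          - 1/2 * trace (H ** transpose H ** \<Phi>xx (X r) r (A r))) \<le> e"
      using eventually_oscillation_less[OF trc pq' e]
    proof eventually_elim
      case (elim m)
      then show ?case using g_in by (auto simp: dist_norm intro!: less_imp_le)
    qed
  qed
  have len: "(LBINT r:{?g m k..<?g m (Suc k)}. 1) = (q - p) / real (Suc m)" for m k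
    using grid_mono[OF pq', of k "Suc k" m] by (simp add: set_lebesgue_integral_def grid_Suc)
  have sum_eq: "(\<Sum>k<Suc m. P m k) + (\<Sum>k<Suc m. R m k) =
      (\<Sum>k<Suc m. d1 m k \<bullet> (LBINT r:{?g m k..<?g m (Suc k)}. \<beta> r))
      + (\<Sum>k<Suc m. d2 m k \<bullet> (LBINT r:{?g m k..<?g m (Suc k)}. 1))
      + (\<Sum>k<Suc m. d3 m k \<bullet> (LBINT r:{?g m k..<?g m (Suc k)}. \<alpha> r))
      + (\<Sum>k<Suc m. (1/2 * trace (H ** transpose H ** \<Phi>xx (X (?g m k)) (?g m k) (A (?g m k)))) \<bullet> (LBINT r:{?g m k..<?g m (Suc k)}. 1))" for m
  proof -
    have "(\<Sum>k<Suc m. P m k) = (\<Sum>k<Suc m. d1 m k \<bullet> (LBINT r:{?g m k..<?g m (Suc k)}. \<beta> r)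
      + d2 m k \<bullet> (LBINT r:{?g m k..<?g m (Suc k)}. 1) + d3 m k \<bullet> (LBINT r:{?g m k..<?g m (Suc k)}. \<alpha> r))"
      by (rule sum.cong[OF refl], simp only: lessThan_iff, subst d(1))
        (simp_all only: len A_inc B_def inner_real_def)
    moreover have "(\<Sum>k<Suc m. R m k) = (\<Sum>k<Suc m. (1/2 * trace (H ** transpose H ** \<Phi>xx (X (?g m k)) (?g m k) (A (?g m k)))) \<bullet> (LBINT r:{?g m k..<?g m (Suc k)}. 1))"
      by (rule sum.cong[OF refl]) (simp only: R_def len inner_real_def mult.commute)
    ultimately show ?thesis by (simp only: sum.distrib)
  qed
  have i1: "set_integrable lborel {p..<q} (\<lambda>r. \<Phi>x (X r) r (A r) \<bullet> \<beta> r)"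
    by (rule set_integrable_continuous_inner[OF \<beta> path[OF cont_x]])
  have i2: "set_integrable lborel {p..<q} (\<lambda>r. \<Phi>t (X r) r (A r) \<bullet> 1)"
    by (rule set_integrable_continuous_inner[OF one path[OF cont_t]])
  have i3: "set_integrable lborel {p..<q} (\<lambda>r. \<Phi>a (X r) r (A r) \<bullet> \<alpha> r)"
    by (rule set_integrable_continuous_inner[OF \<alpha> path[OF cont_a]])
  have i4: "set_integrable lborel {p..<q} (\<lambda>r. (1/2 * trace (H ** transpose H ** \<Phi>xx (X r) r (A r))) \<bullet> 1)"
    by (rule set_integrable_continuous_inner[OF one trc])
  have "(LBINT r:{p..<q}. ito_generator \<Phi>t \<Phi>a \<Phi>x \<Phi>xx (X r) r (A r) (\<beta> r) (\<alpha> r) H) =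
     (LBINT r:{p..<q}. \<Phi>x (X r) r (A r) \<bullet> \<beta> r) + (LBINT r:{p..<q}. \<Phi>t (X r) r (A r) \<bullet> 1)
     + (LBINT r:{p..<q}. \<Phi>a (X r) r (A r) \<bullet> \<alpha> r)
     + (LBINT r:{p..<q}. (1/2 * trace (H ** transpose H ** \<Phi>xx (X r) r (A r))) \<bullet> 1)"
    unfolding ito_generator_def
    by (subst set_integral_add(2)[symmetric, OF i1 i2], subst set_integral_add(2)[symmetric, OF set_integral_add(1)[OF i1 i2] i3],
        subst set_integral_add(2)[symmetric, OF set_integral_add(1)[OF set_integral_add(1)[OF i1 i2] i3] i4])
      simp
  then show "(\<lambda>m. (\<Sum>k<Suc m. P m k) + (\<Sum>k<Suc m. R m k)) \<longlonglongrightarrow>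
      (LBINT r:{p..<q}. ito_generator \<Phi>t \<Phi>a \<Phi>x \<Phi>xx (X r) r (A r) (\<beta> r) (\<alpha> r) H)"
    unfolding sum_eq using tendsto_add[OF tendsto_add[OF tendsto_add[OF l1 l2] l3] l4] by simp
  \<comment> \<open>From level \<open>c\<close> on both values of \<Phi> vanish, because the clock
    does not decrease. Below it, \<open>P m k\<close> is bounded by \<open>2 * C\<close> as well as
    through the increments, and combining the two bounds produces the truncated increment, which can
    be summed.\<close>
  have Pb: "\<bar>P m k\<bar> \<le> C * ((q - p) / real (Suc m))
      + 2 * C * (if A (?g m k) < c then min 1 (A (?g m (Suc k)) - A (?g m k)) else 0)" if k: "k < Suc m" for k
  proof (cases "A (?g m k) < c")
    case False
    then have "P m k = 0"
      using vanish g_in[OF k] A_mono[OF k] by (simp add: P_def)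
    then show ?thesis using False C pq' by simp
  next
    case True
    define D where "D = A (?g m (Suc k)) - A (?g m k)"
    have D: "D \<ge> 0" using A_mono[OF k] by (simp add: D_def)
    have b: "norm (d1 m k) \<le> C" "\<bar>d2 m k\<bar> \<le> C" "\<bar>d3 m k\<bar> \<le> C"
    proof -
      show "norm (d1 m k) \<le> C" using d(2)[OF k] bound_x g_in[OF k] by auto
      obtain x s where "s \<in> {?g m k..?g m (Suc k)}" "d2 m k = \<Phi>t x s (A (?g m (Suc k)))"
        using d(3)[OF k] by blast
      then show "\<bar>d2 m k\<bar> \<le> C" using bound_t[of s] g_in[OF k] by auto
      show "\<bar>d3 m k\<bar> \<le> C" using d(4)[OF k] bound_a g_in[OF k] by auto
    qed
    have "\<bar>d1 m k \<bullet> B m k\<bar> \<le> C * D"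
      using order_trans[OF Cauchy_Schwarz_ineq2 mult_mono[OF b(1) B_le[OF k] C norm_ge_zero]] by (simp add: D_def)
    moreover have "\<bar>d2 m k * ((q - p) / real (Suc m))\<bar> \<le> C * ((q - p) / real (Suc m))"
      unfolding abs_mult using b(2) pq' by (intro mult_mono) auto
    moreover have "\<bar>d3 m k * D\<bar> \<le> C * D"
      unfolding abs_mult using b(3) D by (intro mult_mono) auto
    ultimately have 1: "\<bar>P m k\<bar> \<le> C * ((q - p) / real (Suc m)) + 2 * C * D"
      using d(1)[OF k] unfolding D_def[symmetric] by linarith
    have 2: "\<bar>P m k\<bar> \<le> 2 * C"
      unfolding P_def using bound[OF g_in(4)[OF k], of "X (?g m (Suc k))" "A (?g m (Suc k))"]
        bound[OF g_in(3)[OF k], of "X (?g m (Suc k)) - B m k" "A (?g m k)"] by linarith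
    have "0 \<le> C * ((q - p) / real (Suc m))" using C pq' by simp
    with 1 2 True show ?thesis unfolding D_def[symmetric] by (auto simp: min_def)
  qed
  have Rb: "\<bar>R m k\<bar> \<le> (q - p) / real (Suc m) * (CARD('k) * ((norm H)\<^sup>2 * C))" if k: "k < Suc m" for k
  proof -
    let ?N = "\<Phi>xx (X (?g m k)) (?g m k) (A (?g m k))"
    have "\<bar>1/2 * trace (H ** transpose H ** ?N)\<bar> \<le> CARD('k) * ((norm H)\<^sup>2 * norm ?N)"
      using abs_trace_congruence_le[of H ?N] by simp
    also have "\<dots> \<le> CARD('k) * ((norm H)\<^sup>2 * C)"
      using bound_xx[OF g_in(3)[OF k]] by (intro mult_left_mono) auto
    finally show ?thesis
      unfolding R_def abs_mult[of "(q - p) / real (Suc m)"] using pq' by - (rule mult_mono, auto)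
  qed
  have "\<bar>(\<Sum>k<Suc m. P m k) + (\<Sum>k<Suc m. R m k)\<bar> \<le> (\<Sum>k<Suc m. \<bar>P m k\<bar>) + (\<Sum>k<Suc m. \<bar>R m k\<bar>)"
    by (intro order_trans[OF abs_triangle_ineq] add_mono sum_abs)
  also have "\<dots> \<le> (\<Sum>k<Suc m. C * ((q - p) / real (Suc m))
      + 2 * C * (if A (?g m k) < c then min 1 (A (?g m (Suc k)) - A (?g m k)) else 0))
      + (\<Sum>k<Suc m. (q - p) / real (Suc m) * (CARD('k) * ((norm H)\<^sup>2 * C)))"
    by (intro add_mono sum_mono Pb Rb) auto
  also have "\<dots> = C * (q - p) + 2 * C * (\<Sum>k<Suc m. if A (?g m k) < c then min 1 (A (?g m (Suc k)) - A (?g m k)) else 0)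
      + (q - p) * (CARD('k) * ((norm H)\<^sup>2 * C))"
    unfolding sum.distrib sum_distrib_left[symmetric] sum_constant card_lessThan
    by (simp del: of_nat_Suc sum.lessThan_Suc)
  also have "\<dots> \<le> C * (q - p) + 2 * C * (c + 1) + (q - p) * (CARD('k) * ((norm H)\<^sup>2 * C))"
  proof -
    \<comment> \<open>Frozen after the last grid point, as monotonicity is known only for indices up
      to \<open>Suc m\<close>.\<close>
    define A' where "A' k = A (?g m (min k (Suc m)))" for k
    have "(\<Sum>k<Suc m. if A (?g m k) < c then min 1 (A (?g m (Suc k)) - A (?g m k)) else 0)
      = (\<Sum>k<Suc m. if A' k < c then min 1 (A' (Suc k) - A' k) else 0)"
      by (rule sum.cong) (auto simp: A'_def min_def)
    also have "\<dots> \<le> c + 1"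
    proof (rule sum_truncated_increments_le)
      show "A' k \<le> A' (Suc k)" for k
        using A_mono[of k m] by (cases "k < Suc m") (auto simp: A'_def min_def)
    qed (use A0 c_nonneg in \<open>auto simp: A'_def\<close>)
    finally show ?thesis using C pq' by (intro add_mono mult_left_mono) auto
  qed
  finally show "\<bar>(\<Sum>k<Suc m. P m k) + (\<Sum>k<Suc m. R m k)\<bar>
      \<le> C * (q - p) + 2 * C * (c + 1) + (q - p) * (CARD('k) * ((norm H)\<^sup>2 * C))" .
qed

text \<open>Telescoping over the grid turns the increment of \<Phi> into the sums of
  \<open>P\<close>, of \<open>Q\<close> and of \<open>R\<close>. The sums of \<open>P\<close> and
  \<open>R\<close> together converge path by path and are bounded, those of \<open>Q\<close> vanish
  in the mean by the Taylor estimate; comparing the two limits of the expectation gives the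
  claim.\<close>

lemma (in filtered_wiener) ito_constant_diffusion:
  fixes \<Phi> :: "real^'n \<Rightarrow> real \<Rightarrow> real \<Rightarrow> real" and \<xi> :: "'w \<Rightarrow> real^'k^'n"
  assumes \<Phi>: "test_function lo hi \<Phi> \<Phi>t \<Phi>a \<Phi>x \<Phi>xx C c"
    and pq: "t \<le> p" "p < q" "q \<le> T" "lo \<le> p" "q \<le> hi"
    and Z: "Z \<in> borel_measurable (F p)" "\<And>\<omega>. \<omega> \<in> space M \<Longrightarrow> \<bar>Z \<omega>\<bar> \<le> b"
    and \<xi>: "\<xi> \<in> borel_measurable (F p)" "\<And>\<omega>. \<omega> \<in> space M \<Longrightarrow> norm (\<xi> \<omega>) \<le> L"
    and \<beta>: "\<And>\<omega>. \<omega> \<in> space M \<Longrightarrow> set_integrable lborel {p..<q} (\<lambda>r. \<beta> r \<omega>)"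
    and \<alpha>: "\<And>\<omega>. \<omega> \<in> space M \<Longrightarrow> set_integrable lborel {p..<q} (\<lambda>r. \<alpha> r \<omega>)"
    and le: "\<And>\<omega> r. \<omega> \<in> space M \<Longrightarrow> r \<in> {p..<q} \<Longrightarrow> norm (\<beta> r \<omega>) \<le> \<alpha> r \<omega>"
    and X: "\<And>\<omega> s. \<omega> \<in> space M \<Longrightarrow> s \<in> {p..q} \<Longrightarrow>
        X s \<omega> = X p \<omega> + (LBINT r:{p..<s}. \<beta> r \<omega>) + \<xi> \<omega> *v (w s \<omega> - w p \<omega>)"
    and A: "\<And>\<omega> s. \<omega> \<in> space M \<Longrightarrow> s \<in> {p..q} \<Longrightarrow> A s \<omega> = A p \<omega> + (LBINT r:{p..<s}. \<alpha> r \<omega>)"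
    and A0: "\<And>\<omega>. \<omega> \<in> space M \<Longrightarrow> A p \<omega> \<ge> 0"
    and adX: "\<And>s. s \<in> {p..q} \<Longrightarrow> X s \<in> borel_measurable (F s)"
    and adA: "\<And>s. s \<in> {p..q} \<Longrightarrow> A s \<in> borel_measurable (F s)"
  shows "has_bochner_integral M (\<lambda>\<omega>. Z \<omega> * (\<Phi> (X q \<omega>) q (A q \<omega>) - \<Phi> (X p \<omega>) p (A p \<omega>)
      - (LBINT r:{p..<q}. ito_generator \<Phi>t \<Phi>a \<Phi>x \<Phi>xx (X r \<omega>) r (A r \<omega>) (\<beta> r \<omega>) (\<alpha> r \<omega>) (\<xi> \<omega>)))) 0"
proof -
  interpret \<Phi>: test_function lo hi \<Phi> \<Phi>t \<Phi>a \<Phi>x \<Phi>xx C c by fact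
  let ?g = "grid p q"
  let ?K = "real CARD('k)"
  define h where "h m = (q - p) / real (Suc m)" for m
  define B where "B m k \<omega> = (LBINT r:{?g m k..<?g m (Suc k)}. \<beta> r \<omega>)" for m k \<omega>
  define P where "P m k \<omega> = \<Phi> (X (?g m (Suc k)) \<omega>) (?g m (Suc k)) (A (?g m (Suc k)) \<omega>)
      - \<Phi> (X (?g m (Suc k)) \<omega> - B m k \<omega>) (?g m k) (A (?g m k) \<omega>)" for m k \<omega>
  define R where "R m k \<omega> = h m * (1/2 * trace (\<xi> \<omega> ** transpose (\<xi> \<omega>) **
      \<Phi>xx (X (?g m k) \<omega>) (?g m k) (A (?g m k) \<omega>)))" for m k \<omega>
  define Q where "Q m k \<omega> = Z \<omega> * (\<Phi> (X (?g m k) \<omega> + \<xi> \<omega> *v (w (?g m (Suc k)) \<omega> - w (?g m k) \<omega>)) (?g m k) (A (?g m k) \<omega>)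
      - \<Phi> (X (?g m k) \<omega>) (?g m k) (A (?g m k) \<omega>)
      - (?g m (Suc k) - ?g m k) * (1/2 * trace (\<xi> \<omega> ** transpose (\<xi> \<omega>) ** \<Phi>xx (X (?g m k) \<omega>) (?g m k) (A (?g m k) \<omega>))))" for m k \<omega>
  define I where "I \<omega> = (LBINT r:{p..<q}. ito_generator \<Phi>t \<Phi>a \<Phi>x \<Phi>xx (X r \<omega>) r (A r \<omega>) (\<beta> r \<omega>) (\<alpha> r \<omega>) (\<xi> \<omega>))" for \<omega>
  define D where "D \<omega> = \<Phi> (X q \<omega>) q (A q \<omega>) - \<Phi> (X p \<omega>) p (A p \<omega>)" for \<omega>
  define V where "V m \<omega> = (\<Sum>k<Suc m. P m k \<omega>) + (\<Sum>k<Suc m. R m k \<omega>)" for m \<omega>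
  have pq': "p \<le> q" using pq by simp
  obtain \<omega>0 where \<omega>0: "\<omega>0 \<in> space M" using not_empty by auto
  have b: "b \<ge> 0" using Z(2)[OF \<omega>0] by linarith
  have L: "L \<ge> 0" using \<xi>(2)[OF \<omega>0] norm_ge_zero order_trans by blast
  have C: "C \<ge> 0" using \<Phi>.bound[of lo 0 0] pq by auto
  have hm: "h m = ?g m (Suc k) - ?g m k" for m k by (simp add: h_def grid_Suc)
  have h0: "h m \<ge> 0" for m using pq' by (simp add: h_def)
  have g_in: "?g m k \<in> {p..q}" "?g m (Suc k) \<in> {p..q}" "?g m k \<in> {lo..hi}" "?g m (Suc k) \<in> {lo..hi}"
    "?g m k < ?g m (Suc k)" "t \<le> ?g m k" "?g m (Suc k) \<le> T" "?g m k \<in> {t..T}" "?g m (Suc k) \<in> {t..T}" if "k < Suc m" for m k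
    using grid_in[OF pq', of k m] grid_in[OF pq', of "Suc k" m] pq that grid_Suc_less[OF pq(2)] by auto
  have Xc: "continuous_on {p..q} (\<lambda>s. X s \<omega>)" if \<omega>: "\<omega> \<in> space M" for \<omega>
  proof -
    have "continuous_on {p..q} (\<lambda>s. w s \<omega>)"
      using w_continuous[OF \<omega>] by (rule continuous_on_subset) (use pq in auto)
    then have "continuous_on {p..q} (\<lambda>s. X p \<omega> + (LBINT r:{p..<s}. \<beta> r \<omega>) + \<xi> \<omega> *v (w s \<omega> - w p \<omega>))"
      by (intro continuous_intros continuous_on_indefinite_set_integral[OF \<beta>[OF \<omega>]]
          bounded_linear.continuous_on[OF matrix_vector_mul_bounded_linear])
    then show ?thesis by (rule continuous_on_eq) (rule X[OF \<omega>, symmetric])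
  qed
  note fv = \<Phi>.finite_variation_part[OF pq(4,2,5) Xc A0 A \<beta> \<alpha> le, where H = "\<xi> \<omega>" for \<omega>]
  have V_lim: "(\<lambda>m. V m \<omega>) \<longlonglongrightarrow> I \<omega>" if \<omega>: "\<omega> \<in> space M" for \<omega>
    unfolding V_def P_def R_def B_def h_def I_def by (rule fv(1)) (use \<omega> in auto)
  have V_bound: "\<bar>V m \<omega>\<bar> \<le> C * (q - p) + 2 * C * (c + 1) + (q - p) * (?K * (L\<^sup>2 * C))" if \<omega>: "\<omega> \<in> space M" for m \<omega>
  proof -
    have "\<bar>V m \<omega>\<bar> \<le> C * (q - p) + 2 * C * (c + 1) + (q - p) * (?K * ((norm (\<xi> \<omega>))\<^sup>2 * C))"
      unfolding V_def P_def R_def B_def h_def by (rule fv(2)) (use \<omega> in auto)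
    also have "\<dots> \<le> C * (q - p) + 2 * C * (c + 1) + (q - p) * (?K * (L\<^sup>2 * C))"
      using \<xi>(2)[OF \<omega>] pq' C by (intro add_mono mult_left_mono mult_right_mono power_mono) auto
    finally show ?thesis .
  qed
  have X_step: "X (?g m (Suc k)) \<omega> - B m k \<omega> = X (?g m k) \<omega> + \<xi> \<omega> *v (w (?g m (Suc k)) \<omega> - w (?g m k) \<omega>)"
    if k: "k < Suc m" and \<omega>: "\<omega> \<in> space M" for m k \<omega>
  proof -
    have "set_integrable lborel {p..<?g m (Suc k)} (\<lambda>r. \<beta> r \<omega>)"
      by (rule set_integrable_subset[OF \<beta>[OF \<omega>]]) (use g_in[OF k] in auto)
    from set_integral_split[OF this, of "?g m k"] g_in[OF k]
    have "(LBINT r:{p..<?g m (Suc k)}. \<beta> r \<omega>) = (LBINT r:{p..<?g m k}. \<beta> r \<omega>) + B m k \<omega>"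
      by (simp add: B_def)
    then show ?thesis
      using X[OF \<omega> g_in(1)[OF k]] X[OF \<omega> g_in(2)[OF k]]
      by (simp add: matrix_vector_mult_diff_distrib)
  qed
  have ZV: "Z \<omega> * V m \<omega> = Z \<omega> * D \<omega> - (\<Sum>k<Suc m. Q m k \<omega>)" if \<omega>: "\<omega> \<in> space M" for m \<omega>
  proof -
    let ?f = "\<lambda>k. \<Phi> (X (?g m k) \<omega>) (?g m k) (A (?g m k) \<omega>)"
    have "(\<Sum>k<Suc m. ?f (Suc k) - ?f k) = ?f (Suc m) - ?f 0" by (rule sum_lessThan_telescope)
    then have "Z \<omega> * D \<omega> = Z \<omega> * (\<Sum>k<Suc m. ?f (Suc k) - ?f k)"
      unfolding D_def by (simp only: grid_0 grid_last)
    also have "\<dots> = (\<Sum>k<Suc m. Z \<omega> * P m k \<omega> + (Q m k \<omega> + Z \<omega> * R m k \<omega>))"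
      unfolding sum_distrib_left
      by (rule sum.cong) (auto simp: P_def Q_def R_def X_step[OF _ \<omega>] hm[symmetric] algebra_simps)
    finally show ?thesis by (simp add: V_def sum.distrib sum_distrib_left algebra_simps)
  qed
  note ad = measurable_F_mono[OF pq(1)]
  have Zk: "Z \<in> borel_measurable (F (?g m k))" "\<xi> \<in> borel_measurable (F (?g m k))" if "k < Suc m" for m k
    using measurable_F_mono[OF pq(1) _ _ Z(1)] measurable_F_mono[OF pq(1) _ _ \<xi>(1)] g_in[OF that] by auto
  have pT: "p \<in> {t..T}" "q \<in> {t..T}" using pq by auto
  have Qb: "integrable M (Q m k)" "\<bar>\<integral>\<omega>. Q m k \<omega> \<partial>M\<bar> \<le> b * (\<epsilon> * L\<^sup>2 * (?K * h m) + C / \<delta>\<^sup>2 * L ^ 4 * (3 * ?K\<^sup>2 * (h m)\<^sup>2))"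
    if k: "k < Suc m" and \<epsilon>: "\<delta> > 0" "\<epsilon> > 0"
      and unif: "\<And>x y s a. s \<in> {lo..hi} \<Longrightarrow> norm (x - y) < \<delta> \<Longrightarrow> norm (\<Phi>xx x s a - \<Phi>xx y s a) \<le> \<epsilon>" for m k \<delta> \<epsilon>
    unfolding Q_def hm[of m k]
    using conditional_taylor_bound[OF \<Phi> g_in(6,5,7,3)[OF k] Zk(1)[OF k] Z(2) adX[OF g_in(1)[OF k]] adA[OF g_in(1)[OF k]]
        Zk(2)[OF k] \<xi>(2) \<epsilon> unif[OF g_in(3)[OF k]]] by auto
  note [measurable] = measurable_F_M[OF pT(1) Z(1)] measurable_F_M[OF pT(1) \<xi>(1)]
  have Dm [measurable]: "D \<in> borel_measurable M"
  proof -
    have [measurable]: "X q \<in> borel_measurable M" "A q \<in> borel_measurable M" "X p \<in> borel_measurable M" "A p \<in> borel_measurable M"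
      using measurable_F_M[OF pT(2) adX[of q]] measurable_F_M[OF pT(2) adA[of q]]
        measurable_F_M[OF pT(1) adX[of p]] measurable_F_M[OF pT(1) adA[of p]] pq' by auto
    have "(\<lambda>\<omega>. \<Phi> (X q \<omega>) q (A q \<omega>)) \<in> borel_measurable M"
      by (rule continuous_slice_measurable[OF \<Phi>.cont]) (use pq in auto)
    moreover have "(\<lambda>\<omega>. \<Phi> (X p \<omega>) p (A p \<omega>)) \<in> borel_measurable M"
      by (rule continuous_slice_measurable[OF \<Phi>.cont]) (use pq in auto)
    ultimately show ?thesis unfolding D_def by measurable
  qed
  have Db: "\<bar>D \<omega>\<bar> \<le> 2 * C" for \<omega>
    unfolding D_def using \<Phi>.bound[of q "X q \<omega>" "A q \<omega>"] \<Phi>.bound[of p "X p \<omega>" "A p \<omega>"] pq by auto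
  have ZD: "integrable M (\<lambda>\<omega>. Z \<omega> * D \<omega>)"
    by (rule integrable_const_bound[where B = "b * (2 * C)"])
      (use Z(2) Db b in \<open>auto simp: abs_mult intro!: AE_I2 mult_mono\<close>)
  \<comment> \<open>The value 1 is arbitrary: only the integrability of \<open>Q\<close> is wanted
    here, not a small bound.\<close>
  obtain \<delta>1 where \<delta>1: "\<delta>1 > 0" "\<And>x y s a. s \<in> {lo..hi} \<Longrightarrow> norm (x - y) < \<delta>1 \<Longrightarrow> norm (\<Phi>xx x s a - \<Phi>xx y s a) \<le> 1"
    using \<Phi>.ucont_xx_slice[OF zero_less_one] by blast
  have Qi: "integrable M (Q m k)" if "k < Suc m" for m k
    using Qb(1)[OF that \<delta>1(1) zero_less_one \<delta>1(2)] by blast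
  have ZVi: "has_bochner_integral M (\<lambda>\<omega>. Z \<omega> * V m \<omega>) ((\<integral>\<omega>. Z \<omega> * D \<omega> \<partial>M) - (\<Sum>k<Suc m. \<integral>\<omega>. Q m k \<omega> \<partial>M))" for m
  proof -
    have "has_bochner_integral M (\<lambda>\<omega>. Z \<omega> * D \<omega> - (\<Sum>k<Suc m. Q m k \<omega>)) ((\<integral>\<omega>. Z \<omega> * D \<omega> \<partial>M) - (\<Sum>k<Suc m. \<integral>\<omega>. Q m k \<omega> \<partial>M))"
      by (intro has_bochner_integral_diff has_bochner_integral_sum has_bochner_integral_integrable ZD Qi) simp
    then show ?thesis
      by (rule has_bochner_integral_cong[THEN iffD1, rotated 3]) (auto simp: ZV)
  qed
  have "(\<lambda>m. \<Sum>k<Suc m. \<integral>\<omega>. Q m k \<omega> \<partial>M) \<longlonglongrightarrow> 0"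
  proof (rule LIMSEQ_I)
    fix e :: real assume e: "e > 0"
    \<comment> \<open>Chosen so that the \<epsilon>-parts of the Taylor errors add up to less than
      \<open>e / 2\<close> over all cells; the summand 1 excludes a zero denominator.\<close>
    define \<epsilon> where "\<epsilon> = e / (2 * (b * L\<^sup>2 * ?K * (q - p) + 1))"
    have den: "b * L\<^sup>2 * ?K * (q - p) \<ge> 0" using b pq' by simp
    have \<epsilon>: "\<epsilon> > 0" using e den by (simp add: \<epsilon>_def)
    obtain \<delta> where \<delta>: "\<delta> > 0" "\<And>x y s a. s \<in> {lo..hi} \<Longrightarrow> norm (x - y) < \<delta> \<Longrightarrow> norm (\<Phi>xx x s a - \<Phi>xx y s a) \<le> \<epsilon>"
      using \<Phi>.ucont_xx_slice[OF \<epsilon>] by blast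
    define E where "E = b * (C / \<delta>\<^sup>2 * L ^ 4 * (3 * ?K\<^sup>2)) * (q - p)"
    have small: "\<epsilon> * (b * L\<^sup>2 * ?K * (q - p)) < e / 2 + 0"
      using e den by (simp add: \<epsilon>_def field_simps)
    have "(\<lambda>m. E * h m) \<longlonglongrightarrow> E * 0" unfolding h_def by (intro tendsto_mult mesh_tendsto_0 tendsto_const)
    then have "\<forall>\<^sub>F m in sequentially. E * h m < e / 2" using e by (intro order_tendstoD(2)) auto
    then obtain m0 where m0: "\<And>m. m \<ge> m0 \<Longrightarrow> E * h m < e / 2" unfolding eventually_sequentially by blast
    show "\<exists>no. \<forall>m\<ge>no. norm ((\<Sum>k<Suc m. \<integral>\<omega>. Q m k \<omega> \<partial>M) - 0) < e"
    proof (intro exI allI impI)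
      fix m assume m: "m \<ge> m0"
      have "\<bar>\<Sum>k<Suc m. \<integral>\<omega>. Q m k \<omega> \<partial>M\<bar> \<le> (\<Sum>k<Suc m. b * (\<epsilon> * L\<^sup>2 * (?K * h m) + C / \<delta>\<^sup>2 * L ^ 4 * (3 * ?K\<^sup>2 * (h m)\<^sup>2)))"
        by (rule order_trans[OF sum_abs], rule sum_mono) (use Qb(2)[OF _ \<delta>(1) \<epsilon> \<delta>(2)] in auto)
      also have "\<dots> = real (Suc m) * (b * (\<epsilon> * L\<^sup>2 * (?K * h m) + C / \<delta>\<^sup>2 * L ^ 4 * (3 * ?K\<^sup>2 * (h m)\<^sup>2)))"
        by (simp only: sum_constant card_lessThan)
      also have "\<dots> = \<epsilon> * (b * L\<^sup>2 * ?K * (real (Suc m) * h m)) + b * (C / \<delta>\<^sup>2 * L ^ 4 * (3 * ?K\<^sup>2)) * (real (Suc m) * h m) * h m"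
        by (simp add: algebra_simps power2_eq_square)
      \<comment> \<open>The number of cells cancels one factor of the mesh; the fourth-moment part
        keeps another one and therefore tends to zero.\<close>
      also have "real (Suc m) * h m = q - p" by (simp add: h_def del: of_nat_Suc)
      also have "\<epsilon> * (b * L\<^sup>2 * ?K * (q - p)) + b * (C / \<delta>\<^sup>2 * L ^ 4 * (3 * ?K\<^sup>2)) * (q - p) * h m < e"
        using small m0[OF m] unfolding E_def by linarith
      finally show "norm ((\<Sum>k<Suc m. \<integral>\<omega>. Q m k \<omega> \<partial>M) - 0) < e" by simp
    qed
  qed
  from tendsto_diff[OF tendsto_const this]
  have lim1: "(\<lambda>m. \<integral>\<omega>. Z \<omega> * V m \<omega> \<partial>M) \<longlonglongrightarrow> (\<integral>\<omega>. Z \<omega> * D \<omega> \<partial>M)"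
    by (simp add: has_bochner_integral_integral_eq[OF ZVi])
  have ZVm: "(\<lambda>\<omega>. Z \<omega> * V m \<omega>) \<in> borel_measurable M" for m
    using ZVi by (auto dest: has_bochner_integral_integrable integrable.intros)
  have ZVl: "(\<lambda>m. Z \<omega> * V m \<omega>) \<longlonglongrightarrow> Z \<omega> * I \<omega>" if "\<omega> \<in> space M" for \<omega>
    by (intro tendsto_mult tendsto_const V_lim that)
  have ZIm: "(\<lambda>\<omega>. Z \<omega> * I \<omega>) \<in> borel_measurable M"
    by (rule borel_measurable_LIMSEQ_real[OF ZVl ZVm])
  define G where "G = b * (C * (q - p) + 2 * C * (c + 1) + (q - p) * (?K * (L\<^sup>2 * C)))"
  have dom: "AE \<omega> in M. norm (Z \<omega> * V m \<omega>) \<le> G" for m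
    using Z(2) V_bound b by (auto simp: abs_mult G_def intro!: AE_I2 mult_mono)
  have lims: "AE \<omega> in M. (\<lambda>m. Z \<omega> * V m \<omega>) \<longlonglongrightarrow> Z \<omega> * I \<omega>" using ZVl by auto
  have ZI: "integrable M (\<lambda>\<omega>. Z \<omega> * I \<omega>)"
    by (rule integrable_dominated_convergence[OF ZIm ZVm _ lims dom]) simp
  have lim2: "(\<lambda>m. \<integral>\<omega>. Z \<omega> * V m \<omega> \<partial>M) \<longlonglongrightarrow> (\<integral>\<omega>. Z \<omega> * I \<omega> \<partial>M)"
    by (rule integral_dominated_convergence[OF ZIm ZVm _ lims dom]) simp
  have eq: "(\<integral>\<omega>. Z \<omega> * D \<omega> \<partial>M) = (\<integral>\<omega>. Z \<omega> * I \<omega> \<partial>M)"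
    using LIMSEQ_unique[OF lim1 lim2] .
  have "has_bochner_integral M (\<lambda>\<omega>. Z \<omega> * D \<omega> - Z \<omega> * I \<omega>) 0"
    using has_bochner_integral_diff[OF has_bochner_integral_integrable[OF ZD] has_bochner_integral_integrable[OF ZI]] eq by simp
  then show ?thesis by (simp add: D_def I_def algebra_simps)
qed

text \<open>The drift and the clock contribute \<open>C * \<alpha>\<close> each, the trace
  \<open>CARD('k)\<close> times as much at most. It is here that \<alpha> has to dominate both the
  drift and the squared diffusion.\<close>

lemma (in test_function) abs_ito_generator_le:
  fixes H :: "real^'k^'n"
  assumes s: "s \<in> {lo..hi}" and b: "norm b \<le> \<alpha>" and h: "(norm H)\<^sup>2 \<le> \<alpha>"
  shows "\<bar>ito_generator \<Phi>t \<Phi>a \<Phi>x \<Phi>xx x s a b \<alpha> H\<bar> \<le> C + C * (2 + CARD('k)) * \<alpha>"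
proof -
  have \<alpha>: "\<alpha> \<ge> 0" using b norm_ge_zero order_trans by blast
  have C: "C \<ge> 0" using bound[OF s, of 0 0] by linarith
  have "\<bar>\<Phi>x x s a \<bullet> b\<bar> \<le> C * \<alpha>"
    using order_trans[OF Cauchy_Schwarz_ineq2 mult_mono[OF bound_x[OF s] b C norm_ge_zero]] .
  moreover have "\<bar>\<Phi>t x s a\<bar> \<le> C" by (rule bound_t[OF s])
  moreover have "\<bar>\<Phi>a x s a * \<alpha>\<bar> \<le> C * \<alpha>"
    unfolding abs_mult using bound_a[OF s] \<alpha> C by (intro mult_mono) auto
  moreover have "\<bar>1/2 * trace (H ** transpose H ** \<Phi>xx x s a)\<bar> \<le> CARD('k) * (\<alpha> * C)"
  proof -
    have "\<bar>1/2 * trace (H ** transpose H ** \<Phi>xx x s a)\<bar> \<le> CARD('k) * ((norm H)\<^sup>2 * norm (\<Phi>xx x s a))"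
      using abs_trace_congruence_le[of H "\<Phi>xx x s a"] by simp
    also have "\<dots> \<le> CARD('k) * (\<alpha> * C)"
      using bound_xx[OF s] C \<alpha> h by (intro mult_left_mono mult_mono) auto
    finally show ?thesis .
  qed
  ultimately have "\<bar>ito_generator \<Phi>t \<Phi>a \<Phi>x \<Phi>xx x s a b \<alpha> H\<bar> \<le> C * \<alpha> + C + C * \<alpha> + CARD('k) * (\<alpha> * C)"
    unfolding ito_generator_def by linarith
  then show ?thesis by (simp add: algebra_simps)
qed

section \<open>Ito's formula for simple diffusion coefficients\<close>

lemma borel_measurable_trace_congruence [measurable (raw)]:
  fixes H :: "'a \<Rightarrow> real^'k^'n" and N :: "'a \<Rightarrow> real^'n^'n"
  assumes [measurable]: "H \<in> borel_measurable M" "N \<in> borel_measurable M"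
  shows "(\<lambda>x. trace (H x ** transpose (H x) ** N x)) \<in> borel_measurable M"
  unfolding trace_def matrix_matrix_mult_def transpose_def by simp

text \<open>Nothing here relates \<open>Y\<close> to \<open>H\<close>; that \<open>Y\<close> is the
  stochastic integral enters only through approximation by simple processes. The endpoint
  \<open>hi\<close> is kept apart from \<open>T\<close> because simple processes and their integrals
  live on all of \<open>{t..T}\<close>, the drift only up to \<open>hi\<close>.\<close>

locale ito_process = filtered_wiener M F w t T
  for M :: "'w measure" and F and w :: "real \<Rightarrow> 'w \<Rightarrow> real^'k" and t T +
  fixes hi :: real and x0 :: "real^'n" and \<beta> :: "real \<Rightarrow> 'w \<Rightarrow> real^'n"
    and H :: "real \<Rightarrow> 'w \<Rightarrow> real^'k^'n" and Y :: "real \<Rightarrow> 'w \<Rightarrow> real^'n"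
  assumes hi: "t \<le> hi" "hi \<le> T"
    and \<beta>_progressive: "\<And>s. s \<in> {t..hi} \<Longrightarrow> (\<lambda>(r, \<omega>). \<beta> r \<omega>) \<in> borel_measurable (restrict_space borel {t..s} \<Otimes>\<^sub>M F s)"
    and \<beta>_integrable: "\<And>\<omega>. \<omega> \<in> space M \<Longrightarrow> set_integrable lborel {t..<hi} (\<lambda>r. \<beta> r \<omega>)"
    and H_progressive: "\<And>s. s \<in> {t..hi} \<Longrightarrow> (\<lambda>(r, \<omega>). H r \<omega>) \<in> borel_measurable (restrict_space borel {t..s} \<Otimes>\<^sub>M F s)"
    and H_square_integrable: "\<And>\<omega>. \<omega> \<in> space M \<Longrightarrow> set_integrable lborel {t..<hi} (\<lambda>r. (norm (H r \<omega>))\<^sup>2)"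
    and Y_adapted: "\<And>s. s \<in> {t..hi} \<Longrightarrow> Y s \<in> borel_measurable (F s)"
    and Y_continuous: "\<And>\<omega>. \<omega> \<in> space M \<Longrightarrow> continuous_on {t..hi} (\<lambda>s. Y s \<omega>)"
begin

definition rate :: "real \<Rightarrow> 'w \<Rightarrow> real" where
  "rate r \<omega> = norm (\<beta> r \<omega>) + (norm (H r \<omega>))\<^sup>2"

definition state :: "real \<Rightarrow> 'w \<Rightarrow> real^'n" where
  "state s \<omega> = x0 + (LBINT r:{t..<s}. \<beta> r \<omega>) + Y s \<omega>"

definition clock :: "real \<Rightarrow> 'w \<Rightarrow> real" where
  "clock s \<omega> = (LBINT r:{t..<s}. rate r \<omega>)"

lemma rate_nonneg: "0 \<le> rate r \<omega>"
  by (simp add: rate_def)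

lemma norm_\<beta>_le_rate: "norm (\<beta> r \<omega>) \<le> rate r \<omega>"
  by (simp add: rate_def)

lemma rate_integrable: "\<omega> \<in> space M \<Longrightarrow> set_integrable lborel {t..<hi} (\<lambda>r. rate r \<omega>)"
  unfolding rate_def by (intro set_integral_add set_integrable_norm \<beta>_integrable H_square_integrable)

lemma continuous_state: "\<omega> \<in> space M \<Longrightarrow> continuous_on {t..hi} (\<lambda>s. state s \<omega>)"
  unfolding state_def
  by (intro continuous_intros continuous_on_indefinite_set_integral \<beta>_integrable Y_continuous)

lemma continuous_clock: "\<omega> \<in> space M \<Longrightarrow> continuous_on {t..hi} (\<lambda>s. clock s \<omega>)"
  unfolding clock_def by (intro continuous_on_indefinite_set_integral rate_integrable)

lemma restrict_progressive:
  assumes "(\<lambda>(r, \<omega>). f r \<omega>) \<in> borel_measurable (restrict_space borel S \<Otimes>\<^sub>M N)" "S' \<subseteq> S"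
  shows "(\<lambda>(r, \<omega>). f r \<omega>) \<in> borel_measurable (restrict_space borel S' \<Otimes>\<^sub>M N)"
proof -
  have "(\<lambda>x. (fst x, snd x)) \<in> measurable (restrict_space borel S' \<Otimes>\<^sub>M N) (restrict_space borel S \<Otimes>\<^sub>M N)"
  proof (rule measurable_Pair)
    have "(\<lambda>x. x) \<in> measurable (restrict_space borel S') (restrict_space borel S)"
      by (rule measurable_restrict_space2)
        (use assms(2) in \<open>auto simp: space_restrict_space intro: measurable_restrict_space1\<close>)
    then show "fst \<in> measurable (restrict_space borel S' \<Otimes>\<^sub>M N) (restrict_space borel S)"
      by (rule measurable_compose[OF measurable_fst])
  qed simp
  from measurable_compose[OF this assms(1)] show ?thesis by simp
qed

lemma rate_progressive:
  assumes "s \<in> {t..hi}"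
  shows "(\<lambda>(r, \<omega>). rate r \<omega>) \<in> borel_measurable (restrict_space borel {t..s} \<Otimes>\<^sub>M F s)"
  using \<beta>_progressive[OF assms] H_progressive[OF assms] unfolding rate_def split_beta' by measurable

lemma state_adapted: "s \<in> {t..hi} \<Longrightarrow> state s \<in> borel_measurable (F s)"
proof -
  assume s: "s \<in> {t..hi}"
  have "(\<lambda>\<omega>. LBINT r:{t..<s}. \<beta> r \<omega>) \<in> borel_measurable (F s)"
    by (rule set_integral_adapted[OF restrict_progressive[OF \<beta>_progressive[OF s]]]) auto
  then show ?thesis unfolding state_def using Y_adapted[OF s] by measurable
qed

lemma clock_adapted: "s \<in> {t..hi} \<Longrightarrow> clock s \<in> borel_measurable (F s)"
  unfolding clock_def
  by (rule set_integral_adapted[OF restrict_progressive[OF rate_progressive]]) auto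

lemma in_horizon: "s \<in> {t..hi} \<Longrightarrow> s \<in> {t..T}"
  using hi by auto

lemma state_measurable: "s \<in> {t..hi} \<Longrightarrow> state s \<in> borel_measurable M"
  using measurable_F_M[OF in_horizon state_adapted] .

lemma clock_measurable: "s \<in> {t..hi} \<Longrightarrow> clock s \<in> borel_measurable M"
  using measurable_F_M[OF in_horizon clock_adapted] .

lemma split_from_t:
  fixes f :: "real \<Rightarrow> 'b::{banach, second_countable_topology}"
  assumes "set_integrable lborel {t..<hi} f" "t \<le> r" "r \<le> s" "s \<le> hi"
  shows "(LBINT x:{t..<s}. f x) = (LBINT x:{t..<r}. f x) + (LBINT x:{r..<s}. f x)"
  by (rule set_integral_split[OF set_integrable_subset[OF assms(1)]]) (use assms in auto)

lemma clock_increment: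
  assumes "\<omega> \<in> space M" "t \<le> r" "r \<le> s" "s \<le> hi"
  shows "clock s \<omega> = clock r \<omega> + (LBINT x:{r..<s}. rate x \<omega>)"
  unfolding clock_def by (rule split_from_t[OF rate_integrable[OF assms(1)] assms(2-4)])

lemma state_increment:
  assumes "\<omega> \<in> space M" "t \<le> r" "r \<le> s" "s \<le> hi"
  shows "state s \<omega> = state r \<omega> + (LBINT x:{r..<s}. \<beta> x \<omega>) + (Y s \<omega> - Y r \<omega>)"
  unfolding state_def using split_from_t[OF \<beta>_integrable[OF assms(1)] assms(2-4)] by simp

lemma set_integral_rate_nonneg: "0 \<le> (LBINT x:S. rate x \<omega>)"
  unfolding set_lebesgue_integral_def
  by (rule Bochner_Integration.integral_nonneg) (simp add: rate_nonneg)

lemma clock_nonneg: "0 \<le> clock s \<omega>"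
  unfolding clock_def by (rule set_integral_rate_nonneg)

lemma clock_mono:
  assumes "\<omega> \<in> space M" "t \<le> r" "r \<le> s" "s \<le> hi"
  shows "clock r \<omega> \<le> clock s \<omega>"
  using clock_increment[OF assms] set_integral_rate_nonneg[of "{r..<s}" \<omega>] by simp

lemma H_path_measurable:
  assumes "\<omega> \<in> space M"
  shows "(\<lambda>r. indicat_real {t..<hi} r *\<^sub>R H r \<omega>) \<in> borel_measurable lborel"
proof -
  have s: "hi \<in> {t..hi}" using hi by simp
  have \<omega>: "\<omega> \<in> space (F hi)" using assms space_F[OF in_horizon[OF s]] by simp
  have m: "(\<lambda>(\<omega>, r). indicat_real {t..<hi} r *\<^sub>R H r \<omega>) \<in> borel_measurable (F hi \<Otimes>\<^sub>M lborel)"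
    by (rule measurable_indicator_times_restricted[OF restrict_progressive[OF H_progressive[OF s]]]) auto
  from measurable_compose[OF measurable_Pair1'[OF \<omega>] m] show ?thesis by simp
qed

end

locale ito_process_test = ito_process M F w t T hi x0 \<beta> H Y + test_function t hi \<Phi> \<Phi>t \<Phi>a \<Phi>x \<Phi>xx C c
  for M :: "'w measure" and F and w :: "real \<Rightarrow> 'w \<Rightarrow> real^'k" and t T hi
    and x0 :: "real^'n" and \<beta> H Y and \<Phi> :: "real^'n \<Rightarrow> real \<Rightarrow> real \<Rightarrow> real" and \<Phi>t \<Phi>a \<Phi>x \<Phi>xx C c
begin

definition gen :: "real \<Rightarrow> 'w \<Rightarrow> real" where
  "gen r \<omega> = ito_generator \<Phi>t \<Phi>a \<Phi>x \<Phi>xx (state r \<omega>) r (clock r \<omega>) (\<beta> r \<omega>) (rate r \<omega>) (H r \<omega>)"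

definition mart :: "real \<Rightarrow> real \<Rightarrow> 'w \<Rightarrow> real" where
  "mart p q \<omega> = \<Phi> (state q \<omega>) q (clock q \<omega>) - \<Phi> (state p \<omega>) p (clock p \<omega>) - (LBINT r:{p..<q}. gen r \<omega>)"

lemma continuous_path:
  assumes "continuous_on (UNIV \<times> {t..hi} \<times> UNIV) (\<lambda>(x, s, a). f x s a)" "\<omega> \<in> space M"
  shows "continuous_on {t..hi} (\<lambda>r. f (state r \<omega>) r (clock r \<omega>))"
  by (rule continuous_along_path[OF assms(1) continuous_state[OF assms(2)] continuous_clock[OF assms(2)]]) simp

lemma jointly_measurable_path:
  fixes f :: "real^'n \<Rightarrow> real \<Rightarrow> real \<Rightarrow> 'b::{metric_space, second_countable_topology}"
  assumes "continuous_on (UNIV \<times> {t..hi} \<times> UNIV) (\<lambda>(x, s, a). f x s a)"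
  shows "(\<lambda>(r, \<omega>). f (state r \<omega>) r (clock r \<omega>)) \<in> borel_measurable (restrict_space borel {t..hi} \<Otimes>\<^sub>M M)"
  by (rule continuous_paths_jointly_measurable[OF continuous_path[OF assms]], assumption,
      rule continuous_slice_measurable[OF assms])
    (auto intro: state_measurable clock_measurable)

lemma measurable_F_M_joint:
  assumes "f \<in> measurable (restrict_space borel S \<Otimes>\<^sub>M F s) N" "s \<in> {t..hi}"
  shows "f \<in> measurable (restrict_space borel S \<Otimes>\<^sub>M M) N"
  using in_horizon[OF assms(2)] by (intro measurable_restricted_pair_mono[OF assms(1)] F_le space_F)

lemma gen_jointly_measurable:
  "(\<lambda>(r, \<omega>). gen r \<omega>) \<in> borel_measurable (restrict_space borel {t..hi} \<Otimes>\<^sub>M M)"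
proof -
  have h: "hi \<in> {t..hi}" using hi by simp
  note [measurable] = jointly_measurable_path[OF cont_x, unfolded split_beta'] jointly_measurable_path[OF cont_t, unfolded split_beta']
    jointly_measurable_path[OF cont_a, unfolded split_beta'] jointly_measurable_path[OF cont_xx, unfolded split_beta']
    measurable_F_M_joint[OF \<beta>_progressive[OF h] h, unfolded split_beta'] measurable_F_M_joint[OF H_progressive[OF h] h, unfolded split_beta']
    measurable_F_M_joint[OF rate_progressive[OF h] h, unfolded split_beta']
  show ?thesis unfolding gen_def ito_generator_def split_beta' by measurable
qed

lemma mart_measurable:
  assumes "t \<le> p" "p \<le> q" "q \<le> hi"
  shows "mart p q \<in> borel_measurable M"
proof -
  have pq: "p \<in> {t..hi}" "q \<in> {t..hi}" using assms by auto
  have "(\<lambda>\<omega>. LBINT r:{p..<q}. gen r \<omega>) \<in> borel_measurable M"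
    by (rule set_integral_adapted[OF restrict_progressive[OF gen_jointly_measurable]]) (use assms in auto)
  moreover have "(\<lambda>\<omega>. \<Phi> (state q \<omega>) q (clock q \<omega>)) \<in> borel_measurable M" "(\<lambda>\<omega>. \<Phi> (state p \<omega>) p (clock p \<omega>)) \<in> borel_measurable M"
    using pq by (auto intro!: continuous_slice_measurable[OF cont] state_measurable clock_measurable)
  ultimately show ?thesis unfolding mart_def by measurable
qed

lemma C_nonneg: "C \<ge> 0"
  using bound[of t 0 0] hi by auto

lemma abs_gen_le:
  assumes "r \<in> {t..hi}"
  shows "\<bar>gen r \<omega>\<bar> \<le> C + C * (2 + CARD('k)) * (if clock r \<omega> < c then rate r \<omega> else 0)"
proof (cases "clock r \<omega> < c")
  case False
  then have "gen r \<omega> = 0"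
    unfolding gen_def ito_generator_def
    using vanish_x vanish_t vanish_a vanish_xx assms by (simp add: trace_def matrix_matrix_mult_def)
  then show ?thesis using False C_nonneg by simp
next
  case True
  have "(norm (H r \<omega>))\<^sup>2 \<le> rate r \<omega>" by (simp add: rate_def)
  then show ?thesis
    unfolding gen_def using True abs_ito_generator_le[OF assms norm_\<beta>_le_rate] by simp
qed

lemma gen_path_measurable:
  assumes "\<omega> \<in> space M" "S \<in> sets borel" "S \<subseteq> {t..hi}"
  shows "(\<lambda>r. indicat_real S r *\<^sub>R gen r \<omega>) \<in> borel_measurable lborel"
  using measurable_compose[OF measurable_Pair1'[OF assms(1)] measurable_indicator_times_restricted[OF restrict_progressive[OF gen_jointly_measurable assms(3)] assms(2)]]
  by simp

lemma gen_integrable: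
  assumes \<omega>: "\<omega> \<in> space M"
  shows "set_integrable lborel {t..<hi} (\<lambda>r. gen r \<omega>)"
  unfolding set_integrable_def
proof (rule Bochner_Integration.integrable_bound)
  have "set_integrable lborel {t..<hi} (\<lambda>_. C)"
    unfolding set_integrable_def by (intro integrable_scaleR_left integrable_real_indicator) (use hi in auto)
  then have "set_integrable lborel {t..<hi} (\<lambda>r. C + C * (2 + CARD('k)) * rate r \<omega>)"
    by (intro set_integral_add(1) set_integrable_mult_right rate_integrable[OF \<omega>]) auto
  then show "integrable lborel (\<lambda>r. indicat_real {t..<hi} r *\<^sub>R (C + C * (2 + CARD('k)) * rate r \<omega>))"
    by (simp add: set_integrable_def)
  show "(\<lambda>r. indicat_real {t..<hi} r *\<^sub>R gen r \<omega>) \<in> borel_measurable lborel"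
    by (rule gen_path_measurable[OF \<omega>]) auto
  show "AE r in lborel. norm (indicat_real {t..<hi} r *\<^sub>R gen r \<omega>)
      \<le> norm (indicat_real {t..<hi} r *\<^sub>R (C + C * (2 + CARD('k)) * rate r \<omega>))"
  proof (rule AE_I2)
    fix r
    have "\<bar>gen r \<omega>\<bar> \<le> \<bar>C + C * (2 + CARD('k)) * rate r \<omega>\<bar>" if "r \<in> {t..hi}"
    proof -
      have "C * (2 + CARD('k)) * (if clock r \<omega> < c then rate r \<omega> else 0) \<le> C * (2 + CARD('k)) * rate r \<omega>"
        using C_nonneg rate_nonneg[of r \<omega>] by (intro mult_left_mono) auto
      with abs_gen_le[OF that, of \<omega>] show ?thesis by linarith
    qed
    then show "norm (indicat_real {t..<hi} r *\<^sub>R gen r \<omega>)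
      \<le> norm (indicat_real {t..<hi} r *\<^sub>R (C + C * (2 + CARD('k)) * rate r \<omega>))"
      by (auto simp: indicator_def)
  qed
qed

lemma mart_add:
  assumes "\<omega> \<in> space M" "t \<le> p" "p \<le> r" "r \<le> q" "q \<le> hi"
  shows "mart p q \<omega> = mart p r \<omega> + mart r q \<omega>"
proof -
  have "(LBINT x:{p..<q}. gen x \<omega>) = (LBINT x:{p..<r}. gen x \<omega>) + (LBINT x:{r..<q}. gen x \<omega>)"
    by (rule set_integral_split[OF set_integrable_subset[OF gen_integrable[OF assms(1)]]]) (use assms in auto)
  then show ?thesis by (simp add: mart_def)
qed

text \<open>The bound is the same for every path: apart from a constant, the generator is at most a
  multiple of the rate, and only while the clock is below \<open>c\<close>, so that its integral is
  at most a multiple of \<open>c\<close>.\<close>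

lemma abs_mart_le:
  assumes \<omega>: "\<omega> \<in> space M" and pq: "t \<le> p" "p \<le> q" "q \<le> hi"
  shows "\<bar>mart p q \<omega>\<bar> \<le> 2 * C + (C * (q - p) + C * (2 + CARD('k)) * c)"
proof -
  let ?f = "\<lambda>r. if clock r \<omega> < c then rate r \<omega> else 0"
  have sub: "{p..<q} \<subseteq> {t..<hi}" using pq by auto
  have ri: "set_integrable lborel {p..<q} (\<lambda>r. rate r \<omega>)" and gi: "set_integrable lborel {p..<q} (\<lambda>r. gen r \<omega>)"
    by (rule set_integrable_subset[OF rate_integrable[OF \<omega>] _ sub] set_integrable_subset[OF gen_integrable[OF \<omega>] _ sub]; simp)+
  have cm: "(\<lambda>r. indicat_real {p..q} r *\<^sub>R clock r \<omega>) \<in> borel_measurable borel"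
    by (rule borel_measurable_continuous_on_indicator[OF _ continuous_on_subset[OF continuous_clock[OF \<omega>]]])
      (use pq in auto)
  have fi: "set_integrable lborel {p..<q} ?f"
    unfolding set_integrable_def
  proof (rule Bochner_Integration.integrable_bound[OF ri[unfolded set_integrable_def]])
    have [measurable]: "(\<lambda>r. indicat_real {p..<q} r *\<^sub>R rate r \<omega>) \<in> borel_measurable lborel"
      using ri unfolding set_integrable_def by (rule borel_measurable_integrable)
    have "(\<lambda>r. if indicat_real {p..q} r *\<^sub>R clock r \<omega> < c then indicat_real {p..<q} r *\<^sub>R rate r \<omega> else 0) \<in> borel_measurable lborel"
      using cm by measurable
    also have "(\<lambda>r. if indicat_real {p..q} r *\<^sub>R clock r \<omega> < c then indicat_real {p..<q} r *\<^sub>R rate r \<omega> else 0)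
      = (\<lambda>r. indicat_real {p..<q} r *\<^sub>R ?f r)"
      by (auto simp: fun_eq_iff indicator_def)
    finally show "(\<lambda>r. indicat_real {p..<q} r *\<^sub>R ?f r) \<in> borel_measurable lborel" .
  qed (auto simp: indicator_def)
  have ci: "set_integrable lborel {p..<q} (\<lambda>_. C)"
    unfolding set_integrable_def by (intro integrable_scaleR_left integrable_real_indicator) (use pq in auto)
  have "\<bar>LBINT r:{p..<q}. gen r \<omega>\<bar> \<le> (LBINT r:{p..<q}. \<bar>gen r \<omega>\<bar>)"
    using set_integral_norm_bound[OF gi] by simp
  also have "\<dots> \<le> (LBINT r:{p..<q}. C + C * (2 + CARD('k)) * ?f r)"
    by (intro set_integral_mono set_integral_add(1) ci set_integrable_mult_right fi abs_gen_le)
      (use set_integrable_norm[OF gi] sub in auto)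
  also have "\<dots> = (LBINT r:{p..<q}. C) + (LBINT r:{p..<q}. C * (2 + CARD('k)) * ?f r)"
    by (rule set_integral_add(2)[OF ci]) (use fi in simp)
  also have "\<dots> = C * (q - p) + C * (2 + CARD('k)) * (LBINT r:{p..<q}. ?f r)"
    using pq by (simp add: set_lebesgue_integral_def)
  also have "\<dots> \<le> C * (q - p) + C * (2 + CARD('k)) * c"
  proof -
    have "(LBINT r:{p..<q}. ?f r) = (LBINT r:{p..<q}. (if clock p \<omega> + (LBINT x:{p..<r}. rate x \<omega>) < c then rate r \<omega> else 0))"
    proof (rule set_lebesgue_integral_cong, simp, intro allI impI)
      fix r assume "r \<in> {p..<q}"
      then have "clock r \<omega> = clock p \<omega> + (LBINT x:{p..<r}. rate x \<omega>)"
        using pq by (intro clock_increment[OF \<omega>]) auto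
      then show "?f r = (if clock p \<omega> + (LBINT x:{p..<r}. rate x \<omega>) < c then rate r \<omega> else 0)"
        by (simp only:)
    qed
    also have "\<dots> \<le> c"
      by (rule integral_below_level_le[OF ri rate_nonneg c_nonneg clock_nonneg])
    finally show ?thesis using C_nonneg by (intro add_left_mono mult_left_mono) auto
  qed
  finally have 1: "\<bar>LBINT r:{p..<q}. gen r \<omega>\<bar> \<le> C * (q - p) + C * (2 + CARD('k)) * c" .
  have "\<bar>\<Phi> (state q \<omega>) q (clock q \<omega>)\<bar> \<le> C" "\<bar>\<Phi> (state p \<omega>) p (clock p \<omega>)\<bar> \<le> C"
    using bound pq by auto
  with 1 show ?thesis unfolding mart_def by linarith
qed

lemma times_mart_integrable:
  assumes Z: "Z \<in> borel_measurable M" "\<And>\<omega>. \<omega> \<in> space M \<Longrightarrow> \<bar>Z \<omega>\<bar> \<le> b"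
    and pq: "t \<le> p" "p \<le> q" "q \<le> hi"
  shows "integrable M (\<lambda>\<omega>. Z \<omega> * mart p q \<omega>)"
proof (rule integrable_const_bound)
  show "(\<lambda>\<omega>. Z \<omega> * mart p q \<omega>) \<in> borel_measurable M"
    using Z(1) mart_measurable[OF pq] by measurable
  show "AE \<omega> in M. norm (Z \<omega> * mart p q \<omega>) \<le> \<bar>b\<bar> * (2 * C + (C * (q - p) + C * (2 + CARD('k)) * c))"
  proof (rule AE_I2)
    fix \<omega> assume \<omega>: "\<omega> \<in> space M"
    have "\<bar>Z \<omega>\<bar> \<le> \<bar>b\<bar>" using Z(2)[OF \<omega>] by linarith
    then show "norm (Z \<omega> * mart p q \<omega>) \<le> \<bar>b\<bar> * (2 * C + (C * (q - p) + C * (2 + CARD('k)) * c))"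
      unfolding real_norm_def abs_mult using abs_mart_le[OF \<omega> pq] by (intro mult_mono) auto
  qed
qed

lemma continuous_mart:
  assumes \<omega>: "\<omega> \<in> space M" and p: "p \<in> {t..hi}"
  shows "continuous_on {p..hi} (\<lambda>q. mart p q \<omega>)"
proof -
  have "set_integrable lborel {p..<hi} (\<lambda>r. gen r \<omega>)"
    by (rule set_integrable_subset[OF gen_integrable[OF \<omega>]]) (use p in auto)
  then show ?thesis
    unfolding mart_def
    by (intro continuous_intros continuous_on_indefinite_set_integral
        continuous_on_subset[OF continuous_path[OF cont \<omega>]]) (use p in auto)
qed

end

text \<open>Simple processes are constant on intervals open on the left and closed on the right,
  whereas time integrals here run over intervals closed on the left and open on the right. Between
  jump times the two conventions differ at one point.\<close>

lemma set_integral_cong_except_point: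
  fixes f g :: "real \<Rightarrow> 'b::{banach, second_countable_topology}"
  assumes f: "set_integrable lborel S f" and eq: "\<And>r. r \<in> S \<Longrightarrow> r \<noteq> p \<Longrightarrow> f r = g r"
  shows "set_integrable lborel S g" and "(LBINT r:S. g r) = (LBINT r:S. f r)"
proof -
  let ?f = "\<lambda>r. indicat_real S r *\<^sub>R f r" and ?g = "\<lambda>r. indicat_real S r *\<^sub>R g r"
  have fm: "?f \<in> borel_measurable lborel"
    using f unfolding set_integrable_def by (rule borel_measurable_integrable)
  have "(\<lambda>r. if r = p then ?g p else ?f r) \<in> borel_measurable lborel"
    using fm by measurable
  also have "(\<lambda>r. if r = p then ?g p else ?f r) = ?g"
    using eq by (auto simp: fun_eq_iff indicator_def)
  finally have gm: "?g \<in> borel_measurable lborel" .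
  have ae: "AE r in lborel. ?f r = ?g r"
    using AE_lborel_singleton[of p] by eventually_elim (use eq in \<open>auto simp: indicator_def\<close>)
  show "set_integrable lborel S g"
    unfolding set_integrable_def using integrable_cong_AE[OF fm gm ae] f by (simp add: set_integrable_def)
  show "(LBINT r:S. g r) = (LBINT r:S. f r)"
    unfolding set_lebesgue_integral_def using integral_cong_AE[OF fm gm ae] by simp
qed

context filtered_wiener
begin

lemma simple_value_bounded:
  fixes \<xi> :: "nat \<Rightarrow> 'w \<Rightarrow> real^'k^'n"
  assumes "simple_process t T F N p \<xi>"
  obtains L where "L \<ge> 0" "\<And>r \<omega>. \<omega> \<in> space M \<Longrightarrow> norm (simple_value N p \<xi> r \<omega>) \<le> L"
    "\<And>i \<omega>. i < N \<Longrightarrow> \<omega> \<in> space M \<Longrightarrow> norm (\<xi> i \<omega>) \<le> L"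
proof -
  have "\<forall>i. \<exists>c. i < N \<longrightarrow> (\<forall>\<omega>\<in>space M. norm (\<xi> i \<omega>) \<le> c)"
    using assms space_F unfolding simple_process_def by (metis less_imp_le)
  then obtain c where c: "\<And>i \<omega>. i < N \<Longrightarrow> \<omega> \<in> space M \<Longrightarrow> norm (\<xi> i \<omega>) \<le> c i" by metis
  show thesis
  proof (rule that)
    show "0 \<le> (\<Sum>i<N. \<bar>c i\<bar>)" by (rule sum_nonneg) simp
    fix r \<omega> assume \<omega>: "\<omega> \<in> space M"
    show "norm (simple_value N p \<xi> r \<omega>) \<le> (\<Sum>i<N. \<bar>c i\<bar>)"
      unfolding simple_value_def
    proof (rule order_trans[OF norm_sum], rule sum_mono)
      fix i assume "i \<in> {..<N}"
      then have "norm (\<xi> i \<omega>) \<le> \<bar>c i\<bar>" using c[OF _ \<omega>, of i] by simp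
      then show "norm (indicat_real {p i<..p (Suc i)} r *\<^sub>R \<xi> i \<omega>) \<le> \<bar>c i\<bar>" by (auto simp: indicator_def)
    qed
  next
    fix i \<omega> assume i: "i < N" and \<omega>: "\<omega> \<in> space M"
    have "\<bar>c i\<bar> \<le> (\<Sum>i<N. \<bar>c i\<bar>)" by (rule member_le_sum) (use i in auto)
    then show "norm (\<xi> i \<omega>) \<le> (\<Sum>i<N. \<bar>c i\<bar>)" using c[OF i \<omega>] by linarith
  qed
qed

lemma simple_value_progressive:
  fixes \<xi> :: "nat \<Rightarrow> 'w \<Rightarrow> real^'k^'n"
  assumes sp: "simple_process t T F N p \<xi>" and s: "s \<in> {t..T}"
  shows "(\<lambda>(r, \<omega>). simple_value N p \<xi> r \<omega>) \<in> borel_measurable (restrict_space borel {t..s} \<Otimes>\<^sub>M F s)"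
proof -
  \<comment> \<open>A coefficient fixed after time \<open>s\<close> need not be measurable with
    respect to \<open>F s\<close>; since its indicator vanishes up to \<open>s\<close>, the term may
    be dropped.\<close>
  have "(\<lambda>x. \<Sum>i<N. if p i \<le> s then indicat_real {p i<..p (Suc i)} (fst x) *\<^sub>R \<xi> i (snd x) else 0)
      \<in> borel_measurable (restrict_space borel {t..s} \<Otimes>\<^sub>M F s)"
  proof (rule borel_measurable_sum)
    fix i assume i: "i \<in> {..<N}"
    show "(\<lambda>x. if p i \<le> s then indicat_real {p i<..p (Suc i)} (fst x) *\<^sub>R \<xi> i (snd x) else 0)
      \<in> borel_measurable (restrict_space borel {t..s} \<Otimes>\<^sub>M F s)"
    proof (cases "p i \<le> s")
      case True
      have "t \<le> p i" using sp i by (auto simp: simple_process_def)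
      then have [measurable]: "\<xi> i \<in> borel_measurable (F s)"
        using measurable_F_mono[OF _ True, of "\<xi> i" borel] sp i s by (auto simp: simple_process_def)
      have [measurable]: "fst \<in> borel_measurable (restrict_space borel {t..s} \<Otimes>\<^sub>M F s)"
        by (rule measurable_compose[OF measurable_fst measurable_restrict_space1]) simp
      show ?thesis using True by simp
    qed simp
  qed
  also have "?this \<longleftrightarrow> ?thesis"
    by (rule measurable_cong)
      (auto simp: simple_value_def space_pair_measure space_restrict_space indicator_def intro!: sum.cong)
  finally show ?thesis .
qed

lemma simple_integral_adapted:
  fixes \<xi> :: "nat \<Rightarrow> 'w \<Rightarrow> real^'k^'n"
  assumes sp: "simple_process t T F N p \<xi>" and s: "s \<in> {t..T}"
  shows "simple_integral w N p \<xi> s \<in> borel_measurable (F s)"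
proof -
  have "(\<lambda>\<omega>. \<xi> i \<omega> *v (w (min s (p (Suc i))) \<omega> - w (min s (p i)) \<omega>)) \<in> borel_measurable (F s)" if i: "i < N" for i
  proof (cases "p i \<le> s")
    case True
    have pi: "t \<le> p i" "p i \<le> p (Suc i)" using sp i by (auto simp: simple_process_def)
    then have [measurable]: "\<xi> i \<in> borel_measurable (F s)"
      using measurable_F_mono[OF _ True, of "\<xi> i" borel] sp i s by (auto simp: simple_process_def)
    have "(\<lambda>\<omega>. w (min s (p (Suc i))) \<omega> - w (p i) \<omega>) \<in> borel_measurable (F (min s (p (Suc i))))"
      using True pi s by (intro w_adapted) auto
    then have [measurable]: "(\<lambda>\<omega>. w (min s (p (Suc i))) \<omega> - w (p i) \<omega>) \<in> borel_measurable (F s)"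
      using True pi s by (intro measurable_F_mono[of "min s (p (Suc i))" s]) auto
    have "min s (p i) = p i" using True by simp
    then show ?thesis by simp
  next
    case False
    \<comment> \<open>A cell that begins after \<open>s\<close> has a zero increment, whatever its
      coefficient.\<close>
    then have "min s (p i) = s" "min s (p (Suc i)) = s" using sp i by (auto simp: simple_process_def)
    then show ?thesis by simp
  qed
  then show ?thesis unfolding simple_integral_def[abs_def] by (intro borel_measurable_sum) auto
qed

lemma simple_integral_continuous:
  fixes \<xi> :: "nat \<Rightarrow> 'w \<Rightarrow> real^'k^'n"
  assumes sp: "simple_process t T F N p \<xi>" and \<omega>: "\<omega> \<in> space M"
  shows "continuous_on {t..T} (\<lambda>s. simple_integral w N p \<xi> s \<omega>)"
proof -
  have c: "continuous_on {t..T} (\<lambda>s. w (min s (p i)) \<omega>)" if "i \<le> N" for i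
  proof (rule continuous_on_compose2[OF w_continuous[OF \<omega>]])
    show "(\<lambda>s. min s (p i)) ` {t..T} \<subseteq> {t..T}" using sp that by (auto simp: simple_process_def)
  qed (intro continuous_intros)
  show ?thesis
    unfolding simple_integral_def
    by (intro continuous_on_sum bounded_linear.continuous_on[OF matrix_vector_mul_bounded_linear] continuous_on_diff c) auto
qed

lemma simple_ito_process:
  fixes \<xi> :: "nat \<Rightarrow> 'w \<Rightarrow> real^'k^'n" and \<beta> :: "real \<Rightarrow> 'w \<Rightarrow> real^'n"
  assumes sp: "simple_process t T F N p \<xi>"
    and hi: "t \<le> hi" "hi \<le> T"
    and \<beta>: "\<And>s. s \<in> {t..hi} \<Longrightarrow> (\<lambda>(r, \<omega>). \<beta> r \<omega>) \<in> borel_measurable (restrict_space borel {t..s} \<Otimes>\<^sub>M F s)"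
      "\<And>\<omega>. \<omega> \<in> space M \<Longrightarrow> set_integrable lborel {t..<hi} (\<lambda>r. \<beta> r \<omega>)"
  shows "ito_process M F w t T hi \<beta> (simple_value N p \<xi>) (simple_integral w N p \<xi>)"
proof unfold_locales
  fix \<omega> assume \<omega>: "\<omega> \<in> space M"
  obtain L where L: "L \<ge> 0" "\<And>r \<omega>. \<omega> \<in> space M \<Longrightarrow> norm (simple_value N p \<xi> r \<omega>) \<le> L"
    using simple_value_bounded[OF sp] by metis
  show "set_integrable lborel {t..<hi} (\<lambda>r. (norm (simple_value N p \<xi> r \<omega>))\<^sup>2)"
    unfolding set_integrable_def
  proof (rule Bochner_Integration.integrable_bound)
    show "integrable lborel (\<lambda>r. indicat_real {t..<hi} r *\<^sub>R L\<^sup>2)"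
      by (intro integrable_scaleR_left integrable_real_indicator) (use hi in auto)
    show "(\<lambda>r. indicat_real {t..<hi} r *\<^sub>R (norm (simple_value N p \<xi> r \<omega>))\<^sup>2) \<in> borel_measurable lborel"
      unfolding simple_value_def by measurable
    show "AE r in lborel. norm (indicat_real {t..<hi} r *\<^sub>R (norm (simple_value N p \<xi> r \<omega>))\<^sup>2)
        \<le> norm (indicat_real {t..<hi} r *\<^sub>R L\<^sup>2)"
      using L(2)[OF \<omega>] by (auto simp: indicator_def intro!: AE_I2 power_mono)
  qed
  show "continuous_on {t..hi} (\<lambda>s. simple_integral w N p \<xi> s \<omega>)"
    by (rule continuous_on_subset[OF simple_integral_continuous[OF sp \<omega>]]) (use hi in auto)
qed (use hi \<beta> simple_value_progressive[OF sp] simple_integral_adapted[OF sp] in auto)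

end

locale simple_ito_process = ito_process_test M F w t T hi x0 \<beta> "simple_value N pp \<xi>" "simple_integral w N pp \<xi>" \<Phi> \<Phi>t \<Phi>a \<Phi>x \<Phi>xx C c
  for M :: "'w measure" and F and w :: "real \<Rightarrow> 'w \<Rightarrow> real^'k" and t T hi
    and x0 :: "real^'n" and \<beta> N pp \<xi> and \<Phi> :: "real^'n \<Rightarrow> real \<Rightarrow> real \<Rightarrow> real" and \<Phi>t \<Phi>a \<Phi>x \<Phi>xx C c +
  assumes simple: "simple_process t T F N pp \<xi>"
begin

text \<open>Between jump times the simple coefficient is a single variable of the past, so that the
  formula for a constant coefficient applies.\<close>

lemma ito_formula_no_jump:
  assumes pq: "t \<le> p" "p < q" "q \<le> hi"
    and none: "\<And>i. i \<le> N \<Longrightarrow> \<not> (p < pp i \<and> pp i < q)"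
    and Z: "Z \<in> borel_measurable (F p)" "\<And>\<omega>. \<omega> \<in> space M \<Longrightarrow> \<bar>Z \<omega>\<bar> \<le> b"
  shows "(\<integral>\<omega>. Z \<omega> * mart p q \<omega> \<partial>M) = 0"
proof -
  \<comment> \<open>At most one cell of the simple process covers the interval from \<open>p\<close>
    to \<open>q\<close>, and none if the interval lies outside its grid; summing over
    \<open>J\<close> treats both cases alike.\<close>
  define J where "J = {i. i < N \<and> pp i \<le> p \<and> q \<le> pp (Suc i)}"
  define \<zeta> where "\<zeta> \<omega> = (\<Sum>i\<in>J. \<xi> i \<omega>)" for \<omega>
  have grid: "\<And>i. i \<le> N \<Longrightarrow> pp i \<in> {t..T}" "\<And>i. i < N \<Longrightarrow> pp i \<le> pp (Suc i)"
    "\<And>i. i < N \<Longrightarrow> \<xi> i \<in> borel_measurable (F (pp i))"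
    using simple by (auto simp: simple_process_def)
  obtain L where L: "L \<ge> 0" "\<And>i \<omega>. i < N \<Longrightarrow> \<omega> \<in> space M \<Longrightarrow> norm (\<xi> i \<omega>) \<le> L"
    using simple_value_bounded[OF simple] by metis
  have finJ: "finite J" "J \<subseteq> {..<N}" by (auto simp: J_def)
  have outside: "pp (Suc i) \<le> p \<or> q \<le> pp i" if "i < N" "i \<notin> J" for i
    using none[of i] none[of "Suc i"] grid(2)[OF that(1)] that by (auto simp: J_def not_less)
  have \<zeta>m: "\<zeta> \<in> borel_measurable (F p)"
    unfolding \<zeta>_def
  proof (rule borel_measurable_sum)
    fix i assume "i \<in> J"
    then have i: "i < N" "pp i \<le> p" by (auto simp: J_def)
    show "\<xi> i \<in> borel_measurable (F p)"
      by (rule measurable_F_mono[OF _ i(2) _ grid(3)[OF i(1)]]) (use grid(1)[of i] i pq hi in auto)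
  qed
  have \<zeta>b: "norm (\<zeta> \<omega>) \<le> card J * L" if "\<omega> \<in> space M" for \<omega>
    unfolding \<zeta>_def using L(2)[OF _ that] by (intro order_trans[OF norm_sum sum_bounded_above]) (auto simp: J_def)
  have val: "simple_value N pp \<xi> r \<omega> = \<zeta> \<omega>" if "p < r" "r \<le> q" for r \<omega>
  proof -
    have "simple_value N pp \<xi> r \<omega> = (\<Sum>i<N. if i \<in> J then \<xi> i \<omega> else 0)"
      unfolding simple_value_def
      by (rule sum.cong) (use that outside in \<open>auto simp: indicator_def J_def\<close>, fastforce+)
    also have "\<dots> = \<zeta> \<omega>"
      using finJ by (simp add: \<zeta>_def sum.If_cases Int_absorb1)
    finally show ?thesis .
  qed
  have incr: "simple_integral w N pp \<xi> s \<omega> - simple_integral w N pp \<xi> p \<omega> = \<zeta> \<omega> *v (w s \<omega> - w p \<omega>)" if s: "s \<in> {p..q}" for s \<omega>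
  proof -
    have "simple_integral w N pp \<xi> s \<omega> - simple_integral w N pp \<xi> p \<omega>
      = (\<Sum>i<N. \<xi> i \<omega> *v (w (min s (pp (Suc i))) \<omega> - w (min s (pp i)) \<omega>)
          - \<xi> i \<omega> *v (w (min p (pp (Suc i))) \<omega> - w (min p (pp i)) \<omega>))"
      unfolding simple_integral_def by (rule sum_subtractf[symmetric])
    also have "\<dots> = (\<Sum>i<N. if i \<in> J then \<xi> i \<omega> *v (w s \<omega> - w p \<omega>) else 0)"
    proof (rule sum.cong[OF refl])
      fix i assume "i \<in> {..<N}"
      then have i: "i < N" by simp
      show "\<xi> i \<omega> *v (w (min s (pp (Suc i))) \<omega> - w (min s (pp i)) \<omega>)
          - \<xi> i \<omega> *v (w (min p (pp (Suc i))) \<omega> - w (min p (pp i)) \<omega>)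
        = (if i \<in> J then \<xi> i \<omega> *v (w s \<omega> - w p \<omega>) else 0)"
      proof (cases "i \<in> J")
        case True
        then have "min s (pp (Suc i)) = s" "min s (pp i) = pp i" "min p (pp (Suc i)) = p" "min p (pp i) = pp i"
          using s pq by (auto simp: J_def)
        then show ?thesis using True by (simp add: matrix_vector_mult_diff_distrib)
      next
        case False
        from outside[OF i False] show ?thesis
        proof
          assume "pp (Suc i) \<le> p"
          then have "min s (pp (Suc i)) = pp (Suc i)" "min s (pp i) = pp i" "min p (pp (Suc i)) = pp (Suc i)" "min p (pp i) = pp i"
            using s grid(2)[OF i] by auto
          then show ?thesis using False by simp
        next
          assume "q \<le> pp i"
          then have "min s (pp (Suc i)) = s" "min s (pp i) = s" "min p (pp (Suc i)) = p" "min p (pp i) = p"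
            using s grid(2)[OF i] pq by auto
          then show ?thesis using False by simp
        qed
      qed
    qed
    also have "\<dots> = (\<Sum>i\<in>J. \<xi> i \<omega> *v (w s \<omega> - w p \<omega>))"
      using finJ by (simp add: sum.If_cases Int_absorb1)
    also have "\<dots> = \<zeta> \<omega> *v (w s \<omega> - w p \<omega>)"
      unfolding \<zeta>_def by (induction J rule: infinite_finite_induct) (auto simp: matrix_vector_mult_add_rdistrib)
    finally show ?thesis .
  qed
  \<comment> \<open>The rate computed with the constant coefficient; on the interval it agrees with
    \<open>rate\<close> except perhaps at the left endpoint \<open>p\<close>.\<close>
  define \<alpha> where "\<alpha> r \<omega> = norm (\<beta> r \<omega>) + (norm (\<zeta> \<omega>))\<^sup>2" for r \<omega>
  have rate_eq: "rate r \<omega> = \<alpha> r \<omega>" if "r \<in> {p..<q}" "r \<noteq> p" for r \<omega>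
    using val[of r \<omega>] that by (simp add: rate_def \<alpha>_def)
  have sub: "{p..<s} \<subseteq> {t..<hi}" if "s \<le> q" for s using that pq by auto
  have ri: "set_integrable lborel {p..<s} (\<lambda>r. rate r \<omega>)" if "\<omega> \<in> space M" "s \<le> q" for \<omega> s
    by (rule set_integrable_subset[OF rate_integrable[OF that(1)] _ sub[OF that(2)]]) simp
  have \<alpha>i: "set_integrable lborel {p..<s} (\<lambda>r. \<alpha> r \<omega>)" "(LBINT r:{p..<s}. \<alpha> r \<omega>) = (LBINT r:{p..<s}. rate r \<omega>)"
    if "\<omega> \<in> space M" "s \<le> q" for \<omega> s
    using set_integral_cong_except_point[OF ri[OF that], of p "\<lambda>r. \<alpha> r \<omega>"] rate_eq that(2) by auto
  have "has_bochner_integral M (\<lambda>\<omega>. Z \<omega> * (\<Phi> (state q \<omega>) q (clock q \<omega>) - \<Phi> (state p \<omega>) p (clock p \<omega>)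
      - (LBINT r:{p..<q}. ito_generator \<Phi>t \<Phi>a \<Phi>x \<Phi>xx (state r \<omega>) r (clock r \<omega>) (\<beta> r \<omega>) (\<alpha> r \<omega>) (\<zeta> \<omega>)))) 0"
  proof (rule ito_constant_diffusion[where L = "card J * L" and b = b])
    show "test_function t hi \<Phi> \<Phi>t \<Phi>a \<Phi>x \<Phi>xx C c" by unfold_locales
    show "state s \<omega> = state p \<omega> + (LBINT r:{p..<s}. \<beta> r \<omega>) + \<zeta> \<omega> *v (w s \<omega> - w p \<omega>)"
      if "\<omega> \<in> space M" "s \<in> {p..q}" for \<omega> s
    proof -
      have "p \<le> s" "s \<le> hi" using that(2) pq by auto
      from state_increment[OF that(1) pq(1) this] show ?thesis unfolding incr[OF that(2)] .
    qed
    show "clock s \<omega> = clock p \<omega> + (LBINT r:{p..<s}. \<alpha> r \<omega>)" if "\<omega> \<in> space M" "s \<in> {p..q}" for \<omega> s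
    proof -
      have s: "p \<le> s" "s \<le> q" "s \<le> hi" using that(2) pq by auto
      from clock_increment[OF that(1) pq(1) s(1,3)] show ?thesis unfolding \<alpha>i(2)[OF that(1) s(2)] .
    qed
    show "set_integrable lborel {p..<q} (\<lambda>r. \<beta> r \<omega>)" if "\<omega> \<in> space M" for \<omega>
      by (rule set_integrable_subset[OF \<beta>_integrable[OF that] _ sub]) auto
    show "norm (\<beta> r \<omega>) \<le> \<alpha> r \<omega>" for r \<omega> by (simp add: \<alpha>_def)
    show "state s \<in> borel_measurable (F s)" "clock s \<in> borel_measurable (F s)" if "s \<in> {p..q}" for s
      using that pq by (auto intro!: state_adapted clock_adapted)
    show "set_integrable lborel {p..<q} (\<lambda>r. \<alpha> r \<omega>)" if "\<omega> \<in> space M" for \<omega>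
      by (rule \<alpha>i(1)[OF that order_refl])
    show "0 \<le> clock p \<omega>" for \<omega> by (rule clock_nonneg)
    show "norm (\<zeta> \<omega>) \<le> card J * L" if "\<omega> \<in> space M" for \<omega> by (rule \<zeta>b[OF that])
    show "q \<le> T" using pq hi by simp
  qed (fact pq Z \<zeta>m order_refl)+
  then have "(\<integral>\<omega>. Z \<omega> * (\<Phi> (state q \<omega>) q (clock q \<omega>) - \<Phi> (state p \<omega>) p (clock p \<omega>)
      - (LBINT r:{p..<q}. ito_generator \<Phi>t \<Phi>a \<Phi>x \<Phi>xx (state r \<omega>) r (clock r \<omega>) (\<beta> r \<omega>) (\<alpha> r \<omega>) (\<zeta> \<omega>))) \<partial>M) = 0"
    by (rule has_bochner_integral_integral_eq)
  also have "(\<integral>\<omega>. Z \<omega> * (\<Phi> (state q \<omega>) q (clock q \<omega>) - \<Phi> (state p \<omega>) p (clock p \<omega>)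
      - (LBINT r:{p..<q}. ito_generator \<Phi>t \<Phi>a \<Phi>x \<Phi>xx (state r \<omega>) r (clock r \<omega>) (\<beta> r \<omega>) (\<alpha> r \<omega>) (\<zeta> \<omega>))) \<partial>M)
     = (\<integral>\<omega>. Z \<omega> * mart p q \<omega> \<partial>M)"
  proof (rule Bochner_Integration.integral_cong[OF refl])
    fix \<omega> assume \<omega>: "\<omega> \<in> space M"
    have gi: "set_integrable lborel {p..<q} (\<lambda>r. gen r \<omega>)"
      by (rule set_integrable_subset[OF gen_integrable[OF \<omega>] _ sub]) auto
    have "(LBINT r:{p..<q}. ito_generator \<Phi>t \<Phi>a \<Phi>x \<Phi>xx (state r \<omega>) r (clock r \<omega>) (\<beta> r \<omega>) (\<alpha> r \<omega>) (\<zeta> \<omega>))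
      = (LBINT r:{p..<q}. gen r \<omega>)"
      by (rule set_integral_cong_except_point(2)[OF gi, of p]) (use val rate_eq in \<open>auto simp: gen_def\<close>)
    then show "Z \<omega> * (\<Phi> (state q \<omega>) q (clock q \<omega>) - \<Phi> (state p \<omega>) p (clock p \<omega>)
      - (LBINT r:{p..<q}. ito_generator \<Phi>t \<Phi>a \<Phi>x \<Phi>xx (state r \<omega>) r (clock r \<omega>) (\<beta> r \<omega>) (\<alpha> r \<omega>) (\<zeta> \<omega>)))
      = Z \<omega> * mart p q \<omega>"
      by (simp add: mart_def)
  qed
  finally show ?thesis by simp
qed

text \<open>Induction on the number of jump times strictly between \<open>p\<close> and
  \<open>q\<close>: the increment splits at one of them, and \<open>Z\<close>, being measurable at
  time \<open>p\<close>, is also measurable there.\<close>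

lemma ito_formula_simple:
  assumes "t \<le> p" "p \<le> q" "q \<le> hi"
    and "Z \<in> borel_measurable (F p)" "\<And>\<omega>. \<omega> \<in> space M \<Longrightarrow> \<bar>Z \<omega>\<bar> \<le> b"
  shows "(\<integral>\<omega>. Z \<omega> * mart p q \<omega> \<partial>M) = 0"
  using assms
proof (induction "card {i. i \<le> N \<and> p < pp i \<and> pp i < q}" arbitrary: p q rule: less_induct)
  case less
  have fin: "finite {i. i \<le> N \<and> P i}" for P by (rule finite_subset[of _ "{..N}"]) auto
  show ?case
  proof (cases "\<exists>i\<le>N. p < pp i \<and> pp i < q")
    case False
    show ?thesis
    proof (cases "p = q")
      case True
      then show ?thesis by (simp add: mart_def set_lebesgue_integral_def)
    next
      case neq: False
      with less.prems have "p < q" by simp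
      then show ?thesis using ito_formula_no_jump less.prems False by blast
    qed
  next
    case True
    then obtain i where i: "i \<le> N" "p < pp i" "pp i < q" by blast
    have h: "t \<le> pp i" "p \<le> pp i" "pp i \<le> q" "pp i \<le> hi" "pp i \<le> T" using less.prems i hi by auto
    have Zi: "Z \<in> borel_measurable (F (pp i))"
      by (rule measurable_F_mono[OF less.prems(1) h(2,5) less.prems(4)])
    have ZM: "Z \<in> borel_measurable M"
      by (rule measurable_F_M[OF _ less.prems(4)]) (use less.prems h in auto)
    have "(\<integral>\<omega>. Z \<omega> * mart p (pp i) \<omega> \<partial>M) = 0"
      by (rule less.hyps[OF psubset_card_mono[OF fin] less.prems(1) h(2,4) less.prems(4,5)])
        (use i in auto)
    moreover have "(\<integral>\<omega>. Z \<omega> * mart (pp i) q \<omega> \<partial>M) = 0"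
      by (rule less.hyps[OF psubset_card_mono[OF fin] h(1,3) less.prems(3) Zi less.prems(5)])
        (use i in auto)
    moreover have "(\<integral>\<omega>. Z \<omega> * mart p q \<omega> \<partial>M) = (\<integral>\<omega>. Z \<omega> * mart p (pp i) \<omega> + Z \<omega> * mart (pp i) q \<omega> \<partial>M)"
      by (rule Bochner_Integration.integral_cong[OF refl])
        (use mart_add[OF _ less.prems(1) h(2,3) less.prems(3)] in \<open>auto simp: algebra_simps\<close>)
    moreover have "\<dots> = (\<integral>\<omega>. Z \<omega> * mart p (pp i) \<omega> \<partial>M) + (\<integral>\<omega>. Z \<omega> * mart (pp i) q \<omega> \<partial>M)"
      by (intro Bochner_Integration.integral_add times_mart_integrable[OF ZM less.prems(5)]) (use less.prems h in auto)
    ultimately show ?thesis by simp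
  qed
qed

end

section \<open>Ito's formula for general diffusion coefficients\<close>

text \<open>With \<open>D = G - H\<close>, the difference of the quadratic expressions is
  \<open>D D + D H + H D\<close> up to transposes. A bound of the same shape holds for the squared
  norms, so that a single quantity controls the error of the generator and of the clock.\<close>

lemma abs_trace_congruence_diff_le:
  fixes H G :: "real^'k^'n" and N :: "real^'n^'n"
  shows "\<bar>trace (G ** transpose G ** N) - trace (H ** transpose H ** N)\<bar>
    \<le> CARD('k) * (((norm (G - H))\<^sup>2 + 2 * (norm (G - H) * norm H)) * norm N)"
proof -
  have "trace (G ** transpose G ** N) - trace (H ** transpose H ** N)
      = trace ((G - H) ** transpose (G - H) ** N) + (trace ((G - H) ** transpose H ** N) + trace (H ** transpose (G - H) ** N))"
    unfolding trace_def matrix_matrix_mult_def transpose_def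
    by (simp add: sum_subtractf sum.distrib sum_distrib_left sum_distrib_right algebra_simps)
  also have "\<bar>\<dots>\<bar> \<le> CARD('k) * (norm (G - H) * norm (G - H) * norm N)
      + (CARD('k) * (norm (G - H) * norm H * norm N) + CARD('k) * (norm H * norm (G - H) * norm N))"
    by (intro order_trans[OF abs_triangle_ineq] add_mono abs_trace_bilinear_le)
  also have "\<dots> = CARD('k) * (((norm (G - H))\<^sup>2 + 2 * (norm (G - H) * norm H)) * norm N)"
    by (simp add: algebra_simps power2_eq_square)
  finally show ?thesis .
qed

lemma abs_square_norm_diff_le:
  fixes G H :: "'a::real_normed_vector"
  shows "\<bar>(norm G)\<^sup>2 - (norm H)\<^sup>2\<bar> \<le> (norm (G - H))\<^sup>2 + 2 * (norm (G - H) * norm H)"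
proof -
  have "\<bar>norm G - norm H\<bar> \<le> norm (G - H)" by (rule norm_triangle_ineq3)
  moreover have "norm G + norm H \<le> norm (G - H) + 2 * norm H"
    using norm_triangle_ineq[of "G - H" H] by simp
  ultimately have "\<bar>norm G - norm H\<bar> * \<bar>norm G + norm H\<bar> \<le> norm (G - H) * (norm (G - H) + 2 * norm H)"
    by (intro mult_mono) auto
  moreover have "(norm G)\<^sup>2 - (norm H)\<^sup>2 = (norm G - norm H) * (norm G + norm H)"
    by (simp add: power2_eq_square algebra_simps)
  moreover have "norm (G - H) * (norm (G - H) + 2 * norm H) = (norm (G - H))\<^sup>2 + 2 * (norm (G - H) * norm H)"
    by (simp add: power2_eq_square algebra_simps)
  ultimately show ?thesis by (simp only: abs_mult)
qed

text \<open>Young's inequality with weight \<open>e\<close> trades the mixed term for a large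
  multiple of the square of \<open>D j\<close>, which vanishes in the limit, and a small multiple of
  the square of \<open>h\<close>, which is fixed.\<close>

lemma cross_term_tendsto_0:
  fixes D :: "nat \<Rightarrow> 'a \<Rightarrow> real" and h :: "'a \<Rightarrow> real"
  assumes m: "\<And>j. D j \<in> borel_measurable M" "h \<in> borel_measurable M"
    and nn: "\<And>j x. D j x \<ge> 0" "\<And>x. h x \<ge> 0"
    and i: "\<And>j. integrable M (\<lambda>x. (D j x)\<^sup>2)" "integrable M (\<lambda>x. (h x)\<^sup>2)"
    and lim: "(\<lambda>j. \<integral>x. (D j x)\<^sup>2 \<partial>M) \<longlonglongrightarrow> 0"
  shows "integrable M (\<lambda>x. (D j x)\<^sup>2 + 2 * (D j x * h x))"
    and "(\<lambda>j. \<integral>x. (D j x)\<^sup>2 + 2 * (D j x * h x) \<partial>M) \<longlonglongrightarrow> 0"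
proof -
  have young: "2 * (D j x * h x) \<le> 1 / e * (D j x)\<^sup>2 + e * (h x)\<^sup>2" if "e > 0" for e j x
  proof -
    have "0 \<le> (D j x - e * h x)\<^sup>2 / e" using that by simp
    also have "\<dots> = 1 / e * (D j x)\<^sup>2 + e * (h x)\<^sup>2 - 2 * (D j x * h x)"
      using that by (simp add: power2_eq_square field_simps)
    finally show ?thesis by simp
  qed
  have cross: "integrable M (\<lambda>x. 2 * (D j x * h x))" for j
  proof (rule Bochner_Integration.integrable_bound)
    show "integrable M (\<lambda>x. 1 / 1 * (D j x)\<^sup>2 + 1 * (h x)\<^sup>2)" using i by auto
    show "(\<lambda>x. 2 * (D j x * h x)) \<in> borel_measurable M" using m by measurable
    show "AE x in M. norm (2 * (D j x * h x)) \<le> norm (1 / 1 * (D j x)\<^sup>2 + 1 * (h x)\<^sup>2)"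
      using young[of 1 j] nn by (auto simp: abs_mult intro!: AE_I2)
  qed
  show I: "integrable M (\<lambda>x. (D j x)\<^sup>2 + 2 * (D j x * h x))" for j using i(1) cross by auto
  show "(\<lambda>j. \<integral>x. (D j x)\<^sup>2 + 2 * (D j x * h x) \<partial>M) \<longlonglongrightarrow> 0"
  proof (rule LIMSEQ_I)
    fix r :: real assume r: "r > 0"
    define hh where "hh = (\<integral>x. (h x)\<^sup>2 \<partial>M)"
    have hh: "hh \<ge> 0" by (simp add: hh_def)
    define e where "e = r / (2 * (hh + 1))"
    have e: "e > 0" using r hh by (simp add: e_def)
    have e': "e * hh < r / 2" using r hh by (simp add: e_def field_simps)
    have "(\<lambda>j. (1 + 1 / e) * (\<integral>x. (D j x)\<^sup>2 \<partial>M)) \<longlonglongrightarrow> (1 + 1 / e) * 0"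
      by (intro tendsto_mult tendsto_const lim)
    then have "\<forall>\<^sub>F j in sequentially. (1 + 1 / e) * (\<integral>x. (D j x)\<^sup>2 \<partial>M) < r / 2"
      using r by (intro order_tendstoD(2)) auto
    then obtain j0 where j0: "\<And>j. j \<ge> j0 \<Longrightarrow> (1 + 1 / e) * (\<integral>x. (D j x)\<^sup>2 \<partial>M) < r / 2"
      unfolding eventually_sequentially by blast
    show "\<exists>no. \<forall>j\<ge>no. norm ((\<integral>x. (D j x)\<^sup>2 + 2 * (D j x * h x) \<partial>M) - 0) < r"
    proof (intro exI allI impI)
      fix j assume j: "j \<ge> j0"
      have "(\<integral>x. (D j x)\<^sup>2 + 2 * (D j x * h x) \<partial>M) \<le> (\<integral>x. (1 + 1 / e) * (D j x)\<^sup>2 + e * (h x)\<^sup>2 \<partial>M)"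
        by (rule integral_mono[OF I]) (use i young[OF e] in \<open>auto simp: algebra_simps\<close>)
      also have "\<dots> = (1 + 1 / e) * (\<integral>x. (D j x)\<^sup>2 \<partial>M) + e * hh" using i by (simp add: hh_def)
      also have "\<dots> < r" using j0[OF j] e' by linarith
      finally have "(\<integral>x. (D j x)\<^sup>2 + 2 * (D j x * h x) \<partial>M) < r" .
      moreover have "0 \<le> (\<integral>x. (D j x)\<^sup>2 + 2 * (D j x * h x) \<partial>M)" using nn by (intro Bochner_Integration.integral_nonneg) auto
      ultimately show "norm ((\<integral>x. (D j x)\<^sup>2 + 2 * (D j x * h x) \<partial>M) - 0) < r" by simp
    qed
  qed
qed

context test_function
begin

lemma ito_generator_path_measurable:
  fixes H :: "real \<Rightarrow> real^'k^'n"
  assumes X: "continuous_on {lo..hi} X" and A: "continuous_on {lo..hi} A"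
    and [measurable]: "(\<lambda>r. indicat_real {lo..<hi} r *\<^sub>R b r) \<in> borel_measurable lborel"
      "(\<lambda>r. indicat_real {lo..<hi} r *\<^sub>R \<alpha> r) \<in> borel_measurable lborel"
      "(\<lambda>r. indicat_real {lo..<hi} r *\<^sub>R H r) \<in> borel_measurable lborel"
  shows "(\<lambda>r. indicat_real {lo..<hi} r *\<^sub>R ito_generator \<Phi>t \<Phi>a \<Phi>x \<Phi>xx (X r) r (A r) (b r) (\<alpha> r) (H r)) \<in> borel_measurable lborel"
proof -
  let ?i = "indicat_real {lo..<hi}" and ?I = "indicat_real {lo..hi}"
  have path: "(\<lambda>r. ?I r *\<^sub>R f (X r) r (A r)) \<in> borel_measurable lborel"
    if "continuous_on (UNIV \<times> {lo..hi} \<times> UNIV) (\<lambda>(x, s, a). f x s a)"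
    for f :: "real^'n \<Rightarrow> real \<Rightarrow> real \<Rightarrow> 'z::{real_normed_vector, second_countable_topology}"
    using borel_measurable_continuous_on_indicator[OF _ continuous_along_path[OF that X A]] by simp
  note [measurable] = path[OF cont_x] path[OF cont_t] path[OF cont_a] path[OF cont_xx]
  have "(\<lambda>r. (?I r *\<^sub>R \<Phi>x (X r) r (A r)) \<bullet> (?i r *\<^sub>R b r) + ?i r *\<^sub>R (?I r *\<^sub>R \<Phi>t (X r) r (A r))
      + (?I r *\<^sub>R \<Phi>a (X r) r (A r)) * (?i r *\<^sub>R \<alpha> r)
      + 1/2 * trace ((?i r *\<^sub>R H r) ** transpose (?i r *\<^sub>R H r) ** (?I r *\<^sub>R \<Phi>xx (X r) r (A r)))) \<in> borel_measurable lborel"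
    by measurable
  also have "(\<lambda>r. (?I r *\<^sub>R \<Phi>x (X r) r (A r)) \<bullet> (?i r *\<^sub>R b r) + ?i r *\<^sub>R (?I r *\<^sub>R \<Phi>t (X r) r (A r))
      + (?I r *\<^sub>R \<Phi>a (X r) r (A r)) * (?i r *\<^sub>R \<alpha> r)
      + 1/2 * trace ((?i r *\<^sub>R H r) ** transpose (?i r *\<^sub>R H r) ** (?I r *\<^sub>R \<Phi>xx (X r) r (A r))))
    = (\<lambda>r. ?i r *\<^sub>R ito_generator \<Phi>t \<Phi>a \<Phi>x \<Phi>xx (X r) r (A r) (b r) (\<alpha> r) (H r))"
    by (auto simp: fun_eq_iff ito_generator_def indicator_def trace_def matrix_matrix_mult_def)
  finally show ?thesis .
qed

end

text \<open>Convergence in probability becomes convergence in mean after truncation at 1. In this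
  form it can be integrated over time and turned into almost sure convergence of a
  subsequence.\<close>

lemma (in prob_space) expectation_truncated_tendsto_0:
  fixes X :: "nat \<Rightarrow> 'a \<Rightarrow> real"
  assumes X: "\<And>j. X j \<in> borel_measurable M" "\<And>j \<omega>. X j \<omega> \<ge> 0"
    and conv: "\<And>\<epsilon>. \<epsilon> > 0 \<Longrightarrow> (\<lambda>j. measure M {\<omega>\<in>space M. X j \<omega> > \<epsilon>}) \<longlonglongrightarrow> 0"
  shows "(\<lambda>j. \<integral>\<omega>. min 1 (X j \<omega>) \<partial>M) \<longlonglongrightarrow> 0"
proof (rule LIMSEQ_I)
  fix e :: real assume e: "e > 0"
  have e2: "e / 2 > 0" using e by simp
  from order_tendstoD(2)[OF conv[OF e2] e2]
  obtain j0 where j0: "\<And>j. j \<ge> j0 \<Longrightarrow> measure M {\<omega>\<in>space M. X j \<omega> > e / 2} < e / 2"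
    unfolding eventually_sequentially by blast
  show "\<exists>no. \<forall>j\<ge>no. norm ((\<integral>\<omega>. min 1 (X j \<omega>) \<partial>M) - 0) < e"
  proof (intro exI allI impI)
    fix j assume j: "j \<ge> j0"
    note [measurable] = X(1)
    let ?S = "{\<omega>\<in>space M. X j \<omega> > e / 2}"
    have S: "?S \<in> sets M" by measurable
    have i1: "integrable M (\<lambda>\<omega>. min 1 (X j \<omega>))"
      by (rule integrable_const_bound[where B = 1]) (use X(2) in auto)
    have i2: "integrable M (\<lambda>\<omega>. e / 2 + indicator ?S \<omega>)"
      using S by (intro Bochner_Integration.integrable_add integrable_const integrable_real_indicator) (auto simp: less_top[symmetric])
    have "(\<integral>\<omega>. min 1 (X j \<omega>) \<partial>M) \<le> (\<integral>\<omega>. e / 2 + indicator ?S \<omega> \<partial>M)"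
      by (rule integral_mono[OF i1 i2]) (use e in \<open>auto simp: indicator_def min_def\<close>)
    also have "\<dots> = e / 2 + measure M ?S"
      using S by (subst Bochner_Integration.integral_add) (auto simp: less_top[symmetric] prob_space)
    also have "\<dots> < e" using j0[OF j] by linarith
    finally have "(\<integral>\<omega>. min 1 (X j \<omega>) \<partial>M) < e" .
    moreover have "0 \<le> (\<integral>\<omega>. min 1 (X j \<omega>) \<partial>M)"
      using X(2) by (intro Bochner_Integration.integral_nonneg) auto
    ultimately show "norm ((\<integral>\<omega>. min 1 (X j \<omega>) \<partial>M) - 0) < e" by simp
  qed
qed

lemma min_1_tendsto_0D:
  fixes x :: "nat \<Rightarrow> real"
  assumes "(\<lambda>n. min 1 (x n)) \<longlonglongrightarrow> 0"
  shows "x \<longlonglongrightarrow> 0"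
proof (rule Lim_transform_eventually[OF assms])
  have "\<forall>\<^sub>F n in sequentially. min 1 (x n) < 1" by (rule order_tendstoD(2)[OF assms]) simp
  then show "\<forall>\<^sub>F n in sequentially. min 1 (x n) = x n" by eventually_elim auto
qed

text \<open>Convergence of the simple processes is left to the individual lemmas: path by path along
  a subsequence for the limits, in probability for the formula itself.\<close>

locale ito_approximation = ito_process_test M F w t T hi x0 \<beta> H Y \<Phi> \<Phi>t \<Phi>a \<Phi>x \<Phi>xx C c
  for M :: "'w measure" and F and w :: "real \<Rightarrow> 'w \<Rightarrow> real^'k" and t T hi
    and x0 :: "real^'n" and \<beta> H Y and \<Phi> :: "real^'n \<Rightarrow> real \<Rightarrow> real \<Rightarrow> real" and \<Phi>t \<Phi>a \<Phi>x \<Phi>xx C c +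
  fixes N :: "nat \<Rightarrow> nat" and pp :: "nat \<Rightarrow> nat \<Rightarrow> real" and \<xi> :: "nat \<Rightarrow> nat \<Rightarrow> 'w \<Rightarrow> real^'k^'n"
  assumes simple: "\<And>j. simple_process t T F (N j) (pp j) (\<xi> j)"
begin

abbreviation "Hs j \<equiv> simple_value (N j) (pp j) (\<xi> j)"
abbreviation "Ys j \<equiv> simple_integral w (N j) (pp j) (\<xi> j)"

interpretation A: simple_ito_process M F w t T hi x0 \<beta> "N j" "pp j" "\<xi> j" \<Phi> \<Phi>t \<Phi>a \<Phi>x \<Phi>xx C c for j
  unfolding simple_ito_process_def ito_process_test_def simple_ito_process_axioms_def
  by (intro conjI simple_ito_process[OF simple hi \<beta>_progressive \<beta>_integrable] test_function_axioms simple)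

text \<open>Bounds the error made in the clock rate when \<open>H\<close> is replaced by
  \<open>Hs j\<close> and, up to a factor, the error in the trace term. Its time integral tends to
  zero when \<open>Hs j\<close> tends to \<open>H\<close> in mean square over time.\<close>

definition gap :: "nat \<Rightarrow> real \<Rightarrow> 'w \<Rightarrow> real" where
  "gap j r \<omega> = (norm (Hs j r \<omega> - H r \<omega>))\<^sup>2 + 2 * (norm (Hs j r \<omega> - H r \<omega>) * norm (H r \<omega>))"

lemma gap_nonneg: "0 \<le> gap j r \<omega>"
  by (simp add: gap_def)

lemma square_distance_integrable:
  assumes \<omega>: "\<omega> \<in> space M"
  shows "set_integrable lborel {t..<hi} (\<lambda>r. (norm (Hs j r \<omega> - H r \<omega>))\<^sup>2)"
  unfolding set_integrable_def
proof (rule Bochner_Integration.integrable_bound)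
  let ?i = "indicat_real {t..<hi}"
  note [measurable] = H_path_measurable[OF \<omega>] A.H_path_measurable[OF \<omega>, of j]
  show "integrable lborel (\<lambda>r. ?i r *\<^sub>R (2 * (norm (Hs j r \<omega>))\<^sup>2 + 2 * (norm (H r \<omega>))\<^sup>2))"
    unfolding set_integrable_def[symmetric]
    by (intro set_integral_add(1) set_integrable_mult_right A.H_square_integrable[OF \<omega>] H_square_integrable[OF \<omega>])
  have "(\<lambda>r. (norm (?i r *\<^sub>R Hs j r \<omega> - ?i r *\<^sub>R H r \<omega>))\<^sup>2) \<in> borel_measurable lborel" by measurable
  also have "(\<lambda>r. (norm (?i r *\<^sub>R Hs j r \<omega> - ?i r *\<^sub>R H r \<omega>))\<^sup>2) = (\<lambda>r. ?i r *\<^sub>R (norm (Hs j r \<omega> - H r \<omega>))\<^sup>2)"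
    by (auto simp: fun_eq_iff indicator_def)
  finally show "(\<lambda>r. ?i r *\<^sub>R (norm (Hs j r \<omega> - H r \<omega>))\<^sup>2) \<in> borel_measurable lborel" .
  have "(norm (a - b))\<^sup>2 \<le> 2 * (norm a)\<^sup>2 + 2 * (norm b)\<^sup>2" for a b :: "real^'k^'n"
  proof -
    have "(norm (a - b))\<^sup>2 \<le> (norm a + norm b)\<^sup>2" by (intro power_mono norm_triangle_ineq4) simp
    also have "\<dots> \<le> 2 * (norm a)\<^sup>2 + 2 * (norm b)\<^sup>2"
      using zero_le_power2[of "norm a - norm b"] unfolding power2_eq_square by (simp add: algebra_simps)
    finally show ?thesis .
  qed
  then show "AE r in lborel. norm (?i r *\<^sub>R (norm (Hs j r \<omega> - H r \<omega>))\<^sup>2)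
      \<le> norm (?i r *\<^sub>R (2 * (norm (Hs j r \<omega>))\<^sup>2 + 2 * (norm (H r \<omega>))\<^sup>2))"
    by (auto simp: indicator_def intro!: AE_I2)
qed

lemma gap_limit:
  assumes \<omega>: "\<omega> \<in> space M"
    and lim: "(\<lambda>j. LBINT r:{t..<hi}. (norm (Hs (\<sigma> j) r \<omega> - H r \<omega>))\<^sup>2) \<longlonglongrightarrow> 0"
  shows "set_integrable lborel {t..<hi} (\<lambda>r. gap (\<sigma> j) r \<omega>)"
    and "(\<lambda>j. LBINT r:{t..<hi}. gap (\<sigma> j) r \<omega>) \<longlonglongrightarrow> 0"
proof -
  let ?i = "indicat_real {t..<hi}"
  note [measurable] = H_path_measurable[OF \<omega>] A.H_path_measurable[OF \<omega>]
  define D where "D j r = norm (?i r *\<^sub>R Hs (\<sigma> j) r \<omega> - ?i r *\<^sub>R H r \<omega>)" for j r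
  define h where "h r = norm (?i r *\<^sub>R H r \<omega>)" for r
  have D2: "(D j r)\<^sup>2 = ?i r *\<^sub>R (norm (Hs (\<sigma> j) r \<omega> - H r \<omega>))\<^sup>2" and h2: "(h r)\<^sup>2 = ?i r *\<^sub>R (norm (H r \<omega>))\<^sup>2"
    and g: "(D j r)\<^sup>2 + 2 * (D j r * h r) = ?i r *\<^sub>R gap (\<sigma> j) r \<omega>" for j r
    by (auto simp: D_def h_def gap_def indicator_def)
  have 1: "\<And>j. D j \<in> borel_measurable lborel" "h \<in> borel_measurable lborel" unfolding D_def h_def by measurable
  have 2: "\<And>j. integrable lborel (\<lambda>r. (D j r)\<^sup>2)" "integrable lborel (\<lambda>r. (h r)\<^sup>2)"
    unfolding D2 h2 using square_distance_integrable[OF \<omega>] H_square_integrable[OF \<omega>] by (auto simp: set_integrable_def)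
  have 3: "(\<lambda>j. \<integral>r. (D j r)\<^sup>2 \<partial>lborel) \<longlonglongrightarrow> 0" unfolding D2 using lim by (simp add: set_lebesgue_integral_def)
  have nn: "\<And>j r. D j r \<ge> 0" "\<And>r. h r \<ge> 0" by (auto simp: D_def h_def)
  note c = cross_term_tendsto_0[OF 1 nn 2 3]
  show "set_integrable lborel {t..<hi} (\<lambda>r. gap (\<sigma> j) r \<omega>)"
    and "(\<lambda>j. LBINT r:{t..<hi}. gap (\<sigma> j) r \<omega>) \<longlonglongrightarrow> 0"
    using c unfolding g by (auto simp: set_integrable_def set_lebesgue_integral_def)
qed

lemma abs_rate_diff_le: "\<bar>A.rate j r \<omega> - rate r \<omega>\<bar> \<le> gap j r \<omega>"
  unfolding A.rate_def rate_def gap_def using abs_square_norm_diff_le[of "Hs j r \<omega>" "H r \<omega>"] by simp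

lemma clock_limit:
  assumes \<omega>: "\<omega> \<in> space M"
    and lim: "(\<lambda>j. LBINT r:{t..<hi}. (norm (Hs (\<sigma> j) r \<omega> - H r \<omega>))\<^sup>2) \<longlonglongrightarrow> 0"
    and s: "s \<in> {t..hi}"
  shows "(\<lambda>j. A.clock (\<sigma> j) s \<omega>) \<longlonglongrightarrow> clock s \<omega>"
proof (rule LIM_zero_cancel)
  note g = gap_limit[OF \<omega> lim]
  have sub: "{t..<s} \<subseteq> {t..<hi}" using s by auto
  show "(\<lambda>j. A.clock (\<sigma> j) s \<omega> - clock s \<omega>) \<longlonglongrightarrow> 0"
  proof (rule Lim_null_comparison[OF always_eventually g(2)], rule allI)
    fix j
    have i: "set_integrable lborel {t..<s} (\<lambda>r. rate r \<omega>)" "set_integrable lborel {t..<s} (\<lambda>r. A.rate (\<sigma> j) r \<omega>)"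
      "set_integrable lborel {t..<s} (\<lambda>r. gap (\<sigma> j) r \<omega>)"
      by (rule set_integrable_subset[OF rate_integrable[OF \<omega>] _ sub] set_integrable_subset[OF A.rate_integrable[OF \<omega>] _ sub]
          set_integrable_subset[OF g(1) _ sub]; simp)+
    have "norm (A.clock (\<sigma> j) s \<omega> - clock s \<omega>) = norm (LBINT r:{t..<s}. A.rate (\<sigma> j) r \<omega> - rate r \<omega>)"
      unfolding clock_def A.clock_def using set_integral_diff(2)[OF i(2,1)] by simp
    also have "\<dots> \<le> (LBINT r:{t..<s}. norm (A.rate (\<sigma> j) r \<omega> - rate r \<omega>))"
      by (rule set_integral_norm_bound[OF set_integral_diff(1)[OF i(2,1)]])
    also have "\<dots> \<le> (LBINT r:{t..<s}. gap (\<sigma> j) r \<omega>)"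
      by (rule set_integral_mono[OF set_integrable_norm[OF set_integral_diff(1)[OF i(2,1)]] i(3)])
        (use abs_rate_diff_le in auto)
    also have "\<dots> \<le> (LBINT r:{t..<hi}. gap (\<sigma> j) r \<omega>)"
      unfolding set_lebesgue_integral_def
      by (rule integral_mono) (use g(1)[of j] i(3) sub gap_nonneg in \<open>auto simp: set_integrable_def indicator_def\<close>)
    finally show "norm (A.clock (\<sigma> j) s \<omega> - clock s \<omega>) \<le> (LBINT r:{t..<hi}. gap (\<sigma> j) r \<omega>)" .
  qed
qed

lemma path_limit:
  fixes f :: "real^'n \<Rightarrow> real \<Rightarrow> real \<Rightarrow> 'z::topological_space"
  assumes f: "continuous_on (UNIV \<times> {t..hi} \<times> UNIV) (\<lambda>(x, s, a). f x s a)"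
    and \<omega>: "\<omega> \<in> space M"
    and lim: "(\<lambda>j. LBINT r:{t..<hi}. (norm (Hs (\<sigma> j) r \<omega> - H r \<omega>))\<^sup>2) \<longlonglongrightarrow> 0"
    and s: "s \<in> {t..hi}" and Y: "(\<lambda>j. Ys (\<sigma> j) s \<omega>) \<longlonglongrightarrow> Y s \<omega>"
  shows "(\<lambda>j. f (A.state (\<sigma> j) s \<omega>) s (A.clock (\<sigma> j) s \<omega>)) \<longlonglongrightarrow> f (state s \<omega>) s (clock s \<omega>)"
proof -
  have "(\<lambda>j. A.state (\<sigma> j) s \<omega>) \<longlonglongrightarrow> state s \<omega>"
    unfolding state_def A.state_def by (intro tendsto_intros Y)
  then have "(\<lambda>j. (A.state (\<sigma> j) s \<omega>, s, A.clock (\<sigma> j) s \<omega>)) \<longlonglongrightarrow> (state s \<omega>, s, clock s \<omega>)"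
    by (intro tendsto_intros clock_limit[OF \<omega> lim s])
  from continuous_on_tendsto_compose[OF f this] s show ?thesis by simp
qed

text \<open>State and clock are changed before the diffusion coefficient. With the exact coefficient
  the integrands have a bound independent of \<open>j\<close>, and dominated convergence applies;
  exchanging the coefficient costs at most a multiple of the integral of \<open>gap\<close>.\<close>

lemma mart_limit:
  assumes \<omega>: "\<omega> \<in> space M"
    and lim: "(\<lambda>j. LBINT r:{t..<hi}. (norm (Hs (\<sigma> j) r \<omega> - H r \<omega>))\<^sup>2) \<longlonglongrightarrow> 0"
    and pq: "t \<le> p" "p \<le> q" "q \<le> hi"
    and Y: "AE r in lborel. r \<in> {t..hi} \<longrightarrow> (\<lambda>j. Ys (\<sigma> j) r \<omega>) \<longlonglongrightarrow> Y r \<omega>"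
      "(\<lambda>j. Ys (\<sigma> j) p \<omega>) \<longlonglongrightarrow> Y p \<omega>" "(\<lambda>j. Ys (\<sigma> j) q \<omega>) \<longlonglongrightarrow> Y q \<omega>"
  shows "(\<lambda>j. A.mart (\<sigma> j) p q \<omega>) \<longlonglongrightarrow> mart p q \<omega>"
proof -
  let ?i = "indicat_real {t..<hi}"
  let ?K = "real CARD('k)"
  note g = gap_limit[OF \<omega> lim]
  \<comment> \<open>A hybrid: approximating state and clock, but the rate and the diffusion
    coefficient of the limit.\<close>
  define m where "m j r = ito_generator \<Phi>t \<Phi>a \<Phi>x \<Phi>xx (A.state (\<sigma> j) r \<omega>) r (A.clock (\<sigma> j) r \<omega>) (\<beta> r \<omega>) (rate r \<omega>) (H r \<omega>)" for j r
  have sub: "{p..<q} \<subseteq> {t..<hi}" using pq by auto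
  have m_bound: "\<bar>m j r\<bar> \<le> C + C * (2 + CARD('k)) * rate r \<omega>" if "r \<in> {t..hi}" for j r
    unfolding m_def by (rule abs_ito_generator_le[OF that norm_\<beta>_le_rate]) (simp add: rate_def)
  have dom: "integrable lborel (\<lambda>r. ?i r *\<^sub>R (C + C * (2 + CARD('k)) * rate r \<omega>))"
  proof -
    have "set_integrable lborel {t..<hi} (\<lambda>_. C)"
      unfolding set_integrable_def by (intro integrable_scaleR_left integrable_real_indicator) (use hi in auto)
    then have "set_integrable lborel {t..<hi} (\<lambda>r. C + C * (2 + CARD('k)) * rate r \<omega>)"
      by (intro set_integral_add(1) set_integrable_mult_right rate_integrable[OF \<omega>]) auto
    then show ?thesis by (simp add: set_integrable_def)
  qed
  have mm: "(\<lambda>r. ?i r *\<^sub>R m j r) \<in> borel_measurable lborel" for j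
    unfolding m_def
    by (rule ito_generator_path_measurable[OF A.continuous_state[OF \<omega>] A.continuous_clock[OF \<omega>]])
      (use \<beta>_integrable[OF \<omega>] rate_integrable[OF \<omega>] H_path_measurable[OF \<omega>] in \<open>auto simp: set_integrable_def dest: borel_measurable_integrable\<close>)
  have m_le: "norm (?i r *\<^sub>R m j r) \<le> ?i r *\<^sub>R (C + C * (2 + CARD('k)) * rate r \<omega>)" for j r
    using m_bound[of r j] by (auto simp: indicator_def)
  have mi: "set_integrable lborel {t..<hi} (m j)" for j
    unfolding set_integrable_def
    by (rule Bochner_Integration.integrable_bound[OF dom mm]) (use m_le in \<open>auto intro!: AE_I2 intro: order_trans[OF _ abs_ge_self]\<close>)
  have Y': "AE r in lborel. (\<lambda>j. indicat_real {p..<q} r *\<^sub>R m j r) \<longlonglongrightarrow> indicat_real {p..<q} r *\<^sub>R gen r \<omega>"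
    using Y(1)
  proof eventually_elim
    case (elim r)
    show ?case
    proof (cases "r \<in> {p..<q}")
      case True
      then have r: "r \<in> {t..hi}" using pq by auto
      then have Yr: "(\<lambda>j. Ys (\<sigma> j) r \<omega>) \<longlonglongrightarrow> Y r \<omega>" using elim by blast
      note l = path_limit[OF _ \<omega> lim r Yr]
      have tr: "(\<lambda>j. trace (H r \<omega> ** transpose (H r \<omega>) ** \<Phi>xx (A.state (\<sigma> j) r \<omega>) r (A.clock (\<sigma> j) r \<omega>)))
          \<longlonglongrightarrow> trace (H r \<omega> ** transpose (H r \<omega>) ** \<Phi>xx (state r \<omega>) r (clock r \<omega>))"
        using continuous_on_tendsto_compose[OF continuous_on_trace_mult[OF continuous_on_id, of UNIV] l[OF cont_xx]] by simp
      have "(\<lambda>j. m j r) \<longlonglongrightarrow> gen r \<omega>"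
        unfolding m_def gen_def ito_generator_def
        by (intro tendsto_intros tr l[OF cont_x] l[OF cont_t] l[OF cont_a])
      then show ?thesis by (intro tendsto_intros)
    qed simp
  qed
  have l1: "(\<lambda>j. LBINT r:{p..<q}. m j r) \<longlonglongrightarrow> (LBINT r:{p..<q}. gen r \<omega>)"
    unfolding set_lebesgue_integral_def
  proof (rule integral_dominated_convergence[OF _ _ dom Y'])
    show "(\<lambda>r. indicat_real {p..<q} r *\<^sub>R gen r \<omega>) \<in> borel_measurable lborel"
      by (rule gen_path_measurable[OF \<omega>]) (use pq in auto)
    show "(\<lambda>r. indicat_real {p..<q} r *\<^sub>R m j r) \<in> borel_measurable lborel" for j
      using set_integrable_subset[OF mi _ sub, of j] by (auto simp: set_integrable_def dest: borel_measurable_integrable)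
    show "AE r in lborel. norm (indicat_real {p..<q} r *\<^sub>R m j r) \<le> ?i r *\<^sub>R (C + C * (2 + CARD('k)) * rate r \<omega>)" for j
    proof (rule AE_I2)
      fix r
      have "norm (indicat_real {p..<q} r *\<^sub>R m j r) \<le> norm (?i r *\<^sub>R m j r)" using sub by (auto simp: indicator_def)
      then show "norm (indicat_real {p..<q} r *\<^sub>R m j r) \<le> ?i r *\<^sub>R (C + C * (2 + CARD('k)) * rate r \<omega>)"
        using m_le order_trans by blast
    qed
  qed
  have l2: "(\<lambda>j. LBINT r:{p..<q}. A.gen (\<sigma> j) r \<omega> - m j r) \<longlonglongrightarrow> 0"
  proof (rule Lim_null_comparison)
    show "(\<lambda>j. C * (1 + ?K) * (LBINT r:{t..<hi}. gap (\<sigma> j) r \<omega>)) \<longlonglongrightarrow> 0"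
      using tendsto_mult_left[OF g(2), of "C * (1 + ?K)"] by simp
    show "\<forall>\<^sub>F j in sequentially. norm (LBINT r:{p..<q}. A.gen (\<sigma> j) r \<omega> - m j r)
        \<le> C * (1 + ?K) * (LBINT r:{t..<hi}. gap (\<sigma> j) r \<omega>)"
    proof (rule always_eventually, rule allI)
      fix j
      have diff: "\<bar>A.gen (\<sigma> j) r \<omega> - m j r\<bar> \<le> C * (1 + ?K) * gap (\<sigma> j) r \<omega>" if r: "r \<in> {t..hi}" for r
      proof -
        let ?a = "\<Phi>a (A.state (\<sigma> j) r \<omega>) r (A.clock (\<sigma> j) r \<omega>)" and ?N = "\<Phi>xx (A.state (\<sigma> j) r \<omega>) r (A.clock (\<sigma> j) r \<omega>)"
        have "A.gen (\<sigma> j) r \<omega> - m j r = ?a * (A.rate (\<sigma> j) r \<omega> - rate r \<omega>)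
            + 1/2 * (trace (Hs (\<sigma> j) r \<omega> ** transpose (Hs (\<sigma> j) r \<omega>) ** ?N) - trace (H r \<omega> ** transpose (H r \<omega>) ** ?N))"
          unfolding A.gen_def m_def ito_generator_def by (simp add: algebra_simps)
        moreover have "\<bar>?a * (A.rate (\<sigma> j) r \<omega> - rate r \<omega>)\<bar> \<le> C * gap (\<sigma> j) r \<omega>"
          unfolding abs_mult by (intro mult_mono bound_a[OF r] abs_rate_diff_le C_nonneg) auto
        moreover have "\<bar>trace (Hs (\<sigma> j) r \<omega> ** transpose (Hs (\<sigma> j) r \<omega>) ** ?N) - trace (H r \<omega> ** transpose (H r \<omega>) ** ?N)\<bar>
            \<le> ?K * (gap (\<sigma> j) r \<omega> * norm ?N)"
          unfolding gap_def by (rule abs_trace_congruence_diff_le)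
        moreover have "?K * (gap (\<sigma> j) r \<omega> * norm ?N) \<le> ?K * (gap (\<sigma> j) r \<omega> * C)"
          by (intro mult_left_mono bound_xx[OF r] gap_nonneg) auto
        moreover have "0 \<le> ?K * (gap (\<sigma> j) r \<omega> * C)" using gap_nonneg C_nonneg by simp
        moreover have "\<bar>X\<bar> \<le> G + W'"
          if "X = U + 1/2 * V" "\<bar>U\<bar> \<le> G" "\<bar>V\<bar> \<le> W" "W \<le> W'" "0 \<le> W'" for X U V G W W' :: real
          using that by linarith
        ultimately have "\<bar>A.gen (\<sigma> j) r \<omega> - m j r\<bar> \<le> C * gap (\<sigma> j) r \<omega> + ?K * (gap (\<sigma> j) r \<omega> * C)"
          by blast
        then show ?thesis by (simp add: algebra_simps)
      qed
      have i: "set_integrable lborel {p..<q} (\<lambda>r. A.gen (\<sigma> j) r \<omega> - m j r)"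
        by (intro set_integral_diff(1) set_integrable_subset[OF A.gen_integrable[OF \<omega>] _ sub] set_integrable_subset[OF mi _ sub]) auto
      have "norm (LBINT r:{p..<q}. A.gen (\<sigma> j) r \<omega> - m j r) \<le> (LBINT r:{p..<q}. norm (A.gen (\<sigma> j) r \<omega> - m j r))"
        by (rule set_integral_norm_bound[OF i])
      also have "\<dots> \<le> (LBINT r:{t..<hi}. C * (1 + ?K) * gap (\<sigma> j) r \<omega>)"
        unfolding set_lebesgue_integral_def
      proof (rule integral_mono)
        show "integrable lborel (\<lambda>r. indicat_real {p..<q} r *\<^sub>R norm (A.gen (\<sigma> j) r \<omega> - m j r))"
          using set_integrable_norm[OF i] by (simp add: set_integrable_def)
        show "integrable lborel (\<lambda>r. ?i r *\<^sub>R (C * (1 + ?K) * gap (\<sigma> j) r \<omega>))"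
          using set_integrable_mult_right[OF g(1), of "C * (1 + ?K)" j] by (simp add: set_integrable_def)
        have nn: "0 \<le> C * (1 + ?K) * gap (\<sigma> j) r \<omega>" for r using gap_nonneg C_nonneg by simp
        show "indicat_real {p..<q} r *\<^sub>R norm (A.gen (\<sigma> j) r \<omega> - m j r) \<le> ?i r *\<^sub>R (C * (1 + ?K) * gap (\<sigma> j) r \<omega>)" for r
          using diff[of r] nn[of r] pq by (auto simp: indicator_def)
      qed
      also have "\<dots> = C * (1 + ?K) * (LBINT r:{t..<hi}. gap (\<sigma> j) r \<omega>)" by simp
      finally show "norm (LBINT r:{p..<q}. A.gen (\<sigma> j) r \<omega> - m j r) \<le> C * (1 + ?K) * (LBINT r:{t..<hi}. gap (\<sigma> j) r \<omega>)" .
    qed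
  qed
  have split: "(LBINT r:{p..<q}. A.gen (\<sigma> j) r \<omega>) = (LBINT r:{p..<q}. m j r) + (LBINT r:{p..<q}. A.gen (\<sigma> j) r \<omega> - m j r)" for j
    using set_integral_diff(2)[OF set_integrable_subset[OF A.gen_integrable[OF \<omega>, of "\<sigma> j"] _ sub] set_integrable_subset[OF mi[of j] _ sub]] by simp
  have l3: "(\<lambda>j. LBINT r:{p..<q}. A.gen (\<sigma> j) r \<omega>) \<longlonglongrightarrow> (LBINT r:{p..<q}. gen r \<omega>)"
    unfolding split using tendsto_add[OF l1 l2] by simp
  have "p \<in> {t..hi}" "q \<in> {t..hi}" using pq by auto
  then show ?thesis
    unfolding mart_def A.mart_def
    by (intro tendsto_diff l3 path_limit[OF cont \<omega> lim] Y)
qed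

definition sqdist :: "nat \<Rightarrow> 'w \<Rightarrow> real" where
  "sqdist j \<omega> = (LBINT r:{t..<hi}. (norm (Hs j r \<omega> - H r \<omega>))\<^sup>2)"

lemma sqdist_nonneg: "0 \<le> sqdist j \<omega>"
  unfolding sqdist_def set_lebesgue_integral_def by (rule Bochner_Integration.integral_nonneg) auto

lemma sqdist_measurable: "sqdist j \<in> borel_measurable M"
proof -
  have h: "hi \<in> {t..hi}" using hi by simp
  note [measurable] = measurable_F_M_joint[OF H_progressive[OF h] h, unfolded split_beta']
    measurable_F_M_joint[OF A.H_progressive[OF h] h, unfolded split_beta']
  have "(\<lambda>(r, \<omega>). (norm (Hs j r \<omega> - H r \<omega>))\<^sup>2) \<in> borel_measurable (restrict_space borel {t..hi} \<Otimes>\<^sub>M M)"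
    unfolding split_beta' by measurable
  then show ?thesis
    unfolding sqdist_def[abs_def] by (rule set_integral_adapted[OF restrict_progressive]) auto
qed

text \<open>The integrals converge in probability at each fixed time, with a subsequence that could
  depend on the time. Integrating the truncated distances over chance and time gives one convergence
  in mean on the product space, hence one subsequence for almost all pairs, and Fubini returns to
  the single paths.\<close>

lemma convergent_subsequence:
  assumes conv_H: "\<And>\<epsilon>. \<epsilon> > 0 \<Longrightarrow> (\<lambda>j. measure M {\<omega>\<in>space M. sqdist j \<omega> > \<epsilon>}) \<longlonglongrightarrow> 0"
    and conv_Y: "\<And>s \<epsilon>. s \<in> {t..hi} \<Longrightarrow> \<epsilon> > 0 \<Longrightarrow> (\<lambda>j. measure M {\<omega>\<in>space M. norm (Ys j s \<omega> - Y s \<omega>) > \<epsilon>}) \<longlonglongrightarrow> 0"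
    and thi: "t < hi" and p: "p \<in> {t..hi}" and q: "q \<in> {t..hi}"
  obtains \<sigma> :: "nat \<Rightarrow> nat" where
    "AE \<omega> in M. (\<lambda>n. sqdist (\<sigma> n) \<omega>) \<longlonglongrightarrow> 0 \<and> (\<lambda>n. Ys (\<sigma> n) p \<omega>) \<longlonglongrightarrow> Y p \<omega> \<and> (\<lambda>n. Ys (\<sigma> n) q \<omega>) \<longlonglongrightarrow> Y q \<omega> \<and>
      (AE r in lborel. r \<in> {t..hi} \<longrightarrow> (\<lambda>n. Ys (\<sigma> n) r \<omega>) \<longlonglongrightarrow> Y r \<omega>)"
proof -
  define \<Lambda> where "\<Lambda> = restrict_space lborel {t..hi}"
  have fin: "finite_measure \<Lambda>"
    unfolding \<Lambda>_def by (rule finite_measureI) (use hi in \<open>simp add: space_restrict_space emeasure_restrict_space\<close>)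
  interpret L: finite_measure \<Lambda> by fact
  interpret P: pair_sigma_finite M \<Lambda> ..
  interpret PF: finite_measure "M \<Otimes>\<^sub>M \<Lambda>"
    by (rule finite_measure_pair_measure[OF fin finite_measure_axioms])
  define y where "y j s \<omega> = norm (Ys j s \<omega> - Y s \<omega>)" for j s \<omega>
  define k where "k j \<omega> = min 1 (y j p \<omega>) + min 1 (y j q \<omega>) + min 1 (sqdist j \<omega>)" for j \<omega>
  \<comment> \<open>Adding \<open>k\<close> to the time-dependent part forces the convergence at
    \<open>p\<close>, at \<open>q\<close> and of the squared distance along the same
    subsequence.\<close>
  define u where "u j z = min 1 (y j (snd z) (fst z)) + k j (fst z)" for j z
  have y0: "0 \<le> y j s \<omega>" for j s \<omega> by (simp add: y_def)
  have k0: "0 \<le> k j \<omega>" "k j \<omega> \<le> 3" for j \<omega>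
    using y0[of j p \<omega>] y0[of j q \<omega>] sqdist_nonneg[of j \<omega>] by (auto simp: k_def)
  have u0: "0 \<le> u j z" "u j z \<le> 4" for j z
    using y0[of j "snd z" "fst z"] k0[of j "fst z"] by (auto simp: u_def)
  have Ym: "Y s \<in> borel_measurable M" "Ys j s \<in> borel_measurable M" if "s \<in> {t..hi}" for s j
    using measurable_F_M[OF in_horizon Y_adapted] measurable_F_M[OF in_horizon A.Y_adapted] that by auto
  have ym: "y j s \<in> borel_measurable M" if "s \<in> {t..hi}" for j s
    unfolding y_def[abs_def] using Ym[OF that] by measurable
  have km [measurable]: "k j \<in> borel_measurable M" for j
    unfolding k_def[abs_def] using ym[OF p] ym[OF q] sqdist_measurable by measurable
  have "(\<lambda>(r, \<omega>). y j r \<omega>) \<in> borel_measurable (restrict_space borel {t..hi} \<Otimes>\<^sub>M M)" for j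
    by (rule continuous_paths_jointly_measurable)
      (auto simp: y_def[abs_def] intro!: continuous_intros A.Y_continuous Y_continuous ym[unfolded y_def[abs_def]])
  moreover have "sets (restrict_space borel {t..hi} \<Otimes>\<^sub>M M) = sets (\<Lambda> \<Otimes>\<^sub>M M)"
    by (intro sets_pair_measure_cong) (simp_all add: \<Lambda>_def sets_restrict_space)
  ultimately have "(\<lambda>(r, \<omega>). y j r \<omega>) \<in> borel_measurable (\<Lambda> \<Otimes>\<^sub>M M)" for j
    using measurable_cong_sets[OF _ refl] by blast
  from measurable_compose[OF measurable_pair_swap' this]
  have [measurable]: "(\<lambda>z. y j (snd z) (fst z)) \<in> borel_measurable (M \<Otimes>\<^sub>M \<Lambda>)" for j
    by (simp add: split_beta')
  have um: "u j \<in> borel_measurable (M \<Otimes>\<^sub>M \<Lambda>)" for j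
    unfolding u_def[abs_def] by measurable
  have ui: "integrable (M \<Otimes>\<^sub>M \<Lambda>) (u j)" for j
    by (rule PF.integrable_const_bound[OF _ um, of _ 4]) (use u0 in auto)
  have ly: "(\<lambda>j. \<integral>\<omega>. min 1 (y j s \<omega>) \<partial>M) \<longlonglongrightarrow> 0" if "s \<in> {t..hi}" for s
    by (rule expectation_truncated_tendsto_0[OF ym[OF that] y0]) (use conv_Y[OF that] in \<open>simp add: y_def\<close>)
  have ls: "(\<lambda>j. \<integral>\<omega>. min 1 (sqdist j \<omega>) \<partial>M) \<longlonglongrightarrow> 0"
    by (rule expectation_truncated_tendsto_0[OF sqdist_measurable sqdist_nonneg conv_H])
  have ib: "integrable M (\<lambda>\<omega>. min 1 (f \<omega>))" if [measurable]: "f \<in> borel_measurable M" and "\<And>\<omega>. 0 \<le> f \<omega>" for f :: "'w \<Rightarrow> real"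
    by (rule integrable_const_bound[where B = 1]) (use that in auto)
  have ky: "(\<integral>\<omega>. k j \<omega> \<partial>M) = (\<integral>\<omega>. min 1 (y j p \<omega>) \<partial>M) + (\<integral>\<omega>. min 1 (y j q \<omega>) \<partial>M) + (\<integral>\<omega>. min 1 (sqdist j \<omega>) \<partial>M)" for j
    unfolding k_def using ib[OF ym[OF p] y0, of j] ib[OF ym[OF q] y0, of j] ib[OF sqdist_measurable sqdist_nonneg, of j] by simp
  have lk: "(\<lambda>j. \<integral>\<omega>. k j \<omega> \<partial>M) \<longlonglongrightarrow> 0"
    unfolding ky using tendsto_add[OF tendsto_add[OF ly[OF p] ly[OF q]] ls] by simp
  have ki: "integrable M (k j)" for j
    by (rule integrable_const_bound[where B = 3]) (use k0 in auto)
  have inner: "(\<integral>\<omega>. u j (\<omega>, s) \<partial>M) = (\<integral>\<omega>. min 1 (y j s \<omega>) \<partial>M) + (\<integral>\<omega>. k j \<omega> \<partial>M)" if "s \<in> {t..hi}" for s j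
    unfolding u_def using ib[OF ym[OF that] y0, of j] ki[of j] by simp
  have lu: "(\<lambda>j. \<integral>\<omega>. u j (\<omega>, s) \<partial>M) \<longlonglongrightarrow> 0" if "s \<in> {t..hi}" for s
    unfolding inner[OF that] using tendsto_add[OF ly[OF that] lk] by simp
  have "(\<lambda>j. \<integral>s. (\<integral>\<omega>. u j (\<omega>, s) \<partial>M) \<partial>\<Lambda>) \<longlonglongrightarrow> (\<integral>s. 0 \<partial>\<Lambda>)"
  proof (rule integral_dominated_convergence[where w = "\<lambda>_. 4"])
    show "(\<lambda>s. \<integral>\<omega>. u j (\<omega>, s) \<partial>M) \<in> borel_measurable \<Lambda>" for j
    proof (rule borel_measurable_lebesgue_integral)
      show "(\<lambda>(s, \<omega>). u j (\<omega>, s)) \<in> borel_measurable (\<Lambda> \<Otimes>\<^sub>M M)"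
        using measurable_compose[OF measurable_pair_swap' um[of j]] by (simp add: split_beta')
    qed
    show "AE s in \<Lambda>. (\<lambda>j. \<integral>\<omega>. u j (\<omega>, s) \<partial>M) \<longlonglongrightarrow> 0"
      by (rule AE_I2) (use lu in \<open>simp add: \<Lambda>_def space_restrict_space\<close>)
    show "AE s in \<Lambda>. norm (\<integral>\<omega>. u j (\<omega>, s) \<partial>M) \<le> 4" for j
    proof (rule AE_I2)
      fix s assume "s \<in> space \<Lambda>"
      then have s: "s \<in> {t..hi}" by (simp add: \<Lambda>_def space_restrict_space)
      have us: "integrable M (\<lambda>\<omega>. u j (\<omega>, s))"
        unfolding u_def using ib[OF ym[OF s] y0, of j] ki[of j] by simp
      have "\<bar>\<integral>\<omega>. u j (\<omega>, s) \<partial>M\<bar> \<le> 4"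
        unfolding abs_le_iff
      proof (intro conjI)
        show "(\<integral>\<omega>. u j (\<omega>, s) \<partial>M) \<le> 4"
          by (rule integral_le_const[OF us]) (use u0 in auto)
        have "0 \<le> (\<integral>\<omega>. u j (\<omega>, s) \<partial>M)" by (rule Bochner_Integration.integral_nonneg) (rule u0)
        then show "- (\<integral>\<omega>. u j (\<omega>, s) \<partial>M) \<le> 4" by simp
      qed
      then show "norm (\<integral>\<omega>. u j (\<omega>, s) \<partial>M) \<le> 4" by simp
    qed
  qed auto
  moreover have "(\<integral>s. (\<integral>\<omega>. u j (\<omega>, s) \<partial>M) \<partial>\<Lambda>) = (\<integral>z. norm (u j z) \<partial>(M \<Otimes>\<^sub>M \<Lambda>))" for j
    using P.integral_snd[of "\<lambda>\<omega> s. u j (\<omega>, s)"] ui[of j] u0 by (simp add: split_beta')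
  ultimately have "(\<lambda>j. \<integral>z. norm (u j z) \<partial>(M \<Otimes>\<^sub>M \<Lambda>)) \<longlonglongrightarrow> 0" by simp
  from tendsto_L1_AE_subseq[OF ui this]
  obtain \<sigma> :: "nat \<Rightarrow> nat" where \<sigma>: "AE z in M \<Otimes>\<^sub>M \<Lambda>. (\<lambda>n. u (\<sigma> n) z) \<longlonglongrightarrow> 0" by blast
  have conv: "y' \<longlonglongrightarrow> 0" if "(\<lambda>n. u (\<sigma> n) (\<omega>, s)) \<longlonglongrightarrow> 0" "\<And>n. 0 \<le> y' n" "\<And>n. min 1 (y' n) \<le> u (\<sigma> n) (\<omega>, s)" for y' :: "nat \<Rightarrow> real" and \<omega> s
  proof (rule min_1_tendsto_0D, rule tendsto_sandwich[OF _ _ tendsto_const that(1)])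
    show "\<forall>\<^sub>F n in sequentially. 0 \<le> min 1 (y' n)" using that(2) by auto
  qed (use that(3) in auto)
  have le: "min 1 (y j s \<omega>) \<le> u j (\<omega>, s)" "min 1 (y j p \<omega>) \<le> u j (\<omega>, s)" "min 1 (y j q \<omega>) \<le> u j (\<omega>, s)"
    "min 1 (sqdist j \<omega>) \<le> u j (\<omega>, s)" for j s \<omega>
    using y0[of j s \<omega>] y0[of j p \<omega>] y0[of j q \<omega>] sqdist_nonneg[of j \<omega>] by (auto simp: u_def k_def)
  have Yl: "(\<lambda>n. Ys (\<sigma> n) s \<omega>) \<longlonglongrightarrow> Y s \<omega>" if "(\<lambda>n. y (\<sigma> n) s \<omega>) \<longlonglongrightarrow> 0" for s \<omega>
    using that unfolding y_def by (simp add: tendsto_norm_zero_iff LIM_zero_iff)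
  show thesis
  proof (rule that)
    show "AE \<omega> in M. (\<lambda>n. sqdist (\<sigma> n) \<omega>) \<longlonglongrightarrow> 0 \<and> (\<lambda>n. Ys (\<sigma> n) p \<omega>) \<longlonglongrightarrow> Y p \<omega> \<and> (\<lambda>n. Ys (\<sigma> n) q \<omega>) \<longlonglongrightarrow> Y q \<omega> \<and>
      (AE r in lborel. r \<in> {t..hi} \<longrightarrow> (\<lambda>n. Ys (\<sigma> n) r \<omega>) \<longlonglongrightarrow> Y r \<omega>)"
      using P.AE_pair[OF \<sigma>]
    proof eventually_elim
      case (elim \<omega>)
      \<comment> \<open>The summand \<open>k\<close> does not involve the time, so that one good
        time suffices for it; such a time exists because the interval has positive length.\<close>
      have "\<exists>s. (\<lambda>n. u (\<sigma> n) (\<omega>, s)) \<longlonglongrightarrow> 0"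
      proof (rule ccontr)
        assume "\<not> ?thesis"
        with elim have "AE s in \<Lambda>. False" by simp
        then have "emeasure \<Lambda> (space \<Lambda>) = 0" by (simp add: AE_iff_measurable[OF _ refl])
        then show False using thi by (simp add: \<Lambda>_def space_restrict_space emeasure_restrict_space)
      qed
      then obtain s where s: "(\<lambda>n. u (\<sigma> n) (\<omega>, s)) \<longlonglongrightarrow> 0" by blast
      have "AE r in \<Lambda>. (\<lambda>n. Ys (\<sigma> n) r \<omega>) \<longlonglongrightarrow> Y r \<omega>"
        using elim by eventually_elim (rule Yl, rule conv, assumption, use y0 le in auto)
      then have "AE r in lborel. r \<in> {t..hi} \<longrightarrow> (\<lambda>n. Ys (\<sigma> n) r \<omega>) \<longlonglongrightarrow> Y r \<omega>"
        unfolding \<Lambda>_def by (subst (asm) AE_restrict_space_iff) auto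
      moreover have "(\<lambda>n. sqdist (\<sigma> n) \<omega>) \<longlonglongrightarrow> 0" by (rule conv[OF s]) (use sqdist_nonneg le in auto)
      moreover have "(\<lambda>n. Ys (\<sigma> n) p \<omega>) \<longlonglongrightarrow> Y p \<omega>" "(\<lambda>n. Ys (\<sigma> n) q \<omega>) \<longlonglongrightarrow> Y q \<omega>"
        by (rule Yl, rule conv[OF s], use y0 le in auto)+
      ultimately show ?case by simp
    qed
  qed
qed

lemma ito_formula:
  assumes conv_H: "\<And>\<epsilon>. \<epsilon> > 0 \<Longrightarrow> (\<lambda>j. measure M {\<omega>\<in>space M. sqdist j \<omega> > \<epsilon>}) \<longlonglongrightarrow> 0"
    and conv_Y: "\<And>s \<epsilon>. s \<in> {t..hi} \<Longrightarrow> \<epsilon> > 0 \<Longrightarrow> (\<lambda>j. measure M {\<omega>\<in>space M. norm (Ys j s \<omega> - Y s \<omega>) > \<epsilon>}) \<longlonglongrightarrow> 0"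
    and pq: "t \<le> p" "p \<le> q" "q \<le> hi"
    and Z: "Z \<in> borel_measurable (F p)" "\<And>\<omega>. \<omega> \<in> space M \<Longrightarrow> \<bar>Z \<omega>\<bar> \<le> b"
  shows "(\<integral>\<omega>. Z \<omega> * mart p q \<omega> \<partial>M) = 0"
proof (cases "t < hi")
  case False
  then have "p = q" using pq by auto
  then show ?thesis by (simp add: mart_def set_lebesgue_integral_def)
next
  case True
  have pq': "p \<in> {t..hi}" "q \<in> {t..hi}" using pq by auto
  obtain \<sigma> :: "nat \<Rightarrow> nat" where
    \<sigma>: "AE \<omega> in M. (\<lambda>n. sqdist (\<sigma> n) \<omega>) \<longlonglongrightarrow> 0 \<and> (\<lambda>n. Ys (\<sigma> n) p \<omega>) \<longlonglongrightarrow> Y p \<omega> \<and> (\<lambda>n. Ys (\<sigma> n) q \<omega>) \<longlonglongrightarrow> Y q \<omega> \<and>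
      (AE r in lborel. r \<in> {t..hi} \<longrightarrow> (\<lambda>n. Ys (\<sigma> n) r \<omega>) \<longlonglongrightarrow> Y r \<omega>)"
    using convergent_subsequence[OF conv_H conv_Y True pq'] by metis
  have ZM [measurable]: "Z \<in> borel_measurable M" by (rule measurable_F_M[OF in_horizon[OF pq'(1)] Z(1)])
  note [measurable] = mart_measurable[OF pq] A.mart_measurable[OF pq]
  have "(\<lambda>n. \<integral>\<omega>. Z \<omega> * A.mart (\<sigma> n) p q \<omega> \<partial>M) \<longlonglongrightarrow> (\<integral>\<omega>. Z \<omega> * mart p q \<omega> \<partial>M)"
  proof (rule integral_dominated_convergence[where w = "\<lambda>_. \<bar>b\<bar> * (2 * C + (C * (q - p) + C * (2 + CARD('k)) * c))"])
    show "AE \<omega> in M. (\<lambda>n. Z \<omega> * A.mart (\<sigma> n) p q \<omega>) \<longlonglongrightarrow> Z \<omega> * mart p q \<omega>"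
      using \<sigma>
    proof (rule AE_mp, intro AE_I2 impI)
      fix \<omega> assume \<omega>: "\<omega> \<in> space M" and *: "(\<lambda>n. sqdist (\<sigma> n) \<omega>) \<longlonglongrightarrow> 0 \<and> (\<lambda>n. Ys (\<sigma> n) p \<omega>) \<longlonglongrightarrow> Y p \<omega> \<and> (\<lambda>n. Ys (\<sigma> n) q \<omega>) \<longlonglongrightarrow> Y q \<omega> \<and>
        (AE r in lborel. r \<in> {t..hi} \<longrightarrow> (\<lambda>n. Ys (\<sigma> n) r \<omega>) \<longlonglongrightarrow> Y r \<omega>)"
      show "(\<lambda>n. Z \<omega> * A.mart (\<sigma> n) p q \<omega>) \<longlonglongrightarrow> Z \<omega> * mart p q \<omega>"
        by (intro tendsto_mult tendsto_const mart_limit[OF \<omega> _ pq]) (use * in \<open>auto simp: sqdist_def\<close>)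
    qed
    show "AE \<omega> in M. norm (Z \<omega> * A.mart (\<sigma> n) p q \<omega>) \<le> \<bar>b\<bar> * (2 * C + (C * (q - p) + C * (2 + CARD('k)) * c))" for n
    proof (rule AE_I2)
      fix \<omega> assume \<omega>: "\<omega> \<in> space M"
      have "\<bar>Z \<omega>\<bar> \<le> \<bar>b\<bar>" using Z(2)[OF \<omega>] by linarith
      then show "norm (Z \<omega> * A.mart (\<sigma> n) p q \<omega>) \<le> \<bar>b\<bar> * (2 * C + (C * (q - p) + C * (2 + CARD('k)) * c))"
        unfolding real_norm_def abs_mult using A.abs_mart_le[OF \<omega> pq] by (intro mult_mono) auto
    qed
    show "(\<lambda>\<omega>. Z \<omega> * mart p q \<omega>) \<in> borel_measurable M" by measurable
    show "(\<lambda>\<omega>. Z \<omega> * A.mart (\<sigma> n) p q \<omega>) \<in> borel_measurable M" for n by measurable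
  qed simp
  moreover have "(\<integral>\<omega>. Z \<omega> * A.mart (\<sigma> n) p q \<omega> \<partial>M) = 0" for n
    by (rule A.ito_formula_simple[OF pq Z])
  ultimately show ?thesis by (simp add: LIMSEQ_const_iff)
qed

end

lemma abs_indicator_le_1: "\<bar>indicat_real A x\<bar> \<le> 1"
  by (auto simp: indicator_def)

section \<open>Optional stopping\<close>

context ito_process_test
begin

text \<open>
  \<open>E s\<close> is the event that the process has not been stopped by time \<open>s\<close>; the stopping time is
  approximated from above along uniform grids.
\<close>

lemma optional_stopping:
  assumes zero: "\<And>p q Z b. t \<le> p \<Longrightarrow> p \<le> q \<Longrightarrow> q \<le> hi \<Longrightarrow> Z \<in> borel_measurable (F p) \<Longrightarrow>
      (\<And>\<omega>. \<omega> \<in> space M \<Longrightarrow> \<bar>Z \<omega>\<bar> \<le> b) \<Longrightarrow> (\<integral>\<omega>. Z \<omega> * mart p q \<omega> \<partial>M) = 0"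
    and a: "a \<in> {t..hi}"
    and E: "\<And>s. s \<in> {a..hi} \<Longrightarrow> E s \<in> sets (F s)"
    and anti: "\<And>r s. a \<le> r \<Longrightarrow> r \<le> s \<Longrightarrow> s \<le> hi \<Longrightarrow> E s \<subseteq> E r"
  defines "\<rho> \<equiv> \<lambda>\<omega>. Sup {s \<in> {a..hi}. \<omega> \<in> E s}"
  shows "has_bochner_integral M (\<lambda>\<omega>. indicator (E a) \<omega> * mart a (\<rho> \<omega>) \<omega>) 0"
proof -
  let ?g = "grid a hi"
  \<comment> \<open>Increments are collected over the cells at whose beginning the process is still
    running. Each has mean zero, because the indicator belongs to the past of its cell.\<close>
  define S where "S m \<omega> = (\<Sum>k<Suc m. indicator (E (?g m k)) \<omega> * mart (?g m k) (?g m (Suc k)) \<omega>)" for m \<omega>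
  have ahi: "a \<le> hi" "t \<le> a" using a by auto
  have g_in: "?g m k \<in> {a..hi}" "t \<le> ?g m k" "?g m k \<le> ?g m (Suc k)" "?g m (Suc k) \<le> hi" if "k < Suc m" for m k
    using grid_in[OF ahi(1), of k m] grid_in[OF ahi(1), of "Suc k" m] grid_mono[OF ahi(1), of k "Suc k" m] that ahi by auto
  have EM: "E s \<in> sets M" if "s \<in> {a..hi}" for s
    using E[OF that] F_le[of s] that ahi hi by auto
  have term_i: "integrable M (\<lambda>\<omega>. indicator (E (?g m k)) \<omega> * mart (?g m k) (?g m (Suc k)) \<omega>)" if "k < Suc m" for m k
    by (rule times_mart_integrable[OF _ abs_indicator_le_1 g_in(2-4)[OF that]]) (use EM[OF g_in(1)[OF that]] in simp)
  have term_0: "(\<integral>\<omega>. indicator (E (?g m k)) \<omega> * mart (?g m k) (?g m (Suc k)) \<omega> \<partial>M) = 0" if "k < Suc m" for m k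
    by (rule zero[OF g_in(2-4)[OF that] _ abs_indicator_le_1]) (use E[OF g_in(1)[OF that]] in simp)
  have S_int: "integrable M (S m)" for m
    unfolding S_def[abs_def] by (rule Bochner_Integration.integrable_sum, rule term_i) simp
  have S_0: "(\<integral>\<omega>. S m \<omega> \<partial>M) = 0" for m
    unfolding S_def by (subst Bochner_Integration.integral_sum) (auto intro: term_i term_0 intro!: sum.neutral simp del: sum.lessThan_Suc)
  \<comment> \<open>Path by path the sum telescopes up to the first grid point outside the events,
    or the last one, and this point exceeds the stopping time by at most one mesh width.\<close>
  have stopped: "\<exists>g. S m \<omega> = indicator (E a) \<omega> * mart a g \<omega> \<and> g \<in> {a..hi} \<and>
      (\<omega> \<in> E a \<longrightarrow> \<rho> \<omega> \<le> g \<and> g \<le> \<rho> \<omega> + (hi - a) / real (Suc m))" if \<omega>: "\<omega> \<in> space M" for m \<omega>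
  proof (cases "\<omega> \<in> E a")
    case False
    have "\<omega> \<notin> E (?g m k)" if "k < Suc m" for k
      using anti[of a "?g m k"] g_in(1)[OF that] False by auto
    then have "S m \<omega> = 0" unfolding S_def by (intro sum.neutral) auto
    then show ?thesis using False ahi by (intro exI[of _ a]) auto
  next
    case True
    \<comment> \<open>The endpoint \<open>hi\<close> counts as stopped, whether or not its event
      holds.\<close>
    define K where "K = (LEAST k. k = Suc m \<or> \<omega> \<notin> E (?g m k))"
    have K: "K = Suc m \<or> \<omega> \<notin> E (?g m K)" unfolding K_def by (rule LeastI[of _ "Suc m"]) simp
    have K_le: "K \<le> Suc m" unfolding K_def by (rule Least_le) simp
    have before: "\<omega> \<in> E (?g m k)" if "k < K" for k
      using not_less_Least[OF that[unfolded K_def]] by simp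
    have after: "\<omega> \<notin> E (?g m k)" if "K \<le> k" "k < Suc m" for k
    proof -
      have "\<omega> \<notin> E (?g m K)" using K that by auto
      moreover have "E (?g m k) \<subseteq> E (?g m K)"
        using g_in[of K m] g_in[of k m] that grid_mono[OF ahi(1), of K k m] by (intro anti) auto
      ultimately show ?thesis by blast
    qed
    have K0: "K > 0" using K True by (cases K) auto
    have tel: "(\<Sum>k<n. mart (?g m k) (?g m (Suc k)) \<omega>) = mart a (?g m n) \<omega>" if "n \<le> Suc m" for n
      using that
    proof (induction n)
      case 0
      then show ?case by (simp add: mart_def set_lebesgue_integral_def)
    next
      case (Suc n)
      then have n: "n < Suc m" by simp
      have "mart a (?g m (Suc n)) \<omega> = mart a (?g m n) \<omega> + mart (?g m n) (?g m (Suc n)) \<omega>"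
        using g_in[OF n] by (intro mart_add[OF \<omega> ahi(2)]) auto
      then show ?case using Suc by simp
    qed
    have "S m \<omega> = (\<Sum>k<Suc m. if k < K then mart (?g m k) (?g m (Suc k)) \<omega> else 0)"
      unfolding S_def by (rule sum.cong) (use before after in \<open>auto simp: not_less\<close>)
    also have "\<dots> = (\<Sum>k<K. mart (?g m k) (?g m (Suc k)) \<omega>)"
      using K_le by (intro sum.mono_neutral_cong_right) auto
    also have "\<dots> = mart a (?g m K) \<omega>" by (rule tel[OF K_le])
    finally have S: "S m \<omega> = mart a (?g m K) \<omega>" .
    have gK: "?g m K \<in> {a..hi}" by (rule grid_in[OF ahi(1) K_le])
    have bdd: "bdd_above {s \<in> {a..hi}. \<omega> \<in> E s}" by (rule bdd_aboveI[of _ hi]) auto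
    have upper: "\<rho> \<omega> \<le> ?g m K"
      unfolding \<rho>_def
    proof (rule cSup_least)
      show "{s \<in> {a..hi}. \<omega> \<in> E s} \<noteq> {}" using True ahi by auto
      fix s assume s: "s \<in> {s \<in> {a..hi}. \<omega> \<in> E s}"
      show "s \<le> ?g m K"
      proof (cases "K = Suc m")
        case True
        then show ?thesis using s by simp
      next
        case False
        then have "\<omega> \<notin> E (?g m K)" using K by simp
        then show ?thesis using anti[of "?g m K" s] s gK by (cases "s \<le> ?g m K") auto
      qed
    qed
    obtain k where k: "K = Suc k" using K0 by (cases K) auto
    have "?g m k \<le> \<rho> \<omega>"
      unfolding \<rho>_def by (rule cSup_upper[OF _ bdd]) (use before[of k] g_in(1)[of k m] k K_le in auto)
    then have "?g m K \<le> \<rho> \<omega> + (hi - a) / real (Suc m)" unfolding k grid_Suc by simp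
    then show ?thesis using S True upper gK by (intro exI[of _ "?g m K"]) auto
  qed
  have lim: "(\<lambda>m. S m \<omega>) \<longlonglongrightarrow> indicator (E a) \<omega> * mart a (\<rho> \<omega>) \<omega>" if \<omega>: "\<omega> \<in> space M" for \<omega>
  proof -
    obtain g where g: "\<And>m. S m \<omega> = indicator (E a) \<omega> * mart a (g m) \<omega>" "\<And>m. g m \<in> {a..hi}"
      "\<And>m. \<omega> \<in> E a \<longrightarrow> \<rho> \<omega> \<le> g m \<and> g m \<le> \<rho> \<omega> + (hi - a) / real (Suc m)"
      using stopped[OF \<omega>] by metis
    show ?thesis
    proof (cases "\<omega> \<in> E a")
      case True
      have "(\<lambda>m. \<rho> \<omega> + (hi - a) / real (Suc m)) \<longlonglongrightarrow> \<rho> \<omega> + 0" by (intro tendsto_add tendsto_const mesh_tendsto_0)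
      then have gl: "g \<longlonglongrightarrow> \<rho> \<omega>"
        by (intro tendsto_sandwich[OF _ _ tendsto_const, of _ g]) (use g(3) True in auto)
      have bdd: "bdd_above {s \<in> {a..hi}. \<omega> \<in> E s}" by (rule bdd_aboveI[of _ hi]) auto
      have "a \<le> \<rho> \<omega>" unfolding \<rho>_def by (rule cSup_upper[OF _ bdd]) (use True ahi in auto)
      moreover have "\<rho> \<omega> \<le> hi" using g(2)[of 0] g(3)[of 0] True by auto
      ultimately have "(\<lambda>m. mart a (g m) \<omega>) \<longlonglongrightarrow> mart a (\<rho> \<omega>) \<omega>"
        by (intro continuous_on_tendsto_compose[OF continuous_mart[OF \<omega> a] gl]) (use g(2) in auto)
      then show ?thesis unfolding g(1) by (intro tendsto_mult tendsto_const)
    qed (simp add: g(1))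
  qed
  have S_bound: "norm (S m \<omega>) \<le> 2 * C + (C * (hi - a) + C * (2 + CARD('k)) * c)" if \<omega>: "\<omega> \<in> space M" for m \<omega>
  proof -
    obtain g where g: "S m \<omega> = indicator (E a) \<omega> * mart a g \<omega>" "g \<in> {a..hi}" using stopped[OF \<omega>] by metis
    have "\<bar>S m \<omega>\<bar> \<le> \<bar>mart a g \<omega>\<bar>" unfolding g(1) by (auto simp: indicator_def)
    also have "\<dots> \<le> 2 * C + (C * (g - a) + C * (2 + CARD('k)) * c)" by (rule abs_mart_le[OF \<omega> ahi(2)]) (use g(2) in auto)
    also have "\<dots> \<le> 2 * C + (C * (hi - a) + C * (2 + CARD('k)) * c)"
      using g(2) C_nonneg by (intro add_left_mono add_right_mono mult_left_mono) auto
    finally show ?thesis by simp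
  qed
  have m: "(\<lambda>\<omega>. indicator (E a) \<omega> * mart a (\<rho> \<omega>) \<omega>) \<in> borel_measurable M"
    by (rule borel_measurable_LIMSEQ_real[OF lim borel_measurable_integrable[OF S_int]])
  have dom: "AE \<omega> in M. norm (S m \<omega>) \<le> 2 * C + (C * (hi - a) + C * (2 + CARD('k)) * c)" for m
    using S_bound by (intro AE_I2)
  have lims: "AE \<omega> in M. (\<lambda>m. S m \<omega>) \<longlonglongrightarrow> indicator (E a) \<omega> * mart a (\<rho> \<omega>) \<omega>"
    using lim by (intro AE_I2)
  note Sm = borel_measurable_integrable[OF S_int]
  have "integrable M (\<lambda>\<omega>. indicator (E a) \<omega> * mart a (\<rho> \<omega>) \<omega>)"
    by (rule integrable_dominated_convergence[OF m Sm _ lims dom]) simp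
  moreover have "(\<lambda>m. \<integral>\<omega>. S m \<omega> \<partial>M) \<longlonglongrightarrow> (\<integral>\<omega>. indicator (E a) \<omega> * mart a (\<rho> \<omega>) \<omega> \<partial>M)"
    by (rule integral_dominated_convergence[OF m Sm _ lims dom]) simp
  then have "(\<integral>\<omega>. indicator (E a) \<omega> * mart a (\<rho> \<omega>) \<omega> \<partial>M) = 0"
    unfolding S_0 by (simp add: LIMSEQ_const_iff)
  ultimately show ?thesis by (simp add: has_bochner_integral_iff)
qed

end

text \<open>As the events decrease, for \<open>y\<close> not below \<open>a\<close> the supremum
  exceeds \<open>y\<close> exactly if some event at a rational time after \<open>y\<close> holds.
  Outside \<open>E a\<close> the supremum would be that of an empty set and is replaced by
  \<open>a\<close>.\<close>

lemma stopping_time_measurable: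
  fixes E :: "real \<Rightarrow> 'w set"
  assumes "a \<le> b"
    and E: "\<And>s. s \<in> {a..b} \<Longrightarrow> E s \<in> sets M"
    and anti: "\<And>r s. a \<le> r \<Longrightarrow> r \<le> s \<Longrightarrow> s \<le> b \<Longrightarrow> E s \<subseteq> E r"
  shows "(\<lambda>\<omega>. if \<omega> \<in> E a then Sup {s \<in> {a..b}. \<omega> \<in> E s} else a) \<in> borel_measurable M"
proof (rule borel_measurableI_greater)
  fix y
  let ?\<rho> = "\<lambda>\<omega>. if \<omega> \<in> E a then Sup {s \<in> {a..b}. \<omega> \<in> E s} else a"
  show "{\<omega> \<in> space M. y < ?\<rho> \<omega>} \<in> sets M"
  proof (cases "y < a")
    case True
    have le: "a \<le> ?\<rho> \<omega>" for \<omega>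
    proof (cases "\<omega> \<in> E a")
      case in_E: True
      have "bdd_above {s \<in> {a..b}. \<omega> \<in> E s}" by (rule bdd_aboveI[of _ b]) auto
      then have "a \<le> Sup {s \<in> {a..b}. \<omega> \<in> E s}" using in_E assms(1) by (intro cSup_upper) auto
      then show ?thesis by simp
    qed simp
    have "y < ?\<rho> \<omega>" for \<omega> by (rule less_le_trans[OF True le])
    then have "{\<omega> \<in> space M. y < ?\<rho> \<omega>} = space M" by blast
    then show ?thesis by simp
  next
    case False
    have "{\<omega> \<in> space M. y < ?\<rho> \<omega>} = (\<Union>r\<in>\<rat> \<inter> {y<..b}. E r \<inter> space M)"
    proof (intro equalityI subsetI)
      fix \<omega> assume "\<omega> \<in> {\<omega> \<in> space M. y < ?\<rho> \<omega>}"
      then have \<omega>: "\<omega> \<in> space M" "y < ?\<rho> \<omega>" by auto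
      with False have in_E: "\<omega> \<in> E a" by (auto split: if_splits)
      with \<omega> have "y < Sup {s \<in> {a..b}. \<omega> \<in> E s}" by simp
      moreover have "{s \<in> {a..b}. \<omega> \<in> E s} \<noteq> {}" using in_E assms(1) by auto
      ultimately have "\<exists>s\<in>{s \<in> {a..b}. \<omega> \<in> E s}. y < s" by (intro less_cSupD)
      then obtain s where s: "s \<in> {a..b}" "\<omega> \<in> E s" "y < s" by blast
      obtain r where r: "r \<in> \<rat>" "y < r" "r < s" using Rats_dense_in_real[OF s(3)] by blast
      have "\<omega> \<in> E r" using anti[of r s] r s False by auto
      then show "\<omega> \<in> (\<Union>r\<in>\<rat> \<inter> {y<..b}. E r \<inter> space M)" using r s \<omega> by auto
    next
      fix \<omega> assume "\<omega> \<in> (\<Union>r\<in>\<rat> \<inter> {y<..b}. E r \<inter> space M)"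
      then obtain r where r: "y < r" "r \<le> b" "\<omega> \<in> E r" "\<omega> \<in> space M" by auto
      have ra: "a \<le> r" using r False by simp
      have "bdd_above {s \<in> {a..b}. \<omega> \<in> E s}" by (rule bdd_aboveI[of _ b]) auto
      then have "r \<le> Sup {s \<in> {a..b}. \<omega> \<in> E s}" using r ra by (intro cSup_upper) auto
      moreover have "\<omega> \<in> E a" using anti[of a r] r ra by auto
      ultimately show "\<omega> \<in> {\<omega> \<in> space M. y < ?\<rho> \<omega>}" using r by auto
    qed
    also have "\<dots> \<in> sets M"
      by (intro sets.countable_UN' countable_Int1 countable_rat) (use E False in auto)
    finally show ?thesis .
  qed
qed

section \<open>Localised test functions\<close>

text \<open>Covers the exponents from 2 on, for which the derivative at the kink is zero. Two
  successive applications differentiate the cube of the positive part twice.\<close>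

lemma has_real_derivative_max_0_power:
  "((\<lambda>y::real. max 0 y ^ Suc (Suc n)) has_real_derivative real (Suc (Suc n)) * max 0 y ^ Suc n) (at y)"
proof -
  consider "y > 0" | "y < 0" | "y = 0" by linarith
  then show ?thesis
  proof cases
    case 1
    have "((\<lambda>y::real. y ^ Suc (Suc n)) has_real_derivative real (Suc (Suc n)) * y ^ Suc n) (at y)"
      using DERIV_pow[of "Suc (Suc n)" y] by simp
    then have "((\<lambda>y::real. max 0 y ^ Suc (Suc n)) has_real_derivative real (Suc (Suc n)) * y ^ Suc n) (at y)"
      by (rule has_field_derivative_transform_within_open[where S = "{0<..}"]) (use 1 in auto)
    then show ?thesis using 1 by simp
  next
    case 2
    have "((\<lambda>y::real. 0) has_real_derivative 0) (at y)" by simp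
    then have "((\<lambda>y::real. max 0 y ^ Suc (Suc n)) has_real_derivative 0) (at y)"
      by (rule has_field_derivative_transform_within_open[where S = "{..<0}"]) (use 2 in auto)
    then show ?thesis using 2 by simp
  next
    case 3
    have "(\<lambda>h::real. max 0 h ^ Suc (Suc n) / h) \<midarrow>0\<rightarrow> 0"
    proof (rule Lim_null_comparison)
      have "(\<lambda>h::real. \<bar>h\<bar> ^ Suc n) \<midarrow>0\<rightarrow> \<bar>0\<bar> ^ Suc n" by (intro tendsto_intros)
      then show "(\<lambda>h::real. \<bar>h\<bar> ^ Suc n) \<midarrow>0\<rightarrow> 0" by simp
      show "\<forall>\<^sub>F h in at (0::real). norm (max 0 h ^ Suc (Suc n) / h) \<le> \<bar>h\<bar> ^ Suc n"
      proof (rule always_eventually, rule allI)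
        fix h :: real
        show "norm (max 0 h ^ Suc (Suc n) / h) \<le> \<bar>h\<bar> ^ Suc n"
        proof (cases "h > 0")
          case False
          then have "max 0 h = 0" by simp
          then show ?thesis by (simp del: power_Suc)
        qed simp
      qed
    qed
    then show ?thesis unfolding 3 DERIV_def by simp
  qed
qed

definition outer :: "real^'n \<Rightarrow> real^'n \<Rightarrow> real^'n^'n" where
  "outer a b = (\<chi> i j. a $ i * b $ j)"

lemma outer_mult: "outer a b *v h = (b \<bullet> h) *\<^sub>R a"
  by (simp add: vec_eq_iff outer_def matrix_vector_mult_def inner_vec_def sum_distrib_left mult_ac)

lemma outer_0 [simp]: "outer 0 b = 0" "outer a 0 = 0"
  by (simp_all add: outer_def vec_eq_iff)

lemma continuous_on_outer [continuous_intros]: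
  "continuous_on S f \<Longrightarrow> continuous_on S g \<Longrightarrow> continuous_on S (\<lambda>x. outer (f x) (g x))"
  unfolding outer_def by (intro continuous_on_vec_lambda continuous_intros)

text \<open>The bump \<open>(max 0 (r\<^sup>2 - |x - z|\<^sup>2))\<^sup>3\<close> is \<open>C\<^sup>2\<close> and positive exactly on a ball.\<close>

lemma ball_bump:
  fixes z :: "real^'n" and r :: real
  assumes r: "r > 0"
  obtains d :: "real^'n \<Rightarrow> real" and d' d'' where
    "\<And>x. (d has_derivative (\<lambda>h. d' x \<bullet> h)) (at x)" "\<And>x. (d' has_derivative (\<lambda>h. d'' x *v h)) (at x)"
    "continuous_on UNIV d''" "\<And>x. d x \<ge> 0" "\<And>x. x \<in> ball z r \<Longrightarrow> d x > 0"
    "\<And>x. x \<notin> cball z r \<Longrightarrow> d x = 0 \<and> d' x = 0 \<and> d'' x = 0"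
proof -
  define m where "m x = max 0 (r\<^sup>2 - (norm (x - z))\<^sup>2)" for x
  define d where "d x = m x ^ 3" for x
  define d' where "d' x = (3 * m x ^ 2 * - 2) *\<^sub>R (x - z)" for x
  define d'' where "d'' x = (3 * (2 * m x) * 4) *\<^sub>R outer (x - z) (x - z) + (3 * m x ^ 2 * - 2) *\<^sub>R mat 1" for x
  have q: "((\<lambda>x. r\<^sup>2 - (norm (x - z))\<^sup>2) has_derivative (\<lambda>h. - (2 * ((x - z) \<bullet> h)))) (at x)" for x
    unfolding power2_norm_eq_inner by (auto intro!: derivative_eq_intros simp: inner_commute algebra_simps)
  have p3: "((\<lambda>x. m x ^ 3) has_derivative (\<lambda>h. - (2 * ((x - z) \<bullet> h)) * (3 * m x ^ 2))) (at x)" for x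
    using DERIV_compose_FDERIV[OF has_real_derivative_max_0_power[of 1] q[of x]]
    by (simp add: m_def numeral_eq_Suc)
  have p2: "((\<lambda>x. m x ^ 2) has_derivative (\<lambda>h. - (2 * ((x - z) \<bullet> h)) * (2 * m x))) (at x)" for x
    using DERIV_compose_FDERIV[OF has_real_derivative_max_0_power[of 0] q[of x]]
    by (simp add: m_def numeral_eq_Suc)
  have mc: "continuous_on UNIV m" unfolding m_def by (intro continuous_intros)
  show thesis
  proof (rule that)
    show "(d has_derivative (\<lambda>h. d' x \<bullet> h)) (at x)" for x
      using p3[of x] unfolding d_def d'_def by (simp add: mult_ac)
    show "(d' has_derivative (\<lambda>h. d'' x *v h)) (at x)" for x
    proof -
      have "((\<lambda>x. 3 * m x ^ 2 * - 2) has_derivative (\<lambda>h. 3 * (- (2 * ((x - z) \<bullet> h)) * (2 * m x)) * - 2)) (at x)"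
        by (intro has_derivative_mult_left has_derivative_mult_right p2)
      moreover have "((\<lambda>x. x - z) has_derivative (\<lambda>h. h)) (at x)" by (auto intro!: derivative_eq_intros)
      ultimately show ?thesis
        unfolding d'_def d''_def
        by (rule has_derivative_eq_rhs[OF has_derivative_scaleR])
          (auto simp: fun_eq_iff matrix_vector_mult_add_rdistrib matrix_vector_mult_diff_rdistrib scaleR_matrix_vector_assoc[symmetric] outer_mult)
    qed
    show "continuous_on UNIV d''" unfolding d''_def by (intro continuous_intros mc)
    show "d x \<ge> 0" for x by (simp add: d_def m_def)
    show "d x > 0" if "x \<in> ball z r" for x
    proof -
      have "(norm (x - z))\<^sup>2 < r\<^sup>2" using that r by (intro power_strict_mono) (auto simp: dist_norm norm_minus_commute)
      then show ?thesis by (simp add: d_def m_def)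
    qed
    show "d x = 0 \<and> d' x = 0 \<and> d'' x = 0" if "x \<notin> cball z r" for x
    proof -
      have "r\<^sup>2 \<le> (norm (x - z))\<^sup>2" using that r by (intro power_mono) (auto simp: dist_norm norm_minus_commute)
      then have "m x = 0" by (simp add: m_def)
      then show ?thesis by (simp add: d_def d'_def d''_def)
    qed
  qed
qed

text \<open>Finitely many bumps give a sum \<open>D\<close> that is at least some \<delta> on
  \<open>K\<close> and vanishes off a compact subset of \<open>U\<close>. The cutoff
  \<open>1 - (max 0 (1 - D / \<delta>))^3\<close> is 1 where \<open>D\<close> reaches \<delta> and 0
  where \<open>D\<close> is 0; the cube makes the transition twice differentiable.\<close>

lemma smooth_cutoff:
  fixes K U :: "(real^'n) set"
  assumes K: "compact K" and U: "open U" "K \<subseteq> U"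
  obtains \<kappa> :: "real^'n \<Rightarrow> real" and \<kappa>' \<kappa>'' S where
    "compact S" "S \<subseteq> U"
    "\<And>x. (\<kappa> has_derivative (\<lambda>h. \<kappa>' x \<bullet> h)) (at x)" "\<And>x. (\<kappa>' has_derivative (\<lambda>h. \<kappa>'' x *v h)) (at x)"
    "continuous_on UNIV \<kappa>''"
    "\<And>x. x \<in> K \<Longrightarrow> \<kappa> x = 1 \<and> \<kappa>' x = 0 \<and> \<kappa>'' x = 0"
    "\<And>x. x \<notin> S \<Longrightarrow> \<kappa> x = 0 \<and> \<kappa>' x = 0 \<and> \<kappa>'' x = 0"
proof -
  have "\<forall>z\<in>K. \<exists>r>0. cball z r \<subseteq> U" using U open_contains_cball by (metis subsetD)
  then obtain rad where rad: "\<And>z. z \<in> K \<Longrightarrow> rad z > 0" "\<And>z. z \<in> K \<Longrightarrow> cball z (rad z) \<subseteq> U" by metis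
  have "K \<subseteq> (\<Union>z\<in>K. ball z (rad z))" using rad(1) by auto
  then obtain I where I: "I \<subseteq> K" "finite I" "K \<subseteq> (\<Union>z\<in>I. ball z (rad z))"
    using compactE_image[OF K, of K "\<lambda>z. ball z (rad z)"] by auto
  define P where "P z d d' d'' \<longleftrightarrow>
    (\<forall>x. (d has_derivative (\<lambda>h. d' x \<bullet> h)) (at x)) \<and> (\<forall>x. (d' has_derivative (\<lambda>h. d'' x *v h)) (at x)) \<and>
    continuous_on UNIV d'' \<and> (\<forall>x. d x \<ge> (0::real)) \<and> (\<forall>x\<in>ball z (rad z). d x > 0) \<and>
    (\<forall>x. x \<notin> cball z (rad z) \<longrightarrow> d x = 0 \<and> d' x = 0 \<and> d'' x = 0)" for z d d' d''
  have "\<exists>d d' d''. P z d d' d''" if "z \<in> I" for z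
  proof -
    have "rad z > 0" using that rad(1) I(1) by auto
    from ball_bump[OF this, of z] show ?thesis unfolding P_def by metis
  qed
  then obtain d d' d'' where "\<And>z. z \<in> I \<Longrightarrow> P z (d z) (d' z) (d'' z)" by metis
  then have d: "\<And>z x. z \<in> I \<Longrightarrow> (d z has_derivative (\<lambda>h. d' z x \<bullet> h)) (at x)"
    "\<And>z x. z \<in> I \<Longrightarrow> (d' z has_derivative (\<lambda>h. d'' z x *v h)) (at x)" "\<And>z. z \<in> I \<Longrightarrow> continuous_on UNIV (d'' z)"
    "\<And>z x. z \<in> I \<Longrightarrow> d z x \<ge> (0::real)" "\<And>z x. z \<in> I \<Longrightarrow> x \<in> ball z (rad z) \<Longrightarrow> d z x > 0"
    "\<And>z x. z \<in> I \<Longrightarrow> x \<notin> cball z (rad z) \<Longrightarrow> d z x = 0 \<and> d' z x = 0 \<and> d'' z x = 0"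
    unfolding P_def by blast+
  define D where "D x = (\<Sum>z\<in>I. d z x)" for x
  define D' where "D' x = (\<Sum>z\<in>I. d' z x)" for x
  define D'' where "D'' x = (\<Sum>z\<in>I. d'' z x)" for x
  have D: "(D has_derivative (\<lambda>h. D' x \<bullet> h)) (at x)" for x
    unfolding D_def[abs_def] D'_def inner_sum_left by (intro has_derivative_sum d)
  have D': "(D' has_derivative (\<lambda>h. D'' x *v h)) (at x)" for x
  proof -
    have "(\<Sum>z\<in>J. d'' z x) *v h = (\<Sum>z\<in>J. d'' z x *v h)" for J h
      by (induction J rule: infinite_finite_induct) (auto simp: matrix_vector_mult_add_rdistrib)
    then show ?thesis unfolding D'_def[abs_def] D''_def by (auto intro!: has_derivative_sum d)
  qed
  have D''c: "continuous_on UNIV D''" unfolding D''_def[abs_def] by (intro continuous_on_sum d)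
  have Dc: "continuous_on UNIV D"
    using D by (meson continuous_at_imp_continuous_on has_derivative_continuous)
  have D'c: "continuous_on UNIV D'"
    using D' by (meson continuous_at_imp_continuous_on has_derivative_continuous)
  have Dpos: "D x > 0" if x: "x \<in> K" for x
  proof -
    obtain z where "z \<in> I" "x \<in> ball z (rad z)" using I(3) x by blast
    then show ?thesis unfolding D_def using d(4,5) by (intro sum_pos2[OF I(2)]) auto
  qed
  obtain \<delta> where \<delta>: "\<delta> > 0" "\<And>x. x \<in> K \<Longrightarrow> \<delta> \<le> D x"
  proof (cases "K = {}")
    case False
    from continuous_attains_inf[OF K False continuous_on_subset[OF Dc subset_UNIV]]
    obtain x0 where "x0 \<in> K" "\<And>x. x \<in> K \<Longrightarrow> D x0 \<le> D x" by blast
    then show thesis using Dpos[of x0] that by blast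
  qed (use that[of 1] in auto)
  define S where "S = (\<Union>z\<in>I. cball z (rad z))"
  define m where "m x = max 0 (1 - D x / \<delta>)" for x
  define \<kappa> where "\<kappa> x = 1 - m x ^ 3" for x
  define \<kappa>' where "\<kappa>' x = (3 / \<delta> * m x ^ 2) *\<^sub>R D' x" for x
  define \<kappa>'' where "\<kappa>'' x = (- (6 * m x) / \<delta>\<^sup>2) *\<^sub>R outer (D' x) (D' x) + (3 / \<delta> * m x ^ 2) *\<^sub>R D'' x" for x
  have q: "((\<lambda>x. 1 - D x / \<delta>) has_derivative (\<lambda>h. - (D' x \<bullet> h) / \<delta>)) (at x)" for x
    using \<delta>(1) by (auto intro!: derivative_eq_intros D)
  have p3: "((\<lambda>x. m x ^ 3) has_derivative (\<lambda>h. - (D' x \<bullet> h) / \<delta> * (3 * m x ^ 2))) (at x)" for x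
    using DERIV_compose_FDERIV[OF has_real_derivative_max_0_power[of 1] q[of x]]
    by (simp add: m_def numeral_eq_Suc)
  have p2: "((\<lambda>x. m x ^ 2) has_derivative (\<lambda>h. - (D' x \<bullet> h) / \<delta> * (2 * m x))) (at x)" for x
    using DERIV_compose_FDERIV[OF has_real_derivative_max_0_power[of 0] q[of x]]
    by (simp add: m_def numeral_eq_Suc)
  have mc: "continuous_on UNIV m" unfolding m_def by (intro continuous_intros Dc) (use \<delta> in auto)
  show thesis
  proof (rule that)
    show "compact S" unfolding S_def using I(2) by (intro compact_UN) auto
    show "S \<subseteq> U" unfolding S_def using rad(2) I(1) by blast
    show "(\<kappa> has_derivative (\<lambda>h. \<kappa>' x \<bullet> h)) (at x)" for x
    proof -
      have "(\<kappa> has_derivative (\<lambda>h. 0 - (- (D' x \<bullet> h) / \<delta> * (3 * m x ^ 2)))) (at x)"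
        unfolding \<kappa>_def[abs_def] by (intro has_derivative_diff has_derivative_const p3)
      then show ?thesis by (rule has_derivative_eq_rhs) (simp add: fun_eq_iff \<kappa>'_def)
    qed
    show "(\<kappa>' has_derivative (\<lambda>h. \<kappa>'' x *v h)) (at x)" for x
    proof -
      have "((\<lambda>x. 3 / \<delta> * m x ^ 2) has_derivative (\<lambda>h. 3 / \<delta> * (- (D' x \<bullet> h) / \<delta> * (2 * m x)))) (at x)"
        by (intro has_derivative_mult_right p2)
      from has_derivative_scaleR[OF this D'] show ?thesis
        unfolding \<kappa>'_def[abs_def] \<kappa>''_def
        by (rule has_derivative_eq_rhs)
          (simp add: fun_eq_iff matrix_vector_mult_add_rdistrib matrix_vector_mult_diff_rdistrib
            scaleR_matrix_vector_assoc[symmetric] outer_mult power2_eq_square)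
    qed
    show "continuous_on UNIV \<kappa>''"
      unfolding \<kappa>''_def[abs_def] by (intro continuous_intros mc D'c D''c) (use \<delta> in auto)
    show "\<kappa> x = 1 \<and> \<kappa>' x = 0 \<and> \<kappa>'' x = 0" if "x \<in> K" for x
    proof -
      have "m x = 0" using \<delta>(1) \<delta>(2)[OF that] by (simp add: m_def)
      then show ?thesis by (simp add: \<kappa>_def \<kappa>'_def \<kappa>''_def)
    qed
    show "\<kappa> x = 0 \<and> \<kappa>' x = 0 \<and> \<kappa>'' x = 0" if "x \<notin> S" for x
    proof -
      have "D x = 0" "D' x = 0" "D'' x = 0"
        using that d(6) unfolding D_def D'_def D''_def S_def by (auto intro!: sum.neutral)
      then show ?thesis by (simp add: m_def \<kappa>_def \<kappa>'_def \<kappa>''_def)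
    qed
  qed
qed

lemma uniformly_continuous_compact_support:
  fixes f :: "(real^'n) \<times> 'b::metric_space \<Rightarrow> 'c::real_normed_vector"
  assumes f: "continuous_on (UNIV \<times> T) f" and T: "compact T" and S: "compact S"
    and zero: "\<And>x y. x \<notin> S \<Longrightarrow> y \<in> T \<Longrightarrow> f (x, y) = 0"
  shows "uniformly_continuous_on (UNIV \<times> T) f" and "\<exists>B. \<forall>z\<in>UNIV \<times> T. norm (f z) \<le> B"
proof -
  obtain R where R: "\<And>x. x \<in> S \<Longrightarrow> norm x \<le> R" using compact_imp_bounded[OF S] unfolding bounded_iff by blast
  \<comment> \<open>The margin 1 ensures that two points closer than 1 either both lie in the
    enlarged ball or both lie beyond \<open>R\<close>, where \<open>f\<close> is zero.\<close>
  have comp: "compact (cball (0::real^'n) (R + 1) \<times> T)" using T by (intro compact_Times compact_cball)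
  have fc: "continuous_on (cball 0 (R + 1) \<times> T) f" by (rule continuous_on_subset[OF f]) auto
  have out: "f (x, y) = 0" if "norm x > R" "y \<in> T" for x y
    using zero[of x y] R[of x] that by force
  show "uniformly_continuous_on (UNIV \<times> T) f"
    unfolding uniformly_continuous_on_def
  proof (intro allI impI)
    fix e :: real assume e: "e > 0"
    from compact_uniformly_continuous[OF fc comp] e obtain \<delta> where \<delta>: "\<delta> > 0"
      "\<And>z z'. z \<in> cball 0 (R + 1) \<times> T \<Longrightarrow> z' \<in> cball 0 (R + 1) \<times> T \<Longrightarrow> dist z' z < \<delta> \<Longrightarrow> dist (f z') (f z) < e"
      unfolding uniformly_continuous_on_def by metis
    show "\<exists>d>0. \<forall>z\<in>UNIV \<times> T. \<forall>z'\<in>UNIV \<times> T. dist z' z < d \<longrightarrow> dist (f z') (f z) < e"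
    proof (intro exI[of _ "min \<delta> 1"] conjI ballI impI)
      fix z z' :: "(real^'n) \<times> 'b" assume z: "z \<in> UNIV \<times> T" "z' \<in> UNIV \<times> T" and d: "dist z' z < min \<delta> 1"
      obtain x y x' y' where xy: "z = (x, y)" "z' = (x', y')" by fastforce
      have "dist x' x \<le> dist z' z" unfolding xy dist_Pair_Pair by (rule real_sqrt_sum_squares_ge1)
      then have "\<bar>norm x' - norm x\<bar> < 1"
        using d norm_triangle_ineq3[of x' x] by (simp add: dist_norm)
      then consider "norm x \<le> R + 1 \<and> norm x' \<le> R + 1" | "norm x > R \<and> norm x' > R" by linarith
      then show "dist (f z') (f z) < e"
      proof cases
        case 1
        then show ?thesis using z d by (intro \<delta>(2)) (auto simp: xy)
      next
        case 2
        then show ?thesis using z e out by (auto simp: xy)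
      qed
    qed (use \<delta> in auto)
  qed
  have "bounded (f ` (cball 0 (R + 1) \<times> T))" using compact_continuous_image[OF fc comp] by (rule compact_imp_bounded)
  then obtain B where B: "\<forall>z\<in>f ` (cball 0 (R + 1) \<times> T). norm z \<le> B" unfolding bounded_iff ..
  show "\<exists>B. \<forall>z\<in>UNIV \<times> T. norm (f z) \<le> B"
  proof (intro exI[of _ "max B 0"] ballI)
    fix z :: "(real^'n) \<times> 'b" assume z: "z \<in> UNIV \<times> T"
    obtain x y where xy: "z = (x, y)" by fastforce
    show "norm (f z) \<le> max B 0"
    proof (cases "norm x > R")
      case True
      then show ?thesis using out[of x y] z by (simp add: xy)
    next
      case False
      then have "f z \<in> f ` (cball 0 (R + 1) \<times> T)" using z by (auto simp: xy)
      then show ?thesis using B by (auto simp: le_max_iff_disj)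
    qed
  qed
qed

text \<open>The parts over \<open>U\<close> and over the complement of \<open>S\<close> are
  relatively open and cover everything; on the second one \<open>f\<close> is zero.\<close>

lemma continuous_on_extend_by_zero:
  fixes f :: "'a::metric_space \<times> 'b::metric_space \<Rightarrow> 'c::real_normed_vector"
  assumes f: "continuous_on (U \<times> T) f" and U: "open U" and S: "closed S" "S \<subseteq> U"
    and zero: "\<And>x y. x \<notin> S \<Longrightarrow> y \<in> T \<Longrightarrow> f (x, y) = 0"
  shows "continuous_on (UNIV \<times> T) f"
proof -
  have "UNIV \<times> T = (U \<times> T) \<union> ((- S) \<times> T)" using S by auto
  moreover have "continuous_on ((U \<times> T) \<union> ((- S) \<times> T)) f"
  proof (rule continuous_on_Un_local_open)
    have "U \<times> T = (UNIV \<times> T) \<inter> (U \<times> UNIV)" "(- S) \<times> T = (UNIV \<times> T) \<inter> ((- S) \<times> UNIV)" by auto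
    moreover have "open (U \<times> (UNIV :: 'b set))" "open ((- S) \<times> (UNIV :: 'b set))"
      using U S by (auto intro: open_Times)
    ultimately show "openin (top_of_set (U \<times> T \<union> (- S) \<times> T)) (U \<times> T)" "openin (top_of_set (U \<times> T \<union> (- S) \<times> T)) ((- S) \<times> T)"
      unfolding \<open>UNIV \<times> T = (U \<times> T) \<union> ((- S) \<times> T)\<close>[symmetric] by (metis openin_open)+
    show "continuous_on (U \<times> T) f" by fact
    have "continuous_on ((- S) \<times> T) (\<lambda>_. 0 :: 'c)" by (rule continuous_on_const)
    then show "continuous_on ((- S) \<times> T) f" by (rule continuous_on_eq) (use zero in auto)
  qed
  ultimately show ?thesis by simp
qed

text \<open>The clock argument only enters through a function that is constant outside \<open>[n, n + 1]\<close>.\<close>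

lemma cutoff_product_uniformly_continuous:
  fixes \<Psi> :: "real^'n \<Rightarrow> real \<Rightarrow> 'c::real_normed_vector" and \<gamma> :: "real \<Rightarrow> real"
  assumes \<Psi>: "continuous_on (U \<times> {lo..hi}) (\<lambda>(x, s). \<Psi> x s)" and U: "open U" and S: "compact S" "S \<subseteq> U"
    and zero: "\<And>x s. x \<notin> S \<Longrightarrow> \<Psi> x s = 0"
    and \<gamma>: "continuous_on UNIV \<gamma>" "\<And>a. \<gamma> a = \<gamma> (max n (min (n + 1) a))"
  shows "uniformly_continuous_on (UNIV \<times> {lo..hi} \<times> UNIV) (\<lambda>(x, s, a). \<gamma> a *\<^sub>R \<Psi> x s)"
    and "\<exists>B. \<forall>x. \<forall>s\<in>{lo..hi}. \<forall>a. norm (\<gamma> a *\<^sub>R \<Psi> x s) \<le> B"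
proof -
  define T where "T = {lo..hi} \<times> {n..n + 1}"
  define f where "f z = \<gamma> (snd (snd z)) *\<^sub>R \<Psi> (fst z) (fst (snd z))" for z :: "(real^'n) \<times> real \<times> real"
  \<comment> \<open>A nonexpansive map that moves the clock argument into \<open>{n..n + 1}\<close>,
    where compactness is available.\<close>
  define k where "k z = (fst z, fst (snd z), max n (min (n + 1) (snd (snd z))))" for z :: "(real^'n) \<times> real \<times> real"
  have T: "compact T" unfolding T_def by (intro compact_Times compact_Icc)
  have "continuous_on (UNIV \<times> {lo..hi}) (\<lambda>(x, s). \<Psi> x s)"
    by (rule continuous_on_extend_by_zero[OF \<Psi> U compact_imp_closed[OF S(1)] S(2)]) (use zero in auto)
  then have "continuous_on (UNIV \<times> T) (\<lambda>z. (\<lambda>(x, s). \<Psi> x s) (fst z, fst (snd z)))"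
    by (rule continuous_on_compose2) (auto simp: T_def intro!: continuous_intros)
  moreover have "continuous_on (UNIV \<times> T) (\<lambda>z. \<gamma> (snd (snd z)))"
    by (rule continuous_on_compose2[OF \<gamma>(1)]) (auto intro!: continuous_intros)
  ultimately have fc: "continuous_on (UNIV \<times> T) f"
    unfolding f_def by (auto intro!: continuous_intros)
  note u = uniformly_continuous_compact_support[OF fc T S(1)]
  have uc: "uniformly_continuous_on (UNIV \<times> T) f" and ub: "\<exists>B. \<forall>z\<in>UNIV \<times> T. norm (f z) \<le> B"
    by (rule u; simp add: f_def zero)+
  have fk: "(\<lambda>(x, s, a). \<gamma> a *\<^sub>R \<Psi> x s) z = f (k z)" for z
    using \<gamma>(2)[of "snd (snd z)"] by (simp add: f_def k_def split_beta')
  have kd: "dist (k z') (k z) \<le> dist z' z" for z z'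
    unfolding k_def dist_prod_def fst_conv snd_conv
    by (intro real_sqrt_le_mono add_mono power_mono order_refl) (auto simp: dist_real_def)
  have kT: "k z \<in> UNIV \<times> T" if "z \<in> UNIV \<times> {lo..hi} \<times> UNIV" for z
    using that by (auto simp: k_def T_def)
  show "uniformly_continuous_on (UNIV \<times> {lo..hi} \<times> UNIV) (\<lambda>(x, s, a). \<gamma> a *\<^sub>R \<Psi> x s)"
    unfolding uniformly_continuous_on_def fk
  proof (intro allI impI)
    fix e :: real assume "e > 0"
    with uc obtain \<delta> where \<delta>: "\<delta> > 0" "\<And>z z'. z \<in> UNIV \<times> T \<Longrightarrow> z' \<in> UNIV \<times> T \<Longrightarrow> dist z' z < \<delta> \<Longrightarrow> dist (f z') (f z) < e"
      unfolding uniformly_continuous_on_def by metis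
    show "\<exists>d>0. \<forall>z\<in>UNIV \<times> {lo..hi} \<times> UNIV. \<forall>z'\<in>UNIV \<times> {lo..hi} \<times> UNIV. dist z' z < d \<longrightarrow> dist (f (k z')) (f (k z)) < e"
      by (intro exI[of _ \<delta>] conjI ballI impI \<delta> kT le_less_trans[OF kd])
  qed
  from ub obtain B where B: "\<And>z. z \<in> UNIV \<times> T \<Longrightarrow> norm (f z) \<le> B" by blast
  show "\<exists>B. \<forall>x. \<forall>s\<in>{lo..hi}. \<forall>a. norm (\<gamma> a *\<^sub>R \<Psi> x s) \<le> B"
  proof (intro exI[of _ B] allI ballI)
    fix x s a assume "s \<in> {lo..hi}"
    then show "norm (\<gamma> a *\<^sub>R \<Psi> x s) \<le> B" using B[OF kT[of "(x, s, a)"]] fk[of "(x, s, a)"] by simp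
  qed
qed

text \<open>While the state is in \<open>K\<close> and the clock at most \<open>n\<close>, both
  cutoffs are 1 with vanishing derivatives, and the test function cannot be told from
  \<open>J\<close>. The level at which it vanishes is \<open>n + 1\<close>, where the cutoff in the
  clock has reached zero.\<close>

lemma test_function_cutoff:
  fixes J Jt :: "real^'n \<Rightarrow> real \<Rightarrow> real" and Jx :: "real^'n \<Rightarrow> real \<Rightarrow> real^'n" and Jxx :: "real^'n \<Rightarrow> real \<Rightarrow> real^'n^'n"
  assumes U: "open U" and K: "compact K" "K \<subseteq> U" and n: "n \<ge> (0::real)" and lohi: "lo \<le> hi"
    and dt: "\<And>x s. x \<in> U \<Longrightarrow> s \<in> {lo..hi} \<Longrightarrow> ((\<lambda>s. J x s) has_real_derivative Jt x s) (at s within {lo..hi})"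
    and dx: "\<And>x s. x \<in> U \<Longrightarrow> s \<in> {lo..hi} \<Longrightarrow> ((\<lambda>y. J y s) has_derivative (\<lambda>h. Jx x s \<bullet> h)) (at x)"
    and dxx: "\<And>x s. x \<in> U \<Longrightarrow> s \<in> {lo..hi} \<Longrightarrow> ((\<lambda>y. Jx y s) has_derivative (\<lambda>h. Jxx x s *v h)) (at x)"
    and cont: "continuous_on (U \<times> {lo..hi}) (\<lambda>(x, s). J x s)" "continuous_on (U \<times> {lo..hi}) (\<lambda>(x, s). Jt x s)"
      "continuous_on (U \<times> {lo..hi}) (\<lambda>(x, s). Jx x s)" "continuous_on (U \<times> {lo..hi}) (\<lambda>(x, s). Jxx x s)"
  obtains \<Phi> \<Phi>t \<Phi>a \<Phi>x \<Phi>xx C where "test_function lo hi \<Phi> \<Phi>t \<Phi>a \<Phi>x \<Phi>xx C (n + 1)"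
    "\<And>x s a. x \<in> K \<Longrightarrow> s \<in> {lo..hi} \<Longrightarrow> a \<le> n \<Longrightarrow>
      \<Phi> x s a = J x s \<and> \<Phi>t x s a = Jt x s \<and> \<Phi>a x s a = 0 \<and> \<Phi>x x s a = Jx x s \<and> \<Phi>xx x s a = Jxx x s"
proof -
  obtain \<kappa> \<kappa>' \<kappa>'' S where S: "compact S" "S \<subseteq> U"
    and d\<kappa>: "\<And>x. (\<kappa> has_derivative (\<lambda>h. \<kappa>' x \<bullet> h)) (at x)" "\<And>x. (\<kappa>' has_derivative (\<lambda>h. \<kappa>'' x *v h)) (at x)"
    and c\<kappa>: "continuous_on UNIV \<kappa>''"
    and on_K: "\<And>x. x \<in> K \<Longrightarrow> \<kappa> x = (1::real) \<and> \<kappa>' x = 0 \<and> \<kappa>'' x = 0"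
    and off: "\<And>x. x \<notin> S \<Longrightarrow> \<kappa> x = 0 \<and> \<kappa>' x = 0 \<and> \<kappa>'' x = 0"
    using smooth_cutoff[OF K(1) U K(2)] by metis
  have c\<kappa>0: "continuous_on UNIV \<kappa>" and c\<kappa>1: "continuous_on UNIV \<kappa>'"
    using d\<kappa> by (meson continuous_at_imp_continuous_on has_derivative_continuous)+
  \<comment> \<open>Equal to 1 up to \<open>n\<close> and to 0 from \<open>n + 1\<close> on. One
    continuous derivative is enough, since the clock has finite variation.\<close>
  define g where "g a = (max 0 (1 - (max 0 (a - n))\<^sup>2))\<^sup>2" for a
  define g' where "g' a = 2 * max 0 (1 - (max 0 (a - n))\<^sup>2) * - (2 * max 0 (a - n))" for a
  define \<Psi> where "\<Psi> x s = \<kappa> x * J x s" for x s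
  define \<Psi>t where "\<Psi>t x s = \<kappa> x * Jt x s" for x s
  define \<Psi>x where "\<Psi>x x s = J x s *\<^sub>R \<kappa>' x + \<kappa> x *\<^sub>R Jx x s" for x s
  define \<Psi>xx where "\<Psi>xx x s = J x s *\<^sub>R \<kappa>'' x + outer (\<kappa>' x) (Jx x s) + (outer (Jx x s) (\<kappa>' x) + \<kappa> x *\<^sub>R Jxx x s)" for x s
  note defs = \<Psi>_def \<Psi>t_def \<Psi>x_def \<Psi>xx_def
  have zero: "\<Psi> x s = 0" "\<Psi>t x s = 0" "\<Psi>x x s = 0" "\<Psi>xx x s = 0" if "x \<notin> S" for x s
    using off[OF that] by (auto simp: defs)
  have dg: "(g has_real_derivative g' a) (at a)" for a
  proof -
    have p2: "((\<lambda>y::real. (max 0 y)\<^sup>2) has_real_derivative 2 * max 0 y) (at y)" for y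
      using has_real_derivative_max_0_power[of 0 y] by (simp add: numeral_eq_Suc)
    have "((\<lambda>a. 1 - (max 0 (a - n))\<^sup>2) has_real_derivative - (2 * max 0 (a - n))) (at a)"
    proof -
      have "((\<lambda>a. (max 0 (a - n))\<^sup>2) has_real_derivative 2 * max 0 (a - n) * 1) (at a)"
        by (rule DERIV_chain2[OF p2]) (auto intro!: derivative_eq_intros)
      then show ?thesis using DERIV_diff[OF DERIV_const, of "\<lambda>a. (max 0 (a - n))\<^sup>2" _ a UNIV 1] by simp
    qed
    from DERIV_chain2[OF p2 this] show ?thesis unfolding g_def[abs_def] g'_def .
  qed
  have gc: "continuous_on UNIV g" "continuous_on UNIV g'"
    unfolding g_def g'_def by (intro continuous_intros)+
  have g_clamp: "g a = g (max n (min (n + 1) a))" "g' a = g' (max n (min (n + 1) a))" for a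
  proof -
    consider "a \<le> n" | "n \<le> a" "a \<le> n + 1" | "n + 1 \<le> a" by linarith
    then have "g a = g (max n (min (n + 1) a)) \<and> g' a = g' (max n (min (n + 1) a))"
    proof cases
      case 2
      then have "max n (min (n + 1) a) = a" by simp
      then show ?thesis by simp
    next
      case 3
      then have "1\<^sup>2 \<le> (a - n)\<^sup>2" by (intro power_mono) auto
      then have "max 0 (1 - (max 0 (a - n))\<^sup>2) = 0" using 3 by simp
      moreover have "max n (min (n + 1) a) = n + 1" using 3 by simp
      ultimately show ?thesis by (simp add: g_def g'_def)
    qed (auto simp: g_def g'_def max_def min_def)
    then show "g a = g (max n (min (n + 1) a))" "g' a = g' (max n (min (n + 1) a))" by auto
  qed
  have g_high: "g a = 0" "g' a = 0" if "a \<ge> n + 1" for a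
    using g_clamp[of a] that by (auto simp: g_def g'_def)
  have g_low: "g a = 1" "g' a = 0" if "a \<le> n" for a
    using that by (auto simp: g_def g'_def)
  have fstc: "continuous_on (U \<times> {lo..hi}) (\<lambda>z. f (fst z))" if "continuous_on UNIV f" for f :: "real^'n \<Rightarrow> 'z::topological_space"
    by (rule continuous_on_compose2[OF that]) (auto intro!: continuous_intros)
  note [continuous_intros] = cont[unfolded split_beta'] fstc[OF c\<kappa>0] fstc[OF c\<kappa>1] fstc[OF c\<kappa>]
  have c\<Psi>: "continuous_on (U \<times> {lo..hi}) (\<lambda>(x, s). \<Psi> x s)" "continuous_on (U \<times> {lo..hi}) (\<lambda>(x, s). \<Psi>t x s)"
    "continuous_on (U \<times> {lo..hi}) (\<lambda>(x, s). \<Psi>x x s)" "continuous_on (U \<times> {lo..hi}) (\<lambda>(x, s). \<Psi>xx x s)"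
    unfolding defs split_beta' by (intro continuous_intros)+
  note cut = cutoff_product_uniformly_continuous[where n = n, OF _ U S]
  note uc = cut(1)[OF c\<Psi>(1) zero(1) gc(1) g_clamp(1)] cut(1)[OF c\<Psi>(2) zero(2) gc(1) g_clamp(1)]
    cut(1)[OF c\<Psi>(1) zero(1) gc(2) g_clamp(2)] cut(1)[OF c\<Psi>(3) zero(3) gc(1) g_clamp(1)]
    cut(1)[OF c\<Psi>(4) zero(4) gc(1) g_clamp(1)]
  obtain B1 where B1: "\<forall>x. \<forall>s\<in>{lo..hi}. \<forall>a. norm (g a *\<^sub>R \<Psi> x s) \<le> B1"
    using cut(2)[OF c\<Psi>(1) zero(1) gc(1) g_clamp(1)] by blast
  obtain B2 where B2: "\<forall>x. \<forall>s\<in>{lo..hi}. \<forall>a. norm (g a *\<^sub>R \<Psi>t x s) \<le> B2"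
    using cut(2)[OF c\<Psi>(2) zero(2) gc(1) g_clamp(1)] by blast
  obtain B3 where B3: "\<forall>x. \<forall>s\<in>{lo..hi}. \<forall>a. norm (g' a *\<^sub>R \<Psi> x s) \<le> B3"
    using cut(2)[OF c\<Psi>(1) zero(1) gc(2) g_clamp(2)] by blast
  obtain B4 where B4: "\<forall>x. \<forall>s\<in>{lo..hi}. \<forall>a. norm (g a *\<^sub>R \<Psi>x x s) \<le> B4"
    using cut(2)[OF c\<Psi>(3) zero(3) gc(1) g_clamp(1)] by blast
  obtain B5 where B5: "\<forall>x. \<forall>s\<in>{lo..hi}. \<forall>a. norm (g a *\<^sub>R \<Psi>xx x s) \<le> B5"
    using cut(2)[OF c\<Psi>(4) zero(4) gc(1) g_clamp(1)] by blast
  define C where "C = max B1 (max B2 (max B3 (max B4 B5)))"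
  have d\<Psi>: "((\<lambda>y. \<Psi> y s) has_derivative (\<lambda>h. \<Psi>x x s \<bullet> h)) (at x)"
    "((\<lambda>y. \<Psi>x y s) has_derivative (\<lambda>h. \<Psi>xx x s *v h)) (at x)" if s: "s \<in> {lo..hi}" for x s
  proof -
    have "((\<lambda>y. \<Psi> y s) has_derivative (\<lambda>h. \<Psi>x x s \<bullet> h)) (at x) \<and> ((\<lambda>y. \<Psi>x y s) has_derivative (\<lambda>h. \<Psi>xx x s *v h)) (at x)"
    proof (cases "x \<in> S")
      case True
      then have xU: "x \<in> U" using S by auto
      have 1: "((\<lambda>y. \<Psi> y s) has_derivative (\<lambda>h. \<kappa> x * (Jx x s \<bullet> h) + (\<kappa>' x \<bullet> h) * J x s)) (at x)"
        unfolding \<Psi>_def by (rule has_derivative_mult[OF d\<kappa>(1) dx[OF xU s]])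
      have 2: "((\<lambda>y. \<Psi>x y s) has_derivative (\<lambda>h. (J x s *\<^sub>R (\<kappa>'' x *v h) + (Jx x s \<bullet> h) *\<^sub>R \<kappa>' x)
          + (\<kappa> x *\<^sub>R (Jxx x s *v h) + (\<kappa>' x \<bullet> h) *\<^sub>R Jx x s))) (at x)"
        unfolding \<Psi>x_def
        by (rule has_derivative_add[OF has_derivative_scaleR[OF dx[OF xU s] d\<kappa>(2)] has_derivative_scaleR[OF d\<kappa>(1) dxx[OF xU s]]])
      show ?thesis
      proof
        show "((\<lambda>y. \<Psi> y s) has_derivative (\<lambda>h. \<Psi>x x s \<bullet> h)) (at x)"
          by (rule has_derivative_eq_rhs[OF 1]) (simp add: \<Psi>x_def fun_eq_iff inner_add_left)
        show "((\<lambda>y. \<Psi>x y s) has_derivative (\<lambda>h. \<Psi>xx x s *v h)) (at x)"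
          by (rule has_derivative_eq_rhs[OF 2])
            (simp add: \<Psi>xx_def fun_eq_iff matrix_vector_mult_add_rdistrib scaleR_matrix_vector_assoc[symmetric] outer_mult)
      qed
    next
      case False
      have op: "open (- S)" using S by (simp add: compact_imp_closed open_Compl)
      have "((\<lambda>y. \<Psi> y s) has_derivative (\<lambda>h. 0)) (at x)"
        by (rule has_derivative_transform_within_open[OF has_derivative_const op]) (use False zero in auto)
      moreover have "((\<lambda>y. \<Psi>x y s) has_derivative (\<lambda>h. 0)) (at x)"
        by (rule has_derivative_transform_within_open[OF has_derivative_const op]) (use False zero in auto)
      ultimately show ?thesis using zero[OF False] by simp
    qed
    then show "((\<lambda>y. \<Psi> y s) has_derivative (\<lambda>h. \<Psi>x x s \<bullet> h)) (at x)"
      "((\<lambda>y. \<Psi>x y s) has_derivative (\<lambda>h. \<Psi>xx x s *v h)) (at x)" by auto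
  qed
  have dt\<Psi>: "((\<lambda>s. \<Psi> x s) has_real_derivative \<Psi>t x s) (at s within {lo..hi})" if s: "s \<in> {lo..hi}" for x s
  proof (cases "x \<in> S")
    case True
    then have "x \<in> U" using S by auto
    then show ?thesis unfolding \<Psi>_def \<Psi>t_def by (intro DERIV_cmult dt s)
  next
    case False
    then show ?thesis using zero by simp
  qed
  show thesis
  proof (rule that)
    show "test_function lo hi (\<lambda>x s a. g a *\<^sub>R \<Psi> x s) (\<lambda>x s a. g a *\<^sub>R \<Psi>t x s) (\<lambda>x s a. g' a *\<^sub>R \<Psi> x s)
        (\<lambda>x s a. g a *\<^sub>R \<Psi>x x s) (\<lambda>x s a. g a *\<^sub>R \<Psi>xx x s) C (n + 1)"
    proof (unfold_locales, goal_cases)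
      case 1
      show ?case using n by simp
    next
      case (2 x s a)
      show ?case using DERIV_cmult[OF dt\<Psi>[OF 2], of "g a" x] by simp
    next
      case (3 x s a)
      show ?case using DERIV_cmult_right[OF dg, of "\<Psi> x s" a] by simp
    next
      case (4 x s a)
      show ?case using has_derivative_scaleR_right[OF d\<Psi>(1)[OF 4], of "g a" x] by simp
    next
      case (5 x s a)
      show ?case using has_derivative_scaleR_right[OF d\<Psi>(2)[OF 5], of "g a" x] by (simp add: scaleR_matrix_vector_assoc)
    next
      case (6 x s a)
      then show ?case using B1 by (auto simp: C_def le_max_iff_disj)
    next
      case (7 x s a)
      then show ?case using B2 by (auto simp: C_def le_max_iff_disj)
    next
      case (8 x s a)
      then show ?case using B3 by (auto simp: C_def le_max_iff_disj)
    next
      case (9 x s a)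
      then have "norm (g a *\<^sub>R \<Psi>x x s) \<le> B4" using B4 by blast
      then show ?case unfolding C_def by (simp only: le_max_iff_disj simp_thms)
    next
      case (10 x s a)
      then have "norm (g a *\<^sub>R \<Psi>xx x s) \<le> B5" using B5 by blast
      then show ?case unfolding C_def by (simp only: le_max_iff_disj simp_thms)
    qed (use uc g_high in auto)
    show "g a *\<^sub>R \<Psi> x s = J x s \<and> g a *\<^sub>R \<Psi>t x s = Jt x s \<and> g' a *\<^sub>R \<Psi> x s = 0 \<and> g a *\<^sub>R \<Psi>x x s = Jx x s \<and>
        g a *\<^sub>R \<Psi>xx x s = Jxx x s" if "x \<in> K" "s \<in> {lo..hi}" "a \<le> n" for x s a
      using on_K[OF that(1)] g_low[OF that(3)] by (simp add: defs)
  qed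
qed

text \<open>The smoothness hypotheses assert continuity of the derivatives of \<open>J\<close>, not
  of \<open>J\<close> itself. Near a point the gradient is bounded, which controls the change in
  \<open>x\<close> uniformly in time; the change in time is then taken at one fixed \<open>x\<close>
  only.\<close>

lemma continuous_on_of_partial_derivatives:
  fixes J Jt :: "'a::euclidean_space \<Rightarrow> real \<Rightarrow> real" and Jx :: "'a \<Rightarrow> real \<Rightarrow> 'a"
  assumes U: "open U"
    and dt: "\<And>x s. x \<in> U \<Longrightarrow> s \<in> I \<Longrightarrow> ((\<lambda>s. J x s) has_real_derivative Jt x s) (at s within I)"
    and dx: "\<And>x s. x \<in> U \<Longrightarrow> s \<in> I \<Longrightarrow> ((\<lambda>y. J y s) has_derivative (\<lambda>h. Jx x s \<bullet> h)) (at x)"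
    and cont: "continuous_on (U \<times> I) (\<lambda>(x, s). Jx x s)"
  shows "continuous_on (U \<times> I) (\<lambda>(x, s). J x s)"
  unfolding continuous_on_iff
proof (intro ballI allI impI)
  fix z and e :: real assume "z \<in> U \<times> I" and e: "e > 0"
  then obtain x s where z: "z = (x, s)" "x \<in> U" "s \<in> I" by auto
  obtain r where r: "r > 0" "ball x r \<subseteq> U" using U z(2) open_contains_ball by blast
  obtain \<delta>1 where \<delta>1: "\<delta>1 > 0" "\<And>y q. y \<in> U \<Longrightarrow> q \<in> I \<Longrightarrow> dist (y, q) (x, s) < \<delta>1 \<Longrightarrow> norm (Jx y q) \<le> norm (Jx x s) + 1"
  proof -
    obtain d where d: "d > 0" "\<And>z'. z' \<in> U \<times> I \<Longrightarrow> dist z' (x, s) < d \<Longrightarrow> dist ((\<lambda>(x, s). Jx x s) z') (Jx x s) < 1"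
      using cont[unfolded continuous_on_iff, rule_format, of "(x, s)" 1] z by auto
    show thesis
    proof (rule that[OF d(1)])
      fix y q assume "y \<in> U" "q \<in> I" "dist (y, q) (x, s) < d"
      then have "dist (Jx y q) (Jx x s) < 1" using d(2)[of "(y, q)"] by simp
      then show "norm (Jx y q) \<le> norm (Jx x s) + 1"
        using norm_triangle_ineq2[of "Jx y q" "Jx x s"] by (simp add: dist_norm)
    qed
  qed
  define L where "L = norm (Jx x s) + 1"
  have L: "L > 0" by (simp add: L_def add_nonneg_pos)
  have "continuous (at s within I) (\<lambda>s. J x s)"
    using dt[OF z(2,3)] by (rule DERIV_continuous)
  then obtain \<delta>2 where \<delta>2: "\<delta>2 > 0" "\<And>q. q \<in> I \<Longrightarrow> dist q s < \<delta>2 \<Longrightarrow> dist (J x q) (J x s) < e / 2"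
    unfolding continuous_within_eps_delta using e by (metis half_gt_zero)
  \<comment> \<open>The bound by \<open>r\<close> keeps the ball in \<open>U\<close>, \<delta>1 is
    shared between the two variables, and the last two terms leave \<open>e / 2\<close> for each of
    the two changes.\<close>
  define d where "d = min (min r (\<delta>1 / 2)) (min (\<delta>1 / 2) (min \<delta>2 (e / (2 * L))))"
  have d: "d > 0" using r \<delta>1 \<delta>2 e L by (simp add: d_def)
  show "\<exists>d>0. \<forall>z'\<in>U \<times> I. dist z' z < d \<longrightarrow> dist ((\<lambda>(x, s). J x s) z') ((\<lambda>(x, s). J x s) z) < e"
  proof (intro exI[of _ d] conjI d ballI impI)
    fix z' assume z': "z' \<in> U \<times> I" "dist z' z < d"
    then obtain y q where yq: "z' = (y, q)" "y \<in> U" "q \<in> I" by auto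
    have dy: "dist y x < d" "dist q s < d"
      using z'(2) unfolding yq z(1) dist_Pair_Pair
      by (meson le_less_trans real_sqrt_sum_squares_ge1 real_sqrt_sum_squares_ge2)+
    have sub: "ball x d \<subseteq> U" using r(2) by (auto simp: d_def)
    have "norm (J y q - J x q) \<le> L * norm (y - x)"
    proof (rule differentiable_bound[where S = "ball x d" and f' = "\<lambda>v h. Jx v q \<bullet> h"])
      show "convex (ball x d)" by simp
      fix v assume v: "v \<in> ball x d"
      then have vU: "v \<in> U" using sub by auto
      show "((\<lambda>y. J y q) has_derivative (\<lambda>h. Jx v q \<bullet> h)) (at v within ball x d)"
        by (rule has_derivative_at_withinI[OF dx[OF vU yq(3)]])
      have "dist (v, q) (x, s) \<le> dist v x + dist q s"
        unfolding dist_Pair_Pair by (rule sqrt_sum_squares_le_sum) auto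
      also have "\<dots> < \<delta>1" using v dy(2) by (auto simp: d_def dist_commute)
      finally have "norm (Jx v q) \<le> L" unfolding L_def by (rule \<delta>1(2)[OF vU yq(3)])
      then show "onorm (\<lambda>h. Jx v q \<bullet> h) \<le> L"
        by (intro onorm_le) (auto intro: order_trans[OF Cauchy_Schwarz_ineq2 mult_right_mono])
    qed (use dy d in \<open>auto simp: dist_commute\<close>)
    also have "\<dots> < L * (e / (2 * L))"
      using dy(1) L by (intro mult_strict_left_mono) (auto simp: d_def dist_norm)
    also have "\<dots> = e / 2" using L by simp
    finally have "dist (J y q) (J x q) < e / 2" by (simp add: dist_norm)
    moreover have "dist (J x q) (J x s) < e / 2" using dy(2) by (intro \<delta>2(2) yq) (simp add: d_def)
    ultimately show "dist ((\<lambda>(x, s). J x s) z') ((\<lambda>(x, s). J x s) z) < e"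
      using dist_triangle[of "J y q" "J x s" "J x q"] unfolding yq z(1) by simp
  qed
qed

section \<open>The augmented Wiener filtration\<close>

lemma wiener_filtration_generators:
  "{(\<lambda>\<omega>. w r \<omega> - w t \<omega>) -` B \<inter> space M | r B. r \<in> {t..s} \<and> B \<in> sets borel} \<union> null_sets M \<subseteq> Pow (space M)"
  using sets.sets_into_space by (auto dest!: null_setsD2)

lemma space_wiener_filtration [simp]: "space (wiener_filtration M w t s) = space M"
  unfolding wiener_filtration_def using wiener_filtration_generators by (rule space_measure_of)

lemma sets_wiener_filtration:
  "sets (wiener_filtration M w t s) = sigma_sets (space M)
     ({(\<lambda>\<omega>. w r \<omega> - w t \<omega>) -` B \<inter> space M | r B. r \<in> {t..s} \<and> B \<in> sets borel} \<union> null_sets M)"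
  unfolding wiener_filtration_def using wiener_filtration_generators by (rule sets_measure_of)

lemma null_set_in_wiener_filtration: "N \<in> null_sets M \<Longrightarrow> N \<in> sets (wiener_filtration M w t s)"
  unfolding sets_wiener_filtration by (rule sigma_sets.Basic) simp

lemma increment_from_start_adapted:
  fixes w :: "real \<Rightarrow> 'w \<Rightarrow> real^'k"
  assumes "r \<in> {t..s}"
  shows "(\<lambda>\<omega>. w r \<omega> - w t \<omega>) \<in> borel_measurable (wiener_filtration M w t s)"
proof (rule measurableI)
  fix B :: "(real^'k) set" assume "B \<in> sets borel"
  then show "(\<lambda>\<omega>. w r \<omega> - w t \<omega>) -` B \<inter> space (wiener_filtration M w t s) \<in> sets (wiener_filtration M w t s)"
    unfolding sets_wiener_filtration space_wiener_filtration
    using assms by (intro sigma_sets.Basic) auto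
qed simp

lemma increment_adapted:
  assumes "t \<le> q" "q \<le> r" "r \<le> s"
  shows "(\<lambda>\<omega>. w r \<omega> - w q \<omega>) \<in> borel_measurable (wiener_filtration M w t s)"
proof -
  have "(\<lambda>\<omega>. (w r \<omega> - w t \<omega>) - (w q \<omega> - w t \<omega>)) \<in> borel_measurable (wiener_filtration M w t s)"
    by (intro borel_measurable_diff increment_from_start_adapted) (use assms in auto)
  then show ?thesis by simp
qed

lemma wiener_filtration_mono:
  assumes "r \<le> s"
  shows "sets (wiener_filtration M w t r) \<subseteq> sets (wiener_filtration M w t s)"
proof -
  have "{t..r} \<subseteq> {t..s}" using assms by auto
  then show ?thesis unfolding sets_wiener_filtration by (intro sigma_sets_mono') blast
qed

text \<open>An increment from \<open>t\<close> is the difference of two increments from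
  \<open>a\<close>. Hence variables of the filtration started at \<open>t\<close> may be used with
  the independence property, which is stated for the start \<open>a\<close>.\<close>

lemma wiener_filtration_later_start:
  assumes "a \<le> t" "t \<le> s"
  shows "sets (wiener_filtration M w t s) \<subseteq> sets (wiener_filtration M w a s)"
proof -
  have "A \<in> sets (wiener_filtration M w a s)"
    if A: "A \<in> {(\<lambda>\<omega>. w r \<omega> - w t \<omega>) -` B \<inter> space M | r B. r \<in> {t..s} \<and> B \<in> sets borel} \<union> null_sets M" for A
  proof (cases "A \<in> null_sets M")
    case True
    then show ?thesis by (rule null_set_in_wiener_filtration)
  next
    case False
    with A obtain r B where r: "A = (\<lambda>\<omega>. w r \<omega> - w t \<omega>) -` B \<inter> space M" "r \<in> {t..s}" "B \<in> sets borel" by auto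
    then have "(\<lambda>\<omega>. w r \<omega> - w t \<omega>) \<in> borel_measurable (wiener_filtration M w a s)"
      using assms by (intro increment_adapted) auto
    from measurable_sets[OF this r(3)] show ?thesis by (simp add: r(1))
  qed
  then have "sigma_sets (space (wiener_filtration M w a s))
     ({(\<lambda>\<omega>. w r \<omega> - w t \<omega>) -` B \<inter> space M | r B. r \<in> {t..s} \<and> B \<in> sets borel} \<union> null_sets M)
     \<subseteq> sets (wiener_filtration M w a s)"
    by (intro sets.sigma_sets_subset) blast
  then show ?thesis by (simp add: sets_wiener_filtration[of M w t s])
qed

lemma wiener_filtration_le:
  assumes w: "wiener_process M a b w" and "a \<le> t" "s \<le> b"
  shows "sets (wiener_filtration M w t s) \<subseteq> sets M"
proof -
  have m: "w r \<in> borel_measurable M" if "r \<in> {a..b}" for r using w that by (simp add: wiener_process_def)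
  have "A \<in> sets M"
    if A: "A \<in> {(\<lambda>\<omega>. w r \<omega> - w t \<omega>) -` B \<inter> space M | r B. r \<in> {t..s} \<and> B \<in> sets borel} \<union> null_sets M" for A
  proof (cases "A \<in> null_sets M")
    case False
    with A obtain r B where r: "A = (\<lambda>\<omega>. w r \<omega> - w t \<omega>) -` B \<inter> space M" "r \<in> {t..s}" "B \<in> sets borel" by auto
    have "(\<lambda>\<omega>. w r \<omega> - w t \<omega>) \<in> borel_measurable M"
      using m[of r] m[of t] r(2) assms by (intro borel_measurable_diff) auto
    from measurable_sets[OF this r(3)] show ?thesis by (simp add: r(1))
  qed (rule null_setsD2)
  then show ?thesis unfolding sets_wiener_filtration by (intro sets.sigma_sets_subset) blast
qed

text \<open>Independence is given between sigma-algebras; \<zeta> and \<open>h\<close> of the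
  increment generate smaller ones, and for independent integrable variables the expectation of the
  product factorises.\<close>

lemma (in prob_space) wiener_increment_independent:
  fixes \<zeta> :: "'a \<Rightarrow> real" and h :: "real^'k \<Rightarrow> real"
  assumes w: "wiener_process M a b w" and rs: "a \<le> r" "r < s" "s \<le> b"
    and \<zeta>: "\<zeta> \<in> borel_measurable (wiener_filtration M w a r)" "integrable M \<zeta>"
    and h: "h \<in> borel_measurable borel" "integrable M (\<lambda>\<omega>. h (w s \<omega> - w r \<omega>))"
  shows "has_bochner_integral M (\<lambda>\<omega>. \<zeta> \<omega> * h (w s \<omega> - w r \<omega>)) ((\<integral>\<omega>. \<zeta> \<omega> \<partial>M) * (\<integral>\<omega>. h (w s \<omega> - w r \<omega>) \<partial>M))"
proof -
  let ?D = "\<lambda>\<omega>. w s \<omega> - w r \<omega>"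
  have ind: "indep_set (sets (wiener_filtration M w a r)) (sets (vimage_algebra (space M) ?D borel))"
    using w rs by (simp add: wiener_process_def)
  have "{\<zeta> -` A \<inter> space M |A. A \<in> sets borel} \<subseteq> sets (wiener_filtration M w a r)"
    using measurable_sets[OF \<zeta>(1)] by auto
  from sets.sigma_sets_subset[OF this]
  have 1: "sigma_sets (space M) {\<zeta> -` A \<inter> space M |A. A \<in> sets borel} \<subseteq> sets (wiener_filtration M w a r)"
    by simp
  have "(\<lambda>\<omega>. h (?D \<omega>)) \<in> borel_measurable (vimage_algebra (space M) ?D borel)"
    by (rule measurable_compose[OF measurable_vimage_algebra1 h(1)]) simp
  from measurable_sets[OF this]
  have "{(\<lambda>\<omega>. h (?D \<omega>)) -` A \<inter> space M |A. A \<in> sets borel} \<subseteq> sets (vimage_algebra (space M) ?D borel)"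
    by auto
  from sets.sigma_sets_subset[OF this]
  have 2: "sigma_sets (space M) {(\<lambda>\<omega>. h (?D \<omega>)) -` A \<inter> space M |A. A \<in> sets borel} \<subseteq> sets (vimage_algebra (space M) ?D borel)"
    by simp
  have "indep_set (sigma_sets (space M) {\<zeta> -` A \<inter> space M |A. A \<in> sets borel})
      (sigma_sets (space M) {(\<lambda>\<omega>. h (?D \<omega>)) -` A \<inter> space M |A. A \<in> sets borel})"
    using ind 1 2 unfolding indep_set_def by (elim indep_sets_mono_sets) (auto split: bool.split)
  then have iv: "indep_var borel \<zeta> borel (\<lambda>\<omega>. h (?D \<omega>))"
    using \<zeta>(2) h(2) by (simp add: indep_var_eq borel_measurable_integrable)
  show ?thesis
    unfolding has_bochner_integral_iff
    using indep_var_integrable[OF iv \<zeta>(2) h(2)] indep_var_lebesgue_integral[OF iv \<zeta>(2) h(2)] by simp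
qed

text \<open>By independence each moment against \<zeta> is the mean of \<zeta> times a Gaussian
  moment, and an expectation does not change when the process is altered on \<open>N\<close>. The
  standard deviation \<open>sqrt (s - r)\<close> enters the second moment squared and the fourth to
  the fourth power.\<close>

lemma filtered_wiener_modification:
  fixes w :: "real \<Rightarrow> 'w \<Rightarrow> real^'k"
  assumes M: "prob_space M" and w: "wiener_process M a b w" and t: "a \<le> t" "t \<le> b"
    and N: "N \<in> null_sets M" and cont: "\<And>\<omega>. \<omega> \<in> space M \<Longrightarrow> \<omega> \<notin> N \<Longrightarrow> continuous_on {t..b} (\<lambda>s. w s \<omega>)"
  shows "filtered_wiener M (wiener_filtration M w t) (\<lambda>s \<omega>. if \<omega> \<in> N then 0 else w s \<omega>) t b"
proof -
  interpret prob_space M by fact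
  let ?F = "wiener_filtration M w t" and ?w = "\<lambda>s \<omega>. if \<omega> \<in> N then 0 else w s \<omega>"
  have le: "sets (?F s) \<subseteq> sets M" if "s \<le> b" for s by (rule wiener_filtration_le[OF w t(1) that])
  have NM: "N \<in> sets M" using N by auto
  have FM: "f \<in> borel_measurable M" if "f \<in> borel_measurable (?F s)" "s \<le> b" for f :: "'w \<Rightarrow> real" and s
    using that(1) measurable_mono[OF subset_refl refl le[OF that(2)]] by auto
  have adapted: "(\<lambda>\<omega>. ?w s \<omega> - ?w r \<omega>) \<in> borel_measurable (?F s)" if "t \<le> r" "r \<le> s" for r s
  proof -
    have [measurable]: "N \<in> sets (?F s)" "(\<lambda>\<omega>. w s \<omega> - w r \<omega>) \<in> borel_measurable (?F s)"
      using null_set_in_wiener_filtration[OF N] increment_adapted[OF that order_refl] by auto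
    have "(\<lambda>\<omega>. if \<omega> \<in> N then 0 else w s \<omega> - w r \<omega>) \<in> borel_measurable (?F s)" by measurable
    also have "(\<lambda>\<omega>. if \<omega> \<in> N then 0 else w s \<omega> - w r \<omega>) = (\<lambda>\<omega>. ?w s \<omega> - ?w r \<omega>)" by auto
    finally show ?thesis .
  qed
  have ae: "AE \<omega> in M. \<omega> \<notin> N" using N by (rule AE_not_in)
  have dist: "distributed M lborel (\<lambda>\<omega>. w s \<omega> - w r \<omega>) (\<lambda>z. ennreal (\<Prod>i\<in>UNIV. normal_density 0 (sqrt (s - r)) (z $ i)))"
    if "a \<le> r" "r < s" "s \<le> b" for r s
    using w that by (simp add: wiener_process_def)
  have wm: "w s \<in> borel_measurable M" if "s \<in> {a..b}" for s using w that by (simp add: wiener_process_def)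
  have trans: "has_bochner_integral M (\<lambda>\<omega>. \<zeta> \<omega> * h (?w s \<omega> - ?w r \<omega>)) v"
    if h: "has_bochner_integral M (\<lambda>\<omega>. \<zeta> \<omega> * h (w s \<omega> - w r \<omega>)) v" and "h \<in> borel_measurable borel"
      and \<zeta>: "\<zeta> \<in> borel_measurable M" and rs: "a \<le> r" "r < s" "s \<le> b"
    for \<zeta> :: "'w \<Rightarrow> real" and h :: "real^'k \<Rightarrow> real" and v r s
  proof -
    have [measurable]: "w s \<in> borel_measurable M" "w r \<in> borel_measurable M" using rs by (auto intro: wm)
    note [measurable] = NM \<zeta> \<open>h \<in> borel_measurable borel\<close>
    have "AE \<omega> in M. \<zeta> \<omega> * h (w s \<omega> - w r \<omega>) = \<zeta> \<omega> * h (?w s \<omega> - ?w r \<omega>)"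
      using ae by eventually_elim simp
    then show ?thesis
      using h by (subst has_bochner_integral_cong_AE[symmetric]) auto
  qed
  note g = gaussian_vector_moments[OF dist]
  show ?thesis
  proof (unfold_locales, goal_cases)
    case (2 r s)
    then show ?case by (intro wiener_filtration_mono)
  next
    case (3 s)
    then show ?case by (intro le) simp
  next
    case (4 \<omega>)
    then show ?case using cont[of \<omega>] by (cases "\<omega> \<in> N") auto
  next
    case (5 r s)
    then show ?case by (intro adapted)
  next
    case (6 r s \<zeta> B i)
    have ra: "a \<le> r" "s \<le> b" "0 < sqrt (s - r)" using 6 t by auto
    have \<zeta>M: "\<zeta> \<in> borel_measurable M" using 6 by (intro FM[OF 6(4)]) simp
    have \<zeta>i: "integrable M \<zeta>" by (rule integrable_const_bound[OF _ \<zeta>M, of B]) (use 6(5) in auto)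
    have \<zeta>a: "\<zeta> \<in> borel_measurable (wiener_filtration M w a r)"
      using 6(4) measurable_mono[OF subset_refl refl wiener_filtration_later_start[OF t(1) 6(1)]] by auto
    have "has_bochner_integral M (\<lambda>\<omega>. \<zeta> \<omega> * (\<lambda>z. z $ i) (w s \<omega> - w r \<omega>)) ((\<integral>\<omega>. \<zeta> \<omega> \<partial>M) * (\<integral>\<omega>. (\<lambda>z. z $ i) (w s \<omega> - w r \<omega>) \<partial>M))"
      using g(1)[OF ra(1) 6(2) ra(2,3), of i]
      by (intro wiener_increment_independent[OF w ra(1) 6(2) ra(2) \<zeta>a \<zeta>i]) (auto simp: has_bochner_integral_iff)
    moreover have "(\<integral>\<omega>. (w s \<omega> - w r \<omega>) $ i \<partial>M) = 0"
      using has_bochner_integral_integral_eq[OF g(1)[OF ra(1) 6(2) ra(2,3), of i]] .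
    ultimately have "has_bochner_integral M (\<lambda>\<omega>. \<zeta> \<omega> * (\<lambda>z. z $ i) (w s \<omega> - w r \<omega>)) 0" by simp
    from trans[OF this _ \<zeta>M ra(1) 6(2) ra(2)] show ?case by simp
  next
    case (7 r s \<zeta> B i j)
    have ra: "a \<le> r" "s \<le> b" "0 < sqrt (s - r)" using 7 t by auto
    have \<zeta>M: "\<zeta> \<in> borel_measurable M" using 7 by (intro FM[OF 7(4)]) simp
    have \<zeta>i: "integrable M \<zeta>" by (rule integrable_const_bound[OF _ \<zeta>M, of B]) (use 7(5) in auto)
    have \<zeta>a: "\<zeta> \<in> borel_measurable (wiener_filtration M w a r)"
      using 7(4) measurable_mono[OF subset_refl refl wiener_filtration_later_start[OF t(1) 7(1)]] by auto
    note g2 = g(2)[OF ra(1) 7(2) ra(2,3), of i j]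
    have "has_bochner_integral M (\<lambda>\<omega>. \<zeta> \<omega> * (\<lambda>z. z $ i * z $ j) (w s \<omega> - w r \<omega>))
        ((\<integral>\<omega>. \<zeta> \<omega> \<partial>M) * (\<integral>\<omega>. (\<lambda>z. z $ i * z $ j) (w s \<omega> - w r \<omega>) \<partial>M))"
      using g2 by (intro wiener_increment_independent[OF w ra(1) 7(2) ra(2) \<zeta>a \<zeta>i]) (auto simp: has_bochner_integral_iff)
    moreover have "(\<integral>\<omega>. (w s \<omega> - w r \<omega>) $ i * (w s \<omega> - w r \<omega>) $ j \<partial>M) = (if i = j then s - r else 0)"
      using has_bochner_integral_integral_eq[OF g2] 7(2) by simp
    ultimately have "has_bochner_integral M (\<lambda>\<omega>. \<zeta> \<omega> * (\<lambda>z. z $ i * z $ j) (w s \<omega> - w r \<omega>)) (if i = j then (s - r) * (\<integral>\<omega>. \<zeta> \<omega> \<partial>M) else 0)"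
      by (auto simp: mult.commute split: if_splits)
    from trans[OF this _ \<zeta>M ra(1) 7(2) ra(2)] show ?case by simp
  next
    case (8 r s i)
    have ra: "a \<le> r" "s \<le> b" "0 < sqrt (s - r)" using 8 t by auto
    have "sqrt (s - r) ^ 4 = ((sqrt (s - r))\<^sup>2)\<^sup>2" by simp
    also have "\<dots> = (s - r)\<^sup>2" using 8(2) by simp
    finally have "has_bochner_integral M (\<lambda>\<omega>. 1 * (\<lambda>z. z $ i ^ 4) (w s \<omega> - w r \<omega>)) (3 * (s - r)\<^sup>2)"
      using g(3)[OF ra(1) 8(2) ra(2,3), of i] by simp
    from trans[OF this _ _ ra(1) 8(2) ra(2)] show ?case by simp
  qed simp
qed

section \<open>The Isaacs identity and the exit time\<close>

text \<open>Since \<open>matrix_inv\<close> is defined by choice, an inverse has to be exhibited: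
  positive definiteness makes the kernel trivial, and for square matrices a left inverse is
  two-sided.\<close>

lemma pos_def_matrix_inv:
  assumes "pos_def A"
  shows "A ** matrix_inv A = mat 1" "matrix_inv A ** A = mat 1"
proof -
  have "\<forall>x. A *v x = 0 \<longrightarrow> x = 0" using assms unfolding pos_def_def by force
  then obtain B where "B ** A = mat 1" using matrix_left_invertible_ker[of A] by blast
  then have "A ** B = mat 1 \<and> B ** A = mat 1" by (simp add: matrix_left_right_inverse)
  then have "A ** matrix_inv A = mat 1 \<and> matrix_inv A ** A = mat 1"
    unfolding matrix_inv_def by (rule someI[of "\<lambda>B. A ** B = mat 1 \<and> B ** A = mat 1"])
  then show "A ** matrix_inv A = mat 1" "matrix_inv A ** A = mat 1" by auto
qed

lemma pos_def_quadratic_nonneg: "pos_def A \<Longrightarrow> 0 \<le> z \<bullet> (A *v z)"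
  unfolding pos_def_def by (cases "z = 0") (auto intro: less_imp_le)

lemma pos_def_symmetric:
  assumes "pos_def A"
  shows "x \<bullet> (A *v y) = y \<bullet> (A *v x)"
proof -
  have "x \<bullet> (A *v y) = (transpose A *v x) \<bullet> y" by (simp add: dot_lmul_matrix)
  also have "\<dots> = (A *v x) \<bullet> y" using assms by (simp only: pos_def_def)
  finally show ?thesis by (simp add: inner_commute)
qed

text \<open>From \<open>R *v q = transpose B *v y\<close> the mixed terms are
  \<open>y \<bullet> (B *v u)\<close>, and the constant term is the quadratic form that occurs in
  the equation. The first square vanishes at \<open>- q\<close>, the control of the minimiser, the
  second at \<open>q\<close>, that of the maximiser.\<close>

lemma complete_square:
  fixes u :: "real^'m" and y :: "real^'n" and B :: "real^'m^'n" and R :: "real^'m^'m"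
  assumes R: "pos_def R"
  defines "q \<equiv> matrix_inv R *v (transpose B *v y)"
  shows "(u + q) \<bullet> (R *v (u + q)) = u \<bullet> (R *v u) + 2 * (y \<bullet> (B *v u)) + y \<bullet> ((B ** matrix_inv R ** transpose B) *v y)"
    and "(u - q) \<bullet> (R *v (u - q)) = u \<bullet> (R *v u) - 2 * (y \<bullet> (B *v u)) + y \<bullet> ((B ** matrix_inv R ** transpose B) *v y)"
proof -
  have Rq: "R *v q = transpose B *v y"
    unfolding q_def using pos_def_matrix_inv(1)[OF R] by (simp add: matrix_vector_mul_assoc matrix_mul_assoc)
  have uq: "u \<bullet> (R *v q) = y \<bullet> (B *v u)"
    unfolding Rq transpose_matrix_vector by (subst inner_commute) (rule dot_lmul_matrix)
  have qu: "q \<bullet> (R *v u) = y \<bullet> (B *v u)" using pos_def_symmetric[OF R, of q u] uq by simp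
  have qq: "q \<bullet> (R *v q) = y \<bullet> ((B ** matrix_inv R ** transpose B) *v y)"
  proof -
    have "q \<bullet> (R *v q) = y \<bullet> (B *v q)"
      unfolding Rq transpose_matrix_vector by (subst inner_commute) (rule dot_lmul_matrix)
    also have "B *v q = (B ** matrix_inv R ** transpose B) *v y"
      unfolding q_def by (simp only: matrix_vector_mul_assoc matrix_mul_assoc)
    finally show ?thesis .
  qed
  show "(u + q) \<bullet> (R *v (u + q)) = u \<bullet> (R *v u) + 2 * (y \<bullet> (B *v u)) + y \<bullet> ((B ** matrix_inv R ** transpose B) *v y)"
    using uq qu qq by (simp add: matrix_vector_right_distrib inner_add_left inner_add_right)
  show "(u - q) \<bullet> (R *v (u - q)) = u \<bullet> (R *v u) - 2 * (y \<bullet> (B *v u)) + y \<bullet> ((B ** matrix_inv R ** transpose B) *v y)"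
    using uq qu qq by (simp add: matrix_vector_mult_diff_distrib inner_diff_left inner_diff_right)
qed

text \<open>The equation replaces the time derivative, and its quadratic term supplies exactly the
  constants of the two completed squares. A departure of \<open>u\<close> from \<open>ustar\<close>
  can only raise the drift of \<open>J\<close> plus the running cost, a departure of
  \<open>v\<close> from \<open>vstar\<close> can only lower it.\<close>

lemma HJI_complete_square:
  fixes G :: "('n::finite, 'm::finite, 'l::finite, 'k::finite) game"
  assumes game: "game_data G" and hji: "HJI_equation G Jt Jx Jxx" and cyl: "(\<xi> s, s) \<in> cyl G"
    and us: "ustar (\<xi> s) s = - (matrix_inv (weight_u G (\<xi> s) s) *v (transpose (gain_u G (\<xi> s) s) *v Jx (\<xi> s) s))"
    and vs: "vstar (\<xi> s) s = matrix_inv (weight_v G (\<xi> s) s) *v (transpose (gain_v G (\<xi> s) s) *v Jx (\<xi> s) s)"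
  shows "Jx (\<xi> s) s \<bullet> velocity G u v \<xi> s + Jt (\<xi> s) s
      + 1/2 * trace (diffusion G (\<xi> s) s ** transpose (diffusion G (\<xi> s) s) ** Jxx (\<xi> s) s)
    = - running_cost G u v \<xi> s
      + 1/2 * ((u s \<xi> - ustar (\<xi> s) s) \<bullet> (weight_u G (\<xi> s) s *v (u s \<xi> - ustar (\<xi> s) s)))
      - 1/2 * ((v s \<xi> - vstar (\<xi> s) s) \<bullet> (weight_v G (\<xi> s) s *v (v s \<xi> - vstar (\<xi> s) s)))"
proof -
  define x where "x = \<xi> s"
  have s: "s \<in> {init_time G..end_time G}" using cyl by (auto simp: cyl_def)
  have pd: "pos_def (weight_u G x s)" "pos_def (weight_v G x s)"
    using game s by (auto simp: game_data_def)
  let ?y = "Jx x s" and ?Gu = "gain_u G x s" and ?Gv = "gain_v G x s" and ?Ru = "weight_u G x s" and ?Rv = "weight_v G x s"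
  have H: "- Jt x s = state_cost G x s + drift G x s \<bullet> ?y
      + 1/2 * trace (diffusion G x s ** transpose (diffusion G x s) ** Jxx x s)
      + 1/2 * (?y \<bullet> ((?Gv ** matrix_inv ?Rv ** transpose ?Gv - ?Gu ** matrix_inv ?Ru ** transpose ?Gu) *v ?y))"
    using hji cyl by (auto simp: HJI_equation_def x_def)
  note cu = complete_square(1)[OF pd(1), of "u s \<xi>" ?Gu ?y]
  note cv = complete_square(2)[OF pd(2), of "v s \<xi>" ?Gv ?y]
  have vel: "?y \<bullet> velocity G u v \<xi> s = drift G x s \<bullet> ?y + ?y \<bullet> (?Gu *v u s \<xi>) + ?y \<bullet> (?Gv *v v s \<xi>)"
    by (simp add: velocity_def x_def inner_add_right inner_commute)
  have split: "?y \<bullet> ((?Gv ** matrix_inv ?Rv ** transpose ?Gv - ?Gu ** matrix_inv ?Ru ** transpose ?Gu) *v ?y)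
      = ?y \<bullet> ((?Gv ** matrix_inv ?Rv ** transpose ?Gv) *v ?y) - ?y \<bullet> ((?Gu ** matrix_inv ?Ru ** transpose ?Gu) *v ?y)"
    by (simp only: matrix_vector_mult_diff_rdistrib inner_diff_right)
  show ?thesis
    unfolding x_def[symmetric] us[folded x_def] vs[folded x_def] running_cost_def diff_minus_eq_add cu cv
    using H vel unfolding split by (simp add: field_simps)
qed

lemma exit_time_bounds:
  assumes "t \<le> end_time G"
  shows "t \<le> exit_time G t \<xi>" "exit_time G t \<xi> \<le> end_time G"
    "\<And>s. t < s \<Longrightarrow> s < exit_time G t \<xi> \<Longrightarrow> (\<xi> s, s) \<in> cyl G"
proof -
  let ?S = "{s. t < s \<and> (\<xi> s, s) \<notin> cyl G}"
  have bdd: "bdd_below ?S" by (rule bdd_belowI[of _ t]) auto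
  have in_S: "s \<in> ?S" if "s > end_time G" for s using that assms by (auto simp: cyl_def)
  then have ne: "?S \<noteq> {}" using gt_ex by blast
  show "t \<le> exit_time G t \<xi>" unfolding exit_time_def by (rule cInf_greatest[OF ne]) auto
  show "exit_time G t \<xi> \<le> end_time G"
  \<comment> \<open>If \<open>t\<close> is the terminal time, the set over which the infimum is
    taken begins strictly after it, so that the infimum is approached and not attained.\<close>
  proof (rule field_le_epsilon)
    fix e :: real assume "e > 0"
    then show "exit_time G t \<xi> \<le> end_time G + e"
      unfolding exit_time_def by (intro cInf_lower[OF in_S bdd]) simp
  qed
  show "(\<xi> s, s) \<in> cyl G" if "t < s" "s < exit_time G t \<xi>" for s
  proof (rule ccontr)
    assume "(\<xi> s, s) \<notin> cyl G"
    then have "exit_time G t \<xi> \<le> s" unfolding exit_time_def using that by (intro cInf_lower[OF _ bdd]) simp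
    then show False using that by simp
  qed
qed

lemma exit_time_least:
  assumes "t \<le> end_time G" "t < s" "\<And>r. t < r \<Longrightarrow> r \<le> s \<Longrightarrow> (\<xi> r, r) \<in> cyl G"
  shows "s \<le> exit_time G t \<xi>"
  unfolding exit_time_def
proof (rule cInf_greatest)
  have "end_time G + 1 \<in> {s. t < s \<and> (\<xi> s, s) \<notin> cyl G}" using assms(1) by (auto simp: cyl_def)
  then show "{s. t < s \<and> (\<xi> s, s) \<notin> cyl G} \<noteq> {}" by blast
  fix r assume "r \<in> {s. t < s \<and> (\<xi> s, s) \<notin> cyl G}"
  then show "s \<le> r" using assms(3)[of r] by (cases "r \<le> s") auto
qed

text \<open>Before the exit the path is in the safe set, so at the exit it is in the closure. If it
  were in the open safe set before the terminal time, it would by continuity remain in the cylinder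
  a little longer, contradicting the infimum. An immediate exit is covered by the hypothesis on the
  starting point.\<close>

lemma exit_point:
  fixes G :: "('n::finite, 'm::finite, 'l::finite, 'k::finite) game"
  assumes G: "game_data G" and t: "t \<in> {init_time G..end_time G}" and \<xi>: "continuous_on {t..end_time G} \<xi>"
    and start: "\<xi> t \<in> closure (safe_set G)"
  shows "(\<xi> (exit_time G t \<xi>), exit_time G t \<xi>) \<in> cyl_boundary G"
proof -
  let ?\<tau> = "exit_time G t \<xi>"
  have op: "open (safe_set G)" using G by (simp add: game_data_def)
  have tT: "t \<le> end_time G" using t by simp
  note b = exit_time_bounds[where \<xi> = \<xi>, OF tT]
  have closure_in: "\<xi> ?\<tau> \<in> closure (safe_set G)"
  proof (cases "?\<tau> = t")
    case False
    then have lt: "t < ?\<tau>" using b by simp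
    have "continuous_on {t..?\<tau>} \<xi>" using \<xi> by (rule continuous_on_subset) (use b in auto)
    moreover have "closure {t<..<?\<tau>} = {t..?\<tau>}" using lt by simp
    ultimately have "\<xi> ` {t..?\<tau>} \<subseteq> closure (\<xi> ` {t<..<?\<tau>})"
      by (metis closure_subset continuous_on_closure_sequentially image_closure_subset closed_closure)
    moreover have "\<xi> ` {t<..<?\<tau>} \<subseteq> safe_set G" using b(3) by (auto simp: cyl_def)
    moreover have "\<xi> ?\<tau> \<in> \<xi> ` {t..?\<tau>}" using lt by auto
    ultimately show ?thesis using closure_mono[of "\<xi> ` {t<..<?\<tau>}" "safe_set G"] by blast
  qed (use start in simp)
  show ?thesis
  proof (cases "?\<tau> = end_time G")
    case True
    then show ?thesis
      using closure_in op t by (auto simp: cyl_boundary_def frontier_def interior_open)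
  next
    case False
    then have lt: "?\<tau> < end_time G" using b by simp
    have "\<xi> ?\<tau> \<notin> safe_set G"
    proof
      assume safe: "\<xi> ?\<tau> \<in> safe_set G"
      have "continuous (at ?\<tau> within {t..end_time G}) \<xi>"
        using \<xi> b by (auto simp: continuous_on_eq_continuous_within)
      then have "\<forall>\<^sub>F r in at ?\<tau> within {t..end_time G}. \<xi> r \<in> safe_set G"
        using safe op by (auto simp: continuous_within tendsto_def)
      then obtain d where d: "d > 0" "\<And>r. r \<in> {t..end_time G} \<Longrightarrow> r \<noteq> ?\<tau> \<Longrightarrow> dist r ?\<tau> < d \<Longrightarrow> \<xi> r \<in> safe_set G"
        unfolding eventually_at by auto
      define s where "s = min (?\<tau> + d / 2) ((?\<tau> + end_time G) / 2)"
      have s: "?\<tau> < s" "s < end_time G" "s < ?\<tau> + d" using d lt by (auto simp: s_def min_def)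
      have "(\<xi> r, r) \<in> cyl G" if "t < r" "r \<le> s" for r
      proof (cases "r < ?\<tau>")
        case True
        then show ?thesis using b(3) that by simp
      next
        case False
        have "\<xi> r \<in> safe_set G"
        proof (cases "r = ?\<tau>")
          case ne: False
          show ?thesis by (rule d(2)) (use that False ne s in \<open>auto simp: dist_real_def\<close>)
        qed (use safe in simp)
        then show ?thesis using that s t by (simp add: cyl_def)
      qed
      then have "s \<le> ?\<tau>" using s b by (intro exit_time_least[OF tT]) auto
      then show False using s by simp
    qed
    then show ?thesis using closure_in op t b by (auto simp: cyl_boundary_def frontier_def interior_open)
  qed
qed

section \<open>Path events and policies\<close>

text \<open>For a continuous path the condition on all times follows from that on a countable dense
  set of times, because the times at which it holds form a closed set.\<close>

lemma path_in_closed_set_event: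
  fixes X :: "real \<Rightarrow> 'w \<Rightarrow> 'b::metric_space"
  assumes K: "closed K" and X: "\<And>\<omega>. \<omega> \<in> space F \<Longrightarrow> continuous_on {a..b} (\<lambda>r. X r \<omega>)"
    and m: "\<And>r. r \<in> {a..b} \<Longrightarrow> X r \<in> borel_measurable F"
  shows "{\<omega> \<in> space F. \<forall>r\<in>{a..b}. X r \<omega> \<in> K} \<in> sets F"
proof -
  obtain D where D: "countable D" "D \<subseteq> {a..b}" "{a..b} \<subseteq> closure D" using separable[of "{a..b}"] by blast
  have "{\<omega> \<in> space F. \<forall>r\<in>{a..b}. X r \<omega> \<in> K} = {\<omega> \<in> space F. \<forall>r\<in>D. X r \<omega> \<in> K}"
  proof (intro equalityI subsetI)
    fix \<omega> assume "\<omega> \<in> {\<omega> \<in> space F. \<forall>r\<in>D. X r \<omega> \<in> K}"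
    then have \<omega>: "\<omega> \<in> space F" "D \<subseteq> {a..b} \<inter> (\<lambda>r. X r \<omega>) -` K" using D by auto
    have "closed ({a..b} \<inter> (\<lambda>r. X r \<omega>) -` K)"
      by (rule continuous_closed_preimage[OF X[OF \<omega>(1)] _ K]) simp
    then have "closure D \<subseteq> {a..b} \<inter> (\<lambda>r. X r \<omega>) -` K" using \<omega>(2) by (rule closure_minimal[rotated])
    then show "\<omega> \<in> {\<omega> \<in> space F. \<forall>r\<in>{a..b}. X r \<omega> \<in> K}" using \<omega>(1) D(3) by auto
  qed (use D in auto)
  also have "\<dots> = space F - (\<Union>r\<in>D. space F - (X r -` K \<inter> space F))" by auto
  also have "\<dots> \<in> sets F"
    using D m K by (intro sets.Diff sets.top sets.countable_UN' measurable_sets[of _ F borel]) auto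
  finally show ?thesis .
qed

text \<open>
  For \<open>U = UNIV\<close> the distance to the empty complement is 0, so that \<open>inner_set UNIV k\<close> is empty.
\<close>

definition inner_set :: "'a::metric_space set \<Rightarrow> nat \<Rightarrow> 'a set" where
  "inner_set U k = {y. infdist y (- U) \<ge> 1 / real (Suc k)}"

lemma closed_inner_set: "closed (inner_set U k)"
  unfolding inner_set_def by (intro closed_Collect_le continuous_intros)

lemma inner_set_subset: "inner_set U k \<subseteq> U"
proof
  fix y assume y: "y \<in> inner_set U k"
  show "y \<in> U"
  proof (rule ccontr)
    assume "y \<notin> U"
    then have "infdist y (- U) = 0" by (intro infdist_zero) simp
    moreover have "0 < 1 / real (Suc k)" by simp
    ultimately show False using y unfolding inner_set_def mem_Collect_eq by linarith
  qed
qed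

lemma inner_set_mono: "k \<le> l \<Longrightarrow> inner_set U k \<subseteq> inner_set U l"
  unfolding inner_set_def
  by (auto intro: order_trans[rotated] simp: frac_le)

lemma compact_in_inner_set:
  assumes "compact S" "S \<subseteq> U" "open U" "U \<noteq> UNIV"
  shows "\<exists>k. S \<subseteq> inner_set U k"
proof (cases "S = {}")
  case False
  have "continuous_on S (\<lambda>y. infdist y (- U))" by (intro continuous_intros)
  from continuous_attains_inf[OF assms(1) False this]
  obtain y0 where y0: "y0 \<in> S" "\<And>y. y \<in> S \<Longrightarrow> infdist y0 (- U) \<le> infdist y (- U)" by blast
  have "infdist y0 (- U) \<noteq> 0"
    using in_closed_iff_infdist_zero[of "- U" y0] assms y0(1) by auto
  then have pos: "infdist y0 (- U) > 0" using infdist_nonneg[of y0 "- U"] by linarith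
  obtain k where "inverse (real (Suc k)) < infdist y0 (- U)" using reals_Archimedean[OF pos] by blast
  then have "S \<subseteq> inner_set U k"
    unfolding inner_set_def using y0(2) by (fastforce simp: inverse_eq_divide)
  then show ?thesis ..
qed auto

text \<open>The left endpoint is excluded because the path may start on the boundary of
  \<open>U\<close>. The interval is exhausted by compact ones, and on each of these the path keeps a
  positive distance from the complement, which reduces the event to countably many closed
  conditions.\<close>

lemma path_in_open_set_event:
  fixes X :: "real \<Rightarrow> 'w \<Rightarrow> 'b::metric_space"
  assumes U: "open U" "U \<noteq> UNIV" and X: "\<And>\<omega>. \<omega> \<in> space F \<Longrightarrow> continuous_on {a..b} (\<lambda>r. X r \<omega>)"
    and m: "\<And>r. r \<in> {a..b} \<Longrightarrow> X r \<in> borel_measurable F"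
  shows "{\<omega> \<in> space F. \<forall>r\<in>{a<..b}. X r \<omega> \<in> U} \<in> sets F"
proof (cases "a < b")
  case False
  then show ?thesis by simp
next
  case True
  define c where "c n = a + (b - a) / real (Suc n)" for n
  have c: "a < c n" for n using True by (simp add: c_def)
  have "{\<omega> \<in> space F. \<forall>r\<in>{a<..b}. X r \<omega> \<in> U} = (\<Inter>n. \<Union>k. {\<omega> \<in> space F. \<forall>r\<in>{c n..b}. X r \<omega> \<in> inner_set U k})"
  proof (intro equalityI subsetI)
    fix \<omega> assume \<omega>: "\<omega> \<in> {\<omega> \<in> space F. \<forall>r\<in>{a<..b}. X r \<omega> \<in> U}"
    have "\<exists>k. \<omega> \<in> {\<omega> \<in> space F. \<forall>r\<in>{c n..b}. X r \<omega> \<in> inner_set U k}" for n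
    proof -
      have "continuous_on {c n..b} (\<lambda>r. X r \<omega>)"
        by (rule continuous_on_subset[OF X]) (use \<omega> c[of n] in auto)
      then have "compact ((\<lambda>r. X r \<omega>) ` {c n..b})" by (rule compact_continuous_image) simp
      moreover have "(\<lambda>r. X r \<omega>) ` {c n..b} \<subseteq> U" using \<omega> c[of n] by auto
      ultimately obtain k where "(\<lambda>r. X r \<omega>) ` {c n..b} \<subseteq> inner_set U k"
        using compact_in_inner_set[OF _ _ U] by metis
      then show ?thesis using \<omega> by (intro exI[of _ k]) auto
    qed
    then show "\<omega> \<in> (\<Inter>n. \<Union>k. {\<omega> \<in> space F. \<forall>r\<in>{c n..b}. X r \<omega> \<in> inner_set U k})" by blast
  next
    fix \<omega> assume \<omega>: "\<omega> \<in> (\<Inter>n. \<Union>k. {\<omega> \<in> space F. \<forall>r\<in>{c n..b}. X r \<omega> \<in> inner_set U k})"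
    have "X r \<omega> \<in> U" if r: "r \<in> {a<..b}" for r
    proof -
      have "c \<longlonglongrightarrow> a + 0" unfolding c_def by (intro tendsto_add tendsto_const mesh_tendsto_0)
      then have "\<forall>\<^sub>F n in sequentially. c n < r" using r by (intro order_tendstoD(2)) auto
      then obtain n where "c n < r" by (auto dest: eventually_happens)
      then have "r \<in> {c n..b}" using r by simp
      moreover have "\<exists>k. \<forall>r\<in>{c n..b}. X r \<omega> \<in> inner_set U k" using \<omega> by auto
      ultimately obtain k where "X r \<omega> \<in> inner_set U k" by blast
      then show ?thesis by (rule subsetD[OF inner_set_subset])
    qed
    then show "\<omega> \<in> {\<omega> \<in> space F. \<forall>r\<in>{a<..b}. X r \<omega> \<in> U}" using \<omega> by auto
  qed
  also have "\<dots> \<in> sets F"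
  proof -
    have "{\<omega> \<in> space F. \<forall>r\<in>{c n..b}. X r \<omega> \<in> inner_set U k} \<in> sets F" for n k
    proof (rule path_in_closed_set_event[OF closed_inner_set])
      show "continuous_on {c n..b} (\<lambda>r. X r \<omega>)" if "\<omega> \<in> space F" for \<omega>
        by (rule continuous_on_subset[OF X[OF that]]) (use c[of n] in auto)
      show "X r \<in> borel_measurable F" if "r \<in> {c n..b}" for r
        by (rule m) (use c[of n] that in auto)
    qed
    then have "(\<Union>k. {\<omega> \<in> space F. \<forall>r\<in>{c n..b}. X r \<omega> \<in> inner_set U k}) \<in> sets F" for n
      by (intro sets.countable_nat_UN) auto
    then show ?thesis by (intro sets.countable_INT') auto
  qed
  finally show ?thesis .
qed

lemma path_map_measurable:
  fixes X :: "real \<Rightarrow> 'w \<Rightarrow> real^'n"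
  assumes X: "\<And>\<omega>. \<omega> \<in> space F \<Longrightarrow> continuous_on {t..T} (\<lambda>r. X r \<omega>)"
    and m: "\<And>r. r \<in> {t..s} \<Longrightarrow> X r \<in> borel_measurable F"
  shows "(\<lambda>\<omega> r. X r \<omega>) \<in> measurable F (past_states t T s)"
  unfolding past_states_def
proof (rule measurable_measure_of)
  show "{{\<xi>. continuous_on {t..T} \<xi> \<and> \<xi> r \<in> B} |r B. r \<in> {t..s} \<and> B \<in> sets borel} \<subseteq> Pow {\<xi>. continuous_on {t..T} \<xi>}"
    by auto
  show "(\<lambda>\<omega> r. X r \<omega>) \<in> space F \<rightarrow> {\<xi>. continuous_on {t..T} \<xi>}" using X by auto
  fix A :: "(real \<Rightarrow> real^'n) set" assume "A \<in> {{\<xi>. continuous_on {t..T} \<xi> \<and> \<xi> r \<in> B} |r B. r \<in> {t..s} \<and> B \<in> sets borel}"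
  then obtain r B where A: "A = {\<xi>. continuous_on {t..T} \<xi> \<and> \<xi> r \<in> B}" "r \<in> {t..s}" "B \<in> sets borel" by blast
  have "(\<lambda>\<omega> r. X r \<omega>) -` A \<inter> space F = X r -` B \<inter> space F" using X by (auto simp: A)
  then show "(\<lambda>\<omega> r. X r \<omega>) -` A \<inter> space F \<in> sets F"
    using measurable_sets[OF m[OF A(2)] A(3)] by simp
qed

text \<open>Composition of the policy with the map from chance to paths, which is measurable into
  the past states as soon as the state process is adapted.\<close>

lemma policy_jointly_measurable:
  fixes u :: "('n::finite, 'm::finite) policy"
  assumes u: "nonanticipative t T u" and s: "s \<in> {t..<T}"
    and X: "\<And>\<omega>. \<omega> \<in> space F \<Longrightarrow> continuous_on {t..T} (\<lambda>r. X r \<omega>)"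
    and m: "\<And>r. r \<in> {t..s} \<Longrightarrow> X r \<in> borel_measurable F"
  shows "(\<lambda>(r, \<omega>). u r (\<lambda>q. X q \<omega>)) \<in> borel_measurable (restrict_space borel {t..s} \<Otimes>\<^sub>M F)"
proof -
  have "(\<lambda>(r, \<xi>). u r \<xi>) \<in> borel_measurable (restrict_space borel {t..s} \<Otimes>\<^sub>M past_states t T s)"
    using u s by (simp add: nonanticipative_def progressive_def)
  moreover have "(\<lambda>z. (fst z, \<lambda>r. X r (snd z))) \<in> measurable (restrict_space borel {t..s} \<Otimes>\<^sub>M F) (restrict_space borel {t..s} \<Otimes>\<^sub>M past_states t T s)"
    by (intro measurable_Pair measurable_fst measurable_compose[OF measurable_snd path_map_measurable[OF X m]])
  ultimately have "(\<lambda>z. (\<lambda>(r, \<xi>). u r \<xi>) (fst z, \<lambda>r. X r (snd z))) \<in> borel_measurable (restrict_space borel {t..s} \<Otimes>\<^sub>M F)"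
    by (rule measurable_compose[rotated])
  then show ?thesis by (simp add: split_beta')
qed

lemma coefficient_jointly_measurable:
  fixes h :: "real^'n \<Rightarrow> real \<Rightarrow> 'b::topological_space"
    and G :: "('n::finite, 'm::finite, 'l::finite, 'k::finite) game"
  assumes h: "coeff_measurable G h" and s: "{t..s} \<subseteq> {init_time G..end_time G}"
    and X: "\<And>\<omega>. \<omega> \<in> space F \<Longrightarrow> continuous_on {t..s} (\<lambda>r. X r \<omega>)"
    and m: "\<And>r. r \<in> {t..s} \<Longrightarrow> X r \<in> borel_measurable F"
  shows "(\<lambda>(r, \<omega>). h (X r \<omega>) r) \<in> borel_measurable (restrict_space borel {t..s} \<Otimes>\<^sub>M F)"
proof -
  have XJ: "(\<lambda>z. X (fst z) (snd z)) \<in> borel_measurable (restrict_space borel {t..s} \<Otimes>\<^sub>M F)"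
    using continuous_paths_jointly_measurable[OF X m] by (simp add: split_beta')
  have f: "fst \<in> borel_measurable (restrict_space borel {t..s} \<Otimes>\<^sub>M F)"
    by (rule measurable_compose[OF measurable_fst measurable_restrict_space1]) simp
  have "(\<lambda>z. (X (fst z) (snd z), fst z)) \<in> measurable (restrict_space borel {t..s} \<Otimes>\<^sub>M F)
      (restrict_space borel (UNIV \<times> {init_time G..end_time G}))"
  proof (rule measurable_restrict_space2)
    show "(\<lambda>z. (X (fst z) (snd z), fst z)) \<in> space (restrict_space borel {t..s} \<Otimes>\<^sub>M F) \<rightarrow> UNIV \<times> {init_time G..end_time G}"
      using s by (auto simp: space_pair_measure space_restrict_space)
    show "(\<lambda>z. (X (fst z) (snd z), fst z)) \<in> borel_measurable (restrict_space borel {t..s} \<Otimes>\<^sub>M F)"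
      using XJ f by (rule borel_measurable_Pair)
  qed
  from measurable_compose[OF this h[unfolded coeff_measurable_def]] show ?thesis by (simp add: split_beta')
qed

text \<open>
  On the closed cylinder \<open>J\<close> is continuous along sequences that approach from the cylinder, because
  its boundary values are its limits.
\<close>

locale HJI_solution =
  fixes G :: "('n::finite, 'm::finite, 'l::finite, 'k::finite) game"
    and J Jt :: "real^'n \<Rightarrow> real \<Rightarrow> real" and Jx :: "real^'n \<Rightarrow> real \<Rightarrow> real^'n"
    and Jxx :: "real^'n \<Rightarrow> real \<Rightarrow> real^'n^'n"
  assumes game: "game_data G"
    and smooth: "C12_derivs G J Jt Jx Jxx"
    and hji: "HJI_equation G Jt Jx Jxx"
    and boundary: "HJI_boundary G J"
    and boundary_values: "\<forall>(y, s)\<in>cyl_boundary G. J y s = phi G y"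
begin

lemma safe_open: "open (safe_set G)" and safe_bounded: "bounded (safe_set G)" and times: "init_time G < end_time G"
  using game by (auto simp: game_data_def)

lemma safe_not_UNIV: "safe_set G \<noteq> UNIV"
  using safe_bounded not_bounded_UNIV by metis

lemma J_continuous: "continuous_on (cyl G) (\<lambda>(x, s). J x s)"
  unfolding cyl_def
proof (rule continuous_on_of_partial_derivatives[OF safe_open, where Jt = Jt and Jx = Jx])
  show "((\<lambda>s. J x s) has_real_derivative Jt x s) (at s within {init_time G..<end_time G})"
    if "x \<in> safe_set G" "s \<in> {init_time G..<end_time G}" for x s
    using smooth that by (auto simp: C12_derivs_def cyl_def)
  show "((\<lambda>y. J y s) has_derivative (\<lambda>h. Jx x s \<bullet> h)) (at x)"
    if "x \<in> safe_set G" "s \<in> {init_time G..<end_time G}" for x s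
    using smooth that by (auto simp: C12_derivs_def cyl_def gderiv_def inner_commute)
  show "continuous_on (safe_set G \<times> {init_time G..<end_time G}) (\<lambda>(x, s). Jx x s)"
    using smooth by (simp add: C12_derivs_def cyl_def)
qed

lemma J_limit:
  assumes z: "\<And>n. z n \<in> cyl G" "z \<longlonglongrightarrow> z0" and z0: "z0 \<in> cyl G \<union> cyl_boundary G"
  shows "(\<lambda>n. J (fst (z n)) (snd (z n))) \<longlonglongrightarrow> J (fst z0) (snd z0)"
proof (cases "z0 \<in> cyl G")
  case True
  from continuous_on_tendsto_compose[OF J_continuous z(2) True] z(1) show ?thesis by (simp add: split_beta')
next
  case False
  then have b: "z0 \<in> cyl_boundary G" using z0 by simp
  have "z n \<noteq> z0" for n using z(1)[of n] False by metis
  then have "filterlim z (at z0 within cyl G) sequentially"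
    using z by (simp add: filterlim_at)
  moreover have "((\<lambda>(x, s). J x s) \<longlongrightarrow> phi G (fst z0)) (at z0 within cyl G)"
    using boundary b by (auto simp: HJI_boundary_def)
  ultimately have "(\<lambda>n. (\<lambda>(x, s). J x s) (z n)) \<longlonglongrightarrow> phi G (fst z0)" by (rule filterlim_compose[rotated])
  then show ?thesis using boundary_values b by (auto simp: split_beta')
qed

lemma closure_cases:
  assumes "y \<in> closure (safe_set G)" "s \<in> {init_time G..end_time G}"
  shows "(y, s) \<in> cyl G \<union> cyl_boundary G"
  using assms safe_open by (auto simp: cyl_def cyl_boundary_def frontier_def interior_open)

text \<open>A sequence in the cylinder along which \<open>J\<close> is unbounded would have a
  subsequence converging in the compact closure, and along it \<open>J\<close> has a finite limit,
  at boundary points by the boundary condition.\<close>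

lemma J_bounded:
  obtains B where "\<And>y s. (y, s) \<in> cyl G \<Longrightarrow> \<bar>J y s\<bar> \<le> B"
proof -
  have "\<exists>B. \<forall>z\<in>cyl G. \<bar>J (fst z) (snd z)\<bar> \<le> B"
  proof (rule ccontr)
    assume "\<not> ?thesis"
    then have "\<forall>n. \<exists>z\<in>cyl G. \<bar>J (fst z) (snd z)\<bar> > real n" by (metis not_le)
    then obtain z where z: "\<And>n. z n \<in> cyl G" "\<And>n. \<bar>J (fst (z n)) (snd (z n))\<bar> > real n" by metis
    have "compact (closure (safe_set G) \<times> {init_time G..end_time G})"
      using safe_bounded by (intro compact_Times compact_Icc) simp
    moreover have "z n \<in> closure (safe_set G) \<times> {init_time G..end_time G}" for n
      using z(1)[of n] closure_subset[of "safe_set G"] by (auto simp: cyl_def)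
    ultimately obtain l r where l: "l \<in> closure (safe_set G) \<times> {init_time G..end_time G}" "strict_mono r" "(z \<circ> r) \<longlonglongrightarrow> l"
      unfolding compact_def by metis
    have "(\<lambda>n. J (fst ((z \<circ> r) n)) (snd ((z \<circ> r) n))) \<longlonglongrightarrow> J (fst l) (snd l)"
      by (rule J_limit[OF _ l(3)]) (use z(1) l(1) closure_cases[of "fst l" "snd l"] in \<open>auto simp: mem_Times_iff\<close>)
    then have "Bseq (\<lambda>n. J (fst ((z \<circ> r) n)) (snd ((z \<circ> r) n)))" by (intro convergent_imp_Bseq convergentI)
    then obtain B where B: "\<And>n. norm (J (fst ((z \<circ> r) n)) (snd ((z \<circ> r) n))) \<le> B" by (auto simp: Bseq_def)
    obtain n where "B < real n" using reals_Archimedean2 by blast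
    also have "real n \<le> real (r n)" using seq_suble[OF l(2)] by simp
    also have "\<dots> < \<bar>J (fst (z (r n))) (snd (z (r n)))\<bar>" by (rule z(2))
    finally show False using B[of n] by simp
  qed
  then obtain B where "\<forall>z\<in>cyl G. \<bar>J (fst z) (snd z)\<bar> \<le> B" ..
  then show thesis by (intro that[of B]) fastforce
qed

lemma J_on_cyl_measurable: "(\<lambda>z. indicat_real (cyl G) z * J (fst z) (snd z)) \<in> borel_measurable borel"
proof -
  have "cyl G \<in> sets borel"
    unfolding cyl_def using safe_open by (intro borel_Times) auto
  from borel_measurable_continuous_on_indicator[OF this J_continuous] show ?thesis by (simp add: split_beta')
qed

text \<open>Measurability of the terminal cost is not among the data of the game. It follows from
  the boundary condition, which makes the terminal cost on the safe set a pointwise limit of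
  \<open>J\<close> at times increasing to the end.\<close>

lemma phi_measurable: "phi G \<in> borel_measurable borel"
proof -
  define r where "r n = end_time G - (end_time G - init_time G) / real (Suc n)" for n
  have r: "r n \<in> {init_time G..<end_time G}" for n
  proof -
    have "(end_time G - init_time G) / real (Suc n) \<le> end_time G - init_time G"
      using times by (simp add: divide_le_eq)
    then show ?thesis using times by (simp add: r_def)
  qed
  have rl: "r \<longlonglongrightarrow> end_time G - 0" unfolding r_def by (intro tendsto_diff tendsto_const mesh_tendsto_0)
  define f where "f n y = indicat_real (cyl G) (y, r n) * J y (r n) + exit_weight G * indicat_real (frontier (safe_set G)) y" for n y
  have fr: "frontier (safe_set G) \<in> sets borel" by simp
  show ?thesis
  proof (rule borel_measurable_LIMSEQ_real)
    show "f n \<in> borel_measurable borel" for n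
    proof -
      have "(\<lambda>y. (\<lambda>z. indicat_real (cyl G) z * J (fst z) (snd z)) (y, r n)) \<in> borel_measurable borel"
        by (rule measurable_compose[OF _ J_on_cyl_measurable]) (simp add: borel_prod[symmetric])
      then show ?thesis unfolding f_def[abs_def] using fr by simp
    qed
    fix y
    show "(\<lambda>n. f n y) \<longlonglongrightarrow> phi G y"
    proof (cases "y \<in> safe_set G")
      case True
      have c: "(y, r n) \<in> cyl G" for n using True r by (simp add: cyl_def)
      have b: "(y, end_time G) \<in> cyl_boundary G" using True by (simp add: cyl_boundary_def)
      have "(\<lambda>n. J (fst (y, r n)) (snd (y, r n))) \<longlonglongrightarrow> J (fst (y, end_time G)) (snd (y, end_time G))"
        by (rule J_limit[OF c]) (use b rl in \<open>auto intro!: tendsto_intros\<close>)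
      moreover have "y \<notin> frontier (safe_set G)" using True safe_open by (auto simp: frontier_def interior_open)
      ultimately show ?thesis using c boundary_values b by (auto simp: f_def)
    next
      case False
      then have "(y, r n) \<notin> cyl G" for n by (simp add: cyl_def)
      then show ?thesis using False by (simp add: f_def phi_def)
    qed
  qed
qed

end

section \<open>Verification\<close>

lemma half_step:
  assumes "0 < d"
  shows "0 < d / 2 / real (Suc n)" "d / 2 / real (Suc n) < d"
proof -
  have "d / 2 / real (Suc n) \<le> d / 2 / 1" using assms by (intro divide_left_mono) auto
  also have "\<dots> < d" using assms by simp
  finally show "d / 2 / real (Suc n) < d" .
qed (use assms in simp)

lemma half_step_tendsto: "(\<lambda>n. d / 2 / real (Suc n)) \<longlonglongrightarrow> 0"
  using mesh_tendsto_0[of "d / 2" 0] by simp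

text \<open>One pair of policies, one starting point and one solution. The terminal time is excluded
  as a starting time; there the game is over at once and is treated separately.\<close>

locale verification = HJI_solution G J Jt Jx Jxx + prob_space M
  for G :: "('n::finite, 'm::finite, 'l::finite, 'k::finite) game" and J Jt Jx Jxx and M :: "'w measure" +
  fixes w :: "real \<Rightarrow> 'w \<Rightarrow> real^'k" and x :: "real^'n" and t :: real
    and u :: "('n, 'm) policy" and v :: "('n, 'l) policy" and X :: "real \<Rightarrow> 'w \<Rightarrow> real^'n"
  assumes wiener: "wiener_process M (init_time G) (end_time G) w"
    and x: "x \<in> closure (safe_set G)" and t: "t \<in> {init_time G..<end_time G}"
    and u: "nonanticipative t (end_time G) u" and v: "nonanticipative t (end_time G) v"
    and sol: "strong_solution M w G x t u v X"
    and cint: "cost_integrable M G t u v X"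
begin

abbreviation "T \<equiv> end_time G"
abbreviation "Filt s \<equiv> wiener_filtration M w t s"
abbreviation "traj \<omega> \<equiv> (\<lambda>r. X r \<omega>)"

definition tau :: "'w \<Rightarrow> real" where "tau \<omega> = exit_time G t (traj \<omega>)"

text \<open>Cut off at the exit time, so that all integrals can be taken over the whole
  line.\<close>

definition running :: "'w \<Rightarrow> real \<Rightarrow> real" where
  "running \<omega> r = indicat_real {t..<tau \<omega>} r * running_cost G u v (traj \<omega>) r"

text \<open>Time \<open>t\<close> itself is omitted, in accordance with the exit time, which only
  looks at later times.\<close>

definition alive :: "real \<Rightarrow> 'w set" where
  "alive s = {\<omega> \<in> space M. \<forall>r\<in>{t<..s}. X r \<omega> \<in> safe_set G}"

lemma Filt_le: "s \<le> T \<Longrightarrow> sets (Filt s) \<subseteq> sets M"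
  using t by (intro wiener_filtration_le[OF wiener]) auto

lemma Filt_measurable_M: "s \<le> T \<Longrightarrow> f \<in> measurable (Filt s) L \<Longrightarrow> f \<in> measurable M L"
  using measurable_mono[OF subset_refl refl Filt_le[of s], of L] by auto

lemma Filt_measurable_mono: "r \<le> s \<Longrightarrow> f \<in> measurable (Filt r) L \<Longrightarrow> f \<in> measurable (Filt s) L"
  using measurable_mono[OF subset_refl refl wiener_filtration_mono[of r s M w t], of L] by auto

lemma X_adapted: "s \<in> {t..T} \<Longrightarrow> X s \<in> borel_measurable (Filt s)"
  using sol by (simp add: strong_solution_def)

lemma X_measurable: "s \<in> {t..T} \<Longrightarrow> X s \<in> borel_measurable M"
  using Filt_measurable_M[OF _ X_adapted] by simp

lemma X_continuous: "\<omega> \<in> space M \<Longrightarrow> continuous_on {t..T} (traj \<omega>)"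
  using sol by (simp add: strong_solution_def)

lemma X_past: "r \<in> {t..s} \<Longrightarrow> s \<le> T \<Longrightarrow> X r \<in> borel_measurable (Filt s)"
  by (rule Filt_measurable_mono[OF _ X_adapted]) auto

lemma coefficient_progressive:
  fixes h :: "real^'n \<Rightarrow> real \<Rightarrow> 'b::topological_space"
  assumes h: "coeff_measurable G h" and s: "s \<in> {t..T}"
  shows "(\<lambda>(r, \<omega>). h (X r \<omega>) r) \<in> borel_measurable (restrict_space borel {t..s} \<Otimes>\<^sub>M Filt s)"
proof (rule coefficient_jointly_measurable[OF h])
  show "continuous_on {t..s} (traj \<omega>)" if "\<omega> \<in> space (Filt s)" for \<omega>
    by (rule continuous_on_subset[OF X_continuous]) (use that s in auto)
qed (use s t X_past in auto)

lemma policy_progressive: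
  fixes \<pi> :: "real \<Rightarrow> (real \<Rightarrow> real^'n) \<Rightarrow> real^'c::finite"
  assumes "nonanticipative t T \<pi>" "s \<in> {t..<T}"
  shows "(\<lambda>(r, \<omega>). \<pi> r (traj \<omega>)) \<in> borel_measurable (restrict_space borel {t..s} \<Otimes>\<^sub>M Filt s)"
  by (rule policy_jointly_measurable[OF assms]) (use X_continuous X_past assms(2) in auto)

lemma velocity_progressive:
  assumes s: "s \<in> {t..<T}"
  shows "(\<lambda>(r, \<omega>). velocity G u v (traj \<omega>) r) \<in> borel_measurable (restrict_space borel {t..s} \<Otimes>\<^sub>M Filt s)"
proof -
  have sT: "s \<in> {t..T}" using s by simp
  have c: "coeff_measurable G (drift G)" "coeff_measurable G (gain_u G)" "coeff_measurable G (gain_v G)"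
    using game by (auto simp: game_data_def)
  note [measurable] = coefficient_progressive[OF c(1) sT, unfolded split_beta'] coefficient_progressive[OF c(2) sT, unfolded split_beta']
    coefficient_progressive[OF c(3) sT, unfolded split_beta'] policy_progressive[OF u s, unfolded split_beta'] policy_progressive[OF v s, unfolded split_beta']
  show ?thesis unfolding velocity_def split_beta' by measurable
qed

lemma tau_bounds: "t \<le> tau \<omega>" "tau \<omega> \<le> T" "\<And>s. t < s \<Longrightarrow> s < tau \<omega> \<Longrightarrow> (X s \<omega>, s) \<in> cyl G"
  using exit_time_bounds[where \<xi> = "traj \<omega>" and t = t and G = G] t unfolding tau_def by auto

lemma alive_tau:
  assumes "\<omega> \<in> alive s" "s \<in> {t<..<T}"
  shows "s \<le> tau \<omega>"
  unfolding tau_def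
proof (rule exit_time_least)
  show "(X r \<omega>, r) \<in> cyl G" if "t < r" "r \<le> s" for r
    using assms that t by (auto simp: alive_def cyl_def)
qed (use assms t in auto)

lemma tau_alive: "\<omega> \<in> space M \<Longrightarrow> s < tau \<omega> \<Longrightarrow> \<omega> \<in> alive s"
  using tau_bounds(3)[of _ \<omega>] by (auto simp: alive_def cyl_def)

lemma alive_Filt:
  assumes "s \<in> {t..T}"
  shows "alive s \<in> sets (Filt s)"
proof -
  have "{\<omega> \<in> space (Filt s). \<forall>r\<in>{t<..s}. X r \<omega> \<in> safe_set G} \<in> sets (Filt s)"
  proof (rule path_in_open_set_event[OF safe_open safe_not_UNIV])
    show "continuous_on {t..s} (traj \<omega>)" if "\<omega> \<in> space (Filt s)" for \<omega>
      by (rule continuous_on_subset[OF X_continuous]) (use that assms in auto)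
  qed (use X_past assms in auto)
  then show ?thesis by (simp add: alive_def)
qed

lemma alive_M: "s \<in> {t..T} \<Longrightarrow> alive s \<in> sets M"
  using alive_Filt Filt_le[of s] by auto

text \<open>For \<open>y\<close> between \<open>t\<close> and the terminal time, the exit is later
  than \<open>y\<close> exactly if the path is alive at some rational time strictly between
  \<open>y\<close> and the terminal time.\<close>

lemma tau_measurable: "tau \<in> borel_measurable M"
proof (rule borel_measurableI_greater)
  fix y
  consider "y < t" | "y \<ge> T" | "t \<le> y" "y < T" by linarith
  then show "{\<omega> \<in> space M. y < tau \<omega>} \<in> sets M"
  proof cases
    case 1
    then have "{\<omega> \<in> space M. y < tau \<omega>} = space M" using tau_bounds(1) less_le_trans by blast
    then show ?thesis by simp
  next
    case 2
    then have "{\<omega> \<in> space M. y < tau \<omega>} = {}" using tau_bounds(2) by (auto simp: not_less intro: order_trans)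
    then show ?thesis by (simp only: sets.empty_sets)
  next
    case 3
    have "{\<omega> \<in> space M. y < tau \<omega>} = (\<Union>s\<in>\<rat> \<inter> {y<..<T}. alive s)"
    proof (intro equalityI subsetI)
      fix \<omega> assume "\<omega> \<in> {\<omega> \<in> space M. y < tau \<omega>}"
      then have \<omega>: "\<omega> \<in> space M" "y < tau \<omega>" by auto
      obtain s where "s \<in> \<rat>" "y < s" "s < tau \<omega>" using Rats_dense_in_real[OF \<omega>(2)] by blast
      then show "\<omega> \<in> (\<Union>s\<in>\<rat> \<inter> {y<..<T}. alive s)" using tau_alive[OF \<omega>(1)] tau_bounds(2)[of \<omega>] by force
    next
      fix \<omega> assume "\<omega> \<in> (\<Union>s\<in>\<rat> \<inter> {y<..<T}. alive s)"
      then obtain s where s: "y < s" "s < T" "\<omega> \<in> alive s" by auto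
      then have "s \<le> tau \<omega>" using 3 by (intro alive_tau) auto
      then show "\<omega> \<in> {\<omega> \<in> space M. y < tau \<omega>}" using s by (auto simp: alive_def)
    qed
    also have "\<dots> \<in> sets M"
      by (intro sets.countable_UN' countable_Int1 countable_rat) (use alive_M 3 in auto)
    finally show ?thesis .
  qed
qed

lemma X_at_measurable:
  assumes \<rho>: "\<rho> \<in> borel_measurable M" "\<And>\<omega>. \<omega> \<in> space M \<Longrightarrow> \<rho> \<omega> \<in> {t..T}"
  shows "(\<lambda>\<omega>. X (\<rho> \<omega>) \<omega>) \<in> borel_measurable M"
proof -
  have "(\<lambda>(r, \<omega>). X r \<omega>) \<in> borel_measurable (restrict_space borel {t..T} \<Otimes>\<^sub>M M)"
    by (rule continuous_paths_jointly_measurable[OF X_continuous X_measurable])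
  moreover have "(\<lambda>\<omega>. (\<rho> \<omega>, \<omega>)) \<in> measurable M (restrict_space borel {t..T} \<Otimes>\<^sub>M M)"
    using \<rho> by (intro measurable_Pair measurable_restrict_space2) auto
  ultimately have "(\<lambda>\<omega>. (\<lambda>(r, \<omega>). X r \<omega>) (\<rho> \<omega>, \<omega>)) \<in> borel_measurable M"
    by (rule measurable_compose[rotated])
  then show ?thesis by simp
qed

text \<open>
  \<open>J\<close> cut off outside the cylinder, where nothing is known about its measurability.
\<close>

definition Jc :: "real \<Rightarrow> 'w \<Rightarrow> real" where
  "Jc s \<omega> = indicat_real (cyl G) (X s \<omega>, s) * J (X s \<omega>) s"

lemma Jc_at_measurable:
  assumes \<rho>: "\<rho> \<in> borel_measurable M" "\<And>\<omega>. \<omega> \<in> space M \<Longrightarrow> \<rho> \<omega> \<in> {t..T}"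
  shows "(\<lambda>\<omega>. Jc (\<rho> \<omega>) \<omega>) \<in> borel_measurable M"
proof -
  have "(\<lambda>\<omega>. (X (\<rho> \<omega>) \<omega>, \<rho> \<omega>)) \<in> borel_measurable M"
    using X_at_measurable[OF \<rho>] \<rho>(1) by (rule borel_measurable_Pair)
  from measurable_compose[OF this J_on_cyl_measurable] show ?thesis by (simp add: Jc_def)
qed

lemma running_measurable: "(\<lambda>(\<omega>, r). running \<omega> r) \<in> borel_measurable (M \<Otimes>\<^sub>M lborel)"
  using cint unfolding cost_integrable_def running_def tau_def by (rule borel_measurable_integrable)

lemma running_integrable: "integrable (M \<Otimes>\<^sub>M lborel) (\<lambda>(\<omega>, r). running \<omega> r)"
  using cint unfolding cost_integrable_def running_def tau_def .

sublocale M_lborel: pair_sigma_finite M "lborel :: real measure" ..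

lemma running_path_integrable: "AE \<omega> in M. integrable lborel (running \<omega>)"
  using M_lborel.AE_integrable_fst'[OF running_integrable] by simp

text \<open>The common integrable bound for the running cost over any random interval of
  times.\<close>

definition total :: "'w \<Rightarrow> real" where "total \<omega> = (\<integral>r. \<bar>running \<omega> r\<bar> \<partial>lborel)"

lemma total_integrable: "integrable M total"
  unfolding total_def[abs_def]
  using M_lborel.integrable_fst'[OF integrable_abs[OF running_integrable]] by (simp add: split_beta')

lemma partial_running_measurable:
  assumes [measurable]: "\<rho> \<in> borel_measurable M"
  shows "(\<lambda>\<omega>. \<integral>r. indicat_real {a..<\<rho> \<omega>} r * running \<omega> r \<partial>lborel) \<in> borel_measurable M"
proof (rule lborel.borel_measurable_lebesgue_integral)
  have [measurable]: "(\<lambda>z. running (fst z) (snd z)) \<in> borel_measurable (M \<Otimes>\<^sub>M lborel)"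
    using running_measurable by (simp add: split_beta')
  have "(\<lambda>z. if a \<le> snd z \<and> snd z < \<rho> (fst z) then running (fst z) (snd z) else 0) \<in> borel_measurable (M \<Otimes>\<^sub>M lborel)"
    by measurable
  also have "(\<lambda>z. if a \<le> snd z \<and> snd z < \<rho> (fst z) then running (fst z) (snd z) else 0)
      = (\<lambda>(\<omega>, r). indicat_real {a..<\<rho> \<omega>} r * running \<omega> r)"
    by (auto simp: fun_eq_iff indicator_def)
  finally show "(\<lambda>(\<omega>, r). indicat_real {a..<\<rho> \<omega>} r * running \<omega> r) \<in> borel_measurable (M \<Otimes>\<^sub>M lborel)" .
qed

lemma abs_partial_running_le:
  assumes "integrable lborel (running \<omega>)"
  shows "\<bar>\<integral>r. indicat_real S r * running \<omega> r \<partial>lborel\<bar> \<le> total \<omega>"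
proof -
  have "\<bar>\<integral>r. indicat_real S r * running \<omega> r \<partial>lborel\<bar> \<le> (\<integral>r. \<bar>indicat_real S r * running \<omega> r\<bar> \<partial>lborel)"
    by (rule integral_abs_bound)
  also have "\<dots> \<le> total \<omega>"
    unfolding total_def
    by (rule integral_mono') (use assms in \<open>auto simp: indicator_def\<close>)
  finally show ?thesis .
qed

text \<open>The drift of \<open>J\<close> along the trajectory plus the running cost. In the
  cylinder the completed squares turn it into half the difference of the squared departures of the
  two players from their feedback laws.\<close>

definition deviation :: "'w \<Rightarrow> real \<Rightarrow> real" where
  "deviation \<omega> r = Jx (X r \<omega>) r \<bullet> velocity G u v (traj \<omega>) r + Jt (X r \<omega>) r
      + 1/2 * trace (diffusion G (X r \<omega>) r ** transpose (diffusion G (X r \<omega>) r) ** Jxx (X r \<omega>) r)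
      + running_cost G u v (traj \<omega>) r"

end

text \<open>
  On the null set \<open>N\<close> the driving processes are replaced by zero, so that all pathwise properties hold
  everywhere; they stay adapted because the filtration contains the null sets.
\<close>

locale verification_modified = verification G J Jt Jx Jxx M w x t u v X
  for G :: "('n::finite, 'm::finite, 'l::finite, 'k::finite) game" and J Jt Jx Jxx and M :: "'w measure"
    and w :: "real \<Rightarrow> 'w \<Rightarrow> real^'k" and x t u v X +
  fixes N :: "'w set" and Y :: "real \<Rightarrow> 'w \<Rightarrow> real^'n"
  assumes N: "N \<in> null_sets M"
    and good_w: "\<And>\<omega>. \<omega> \<in> space M \<Longrightarrow> \<omega> \<notin> N \<Longrightarrow> continuous_on {t..T} (\<lambda>s. w s \<omega>)"
    and good_velocity: "\<And>\<omega>. \<omega> \<in> space M \<Longrightarrow> \<omega> \<notin> N \<Longrightarrow> set_integrable lborel {t..<T} (velocity G u v (traj \<omega>))"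
    and good_X: "\<And>\<omega> s. \<omega> \<in> space M \<Longrightarrow> \<omega> \<notin> N \<Longrightarrow> s \<in> {t..T} \<Longrightarrow>
        X s \<omega> = x + (LBINT r:{t..<s}. velocity G u v (traj \<omega>) r) + Y s \<omega>"
    and good_diffusion: "\<And>\<omega>. \<omega> \<in> space M \<Longrightarrow> \<omega> \<notin> N \<Longrightarrow>
        (\<integral>\<^sup>+r\<in>{t..T}. ennreal ((norm (diffusion G (X r \<omega>) r))\<^sup>2) \<partial>lborel) < \<infinity>"
    and good_start: "\<And>\<omega>. \<omega> \<in> space M \<Longrightarrow> \<omega> \<notin> N \<Longrightarrow> X t \<omega> = x"
    and good_running: "\<And>\<omega>. \<omega> \<in> space M \<Longrightarrow> \<omega> \<notin> N \<Longrightarrow> integrable lborel (running \<omega>)"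
    and ito: "ito_integral M (wiener_filtration M w t) w t T (\<lambda>s \<omega>. diffusion G (X s \<omega>) s) Y"
begin

definition wn :: "real \<Rightarrow> 'w \<Rightarrow> real^'k" where "wn s \<omega> = (if \<omega> \<in> N then 0 else w s \<omega>)"
definition \<beta> :: "real \<Rightarrow> 'w \<Rightarrow> real^'n" where "\<beta> r \<omega> = (if \<omega> \<in> N then 0 else velocity G u v (traj \<omega>) r)"
definition H :: "real \<Rightarrow> 'w \<Rightarrow> real^'k^'n" where "H r \<omega> = (if \<omega> \<in> N then 0 else diffusion G (X r \<omega>) r)"

lemma AE_not_N: "AE \<omega> in M. \<omega> \<notin> N"
  using N by (rule AE_not_in)

lemma fw: "filtered_wiener M (wiener_filtration M w t) wn t T"
proof -
  have "filtered_wiener M (wiener_filtration M w t) (\<lambda>s \<omega>. if \<omega> \<in> N then 0 else w s \<omega>) t T"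
    by (rule filtered_wiener_modification[OF prob_space_axioms wiener _ _ N good_w]) (use t in auto)
  moreover have "wn = (\<lambda>s \<omega>. if \<omega> \<in> N then 0 else w s \<omega>)" by (intro ext) (simp add: wn_def)
  ultimately show ?thesis by simp
qed

lemma modify_progressive:
  fixes f :: "real \<Rightarrow> 'w \<Rightarrow> 'b::{real_normed_vector, second_countable_topology}"
  assumes "(\<lambda>(r, \<omega>). f r \<omega>) \<in> borel_measurable (restrict_space borel S \<Otimes>\<^sub>M Filt s)"
  shows "(\<lambda>(r, \<omega>). if \<omega> \<in> N then 0 else f r \<omega>) \<in> borel_measurable (restrict_space borel S \<Otimes>\<^sub>M Filt s)"
proof -
  have [measurable]: "N \<in> sets (Filt s)" by (rule null_set_in_wiener_filtration[OF N])
  note [measurable] = assms[unfolded split_beta']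
  show ?thesis unfolding split_beta' by measurable
qed

lemma \<beta>_progressive: "s \<in> {t..<T} \<Longrightarrow> (\<lambda>(r, \<omega>). \<beta> r \<omega>) \<in> borel_measurable (restrict_space borel {t..s} \<Otimes>\<^sub>M Filt s)"
  unfolding \<beta>_def by (rule modify_progressive[OF velocity_progressive])

lemma diffusion_coeff: "coeff_measurable G (diffusion G)"
  using game by (auto simp: game_data_def)

lemma H_progressive: "s \<in> {t..T} \<Longrightarrow> (\<lambda>(r, \<omega>). H r \<omega>) \<in> borel_measurable (restrict_space borel {t..s} \<Otimes>\<^sub>M Filt s)"
  unfolding H_def by (rule modify_progressive[OF coefficient_progressive[OF diffusion_coeff]])

lemma H_square_integrable:
  assumes hi: "hi \<in> {t..T}" and \<omega>: "\<omega> \<in> space M"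
  shows "set_integrable lborel {t..<hi} (\<lambda>r. (norm (H r \<omega>))\<^sup>2)"
proof (cases "\<omega> \<in> N")
  case True
  then show ?thesis by (simp add: H_def set_integrable_def)
next
  case False
  have T: "T \<in> {t..T}" using t by simp
  have "(\<lambda>(\<omega>, r). indicat_real {t..T} r *\<^sub>R H r \<omega>) \<in> borel_measurable (Filt T \<Otimes>\<^sub>M lborel)"
    by (rule measurable_indicator_times_restricted[OF H_progressive[OF T]]) simp
  from measurable_compose[OF measurable_Pair1' this, of \<omega>]
  have m: "(\<lambda>r. indicat_real {t..T} r *\<^sub>R H r \<omega>) \<in> borel_measurable lborel" using \<omega> by simp
  have i: "set_integrable lborel {t..T} (\<lambda>r. (norm (H r \<omega>))\<^sup>2)"
    unfolding set_integrable_def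
  proof (rule integrableI_nonneg)
    have "(\<lambda>r. (norm (indicat_real {t..T} r *\<^sub>R H r \<omega>))\<^sup>2) \<in> borel_measurable lborel" using m by measurable
    also have "(\<lambda>r. (norm (indicat_real {t..T} r *\<^sub>R H r \<omega>))\<^sup>2) = (\<lambda>r. indicat_real {t..T} r *\<^sub>R (norm (H r \<omega>))\<^sup>2)"
      by (auto simp: fun_eq_iff indicator_def)
    finally show "(\<lambda>r. indicat_real {t..T} r *\<^sub>R (norm (H r \<omega>))\<^sup>2) \<in> borel_measurable lborel" .
    have "(\<integral>\<^sup>+r. ennreal (indicat_real {t..T} r *\<^sub>R (norm (H r \<omega>))\<^sup>2) \<partial>lborel)
        = (\<integral>\<^sup>+r\<in>{t..T}. ennreal ((norm (diffusion G (X r \<omega>) r))\<^sup>2) \<partial>lborel)"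
      by (rule nn_integral_cong) (use False in \<open>auto simp: H_def indicator_def\<close>)
    then show "(\<integral>\<^sup>+r. ennreal (indicat_real {t..T} r *\<^sub>R (norm (H r \<omega>))\<^sup>2) \<partial>lborel) < \<infinity>"
      using good_diffusion[OF \<omega> False] by simp
  qed auto
  show ?thesis by (rule set_integrable_subset[OF i]) (use hi in auto)
qed

lemma ito_process_modified:
  assumes hi: "hi \<in> {t..<T}"
  shows "ito_process M (wiener_filtration M w t) wn t T hi \<beta> H Y"
proof (intro ito_process.intro fw, unfold_locales, goal_cases)
  case (3 s)
  then show ?case using hi by (intro \<beta>_progressive) auto
next
  case (4 \<omega>)
  have "set_integrable lborel {t..<hi} (velocity G u v (traj \<omega>))" if "\<omega> \<notin> N"
    by (rule set_integrable_subset[OF good_velocity[OF 4 that]]) (use hi in auto)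
  then show ?case by (cases "\<omega> \<in> N") (auto simp: \<beta>_def set_integrable_def)
next
  case (5 s)
  then show ?case using hi by (intro H_progressive) auto
next
  case (6 \<omega>)
  then show ?case using hi by (intro H_square_integrable) auto
next
  case (7 s)
  then show ?case using ito hi by (auto simp: ito_integral_def)
next
  case (8 \<omega>)
  then have "continuous_on {t..T} (\<lambda>s. Y s \<omega>)" using ito by (auto simp: ito_integral_def)
  then show ?case by (rule continuous_on_subset) (use hi in auto)
qed (use hi in auto)

text \<open>The given approximation refers to \<open>w\<close>, to the unmodified diffusion and to
  the closed interval up to \<open>T\<close>. Off the null set the modified quantities are the same
  and the interval is shorter, so that the events in question are almost surely contained in the
  given ones.\<close>

lemma approximating_processes:
  obtains n :: "nat \<Rightarrow> nat" and p :: "nat \<Rightarrow> nat \<Rightarrow> real" and \<xi> :: "nat \<Rightarrow> nat \<Rightarrow> 'w \<Rightarrow> real^'k^'n" where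
    "\<And>j. simple_process t T (wiener_filtration M w t) (n j) (p j) (\<xi> j)"
    "\<And>hi \<epsilon>. hi \<in> {t..<T} \<Longrightarrow> \<epsilon> > 0 \<Longrightarrow> (\<lambda>j. measure M {\<omega>\<in>space M.
        (LBINT r:{t..<hi}. (norm (simple_value (n j) (p j) (\<xi> j) r \<omega> - H r \<omega>))\<^sup>2) > \<epsilon>}) \<longlonglongrightarrow> 0"
    "\<And>s \<epsilon>. s \<in> {t..T} \<Longrightarrow> \<epsilon> > 0 \<Longrightarrow> (\<lambda>j. measure M {\<omega>\<in>space M.
        norm (simple_integral wn (n j) (p j) (\<xi> j) s \<omega> - Y s \<omega>) > \<epsilon>}) \<longlonglongrightarrow> 0"
proof -
  interpret W: filtered_wiener M "wiener_filtration M w t" wn t T by (rule fw)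
  obtain n p \<xi> where sp: "\<And>j. simple_process t T (wiener_filtration M w t) (n j) (p j) (\<xi> j)"
    and c1: "\<And>\<epsilon>. \<epsilon> > 0 \<Longrightarrow> (\<lambda>j. measure M {\<omega>\<in>space M.
        (\<integral>\<^sup>+r\<in>{t..T}. ennreal ((norm (simple_value (n j) (p j) (\<xi> j) r \<omega> - diffusion G (X r \<omega>) r))\<^sup>2) \<partial>lborel) > ennreal \<epsilon>}) \<longlonglongrightarrow> 0"
    and c2: "\<And>s \<epsilon>. s \<in> {t..T} \<Longrightarrow> \<epsilon> > 0 \<Longrightarrow> (\<lambda>j. measure M {\<omega>\<in>space M.
        norm (simple_integral w (n j) (p j) (\<xi> j) s \<omega> - Y s \<omega>) > \<epsilon>}) \<longlonglongrightarrow> 0"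
    using ito unfolding ito_integral_def by blast
  have T: "T \<in> {t..T}" "t \<le> T" using t by auto
  have YM: "Y s \<in> borel_measurable M" if "s \<in> {t..T}" for s
    using ito that Filt_measurable_M[of s "Y s"] by (auto simp: ito_integral_def)
  show thesis
  proof (rule that[OF sp])
    fix hi \<epsilon> :: real assume hi: "hi \<in> {t..<T}" and \<epsilon>: "\<epsilon> > 0"
    let ?A = "\<lambda>j. {\<omega>\<in>space M. (LBINT r:{t..<hi}. (norm (simple_value (n j) (p j) (\<xi> j) r \<omega> - H r \<omega>))\<^sup>2) > \<epsilon>}"
    let ?B = "\<lambda>j. {\<omega>\<in>space M.
        (\<integral>\<^sup>+r\<in>{t..T}. ennreal ((norm (simple_value (n j) (p j) (\<xi> j) r \<omega> - diffusion G (X r \<omega>) r))\<^sup>2) \<partial>lborel) > ennreal \<epsilon>}"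
    have B: "?B j \<in> sets M" for j
    proof -
      note m1 = measurable_restricted_pair_mono[OF W.simple_value_progressive[OF sp T(1)] Filt_le[OF order_refl] space_wiener_filtration]
      note m2 = measurable_restricted_pair_mono[OF coefficient_progressive[OF diffusion_coeff T(1)] Filt_le[OF order_refl] space_wiener_filtration]
      have diff_meas: "(\<lambda>(r, \<omega>). simple_value (n j) (p j) (\<xi> j) r \<omega> - diffusion G (X r \<omega>) r) \<in> borel_measurable (restrict_space borel {t..T} \<Otimes>\<^sub>M M)"
        using borel_measurable_diff[OF m1[of j] m2] by (simp add: split_beta')
      define g where "g z = indicat_real {t..T} (snd z) *\<^sub>R (simple_value (n j) (p j) (\<xi> j) (snd z) (fst z) - diffusion G (X (snd z) (fst z)) (snd z))" for z
      from measurable_indicator_times_restricted[OF diff_meas]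
      have [measurable]: "g \<in> borel_measurable (M \<Otimes>\<^sub>M lborel)"
        by (simp add: split_beta' g_def[abs_def])
      have "(\<lambda>\<omega>. \<integral>\<^sup>+r. ennreal ((norm (g (\<omega>, r)))\<^sup>2) \<partial>lborel) \<in> borel_measurable M"
        by (rule lborel.borel_measurable_nn_integral) (simp add: split_beta')
      then have "(\<lambda>\<omega>. \<integral>\<^sup>+r. ennreal ((norm (indicat_real {t..T} r *\<^sub>R (simple_value (n j) (p j) (\<xi> j) r \<omega> - diffusion G (X r \<omega>) r)))\<^sup>2) \<partial>lborel) \<in> borel_measurable M"
        by (simp add: g_def)
      also have "(\<lambda>\<omega>. \<integral>\<^sup>+r. ennreal ((norm (indicat_real {t..T} r *\<^sub>R (simple_value (n j) (p j) (\<xi> j) r \<omega> - diffusion G (X r \<omega>) r)))\<^sup>2) \<partial>lborel)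
        = (\<lambda>\<omega>. \<integral>\<^sup>+r\<in>{t..T}. ennreal ((norm (simple_value (n j) (p j) (\<xi> j) r \<omega> - diffusion G (X r \<omega>) r))\<^sup>2) \<partial>lborel)"
        by (intro ext nn_integral_cong) (auto simp: indicator_def)
      finally show ?thesis by measurable
    qed
    have sub: "\<omega> \<in> ?A j \<longrightarrow> \<omega> \<in> ?B j" if "\<omega> \<notin> N" for \<omega> j
    proof
      assume A: "\<omega> \<in> ?A j"
      define f where "f r = (norm (simple_value (n j) (p j) (\<xi> j) r \<omega> - H r \<omega>))\<^sup>2" for r
      \<comment> \<open>The integral of a non-integrable function is 0 by convention and cannot
        exceed \<epsilon>.\<close>
      have i: "set_integrable lborel {t..<hi} f"
      proof (rule ccontr)
        assume "\<not> ?thesis"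
        then have "(LBINT r:{t..<hi}. f r) = 0"
          unfolding set_integrable_def set_lebesgue_integral_def by (rule not_integrable_integral_eq)
        then show False using A \<epsilon> by (simp add: f_def)
      qed
      have "ennreal \<epsilon> < ennreal (LBINT r:{t..<hi}. f r)"
        using A \<epsilon> by (intro ennreal_lessI) (auto simp: f_def)
      also have "\<dots> = (\<integral>\<^sup>+r. ennreal (indicat_real {t..<hi} r *\<^sub>R f r) \<partial>lborel)"
        using i unfolding set_integrable_def set_lebesgue_integral_def
        by (intro nn_integral_eq_integral[symmetric]) (auto simp: f_def)
      also have "\<dots> \<le> (\<integral>\<^sup>+r\<in>{t..T}. ennreal ((norm (simple_value (n j) (p j) (\<xi> j) r \<omega> - diffusion G (X r \<omega>) r))\<^sup>2) \<partial>lborel)"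
        by (rule nn_integral_mono) (use that hi in \<open>auto simp: f_def H_def indicator_def\<close>)
      finally show "\<omega> \<in> ?B j" using A by simp
    qed
    show "(\<lambda>j. measure M (?A j)) \<longlonglongrightarrow> 0"
    proof (rule tendsto_sandwich[OF _ _ tendsto_const c1[OF \<epsilon>]])
      show "\<forall>\<^sub>F j in sequentially. measure M (?A j) \<le> measure M (?B j)"
      proof (intro always_eventually allI)
        fix j
        have "AE \<omega> in M. \<omega> \<in> ?A j \<longrightarrow> \<omega> \<in> ?B j" using AE_not_N by (rule eventually_mono) (rule sub)
        then show "measure M (?A j) \<le> measure M (?B j)" by (rule finite_measure_mono_AE[OF _ B])
      qed
    qed auto
  next
    fix s \<epsilon> :: real assume s: "s \<in> {t..T}" and \<epsilon>: "\<epsilon> > 0"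
    let ?A = "\<lambda>j. {\<omega>\<in>space M. norm (simple_integral wn (n j) (p j) (\<xi> j) s \<omega> - Y s \<omega>) > \<epsilon>}"
    let ?B = "\<lambda>j. {\<omega>\<in>space M. norm (simple_integral w (n j) (p j) (\<xi> j) s \<omega> - Y s \<omega>) > \<epsilon>}"
    have B: "?B j \<in> sets M" for j
    proof -
      have g: "p j i \<in> {t..T}" if "i \<le> n j" for i using sp[of j] that by (simp add: simple_process_def)
      have wM: "w r \<in> borel_measurable M" if "r \<in> {t..T}" for r
        using wiener that t by (auto simp: wiener_process_def)
      have "(\<lambda>\<omega>. \<xi> j i \<omega> *v (w (min s (p j (Suc i))) \<omega> - w (min s (p j i)) \<omega>)) \<in> borel_measurable M" if i: "i < n j" for i
      proof -
        have "\<xi> j i \<in> borel_measurable (Filt (p j i))" using sp[of j] i by (simp add: simple_process_def)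
        then have [measurable]: "\<xi> j i \<in> borel_measurable M" using Filt_measurable_M g[of i] i by auto
        have [measurable]: "w (min s (p j (Suc i))) \<in> borel_measurable M" "w (min s (p j i)) \<in> borel_measurable M"
          using g[of i] g[of "Suc i"] i s by (auto intro!: wM)
        show ?thesis by measurable
      qed
      then have [measurable]: "simple_integral w (n j) (p j) (\<xi> j) s \<in> borel_measurable M"
        unfolding simple_integral_def[abs_def] by (intro borel_measurable_sum) auto
      note [measurable] = YM[OF s]
      show ?thesis by measurable
    qed
    show "(\<lambda>j. measure M (?A j)) \<longlonglongrightarrow> 0"
    proof (rule tendsto_sandwich[OF _ _ tendsto_const c2[OF s \<epsilon>]])
      show "\<forall>\<^sub>F j in sequentially. measure M (?A j) \<le> measure M (?B j)"
      proof (intro always_eventually allI)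
        fix j
        have "AE \<omega> in M. \<omega> \<in> ?A j \<longrightarrow> \<omega> \<in> ?B j"
          using AE_not_N by eventually_elim (simp add: simple_integral_def wn_def)
        then show "measure M (?A j) \<le> measure M (?B j)" by (rule finite_measure_mono_AE[OF _ B])
      qed
    qed auto
  qed
qed

section \<open>Gains up to the localising stopping times\<close>

text \<open>The clock of the modified process written out, so that one function of time serves all
  endpoints \<open>hi\<close>.\<close>

definition clk :: "real \<Rightarrow> 'w \<Rightarrow> real" where
  "clk s \<omega> = (LBINT r:{t..<s}. norm (\<beta> r \<omega>) + (norm (H r \<omega>))\<^sup>2)"

text \<open>
  The process has stayed in the safe set until \<open>\<sigma>\<close>, and since then in a compact part of it with the
  clock below \<open>n\<close>. The conditions on \<open>{\<sigma>..s}\<close> are closed, hence still hold at the stopping time \<open>rho\<close>.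
\<close>

definition contained :: "real \<Rightarrow> nat \<Rightarrow> real \<Rightarrow> 'w set" where
  "contained \<sigma> n s = {\<omega> \<in> alive \<sigma>. \<forall>r\<in>{\<sigma>..s}. X r \<omega> \<in> inner_set (safe_set G) n \<and> clk r \<omega> \<le> real n}"

text \<open>Outside \<open>contained \<sigma> n \<sigma>\<close> the set of times is empty; the
  value \<sigma> keeps \<open>rho\<close> in \<open>{\<sigma>..hi}\<close> there.\<close>

definition rho :: "real \<Rightarrow> nat \<Rightarrow> real \<Rightarrow> 'w \<Rightarrow> real" where
  "rho \<sigma> n hi \<omega> = (if \<omega> \<in> contained \<sigma> n \<sigma> then Sup {s \<in> {\<sigma>..hi}. \<omega> \<in> contained \<sigma> n s} else \<sigma>)"

lemma clk_continuous:
  assumes "hi \<in> {t..<T}" "\<omega> \<in> space M"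
  shows "continuous_on {t..hi} (\<lambda>s. clk s \<omega>)"
proof -
  interpret P: ito_process M "wiener_filtration M w t" wn t T hi x \<beta> H Y by (rule ito_process_modified[OF assms(1)])
  show ?thesis using P.continuous_clock[OF assms(2)] by (simp add: P.clock_def P.rate_def clk_def)
qed

lemma clk_mono:
  assumes "t \<le> r" "r \<le> s" "s < T" "\<omega> \<in> space M"
  shows "clk r \<omega> \<le> clk s \<omega>"
proof -
  interpret P: ito_process M "wiener_filtration M w t" wn t T s x \<beta> H Y
    by (rule ito_process_modified) (use assms in auto)
  show ?thesis using P.clock_mono[OF assms(4,1,2)] by (simp add: P.clock_def P.rate_def clk_def)
qed

lemma clk_adapted:
  assumes "s \<in> {t..<T}"
  shows "clk s \<in> borel_measurable (Filt s)"
proof -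
  interpret P: ito_process M "wiener_filtration M w t" wn t T s x \<beta> H Y by (rule ito_process_modified[OF assms])
  have "clk s = P.clock s" by (simp add: fun_eq_iff P.clock_def P.rate_def clk_def)
  then show ?thesis using P.clock_adapted[of s] assms by simp
qed

lemma contained_Filt:
  assumes \<sigma>: "t < \<sigma>" and s: "s \<in> {\<sigma>..<T}"
  shows "contained \<sigma> n s \<in> sets (Filt s)"
proof -
  have "{\<omega> \<in> space (Filt s). \<forall>r\<in>{\<sigma>..s}. (X r \<omega>, clk r \<omega>) \<in> inner_set (safe_set G) n \<times> {..real n}} \<in> sets (Filt s)"
  proof (rule path_in_closed_set_event)
    show "closed (inner_set (safe_set G) n \<times> {..real n})" by (intro closed_Times closed_inner_set closed_atMost)
    show "continuous_on {\<sigma>..s} (\<lambda>r. (X r \<omega>, clk r \<omega>))" if "\<omega> \<in> space (Filt s)" for \<omega>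
      by (intro continuous_on_Pair continuous_on_subset[OF X_continuous] continuous_on_subset[OF clk_continuous[of s]])
        (use that \<sigma> s in auto)
    show "(\<lambda>\<omega>. (X r \<omega>, clk r \<omega>)) \<in> borel_measurable (Filt s)" if "r \<in> {\<sigma>..s}" for r
      by (intro borel_measurable_Pair X_past Filt_measurable_mono[OF _ clk_adapted]) (use that \<sigma> s in auto)
  qed
  moreover have "alive \<sigma> \<in> sets (Filt s)"
    using alive_Filt[of \<sigma>] wiener_filtration_mono[of \<sigma> s M w t] \<sigma> s by auto
  moreover have "contained \<sigma> n s = alive \<sigma> \<inter>
      {\<omega> \<in> space (Filt s). \<forall>r\<in>{\<sigma>..s}. (X r \<omega>, clk r \<omega>) \<in> inner_set (safe_set G) n \<times> {..real n}}"
    by (auto simp: contained_def alive_def)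
  ultimately show ?thesis by simp
qed

lemma contained_anti: "r \<le> s \<Longrightarrow> contained \<sigma> n s \<subseteq> contained \<sigma> n r"
  by (auto simp: contained_def)

lemma contained_M: "t < \<sigma> \<Longrightarrow> s \<in> {\<sigma>..<T} \<Longrightarrow> contained \<sigma> n s \<in> sets M"
  using contained_Filt[of \<sigma> s n] Filt_le[of s] by auto

lemma contained_space: "\<omega> \<in> contained \<sigma> n s \<Longrightarrow> \<omega> \<in> space M"
  by (simp add: contained_def alive_def)

lemma rho_in: "\<sigma> \<le> hi \<Longrightarrow> rho \<sigma> n hi \<omega> \<in> {\<sigma>..hi}"
  unfolding rho_def by (auto intro!: cSup_upper2[of \<sigma>] cSup_least bdd_aboveI[of _ hi])

lemma rho_ge: "\<omega> \<in> contained \<sigma> n s \<Longrightarrow> \<sigma> \<le> s \<Longrightarrow> s \<le> hi \<Longrightarrow> s \<le> rho \<sigma> n hi \<omega>"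
  using contained_anti[of \<sigma> s] unfolding rho_def by (auto intro!: cSup_upper bdd_aboveI[of _ hi])

lemma rho_measurable:
  assumes "t < \<sigma>" "\<sigma> \<le> hi" "hi < T"
  shows "rho \<sigma> n hi \<in> borel_measurable M"
  unfolding rho_def[abs_def]
  by (rule stopping_time_measurable) (use assms contained_M contained_anti in auto)

lemma contained_rho:
  assumes \<sigma>: "t < \<sigma>" "\<sigma> \<le> hi" "hi < T" and \<omega>: "\<omega> \<in> contained \<sigma> n \<sigma>"
  shows "\<omega> \<in> contained \<sigma> n (rho \<sigma> n hi \<omega>)"
proof (cases "rho \<sigma> n hi \<omega> = \<sigma>")
  case True
  then show ?thesis using \<omega> by simp
next
  case False
  let ?\<rho> = "rho \<sigma> n hi \<omega>"
  have \<rho>: "\<sigma> < ?\<rho>" "?\<rho> \<le> hi" using rho_in[OF \<sigma>(2), of n \<omega>] False by auto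
  let ?K = "inner_set (safe_set G) n \<times> {..real n}"
  have \<omega>M: "\<omega> \<in> space M" by (rule contained_space[OF \<omega>])
  have "closed ({\<sigma>..hi} \<inter> (\<lambda>r. (X r \<omega>, clk r \<omega>)) -` ?K)"
  proof (rule continuous_closed_preimage)
    show "continuous_on {\<sigma>..hi} (\<lambda>r. (X r \<omega>, clk r \<omega>))"
      by (intro continuous_on_Pair continuous_on_subset[OF X_continuous] continuous_on_subset[OF clk_continuous[of hi]])
        (use \<omega>M \<sigma> in auto)
    show "closed ?K" by (intro closed_Times closed_inner_set closed_atMost)
  qed simp
  moreover have "{\<sigma>..<?\<rho>} \<subseteq> {\<sigma>..hi} \<inter> (\<lambda>r. (X r \<omega>, clk r \<omega>)) -` ?K"
  proof
    fix r assume r: "r \<in> {\<sigma>..<?\<rho>}"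
    have "r < Sup {s \<in> {\<sigma>..hi}. \<omega> \<in> contained \<sigma> n s}" using r \<omega> by (simp add: rho_def)
    then obtain s where "s \<in> {s \<in> {\<sigma>..hi}. \<omega> \<in> contained \<sigma> n s}" "r < s"
      by (rule less_cSupE) (use \<omega> \<sigma> in auto)
    then show "r \<in> {\<sigma>..hi} \<inter> (\<lambda>r. (X r \<omega>, clk r \<omega>)) -` ?K" using r by (auto simp: contained_def)
  qed
  ultimately have "closure {\<sigma>..<?\<rho>} \<subseteq> {\<sigma>..hi} \<inter> (\<lambda>r. (X r \<omega>, clk r \<omega>)) -` ?K" by (rule closure_minimal[rotated])
  then show ?thesis using \<rho> \<omega> by (auto simp: contained_def)
qed

lemma contained_cyl:
  assumes "\<omega> \<in> contained \<sigma> n s" "\<sigma> \<le> s" "s < T" "t < r" "r \<le> s"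
  shows "(X r \<omega>, r) \<in> cyl G"
proof -
  have "X r \<omega> \<in> safe_set G"
    using assms inner_set_subset[of "safe_set G" n] by (cases "r \<le> \<sigma>") (auto simp: contained_def alive_def)
  then show ?thesis using assms t by (simp add: cyl_def)
qed

lemma contained_le_tau:
  assumes "\<omega> \<in> contained \<sigma> n s" "t < \<sigma>" "\<sigma> \<le> s" "s < T"
  shows "s \<le> tau \<omega>"
  unfolding tau_def
  by (rule exit_time_least) (use contained_cyl[OF assms(1,3,4)] assms t in auto)

definition stopped_gain :: "real \<Rightarrow> nat \<Rightarrow> real \<Rightarrow> 'w \<Rightarrow> real" where
  "stopped_gain \<sigma> n hi \<omega> = indicat_real (contained \<sigma> n \<sigma>) \<omega> *
     (Jc (rho \<sigma> n hi \<omega>) \<omega> - Jc \<sigma> \<omega> + (\<integral>r. indicat_real {\<sigma>..<rho \<sigma> n hi \<omega>} r * running \<omega> r \<partial>lborel))"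

lemma stopped_gain_measurable:
  assumes "t < \<sigma>" "\<sigma> \<le> hi" "hi < T"
  shows "stopped_gain \<sigma> n hi \<in> borel_measurable M"
proof -
  have \<rho>: "rho \<sigma> n hi \<omega> \<in> {t..T}" for \<omega> using rho_in[OF assms(2), of n \<omega>] assms by auto
  note [measurable] = rho_measurable[OF assms] contained_M[OF assms(1), of \<sigma>]
    Jc_at_measurable[OF rho_measurable[OF assms] \<rho>] partial_running_measurable[OF rho_measurable[OF assms]]
  have [measurable]: "Jc \<sigma> \<in> borel_measurable M" using Jc_at_measurable[of "\<lambda>_. \<sigma>"] assms by simp
  have [measurable]: "contained \<sigma> n \<sigma> \<in> sets M" by (rule contained_M) (use assms in auto)
  show ?thesis unfolding stopped_gain_def[abs_def] by measurable
qed

lemma abs_stopped_gain_le: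
  assumes B: "\<And>y s. (y, s) \<in> cyl G \<Longrightarrow> \<bar>J y s\<bar> \<le> B" and B0: "0 \<le> B" and \<omega>: "integrable lborel (running \<omega>)"
  shows "\<bar>stopped_gain \<sigma> n hi \<omega>\<bar> \<le> 2 * B + total \<omega>"
proof -
  have J: "\<bar>Jc s \<omega>\<bar> \<le> B" for s using B[of "X s \<omega>" s] B0 by (auto simp: Jc_def indicator_def)
  have "\<bar>stopped_gain \<sigma> n hi \<omega>\<bar> \<le>
      \<bar>Jc (rho \<sigma> n hi \<omega>) \<omega> - Jc \<sigma> \<omega> + (\<integral>r. indicat_real {\<sigma>..<rho \<sigma> n hi \<omega>} r * running \<omega> r \<partial>lborel)\<bar>"
    by (simp add: stopped_gain_def indicator_def)
  then show ?thesis
    using J[of "rho \<sigma> n hi \<omega>"] J[of \<sigma>] abs_partial_running_le[OF \<omega>, of "{\<sigma>..<rho \<sigma> n hi \<omega>}"] by linarith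
qed

lemma gain_bound_integrable: "integrable M (\<lambda>\<omega>. 2 * B + total \<omega>)"
  using total_integrable by simp

lemma stopped_gain_integrable:
  assumes "t < \<sigma>" "\<sigma> \<le> hi" "hi < T"
  shows "integrable M (stopped_gain \<sigma> n hi)"
proof -
  obtain B where B: "\<And>y s. (y, s) \<in> cyl G \<Longrightarrow> \<bar>J y s\<bar> \<le> B" by (rule J_bounded) blast
  have B': "\<And>y s. (y, s) \<in> cyl G \<Longrightarrow> \<bar>J y s\<bar> \<le> \<bar>B\<bar>" using B by (meson abs_ge_self order_trans)
  show ?thesis
  proof (rule Bochner_Integration.integrable_bound[OF gain_bound_integrable stopped_gain_measurable[OF assms]])
    show "AE \<omega> in M. norm (stopped_gain \<sigma> n hi \<omega>) \<le> norm (2 * \<bar>B\<bar> + total \<omega>)"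
      using running_path_integrable
    proof eventually_elim
      case (elim \<omega>)
      then show ?case using abs_stopped_gain_le[OF B' abs_ge_zero elim, of \<sigma> n hi] by simp
    qed
  qed
qed

text \<open>Up to \<open>rho\<close> the test function coincides with \<open>J\<close>, so the gain
  differs from a stopped martingale increment by the integral of \<open>deviation\<close>. The
  increment has mean zero, hence the mean of the gain has the sign of the deviation. The factor
  \<epsilon> covers the upper and the lower bound at once.\<close>

lemma stopped_gain_sign:
  assumes \<sigma>: "t < \<sigma>" "\<sigma> < hi" "hi < T"
    and sign: "\<And>\<omega> r. \<omega> \<in> space M \<Longrightarrow> (X r \<omega>, r) \<in> cyl G \<Longrightarrow> 0 \<le> \<epsilon> * deviation \<omega> r"
  shows "0 \<le> \<epsilon> * (\<integral>\<omega>. stopped_gain \<sigma> n hi \<omega> \<partial>M)"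
proof -
  let ?U = "safe_set G" and ?K = "inner_set (safe_set G) n"
  have hi: "hi \<in> {t..<T}" and \<sigma>hi: "\<sigma> \<in> {t..hi}" "\<sigma> \<le> hi" using \<sigma> by auto
  have sub: "{t..hi} \<subseteq> {init_time G..<end_time G}" using \<sigma> t by auto
  have subU: "?U \<times> {t..hi} \<subseteq> cyl G" unfolding cyl_def using sub by (intro Sigma_mono) auto
  have K: "compact ?K"
    using closed_inner_set[of ?U n] bounded_subset[OF safe_bounded inner_set_subset] by (simp add: compact_eq_bounded_closed)
  obtain \<Phi> \<Phi>t \<Phi>a \<Phi>x \<Phi>xx C where tf: "test_function t hi \<Phi> \<Phi>t \<Phi>a \<Phi>x \<Phi>xx C (real n + 1)"
    and \<Phi>: "\<And>x s a. x \<in> ?K \<Longrightarrow> s \<in> {t..hi} \<Longrightarrow> a \<le> real n \<Longrightarrow>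
      \<Phi> x s a = J x s \<and> \<Phi>t x s a = Jt x s \<and> \<Phi>a x s a = 0 \<and> \<Phi>x x s a = Jx x s \<and> \<Phi>xx x s a = Jxx x s"
  proof (rule test_function_cutoff[OF safe_open K inner_set_subset, of "real n" t hi J Jt Jx Jxx])
    fix x s assume xs: "x \<in> ?U" "s \<in> {t..hi}"
    then have c: "(x, s) \<in> cyl G" using subU by auto
    show "((\<lambda>s. J x s) has_real_derivative Jt x s) (at s within {t..hi})"
      using smooth c sub by (auto simp: C12_derivs_def intro: DERIV_subset)
    show "((\<lambda>y. J y s) has_derivative (\<lambda>h. Jx x s \<bullet> h)) (at x)"
      using smooth c by (auto simp: C12_derivs_def gderiv_def inner_commute)
    show "((\<lambda>y. Jx y s) has_derivative (\<lambda>h. Jxx x s *v h)) (at x)"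
      using smooth c by (auto simp: C12_derivs_def)
  next
    show "continuous_on (?U \<times> {t..hi}) (\<lambda>(x, s). J x s)" by (rule continuous_on_subset[OF J_continuous subU])
    show "continuous_on (?U \<times> {t..hi}) (\<lambda>(x, s). Jt x s)" "continuous_on (?U \<times> {t..hi}) (\<lambda>(x, s). Jx x s)"
      "continuous_on (?U \<times> {t..hi}) (\<lambda>(x, s). Jxx x s)"
      using smooth by (auto simp: C12_derivs_def intro: continuous_on_subset[OF _ subU])
  next
    fix \<Phi> \<Phi>t \<Phi>a \<Phi>x \<Phi>xx C
    assume "test_function t hi \<Phi> \<Phi>t \<Phi>a \<Phi>x \<Phi>xx C (real n + 1)"
      "\<And>x s a. x \<in> ?K \<Longrightarrow> s \<in> {t..hi} \<Longrightarrow> a \<le> real n \<Longrightarrow>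
      \<Phi> x s a = J x s \<and> \<Phi>t x s a = Jt x s \<and> \<Phi>a x s a = 0 \<and> \<Phi>x x s a = Jx x s \<and> \<Phi>xx x s a = Jxx x s"
    then show thesis by (rule that)
  qed (use \<sigma> in auto)
  obtain nn pp \<xi> where sp: "\<And>j. simple_process t T (wiener_filtration M w t) (nn j) (pp j) (\<xi> j)"
    and cH: "\<And>hi \<epsilon>. hi \<in> {t..<T} \<Longrightarrow> \<epsilon> > 0 \<Longrightarrow> (\<lambda>j. measure M {\<omega>\<in>space M.
        (LBINT r:{t..<hi}. (norm (simple_value (nn j) (pp j) (\<xi> j) r \<omega> - H r \<omega>))\<^sup>2) > \<epsilon>}) \<longlonglongrightarrow> 0"
    and cY: "\<And>s \<epsilon>. s \<in> {t..T} \<Longrightarrow> \<epsilon> > 0 \<Longrightarrow> (\<lambda>j. measure M {\<omega>\<in>space M.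
        norm (simple_integral wn (nn j) (pp j) (\<xi> j) s \<omega> - Y s \<omega>) > \<epsilon>}) \<longlonglongrightarrow> 0"
    by (rule approximating_processes) blast
  interpret A: ito_approximation M "wiener_filtration M w t" wn t T hi x \<beta> H Y \<Phi> \<Phi>t \<Phi>a \<Phi>x \<Phi>xx C "real n + 1" nn pp \<xi>
    by (intro ito_approximation.intro ito_process_test.intro ito_process_modified[OF hi] tf ito_approximation_axioms.intro sp)
  have zero: "(\<integral>\<omega>. Z \<omega> * A.mart p q \<omega> \<partial>M) = 0"
    if "t \<le> p" "p \<le> q" "q \<le> hi" "Z \<in> borel_measurable (Filt p)" "\<And>\<omega>. \<omega> \<in> space M \<Longrightarrow> \<bar>Z \<omega>\<bar> \<le> b" for p q Z b
  proof (rule A.ito_formula[OF _ _ that])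
    show "(\<lambda>j. measure M {\<omega> \<in> space M. \<epsilon> < A.sqdist j \<omega>}) \<longlonglongrightarrow> 0" if "\<epsilon> > 0" for \<epsilon>
      using cH[OF hi that] by (simp add: A.sqdist_def)
    show "(\<lambda>j. measure M {\<omega> \<in> space M. \<epsilon> < norm (simple_integral wn (nn j) (pp j) (\<xi> j) s \<omega> - Y s \<omega>)}) \<longlonglongrightarrow> 0"
      if "s \<in> {t..hi}" "\<epsilon> > 0" for s \<epsilon>
      using cY[OF _ that(2)] that(1) hi by simp
  qed
  define m where "m \<omega> = indicator (contained \<sigma> n \<sigma>) \<omega> * A.mart \<sigma> (Sup {s \<in> {\<sigma>..hi}. \<omega> \<in> contained \<sigma> n s}) \<omega>" for \<omega>
  have os: "has_bochner_integral M m 0"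
    unfolding m_def[abs_def]
    by (rule A.optional_stopping[OF zero \<sigma>hi(1)]) (use contained_Filt[OF \<sigma>(1)] contained_anti hi in auto)
  have pointwise: "\<epsilon> * m \<omega> \<le> \<epsilon> * stopped_gain \<sigma> n hi \<omega>" if \<omega>: "\<omega> \<in> space M" "\<omega> \<notin> N" for \<omega>
  proof (cases "\<omega> \<in> contained \<sigma> n \<sigma>")
    case False
    then show ?thesis by (simp add: m_def stopped_gain_def)
  next
    case True
    define \<rho> where "\<rho> = rho \<sigma> n hi \<omega>"
    have \<rho>: "\<sigma> \<le> \<rho>" "\<rho> \<le> hi" using rho_in[OF \<sigma>hi(2), of n \<omega>] by (auto simp: \<rho>_def)
    have E: "\<omega> \<in> contained \<sigma> n \<rho>" unfolding \<rho>_def by (rule contained_rho) (use \<sigma> True in auto)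
    have \<rho>\<tau>: "\<rho> \<le> tau \<omega>" by (rule contained_le_tau[OF E]) (use \<sigma> \<rho> in auto)
    have state: "A.state r \<omega> = X r \<omega>" if "r \<in> {t..hi}" for r
      using good_X[OF \<omega>, of r] that hi \<omega>(2) by (simp add: A.state_def \<beta>_def)
    have clock: "A.clock r \<omega> = clk r \<omega>" for r
      by (simp add: A.clock_def A.rate_def clk_def)
    have in_K: "X r \<omega> \<in> ?K" "clk r \<omega> \<le> real n" "r \<in> {t..hi}" "(X r \<omega>, r) \<in> cyl G" if "r \<in> {\<sigma>..\<rho>}" for r
      using E that \<rho> \<sigma> contained_cyl[OF E, of r] by (auto simp: contained_def)
    have Jend: "\<Phi> (A.state r \<omega>) r (A.clock r \<omega>) = Jc r \<omega>" if "r \<in> {\<sigma>..\<rho>}" for r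
      using in_K[OF that] \<Phi> by (simp add: state clock Jc_def)
    \<comment> \<open>While the clock is at most \<open>n\<close>, the derivative in the clock
      vanishes, so that the generator contains no term from the localisation.\<close>
    have gen: "A.gen r \<omega> = deviation \<omega> r - running \<omega> r" if "r \<in> {\<sigma>..<\<rho>}" for r
    proof -
      have r: "r \<in> {\<sigma>..\<rho>}" using that by simp
      have "running \<omega> r = running_cost G u v (traj \<omega>) r" using that \<rho>\<tau> \<sigma> by (simp add: running_def)
      then show ?thesis
        using in_K[OF r] \<Phi>[OF in_K(1)[OF r] in_K(3)[OF r] in_K(2)[OF r]] \<omega>(2)
        by (simp add: A.gen_def ito_generator_def deviation_def state clock \<beta>_def H_def)
    qed
    have gi: "set_integrable lborel {\<sigma>..<\<rho>} (\<lambda>r. A.gen r \<omega>)"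
      by (rule set_integrable_subset[OF A.gen_integrable[OF \<omega>(1)]]) (use \<sigma> \<rho> in auto)
    have ri: "set_integrable lborel {\<sigma>..<\<rho>} (running \<omega>)"
      unfolding set_integrable_def
      by (rule integrable_mult_indicator[OF _ good_running[OF \<omega>]]) simp
    have "0 \<le> (LBINT r:{\<sigma>..<\<rho>}. \<epsilon> * (A.gen r \<omega> + running \<omega> r))"
      unfolding set_lebesgue_integral_def
      by (rule Bochner_Integration.integral_nonneg) (use gen sign[OF \<omega>(1)] in_K(4) in \<open>auto simp: indicator_def\<close>)
    also have "\<dots> = \<epsilon> * ((LBINT r:{\<sigma>..<\<rho>}. A.gen r \<omega>) + (LBINT r:{\<sigma>..<\<rho>}. running \<omega> r))"
      using set_integral_add(2)[OF gi ri] by simp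
    finally have nn: "0 \<le> \<epsilon> * ((LBINT r:{\<sigma>..<\<rho>}. A.gen r \<omega>) + (LBINT r:{\<sigma>..<\<rho>}. running \<omega> r))" .
    have "m \<omega> = A.mart \<sigma> \<rho> \<omega>" using True by (simp add: m_def \<rho>_def rho_def)
    also have "\<dots> = Jc \<rho> \<omega> - Jc \<sigma> \<omega> - (LBINT r:{\<sigma>..<\<rho>}. A.gen r \<omega>)"
      using Jend \<rho> by (simp add: A.mart_def)
    finally have "stopped_gain \<sigma> n hi \<omega> - m \<omega> = (LBINT r:{\<sigma>..<\<rho>}. A.gen r \<omega>) + (LBINT r:{\<sigma>..<\<rho>}. running \<omega> r)"
      using True by (simp add: stopped_gain_def \<rho>_def set_lebesgue_integral_def)
    then have "0 \<le> \<epsilon> * (stopped_gain \<sigma> n hi \<omega> - m \<omega>)" using nn by simp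
    then show ?thesis by (simp add: right_diff_distrib)
  qed
  have si: "integrable M (stopped_gain \<sigma> n hi)" by (rule stopped_gain_integrable) (use \<sigma> in auto)
  have mi: "integrable M m" "(\<integral>\<omega>. m \<omega> \<partial>M) = 0" using os by (auto simp: has_bochner_integral_iff)
  have "(\<integral>\<omega>. \<epsilon> * m \<omega> \<partial>M) \<le> (\<integral>\<omega>. \<epsilon> * stopped_gain \<sigma> n hi \<omega> \<partial>M)"
  proof (rule integral_mono_AE)
    show "AE \<omega> in M. \<epsilon> * m \<omega> \<le> \<epsilon> * stopped_gain \<sigma> n hi \<omega>"
      using AE_not_N AE_space by eventually_elim (rule pointwise)
  qed (use si mi in simp_all)
  then show ?thesis using mi by simp
qed

section \<open>Passage to the exit time and back to the starting time\<close>

definition exit_gain :: "real \<Rightarrow> 'w \<Rightarrow> real" where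
  "exit_gain \<sigma> \<omega> = indicat_real (alive \<sigma>) \<omega> *
     (phi G (X (tau \<omega>) \<omega>) - Jc \<sigma> \<omega> + (\<integral>r. indicat_real {\<sigma>..<tau \<omega>} r * running \<omega> r \<partial>lborel))"

lemma tau_exit_point: "\<omega> \<in> space M \<Longrightarrow> \<omega> \<notin> N \<Longrightarrow> (X (tau \<omega>) \<omega>, tau \<omega>) \<in> cyl_boundary G"
  unfolding tau_def by (rule exit_point[OF game]) (use t x X_continuous good_start in auto)

lemma J_at_tau: "\<omega> \<in> space M \<Longrightarrow> \<omega> \<notin> N \<Longrightarrow> J (X (tau \<omega>) \<omega>) (tau \<omega>) = phi G (X (tau \<omega>) \<omega>)"
  using boundary_values tau_exit_point by fastforce

text \<open>The piece of the path between \<sigma> and \<open>s\<close> is a compact subset of the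
  open safe set, and the clock at \<open>s\<close> is finite; every large \<open>n\<close>
  accommodates both.\<close>

lemma eventually_contained:
  assumes \<omega>: "\<omega> \<in> alive s" and s: "t < \<sigma>" "\<sigma> \<le> s" "s < T"
  shows "\<forall>\<^sub>F n in sequentially. \<omega> \<in> contained \<sigma> n s"
proof -
  have \<omega>M: "\<omega> \<in> space M" using \<omega> by (simp add: alive_def)
  have "continuous_on {\<sigma>..s} (traj \<omega>)" by (rule continuous_on_subset[OF X_continuous[OF \<omega>M]]) (use s in auto)
  then have "compact (traj \<omega> ` {\<sigma>..s})" by (rule compact_continuous_image) simp
  moreover have "traj \<omega> ` {\<sigma>..s} \<subseteq> safe_set G" using \<omega> s by (auto simp: alive_def)
  ultimately obtain k where k: "traj \<omega> ` {\<sigma>..s} \<subseteq> inner_set (safe_set G) k"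
    using compact_in_inner_set[OF _ _ safe_open safe_not_UNIV] by metis
  obtain l where l: "clk s \<omega> \<le> real l" using real_arch_simple by blast
  have "\<omega> \<in> contained \<sigma> n s" if n: "max k l \<le> n" for n
  proof -
    have "X r \<omega> \<in> inner_set (safe_set G) n" if "r \<in> {\<sigma>..s}" for r
      using subsetD[OF k imageI[OF that]] inner_set_mono[of k n "safe_set G"] n by auto
    moreover have "clk r \<omega> \<le> real n" if "r \<in> {\<sigma>..s}" for r
      using clk_mono[of r s \<omega>] that s \<omega>M l n by auto
    ultimately show ?thesis using \<omega> s by (auto simp: contained_def alive_def)
  qed
  then show ?thesis unfolding eventually_sequentially by blast
qed

text \<open>Times below \<open>T\<close> increasing to it. The factor 1/2 keeps even the first of
  them strictly above \<sigma>.\<close>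

definition horizon :: "real \<Rightarrow> nat \<Rightarrow> real" where
  "horizon \<sigma> n = T - (T - \<sigma>) / 2 / real (Suc n)"

lemma horizon_in: "\<sigma> < T \<Longrightarrow> \<sigma> < horizon \<sigma> n \<and> horizon \<sigma> n < T"
  using half_step[of "T - \<sigma>" n] unfolding horizon_def by linarith

lemma horizon_tendsto: "horizon \<sigma> \<longlonglongrightarrow> T"
  unfolding horizon_def using tendsto_diff[OF tendsto_const half_step_tendsto, of T] by simp

definition start :: "nat \<Rightarrow> real" where
  "start l = t + (T - t) / 2 / real (Suc l)"

lemma start_in: "t < start l" "start l < T"
  using half_step[of "T - t" l] t unfolding start_def by auto

lemma start_tendsto: "start \<longlonglongrightarrow> t"
  unfolding start_def using tendsto_add[OF tendsto_const half_step_tendsto, of t] by simp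

text \<open>The stopping times never pass the exit, and every time between \<sigma> and the exit is
  eventually reached, so they converge to the exit time. The boundary condition then turns the
  values of \<open>J\<close> at the stopping times into the exit cost.\<close>

lemma stopped_gain_tendsto:
  assumes \<sigma>: "t < \<sigma>" "\<sigma> < T" and \<omega>: "\<omega> \<in> space M" "\<omega> \<notin> N"
  shows "(\<lambda>n. stopped_gain \<sigma> n (horizon \<sigma> n) \<omega>) \<longlonglongrightarrow> exit_gain \<sigma> \<omega>"
proof (cases "\<omega> \<in> alive \<sigma>")
  case False
  then show ?thesis by (simp add: stopped_gain_def exit_gain_def contained_def)
next
  case True
  define \<rho> where "\<rho> n = rho \<sigma> n (horizon \<sigma> n) \<omega>" for n
  note h = horizon_in[OF \<sigma>(2)]
  have \<rho>_in: "\<rho> n \<in> {\<sigma>..horizon \<sigma> n}" "\<sigma> \<le> \<rho> n" "\<rho> n < T" for n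
    using rho_in[of \<sigma> "horizon \<sigma> n" n \<omega>] h[of n] by (auto simp: \<rho>_def)
  have cyl\<sigma>: "(X \<sigma> \<omega>, \<sigma>) \<in> cyl G" using True \<sigma> t by (auto simp: alive_def cyl_def)
  have \<rho>_cyl: "(X (\<rho> n) \<omega>, \<rho> n) \<in> cyl G \<and> \<rho> n \<le> tau \<omega>" for n
  \<comment> \<open>For small \<open>n\<close> the localisation may fail at once; the stopping time
    is then \<sigma>, still in the cylinder, and the limit theorem for \<open>J\<close> can be
    applied to the whole sequence.\<close>
  proof (cases "\<omega> \<in> contained \<sigma> n \<sigma>")
    case True
    have "\<omega> \<in> contained \<sigma> n (\<rho> n)" unfolding \<rho>_def by (rule contained_rho) (use \<sigma> h[of n] True in auto)
    then show ?thesis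
      using contained_cyl[of \<omega> \<sigma> n "\<rho> n" "\<rho> n"] contained_le_tau[of \<omega> \<sigma> n "\<rho> n"] \<rho>_in[of n] \<sigma> by auto
  next
    case False
    then have "\<rho> n = \<sigma>" by (simp add: \<rho>_def rho_def)
    then show ?thesis using cyl\<sigma> alive_tau[OF True] \<sigma> by simp
  qed
  have late: "\<forall>\<^sub>F n in sequentially. s \<le> \<rho> n" if s: "\<sigma> \<le> s" "s < T" "\<omega> \<in> alive s" for s
    using eventually_contained[OF s(3) \<sigma>(1) s(1,2)] order_tendstoD(1)[OF horizon_tendsto[of \<sigma>] s(2)]
    by eventually_elim (use s in \<open>auto simp: \<rho>_def intro: rho_ge\<close>)
  have \<rho>_lim: "\<rho> \<longlonglongrightarrow> tau \<omega>"
  proof (rule order_tendstoI)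
    fix a assume a: "a < tau \<omega>"
    show "\<forall>\<^sub>F n in sequentially. a < \<rho> n"
    proof (cases "a < \<sigma>")
      case True
      then show ?thesis using \<rho>_in(2) by (intro always_eventually allI) (rule less_le_trans)
    next
      case False
      obtain s where s: "a < s" "s < tau \<omega>" using dense[OF a] by blast
      have "\<forall>\<^sub>F n in sequentially. s \<le> \<rho> n"
        using s False tau_bounds(2)[of \<omega>] tau_alive[OF \<omega>(1) s(2)] by (intro late) auto
      then show ?thesis by eventually_elim (use s in simp)
    qed
  next
    fix a assume "tau \<omega> < a"
    then show "\<forall>\<^sub>F n in sequentially. \<rho> n < a" using \<rho>_cyl by (intro always_eventually allI) (meson le_less_trans)
  qed
  have X_lim: "(\<lambda>n. X (\<rho> n) \<omega>) \<longlonglongrightarrow> X (tau \<omega>) \<omega>"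
  proof (rule continuous_on_tendsto_compose[OF X_continuous[OF \<omega>(1)] \<rho>_lim])
    have "\<rho> n \<in> {t..T}" for n using \<rho>_in[of n] \<sigma> by auto
    then show "\<forall>\<^sub>F n in sequentially. \<rho> n \<in> {t..T}" by simp
  qed (use tau_bounds(1,2)[of \<omega>] in auto)
  have "(\<lambda>n. J (fst (X (\<rho> n) \<omega>, \<rho> n)) (snd (X (\<rho> n) \<omega>, \<rho> n))) \<longlonglongrightarrow> J (fst (X (tau \<omega>) \<omega>, tau \<omega>)) (snd (X (tau \<omega>) \<omega>, tau \<omega>))"
    by (rule J_limit) (use \<rho>_cyl tau_exit_point[OF \<omega>] in \<open>auto intro: tendsto_Pair X_lim \<rho>_lim\<close>)
  then have J_lim: "(\<lambda>n. Jc (\<rho> n) \<omega>) \<longlonglongrightarrow> phi G (X (tau \<omega>) \<omega>)"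
    using \<rho>_cyl by (simp add: Jc_def J_at_tau[OF \<omega>])
  have int_lim: "(\<lambda>n. \<integral>r. indicat_real {\<sigma>..<\<rho> n} r * running \<omega> r \<partial>lborel)
      \<longlonglongrightarrow> (\<integral>r. indicat_real {\<sigma>..<tau \<omega>} r * running \<omega> r \<partial>lborel)"
  proof (rule integral_dominated_convergence)
    note [measurable] = borel_measurable_integrable[OF good_running[OF \<omega>]]
    show "(\<lambda>r. indicat_real {\<sigma>..<tau \<omega>} r * running \<omega> r) \<in> borel_measurable lborel"
      "(\<lambda>r. indicat_real {\<sigma>..<\<rho> n} r * running \<omega> r) \<in> borel_measurable lborel" for n by measurable
    show "integrable lborel (\<lambda>r. \<bar>running \<omega> r\<bar>)" using good_running[OF \<omega>] by simp
    show "AE r in lborel. norm (indicat_real {\<sigma>..<\<rho> n} r * running \<omega> r) \<le> \<bar>running \<omega> r\<bar>" for n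
      by (intro AE_I2) (auto simp: indicator_def)
    show "AE r in lborel. (\<lambda>n. indicat_real {\<sigma>..<\<rho> n} r * running \<omega> r) \<longlonglongrightarrow> indicat_real {\<sigma>..<tau \<omega>} r * running \<omega> r"
    proof (intro AE_I2 tendsto_mult tendsto_const)
      fix r
      show "(\<lambda>n. indicat_real {\<sigma>..<\<rho> n} r) \<longlonglongrightarrow> indicat_real {\<sigma>..<tau \<omega>} r"
      proof (cases "r < tau \<omega>")
        case True
        have "\<forall>\<^sub>F n in sequentially. indicat_real {\<sigma>..<\<rho> n} r = indicat_real {\<sigma>..<tau \<omega>} r"
          using order_tendstoD(1)[OF \<rho>_lim True] by eventually_elim (use True in \<open>auto simp: indicator_def\<close>)
        then show ?thesis by (rule tendsto_eventually)
      next
        case False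
        then have "r \<notin> {\<sigma>..<\<rho> n}" for n using \<rho>_cyl[of n] by auto
        then show ?thesis using False by simp
      qed
    qed
  qed
  have "\<forall>\<^sub>F n in sequentially. Jc (\<rho> n) \<omega> - Jc \<sigma> \<omega> + (\<integral>r. indicat_real {\<sigma>..<\<rho> n} r * running \<omega> r \<partial>lborel)
      = stopped_gain \<sigma> n (horizon \<sigma> n) \<omega>"
    using eventually_contained[OF True \<sigma>(1) order_refl \<sigma>(2)]
    by eventually_elim (simp add: stopped_gain_def \<rho>_def)
  moreover have "(\<lambda>n. Jc (\<rho> n) \<omega> - Jc \<sigma> \<omega> + (\<integral>r. indicat_real {\<sigma>..<\<rho> n} r * running \<omega> r \<partial>lborel)) \<longlonglongrightarrow> exit_gain \<sigma> \<omega>"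
    using True unfolding exit_gain_def by (auto intro!: tendsto_intros J_lim int_lim)
  ultimately show ?thesis by (rule Lim_transform_eventually[rotated])
qed

lemma exit_gain_measurable:
  assumes \<sigma>: "t < \<sigma>" "\<sigma> < T"
  shows "exit_gain \<sigma> \<in> borel_measurable M"
proof -
  have \<tau>: "tau \<omega> \<in> {t..T}" for \<omega> using tau_bounds by auto
  have [measurable]: "Jc \<sigma> \<in> borel_measurable M" using Jc_at_measurable[of "\<lambda>_. \<sigma>"] \<sigma> by simp
  have [measurable]: "alive \<sigma> \<in> sets M" by (rule alive_M) (use \<sigma> in auto)
  note [measurable] = measurable_compose[OF X_at_measurable[OF tau_measurable \<tau>] phi_measurable]
    partial_running_measurable[OF tau_measurable]
  show ?thesis unfolding exit_gain_def[abs_def] by measurable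
qed

lemma AE_good: "AE \<omega> in M. \<omega> \<in> space M \<and> \<omega> \<notin> N"
  using AE_not_N AE_space by eventually_elim simp

text \<open>Both claims are inherited from \<open>stopped_gain\<close> in the limit: the bound path
  by path, the sign through dominated convergence.\<close>

lemma exit_gain_bound_sign:
  assumes \<sigma>: "t < \<sigma>" "\<sigma> < T" and B: "\<And>y s. (y, s) \<in> cyl G \<Longrightarrow> \<bar>J y s\<bar> \<le> B" "0 \<le> B"
  shows "\<omega> \<in> space M \<Longrightarrow> \<omega> \<notin> N \<Longrightarrow> \<bar>exit_gain \<sigma> \<omega>\<bar> \<le> 2 * B + total \<omega>"
    and "(\<And>\<omega> r. \<omega> \<in> space M \<Longrightarrow> (X r \<omega>, r) \<in> cyl G \<Longrightarrow> 0 \<le> \<epsilon> * deviation \<omega> r) \<Longrightarrow> 0 \<le> \<epsilon> * (\<integral>\<omega>. exit_gain \<sigma> \<omega> \<partial>M)"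
proof -
  note h = horizon_in[OF \<sigma>(2)]
  show "\<bar>exit_gain \<sigma> \<omega>\<bar> \<le> 2 * B + total \<omega>" if \<omega>: "\<omega> \<in> space M" "\<omega> \<notin> N" for \<omega>
    by (rule LIMSEQ_le_const2[OF tendsto_rabs[OF stopped_gain_tendsto[OF \<sigma> \<omega>]]])
      (use abs_stopped_gain_le[OF B good_running[OF \<omega>]] in auto)
  assume sign: "\<And>\<omega> r. \<omega> \<in> space M \<Longrightarrow> (X r \<omega>, r) \<in> cyl G \<Longrightarrow> 0 \<le> \<epsilon> * deviation \<omega> r"
  have "(\<lambda>n. \<integral>\<omega>. stopped_gain \<sigma> n (horizon \<sigma> n) \<omega> \<partial>M) \<longlonglongrightarrow> (\<integral>\<omega>. exit_gain \<sigma> \<omega> \<partial>M)"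
  proof (rule integral_dominated_convergence[OF exit_gain_measurable[OF \<sigma>] _ gain_bound_integrable[of B]])
    show "stopped_gain \<sigma> n (horizon \<sigma> n) \<in> borel_measurable M" for n
      by (rule stopped_gain_measurable) (use \<sigma> h[of n] in auto)
    show "AE \<omega> in M. (\<lambda>n. stopped_gain \<sigma> n (horizon \<sigma> n) \<omega>) \<longlonglongrightarrow> exit_gain \<sigma> \<omega>"
      using AE_good by (rule eventually_mono) (use stopped_gain_tendsto[OF \<sigma>] in auto)
    show "AE \<omega> in M. norm (stopped_gain \<sigma> n (horizon \<sigma> n) \<omega>) \<le> 2 * B + total \<omega>" for n
      using running_path_integrable by (rule eventually_mono) (use abs_stopped_gain_le[OF B] in auto)
  qed
  then have "(\<lambda>n. \<epsilon> * (\<integral>\<omega>. stopped_gain \<sigma> n (horizon \<sigma> n) \<omega> \<partial>M)) \<longlonglongrightarrow> \<epsilon> * (\<integral>\<omega>. exit_gain \<sigma> \<omega> \<partial>M)"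
    by (rule tendsto_mult_left)
  then show "0 \<le> \<epsilon> * (\<integral>\<omega>. exit_gain \<sigma> \<omega> \<partial>M)"
    by (rule LIMSEQ_le_const) (use stopped_gain_sign[OF \<sigma>(1) _ _ sign] h in auto)
qed

lemma path_cost_eq: "path_cost G t u v (traj \<omega>) = phi G (X (tau \<omega>) \<omega>) + (\<integral>r. running \<omega> r \<partial>lborel)"
  by (simp add: path_cost_def tau_def running_def set_lebesgue_integral_def)

text \<open>If the exit is immediate, the path is not alive at any \<open>start l\<close>, and the
  claim is the boundary value at the starting point. Otherwise \<open>start l\<close> falls below
  the exit time and \<open>J\<close> converges to its value at the start, even if the start lies on
  the boundary.\<close>

lemma exit_gain_tendsto:
  assumes \<omega>: "\<omega> \<in> space M" "\<omega> \<notin> N"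
  shows "(\<lambda>l. exit_gain (start l) \<omega>) \<longlonglongrightarrow> path_cost G t u v (traj \<omega>) - J x t"
proof -
  show ?thesis
  proof (cases "tau \<omega> = t")
    case True
    have "\<omega> \<notin> alive (start l)" for l using alive_tau[of \<omega> "start l"] start_in[of l] True by auto
    then have "exit_gain (start l) \<omega> = 0" for l by (simp add: exit_gain_def)
    moreover have "path_cost G t u v (traj \<omega>) = J x t"
      using J_at_tau[OF \<omega>] good_start[OF \<omega>] True by (simp add: path_cost_eq running_def)
    ultimately show ?thesis by simp
  next
    case False
    then have \<tau>: "t < tau \<omega>" using tau_bounds(1)[of \<omega>] by simp
    define s0 where "s0 = (t + tau \<omega>) / 2"
    have s0: "t < s0" "s0 < tau \<omega>" using \<tau> by (auto simp: s0_def)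
    \<comment> \<open>Capping at \<open>s0\<close> puts all times before the exit, where the path is
      in the cylinder; for large \<open>l\<close> the cap has no effect.\<close>
    define \<rho> where "\<rho> l = min (start l) s0" for l
    have \<rho>: "t < \<rho> l" "\<rho> l < tau \<omega>" for l using start_in[of l] s0 by (auto simp: \<rho>_def)
    have \<rho>_lim: "\<rho> \<longlonglongrightarrow> t"
    proof -
      have "\<rho> \<longlonglongrightarrow> min t s0" unfolding \<rho>_def by (intro tendsto_min start_tendsto tendsto_const)
      then show ?thesis using s0 by simp
    qed
    have \<rho>_cyl: "(X (\<rho> l) \<omega>, \<rho> l) \<in> cyl G" for l by (rule tau_bounds(3)[OF \<rho>])
    have "(\<lambda>l. X (\<rho> l) \<omega>) \<longlonglongrightarrow> X t \<omega>"
    proof (rule continuous_on_tendsto_compose[OF X_continuous[OF \<omega>(1)] \<rho>_lim])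
      have "\<rho> l \<in> {t..T}" for l using \<rho>[of l] tau_bounds(2)[of \<omega>] by auto
      then show "\<forall>\<^sub>F l in sequentially. \<rho> l \<in> {t..T}" by simp
    qed (use t in auto)
    then have "(\<lambda>l. J (fst (X (\<rho> l) \<omega>, \<rho> l)) (snd (X (\<rho> l) \<omega>, \<rho> l))) \<longlonglongrightarrow> J (fst (X t \<omega>, t)) (snd (X t \<omega>, t))"
      by (intro J_limit \<rho>_cyl tendsto_Pair \<rho>_lim) (use closure_cases[OF x, of t] t good_start[OF \<omega>] in auto)
    then have J_lim: "(\<lambda>l. Jc (\<rho> l) \<omega>) \<longlonglongrightarrow> J x t"
      using \<rho>_cyl good_start[OF \<omega>] by (simp add: Jc_def)
    have int_lim: "(\<lambda>l. \<integral>r. indicat_real {\<rho> l..<tau \<omega>} r * running \<omega> r \<partial>lborel) \<longlonglongrightarrow> (\<integral>r. running \<omega> r \<partial>lborel)"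
    proof (rule integral_dominated_convergence)
      note [measurable] = borel_measurable_integrable[OF good_running[OF \<omega>]]
      show "running \<omega> \<in> borel_measurable lborel"
        "(\<lambda>r. indicat_real {\<rho> l..<tau \<omega>} r * running \<omega> r) \<in> borel_measurable lborel" for l by measurable
      show "integrable lborel (\<lambda>r. \<bar>running \<omega> r\<bar>)" using good_running[OF \<omega>] by simp
      show "AE r in lborel. norm (indicat_real {\<rho> l..<tau \<omega>} r * running \<omega> r) \<le> \<bar>running \<omega> r\<bar>" for l
        by (intro AE_I2) (auto simp: indicator_def)
      have "AE r in lborel. r \<noteq> t" by (rule AE_lborel_singleton)
      then show "AE r in lborel. (\<lambda>l. indicat_real {\<rho> l..<tau \<omega>} r * running \<omega> r) \<longlonglongrightarrow> running \<omega> r"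
      proof eventually_elim
        case (elim r)
        show ?case
        proof (cases "r \<in> {t<..<tau \<omega>}")
          case True
          then have "\<forall>\<^sub>F l in sequentially. \<rho> l < r" by (intro order_tendstoD(2)[OF \<rho>_lim]) simp
          then have "\<forall>\<^sub>F l in sequentially. indicat_real {\<rho> l..<tau \<omega>} r * running \<omega> r = running \<omega> r"
            by eventually_elim (use True in simp)
          then show ?thesis by (rule tendsto_eventually)
        next
          case False
          then have "running \<omega> r = 0" using elim by (auto simp: running_def indicator_def)
          then show ?thesis by simp
        qed
      qed
    qed
    have "\<forall>\<^sub>F l in sequentially. phi G (X (tau \<omega>) \<omega>) - Jc (\<rho> l) \<omega> + (\<integral>r. indicat_real {\<rho> l..<tau \<omega>} r * running \<omega> r \<partial>lborel)
        = exit_gain (start l) \<omega>"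
      using order_tendstoD(2)[OF start_tendsto s0(1)]
    proof eventually_elim
      case (elim l)
      then have "\<omega> \<in> alive (start l)" by (intro tau_alive[OF \<omega>(1)]) (use s0 in simp)
      then show ?case using elim by (simp add: exit_gain_def \<rho>_def)
    qed
    moreover have "(\<lambda>l. phi G (X (tau \<omega>) \<omega>) - Jc (\<rho> l) \<omega> + (\<integral>r. indicat_real {\<rho> l..<tau \<omega>} r * running \<omega> r \<partial>lborel))
        \<longlonglongrightarrow> phi G (X (tau \<omega>) \<omega>) - J x t + (\<integral>r. running \<omega> r \<partial>lborel)"
      by (intro tendsto_intros J_lim int_lim)
    ultimately have "(\<lambda>l. exit_gain (start l) \<omega>) \<longlonglongrightarrow> phi G (X (tau \<omega>) \<omega>) - J x t + (\<integral>r. running \<omega> r \<partial>lborel)"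
      by (rule Lim_transform_eventually[rotated])
    then show ?thesis by (simp add: path_cost_eq algebra_simps)
  qed
qed

lemma expected_cost_sign:
  assumes sign: "\<And>\<omega> r. \<omega> \<in> space M \<Longrightarrow> (X r \<omega>, r) \<in> cyl G \<Longrightarrow> 0 \<le> \<epsilon> * deviation \<omega> r"
  shows "0 \<le> \<epsilon> * ((\<integral>\<omega>. path_cost G t u v (traj \<omega>) \<partial>M) - J x t)"
proof -
  obtain B0 where "\<And>y s. (y, s) \<in> cyl G \<Longrightarrow> \<bar>J y s\<bar> \<le> B0" by (rule J_bounded) blast
  then have B: "\<And>y s. (y, s) \<in> cyl G \<Longrightarrow> \<bar>J y s\<bar> \<le> \<bar>B0\<bar>" by (meson abs_ge_self order_trans)
  have \<tau>: "tau \<omega> \<in> {t..T}" for \<omega> using tau_bounds by auto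
  have m [measurable]: "(\<lambda>\<omega>. path_cost G t u v (traj \<omega>)) \<in> borel_measurable M"
  proof -
    note [measurable] = measurable_compose[OF X_at_measurable[OF tau_measurable \<tau>] phi_measurable]
    have [measurable]: "(\<lambda>\<omega>. \<integral>r. running \<omega> r \<partial>lborel) \<in> borel_measurable M"
      by (rule lborel.borel_measurable_lebesgue_integral[OF running_measurable])
    show ?thesis unfolding path_cost_eq by measurable
  qed
  have m': "(\<lambda>\<omega>. path_cost G t u v (traj \<omega>) - J x t) \<in> borel_measurable M" by measurable
  note bound = exit_gain_bound_sign(1)[OF start_in B abs_ge_zero]
  have lim: "AE \<omega> in M. (\<lambda>l. exit_gain (start l) \<omega>) \<longlonglongrightarrow> path_cost G t u v (traj \<omega>) - J x t"
    using AE_good by (rule eventually_mono) (use exit_gain_tendsto in auto)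
  have dom: "AE \<omega> in M. norm (exit_gain (start l) \<omega>) \<le> 2 * \<bar>B0\<bar> + total \<omega>" for l
    using AE_good by (rule eventually_mono) (use bound in auto)
  note dc = m' exit_gain_measurable[OF start_in] gain_bound_integrable[of "\<bar>B0\<bar>"] lim dom
  have i: "integrable M (\<lambda>\<omega>. path_cost G t u v (traj \<omega>) - J x t)"
    by (rule integrable_dominated_convergence[OF dc])
  have "(\<lambda>l. \<integral>\<omega>. exit_gain (start l) \<omega> \<partial>M) \<longlonglongrightarrow> (\<integral>\<omega>. path_cost G t u v (traj \<omega>) - J x t \<partial>M)"
    by (rule integral_dominated_convergence[OF dc])
  then have "(\<lambda>l. \<epsilon> * (\<integral>\<omega>. exit_gain (start l) \<omega> \<partial>M)) \<longlonglongrightarrow> \<epsilon> * (\<integral>\<omega>. path_cost G t u v (traj \<omega>) - J x t \<partial>M)"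
    by (rule tendsto_mult_left)
  then have le: "0 \<le> \<epsilon> * (\<integral>\<omega>. path_cost G t u v (traj \<omega>) - J x t \<partial>M)"
    by (rule LIMSEQ_le_const) (use exit_gain_bound_sign(2)[OF start_in B abs_ge_zero sign] in auto)
  have ip: "integrable M (\<lambda>\<omega>. path_cost G t u v (traj \<omega>))"
    using Bochner_Integration.integrable_add[OF i, of "\<lambda>_. J x t"] by simp
  have "(\<integral>\<omega>. path_cost G t u v (traj \<omega>) - J x t \<partial>M) = (\<integral>\<omega>. path_cost G t u v (traj \<omega>) \<partial>M) - J x t"
    using ip by (simp add: prob_space)
  then show ?thesis using le by simp
qed

end

section \<open>Initial value of a solution, the null set, and the terminal time\<close>

text \<open>The initial value is not a separate clause of a solution. It follows because every
  simple integral vanishes at time \<open>t\<close>, so that the limit in probability vanishes there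
  almost surely.\<close>

lemma strong_solution_start:
  assumes M: "prob_space M" and w: "wiener_process M (init_time G) (end_time G) w"
    and t: "t \<in> {init_time G..end_time G}" and sol: "strong_solution M w G x t u v X"
  shows "AE \<omega> in M. X t \<omega> = x"
proof -
  interpret prob_space M by (rule M)
  let ?T = "end_time G" and ?F = "wiener_filtration M w t"
  have tT: "t \<in> {t..?T}" using t by simp
  obtain Y where Y: "ito_integral M ?F w t ?T (\<lambda>s \<omega>. diffusion G (X s \<omega>) s) Y"
    and XY: "AE \<omega> in M. set_integrable lborel {t..<?T} (velocity G u v (\<lambda>q. X q \<omega>)) \<and>
      (\<forall>s\<in>{t..?T}. X s \<omega> = x + (LBINT r:{t..<s}. velocity G u v (\<lambda>q. X q \<omega>) r) + Y s \<omega>)"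
    using sol unfolding strong_solution_def by blast
  obtain n p \<xi> where sp: "\<And>j. simple_process t ?T ?F (n j) (p j) (\<xi> j)"
    and conv: "\<And>s \<epsilon>. s \<in> {t..?T} \<Longrightarrow> \<epsilon> > 0 \<Longrightarrow> (\<lambda>j. measure M {\<omega>\<in>space M.
        norm (simple_integral w (n j) (p j) (\<xi> j) s \<omega> - Y s \<omega>) > \<epsilon>}) \<longlonglongrightarrow> 0"
    using Y unfolding ito_integral_def by blast
  have zero: "simple_integral w (n j) (p j) (\<xi> j) t \<omega> = 0" for j \<omega>
    unfolding simple_integral_def
  proof (intro sum.neutral ballI)
    fix i assume "i \<in> {..<n j}"
    then have "t \<le> p j i" "t \<le> p j (Suc i)" using sp[of j] by (auto simp: simple_process_def)
    then show "\<xi> j i \<omega> *v (w (min t (p j (Suc i))) \<omega> - w (min t (p j i)) \<omega>) = 0" by (simp add: min_absorb1)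
  qed
  have "Y t \<in> borel_measurable (?F t)" using Y tT by (simp add: ito_integral_def)
  moreover have "sets (?F t) \<subseteq> sets M" using t by (intro wiener_filtration_le[OF w]) auto
  ultimately have [measurable]: "Y t \<in> borel_measurable M"
    using measurable_mono[OF subset_refl refl, of "?F t" M borel] by auto
  have small: "AE \<omega> in M. norm (Y t \<omega>) \<le> \<epsilon>" if "\<epsilon> > 0" for \<epsilon>
  proof -
    have "measure M {\<omega>\<in>space M. norm (Y t \<omega>) > \<epsilon>} = 0"
      using conv[OF tT that] by (simp add: zero LIMSEQ_const_iff)
    then have "{\<omega>\<in>space M. norm (Y t \<omega>) > \<epsilon>} \<in> null_sets M"
      by (intro null_setsI) (simp_all add: emeasure_eq_measure)
    then show ?thesis by (rule AE_I') (auto simp: not_le)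
  qed
  \<comment> \<open>Countably many thresholds, so that the exceptional sets can be united.\<close>
  have "AE \<omega> in M. \<forall>k. norm (Y t \<omega>) \<le> inverse (real (Suc k))"
    unfolding AE_all_countable by (intro allI small) simp
  then have "AE \<omega> in M. Y t \<omega> = 0"
  proof eventually_elim
    case (elim \<omega>)
    show ?case
    proof (rule ccontr)
      assume "Y t \<omega> \<noteq> 0"
      then obtain k where "inverse (real (Suc k)) < norm (Y t \<omega>)"
        using reals_Archimedean[of "norm (Y t \<omega>)"] by auto
      then show False using elim[rule_format, of k] by simp
    qed
  qed
  with XY show ?thesis
    by eventually_elim (use tT in \<open>simp add: set_lebesgue_integral_def\<close>)
qed

text \<open>All almost sure properties are collected outside one null set, on which the driving
  processes may then be set to zero.\<close>

lemma (in verification) expected_cost_sign: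
  assumes sign: "\<And>\<omega> r. \<omega> \<in> space M \<Longrightarrow> (X r \<omega>, r) \<in> cyl G \<Longrightarrow> 0 \<le> \<epsilon> * deviation \<omega> r"
  shows "0 \<le> \<epsilon> * ((\<integral>\<omega>. path_cost G t u v (traj \<omega>) \<partial>M) - J x t)"
proof -
  obtain Y where Y: "ito_integral M (wiener_filtration M w t) w t T (\<lambda>s \<omega>. diffusion G (X s \<omega>) s) Y"
    and XY: "AE \<omega> in M. set_integrable lborel {t..<T} (velocity G u v (traj \<omega>)) \<and>
      (\<forall>s\<in>{t..T}. X s \<omega> = x + (LBINT r:{t..<s}. velocity G u v (traj \<omega>) r) + Y s \<omega>)"
    using sol unfolding strong_solution_def by blast
  have "AE \<omega> in M. continuous_on {init_time G..T} (\<lambda>s. w s \<omega>)" using wiener by (simp add: wiener_process_def)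
  moreover have "AE \<omega> in M. (\<integral>\<^sup>+r\<in>{t..T}. ennreal ((norm (diffusion G (X r \<omega>) r))\<^sup>2) \<partial>lborel) < \<infinity>"
    using Y by (simp add: ito_integral_def)
  moreover have "AE \<omega> in M. X t \<omega> = x"
    by (rule strong_solution_start[OF prob_space_axioms wiener _ sol]) (use t in auto)
  moreover note XY running_path_integrable
  ultimately have "AE \<omega> in M. continuous_on {t..T} (\<lambda>s. w s \<omega>)
      \<and> set_integrable lborel {t..<T} (velocity G u v (traj \<omega>))
      \<and> (\<forall>s\<in>{t..T}. X s \<omega> = x + (LBINT r:{t..<s}. velocity G u v (traj \<omega>) r) + Y s \<omega>)
      \<and> (\<integral>\<^sup>+r\<in>{t..T}. ennreal ((norm (diffusion G (X r \<omega>) r))\<^sup>2) \<partial>lborel) < \<infinity>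
      \<and> X t \<omega> = x \<and> integrable lborel (running \<omega>)"
    by eventually_elim (use t in \<open>auto intro: continuous_on_subset\<close>)
  then obtain N where N: "N \<in> null_sets M" and good: "\<And>\<omega>. \<omega> \<in> space M \<Longrightarrow> \<omega> \<notin> N \<Longrightarrow> continuous_on {t..T} (\<lambda>s. w s \<omega>)
      \<and> set_integrable lborel {t..<T} (velocity G u v (traj \<omega>))
      \<and> (\<forall>s\<in>{t..T}. X s \<omega> = x + (LBINT r:{t..<s}. velocity G u v (traj \<omega>) r) + Y s \<omega>)
      \<and> (\<integral>\<^sup>+r\<in>{t..T}. ennreal ((norm (diffusion G (X r \<omega>) r))\<^sup>2) \<partial>lborel) < \<infinity>
      \<and> X t \<omega> = x \<and> integrable lborel (running \<omega>)"
    unfolding eventually_ae_filter by blast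
  interpret verification_modified G J Jt Jx Jxx M w x t u v X N Y
    by unfold_locales (use N good Y in auto)
  show ?thesis by (rule expected_cost_sign[OF sign])
qed

context HJI_solution
begin

text \<open>Started at the terminal time, every path exits at once, and the closure of the safe set
  at this time belongs to the boundary of the cylinder.\<close>

lemma terminal_expected_cost:
  assumes M: "prob_space M" and w: "wiener_process M (init_time G) (end_time G) w"
    and x: "x \<in> closure (safe_set G)" and sol: "strong_solution M w G x (end_time G) u v X"
  shows "(\<integral>\<omega>. path_cost G (end_time G) u v (\<lambda>s. X s \<omega>) \<partial>M) = J x (end_time G)"
proof -
  interpret prob_space M by (rule M)
  let ?T = "end_time G"
  have T: "?T \<in> {init_time G..?T}" using times by simp
  have exit: "exit_time G ?T \<xi> = ?T" for \<xi>
    using exit_time_bounds[where G = G and t = ?T and \<xi> = \<xi>] by (simp add: antisym)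
  have pc: "path_cost G ?T u v \<xi> = phi G (\<xi> ?T)" for \<xi>
    by (simp add: path_cost_def exit set_lebesgue_integral_def)
  have "X ?T \<in> borel_measurable (wiener_filtration M w ?T ?T)" using sol by (simp add: strong_solution_def)
  moreover have "sets (wiener_filtration M w ?T ?T) \<subseteq> sets M" using T by (intro wiener_filtration_le[OF w]) auto
  ultimately have [measurable]: "X ?T \<in> borel_measurable M"
    using measurable_mono[OF subset_refl refl, of "wiener_filtration M w ?T ?T" M borel] by auto
  note [measurable] = phi_measurable
  have "(\<integral>\<omega>. path_cost G ?T u v (\<lambda>s. X s \<omega>) \<partial>M) = (\<integral>\<omega>. phi G x \<partial>M)"
    unfolding pc
  proof (rule integral_cong_AE)
    show "AE \<omega> in M. phi G (X ?T \<omega>) = phi G x"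
      using strong_solution_start[OF M w T sol] by eventually_elim simp
  qed measurable
  also have "\<dots> = phi G x" by (simp add: prob_space)
  also have "\<dots> = J x ?T"
    using boundary_values closure_cases[OF x T] by (auto simp: cyl_def)
  finally show ?thesis .
qed

text \<open>Joins the terminal time to the earlier ones and expresses the deviation by the
  departures from the feedback laws. The two policies stay general, since \<open>sign\<close> only
  asks for the combined effect of both departures.\<close>

lemma expected_cost_sign:
  assumes M: "prob_space M" and w: "wiener_process M (init_time G) (end_time G) w"
    and xt: "(x, t) \<in> cyl_closure G"
    and uv: "nonanticipative t (end_time G) u" "nonanticipative t (end_time G) v"
    and sol: "strong_solution M w G x t u v X" and cint: "cost_integrable M G t u v X"
    and ustar: "\<forall>(x, t)\<in>cyl G. ustar x t = - (matrix_inv (weight_u G x t) *v (transpose (gain_u G x t) *v Jx x t))"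
    and vstar: "\<forall>(x, t)\<in>cyl G. vstar x t = matrix_inv (weight_v G x t) *v (transpose (gain_v G x t) *v Jx x t)"
    and sign: "\<And>\<xi> s. (\<xi> s, s) \<in> cyl G \<Longrightarrow>
      0 \<le> \<epsilon> * ((u s \<xi> - ustar (\<xi> s) s) \<bullet> (weight_u G (\<xi> s) s *v (u s \<xi> - ustar (\<xi> s) s))
        - (v s \<xi> - vstar (\<xi> s) s) \<bullet> (weight_v G (\<xi> s) s *v (v s \<xi> - vstar (\<xi> s) s)))"
  shows "0 \<le> \<epsilon> * ((\<integral>\<omega>. path_cost G t u v (\<lambda>s. X s \<omega>) \<partial>M) - J x t)"
proof (cases "t = end_time G")
  case True
  then show ?thesis
    using terminal_expected_cost[OF M w _ sol[unfolded True]] xt by (auto simp: cyl_closure_def)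
next
  case False
  interpret prob_space M by (rule M)
  interpret verification G J Jt Jx Jxx M w x t u v X
    by unfold_locales (use w xt uv sol cint False in \<open>auto simp: cyl_closure_def\<close>)
  show ?thesis
  proof (rule expected_cost_sign)
    fix \<omega> r assume c: "(X r \<omega>, r) \<in> cyl G"
    define d where "d = (u r (traj \<omega>) - ustar (X r \<omega>) r) \<bullet> (weight_u G (X r \<omega>) r *v (u r (traj \<omega>) - ustar (X r \<omega>) r))
        - (v r (traj \<omega>) - vstar (X r \<omega>) r) \<bullet> (weight_v G (X r \<omega>) r *v (v r (traj \<omega>) - vstar (X r \<omega>) r))"
    have half: "deviation \<omega> r = 1/2 * d"
      unfolding deviation_def d_def
      using HJI_complete_square[OF game hji, of "traj \<omega>" r ustar vstar u v] c ustar vstar by (fastforce simp: algebra_simps)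
    have "0 \<le> \<epsilon> * d" unfolding d_def by (rule sign) (rule c)
    then show "0 \<le> \<epsilon> * deviation \<omega> r" unfolding half by simp
  qed
qed

end

section \<open>Saddle point and value of the game\<close>

theorem theorem7:
  fixes M :: "'w measure"
    and w :: "real \<Rightarrow> 'w \<Rightarrow> real^'k"
    and G :: "('n::finite, 'm::finite, 'l::finite, 'k::finite) game"
    and U :: "real \<Rightarrow> ('n, 'm) policy set"
    and V :: "real \<Rightarrow> ('n, 'l) policy set"
    and J Jt :: "real^'n \<Rightarrow> real \<Rightarrow> real"
    and Jx :: "real^'n \<Rightarrow> real \<Rightarrow> real^'n"
    and Jxx :: "real^'n \<Rightarrow> real \<Rightarrow> real^'n^'n"
    and ustar :: "real^'n \<Rightarrow> real \<Rightarrow> real^'m"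
    and vstar :: "real^'n \<Rightarrow> real \<Rightarrow> real^'l"
  assumes game: "game_data G"
    and prob: "prob_space M"
    and wiener: "wiener_process M (init_time G) (end_time G) w"
    and classes: "admissible_classes M w G U V"
    and smooth: "C12_derivs G J Jt Jx Jxx"
    and hji: "HJI_equation G Jt Jx Jxx"
    and boundary: "HJI_boundary G J"
    and boundary_values: "\<forall>(y, s)\<in>cyl_boundary G. J y s = phi G y"
    and ustar: "\<forall>(x, t)\<in>cyl G.
        ustar x t = - (matrix_inv (weight_u G x t) *v (transpose (gain_u G x t) *v Jx x t))"
    and vstar: "\<forall>(x, t)\<in>cyl G.
        vstar x t = matrix_inv (weight_v G x t) *v (transpose (gain_v G x t) *v Jx x t)"
    and ustar_admissible: "\<forall>t\<in>{init_time G..end_time G}. markov ustar \<in> U t"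
    and vstar_admissible: "\<forall>t\<in>{init_time G..end_time G}. markov vstar \<in> V t"
  shows "(\<forall>(x, t)\<in>cyl_closure G.
            J x t = cost M w G x t (markov ustar) (markov vstar) \<and>
            is_min_max (cost M w G x t) (U t) (V t) (J x t) \<and>
            is_max_min (cost M w G x t) (U t) (V t) (J x t)) \<and>
         saddle_point M w G U V (markov ustar) (markov vstar)"
proof -
  interpret HJI_solution G J Jt Jx Jxx
    by (rule HJI_solution.intro[OF game smooth hji boundary boundary_values])
  have pd: "pos_def (weight_u G y s)" "pos_def (weight_v G y s)" if "(y, s) \<in> cyl G" for y s
    using game that by (auto simp: game_data_def cyl_def)
  \<comment> \<open>If \<open>v\<close> follows \<open>vstar\<close>, its square vanishes and what
    is left is nonnegative, which gives the lower bound with \<epsilon> = 1; if \<open>u\<close>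
    follows \<open>ustar\<close>, what is left is nonpositive, and \<epsilon> = -1 gives the upper
    bound.\<close>
  have bound: "0 \<le> \<epsilon> * (cost M w G x t u v - J x t)"
    if xt: "(x, t) \<in> cyl_closure G" and u: "u \<in> U t" and v: "v \<in> V t"
      and \<epsilon>: "\<epsilon> = 1 \<and> v = markov vstar \<or> \<epsilon> = - 1 \<and> u = markov ustar" for x t u v \<epsilon>
  proof -
    have x: "x \<in> closure (safe_set G)" and t: "t \<in> {init_time G..end_time G}" using xt by (auto simp: cyl_closure_def)
    \<comment> \<open>The very solution that \<open>cost\<close> selects.\<close>
    define X where "X = (SOME X. strong_solution M w G x t u v X)"
    have "\<exists>X. strong_solution M w G x t u v X"
      using classes t x u v unfolding admissible_classes_def unique_strong_solution_def by blast
    then have X: "strong_solution M w G x t u v X" unfolding X_def by (rule someI_ex)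
    have ci: "cost_integrable M G t u v X" and na: "nonanticipative t (end_time G) u" "nonanticipative t (end_time G) v"
      using classes t x u v X unfolding admissible_classes_def by blast+
    have "cost M w G x t u v = (\<integral>\<omega>. path_cost G t u v (\<lambda>s. X s \<omega>) \<partial>M)"
      by (simp add: cost_def X_def)
    moreover have "0 \<le> \<epsilon> * ((\<integral>\<omega>. path_cost G t u v (\<lambda>s. X s \<omega>) \<partial>M) - J x t)"
      by (rule expected_cost_sign[OF prob wiener xt na X ci ustar vstar])
        (use \<epsilon> in \<open>auto simp: markov_def intro!: pos_def_quadratic_nonneg pd\<close>)
    ultimately show ?thesis by simp
  qed
  have lower: "J x t \<le> cost M w G x t u (markov vstar)" if "(x, t) \<in> cyl_closure G" "u \<in> U t" for x t u
    using bound[of x t u "markov vstar" 1] that vstar_admissible by (auto simp: cyl_closure_def)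
  have upper: "cost M w G x t (markov ustar) v \<le> J x t" if "(x, t) \<in> cyl_closure G" "v \<in> V t" for x t v
    using bound[of x t "markov ustar" v "- 1"] that ustar_admissible by (auto simp: cyl_closure_def)
  have adm: "markov ustar \<in> U t" "markov vstar \<in> V t" if "(x, t) \<in> cyl_closure G" for x t
    using that ustar_admissible vstar_admissible by (auto simp: cyl_closure_def)
  \<comment> \<open>At the pair of feedback laws both bounds apply.\<close>
  have eq: "J x t = cost M w G x t (markov ustar) (markov vstar)" if "(x, t) \<in> cyl_closure G" for x t
    using lower[OF that adm(1)[OF that]] upper[OF that adm(2)[OF that]] by simp
  have mm: "is_min_max (cost M w G x t) (U t) (V t) (J x t)" if c: "(x, t) \<in> cyl_closure G" for x t
    unfolding is_min_max_def
  proof (intro conjI bexI[OF _ adm(1)[OF c]] bexI[OF _ adm(2)[OF c]] ballI)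
    \<comment> \<open>The single response \<open>vstar\<close> already brings the supremum up to the
      value of \<open>J\<close>.\<close>
    show "ereal (J x t) \<le> (SUP v\<in>V t. ereal (cost M w G x t u v))" if "u \<in> U t" for u
      by (rule SUP_upper2[OF adm(2)[OF c]]) (simp add: lower[OF c that])
  qed (use eq[OF c] upper[OF c] in auto)
  have Mm: "is_max_min (cost M w G x t) (U t) (V t) (J x t)" if c: "(x, t) \<in> cyl_closure G" for x t
    unfolding is_max_min_def
  proof (intro conjI bexI[OF _ adm(1)[OF c]] bexI[OF _ adm(2)[OF c]] ballI)
    show "(INF u\<in>U t. ereal (cost M w G x t u v)) \<le> ereal (J x t)" if "v \<in> V t" for v
      by (rule INF_lower2[OF adm(1)[OF c]]) (simp add: upper[OF c that])
  qed (use eq[OF c] lower[OF c] in auto)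
  show ?thesis
    unfolding saddle_point_def using eq mm Mm adm lower upper by (auto simp: eq[symmetric])
qed

end
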